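(* Let $H^1_\Pi(E)$ be the first Poisson cohomology of a coupling Poisson tensor $\Pi$ on a fiber bundle $\pi:E\to B$, with associated geometric data $(\gamma,\sigma,P)$. Then there exists an isomorphism (of vector spaces) $$H^1_\Pi(E)\cong H^1_{\bar\partial^\gamma}\oplus\frac{\ker\rho^\gamma}{\operatorname{Ham}(E,P)}.$$
   Context: Everything is smooth. For a Poisson tensor $\Pi$ on $E$ ($[\Pi,\Pi]=0$), $\Pi^\sharp:T^*E\to TE$ is given by $\langle\beta,\Pi^\sharp\alpha\rangle=\Pi(\alpha,\beta)$; $\operatorname{Poiss}(E,\Pi)=\{Z\in\mathfrak X(E):L_Z\Pi=0\}$, $\operatorname{Ham}(E,\Pi)=\{\Pi^\sharp dF:F\in C^\infty(E)\}$, $\operatorname{Casim}(E,\Pi)=\{F:\Pi^\sharp dF=0\}$, $H^1_\Pi(E)=\operatorname{Poiss}(E,\Pi)/\operatorname{Ham}(E,\Pi)$. Let $\pi:E\to B$ be a fiber bundle (surjective submersion), $\mathbb V=\ker d\pi$, $\mathbb V^0\subset T^*E$ its annihilator. $\Pi$ is coupling if $TE=\mathbb H\oplus\mathbb V$ with $\mathbb H:=\Pi^\sharp(\mathbb V^0)$. Then $\Pi=\Pi_{2,0}+P$ with $\Pi_{2,0}\in\Gamma(\wedge^2\mathbb H)$ and $P=\Pi_{0,2}\in\Gamma(\wedge^2\mathbb V)$ a vertical Poisson tensor, and $\Pi_{2,0}^\sharp|_{\mathbb V^0}:\mathbb V^0\to\mathbb H$ is an isomorphism. The geometric data $(\gamma,\sigma,P)$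 of $\Pi$: $\gamma$ is the projection $TE\to\mathbb V$ along $\mathbb H$, with horizontal lifts $\operatorname{hor}^\gamma(u)\in\Gamma(\mathbb H)$ of $u\in\mathfrak X(B)$; $\sigma\in\Omega^{2,0}_B(E)$ is the coupling form, defined by $(\pi^*\sigma)^\flat|_{\mathbb H}=-(\Pi_{2,0}^\sharp|_{\mathbb V^0})^{-1}$, where $(\pi^*\sigma)^\flat X=\mathbf i_X\pi^*\sigma$. $\Omega^{p,0}_B(E)=\Omega^p(B)\otimes_{C^\infty(B)}C^\infty(E)$; for $\eta\in\Omega^{p,0}_B(E)$, $(\pi^*\eta)(X_1,\dots,X_p)(e)=\eta(d_e\pi X_1,\dots,d_e\pi X_p)$. The covariant exterior derivative is $$(\partial^\gamma_{1,0}\eta)(u_0,\dots,u_p)=\sum_i(-1)^iL_{\operatorname{hor}^\gamma(u_i)}\eta(u_0,\dots,\hat u_i,\dots,u_p)+\sum_{i<j}(-1)^{i+j}\eta([u_i,u_j],u_0,\dots,\hat u_i,\dots,\hat u_j,\dots,u_p).$$ Let $\mathcal C^p=\Omega^p(B)\otimes_{C^\infty(B)}\operatorname{Casim}(E,P)$; $\bar\partial^\gamma:=\partial^\gamma_{1,0}|_{\mathcal C^*}$ maps $\mathcal C^p$ to $\mathcal C^{p+1}$ and squares to zero; $H^p_{\bar\partial^\gamma}$ is its cohomology. $\operatorname{Poiss}_V(E,P)=\{Y\in\Gamma(\mathbb V):L_YP=0\}$, $\mathcal A^\gamma=\{Y\in\operatorname{Poiss}_V(E,P):[\operatorname{hor}^\gamma(u),Y]\in\operatorname{Ham}(E,P)\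 \forall u\in\mathfrak X(B)\}$. For $Y\in\mathcal A^\gamma$ there is $\beta_Y\in\Omega^{1,0}_B(E)$ with $[\operatorname{hor}^\gamma(u),Y]=-P^\sharp d(\beta_Y(u))$ for all $u$. Put $\tau_Y=\partial^\gamma_{1,0}\beta_Y+L_Y\sigma$ with $(L_Y\sigma)(u_1,u_2)=L_Y(\sigma(u_1,u_2))$. Then $\tau_Y\in\mathcal C^2$ is $\bar\partial^\gamma$-closed with class independent of the choice of $\beta_Y$, and $\rho^\gamma:\mathcal A^\gamma\to H^2_{\bar\partial^\gamma}$ is $\rho^\gamma(Y)=[\tau_Y]$; one has $\operatorname{Ham}(E,P)\subseteq\ker\rho^\gamma$. *)

theory Defs
  imports
    "HOL-Analysis.Analysis"
    "HOL-Algebra.AbelCoset"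
    "HOL-Algebra.Module"
    "HOL-Library.Function_Algebras"
begin

section \<open>Smooth manifolds\<close>

text \<open>The model space is \<^term>\<open>Euclidean_space n\<close>, that is, the set of all
  \<open>x :: nat \<Rightarrow> real\<close> with \<open>x i = 0\<close> for \<open>i \<ge> n\<close>; the dimension \<open>0\<close> is allowed.\<close>

definition partial :: "nat \<Rightarrow> ((nat \<Rightarrow> real) \<Rightarrow> real) \<Rightarrow> (nat \<Rightarrow> real) \<Rightarrow> real" where
  "partial i f x = deriv (\<lambda>t. f (x(i := t))) (x i)"

primrec Ck_on :: "nat \<Rightarrow> nat \<Rightarrow> (nat \<Rightarrow> real) set \<Rightarrow> ((nat \<Rightarrow> real) \<Rightarrow> real) \<Rightarrow> bool" where
  "Ck_on n 0 U f \<longleftrightarrow> continuous_map (subtopology (Euclidean_space n) U) euclideanreal f"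
| "Ck_on n (Suc k) U f \<longleftrightarrow>
     continuous_map (subtopology (Euclidean_space n) U) euclideanreal f \<and>
     (\<forall>i<n. (\<forall>x\<in>U. (\<lambda>t. f (x(i := t))) differentiable (at (x i))) \<and> Ck_on n k U (partial i f))"

text \<open>Used only for sets \<open>U\<close> that are open in \<^term>\<open>Euclidean_space n\<close>; the values of \<open>f\<close>
  outside \<open>U\<close> are then irrelevant.\<close>

definition smooth_on :: "nat \<Rightarrow> (nat \<Rightarrow> real) set \<Rightarrow> ((nat \<Rightarrow> real) \<Rightarrow> real) \<Rightarrow> bool" where
  "smooth_on n U f \<longleftrightarrow> (\<forall>k. Ck_on n k U f)"

text \<open>The points of a manifold are all the elements of the type \<open>'m\<close>. A chart is a pair
  \<open>(U, \<phi>)\<close>; the atlas need not be maximal.\<close>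

record 'm smooth_structure =
  mdim :: nat
  charts :: "('m set \<times> ('m \<Rightarrow> nat \<Rightarrow> real)) set"

definition smooth_manifold ::
  "'m::{second_countable_topology, t2_space} smooth_structure \<Rightarrow> bool" where
  "smooth_manifold M \<longleftrightarrow>
     (\<forall>(U, \<phi>) \<in> charts M. open U \<and> openin (Euclidean_space (mdim M)) (\<phi> ` U) \<and>
        homeomorphic_map (top_of_set U) (subtopology (Euclidean_space (mdim M)) (\<phi> ` U)) \<phi>) \<and>
     (\<Union>(U, \<phi>) \<in> charts M. U) = UNIV \<and>
     (\<forall>(U, \<phi>) \<in> charts M. \<forall>(V, \<psi>) \<in> charts M. \<forall>i < mdim M.
        smooth_on (mdim M) (\<phi> ` (U \<inter> V)) (\<lambda>x. \<psi> (inv_into U \<phi> x) i))"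

definition C_inf :: "'m smooth_structure \<Rightarrow> ('m \<Rightarrow> real) set" where
  "C_inf M = {f. \<forall>(U, \<phi>) \<in> charts M. smooth_on (mdim M) (\<phi> ` U) (f \<circ> inv_into U \<phi>)}"

definition smooth_map ::
  "'m::topological_space smooth_structure \<Rightarrow> 'n::topological_space smooth_structure \<Rightarrow> ('m \<Rightarrow> 'n) \<Rightarrow> bool"
  where
  "smooth_map M N h \<longleftrightarrow> continuous_on UNIV h \<and>
     (\<forall>(U, \<phi>) \<in> charts M. \<forall>(V, \<psi>) \<in> charts N. \<forall>i < mdim N.
        smooth_on (mdim M) (\<phi> ` (U \<inter> h -` V)) (\<lambda>x. \<psi> (h (inv_into U \<phi> x)) i))"


section \<open>Tensor fields\<close>

text \<open>A tangent vector at \<open>p\<close> is a derivation of the algebra of smooth functions at \<open>p\<close>. Tangent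
  vectors, covectors, bivectors and forms are set to \<open>0\<close> on arguments outside their domain, so
  that equality of functions is equality of tensors.\<close>

type_synonym 'm tvec = "('m \<Rightarrow> real) \<Rightarrow> real"
type_synonym 'm covec = "'m tvec \<Rightarrow> real"
type_synonym 'm bivec = "'m covec \<Rightarrow> 'm covec \<Rightarrow> real"
type_synonym 'm vfield = "'m \<Rightarrow> 'm tvec"
type_synonym 'm oneform = "'m \<Rightarrow> 'm covec"
type_synonym 'm bifield = "'m \<Rightarrow> 'm bivec"

definition tangent :: "'m smooth_structure \<Rightarrow> 'm \<Rightarrow> 'm tvec set" where
  "tangent M p = {v.
     (\<forall>f. f \<notin> C_inf M \<longrightarrow> v f = 0) \<and>
     (\<forall>f \<in> C_inf M. \<forall>g \<in> C_inf M. v (f + g) = v f + v g) \<and>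
     (\<forall>c. \<forall>f \<in> C_inf M. v (\<lambda>x. c * f x) = c * v f) \<and>
     (\<forall>f \<in> C_inf M. \<forall>g \<in> C_inf M. v (f * g) = v f * g p + f p * v g)}"

definition cotangent :: "'m smooth_structure \<Rightarrow> 'm \<Rightarrow> 'm covec set" where
  "cotangent M p = {a.
     (\<forall>v. v \<notin> tangent M p \<longrightarrow> a v = 0) \<and>
     (\<forall>v \<in> tangent M p. \<forall>w \<in> tangent M p. a (v + w) = a v + a w) \<and>
     (\<forall>c. \<forall>v \<in> tangent M p. a (\<lambda>f. c * v f) = c * a v)}"

text \<open>\<open>wedge2 M p W\<close> is the second exterior power of a subspace \<open>W\<close> of the tangent space at \<open>p\<close>,
  its elements being regarded as bilinear forms on covectors:
  \<open>(v \<and> w)(a, b) = a(v) b(w) - a(w) b(v)\<close>.\<close>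

definition wedge2 :: "'m smooth_structure \<Rightarrow> 'm \<Rightarrow> 'm tvec set \<Rightarrow> 'm bivec set" where
  "wedge2 M p W = {\<Lambda>. \<exists>(n::nat) v w. (\<forall>i<n. v i \<in> W \<and> w i \<in> W) \<and>
     \<Lambda> = (\<lambda>a b. if a \<in> cotangent M p \<and> b \<in> cotangent M p
                then (\<Sum>i<n. a (v i) * b (w i) - a (w i) * b (v i)) else 0)}"

definition vector_fields :: "'m smooth_structure \<Rightarrow> 'm vfield set" where
  "vector_fields M = {X. (\<forall>p. X p \<in> tangent M p) \<and> (\<forall>f \<in> C_inf M. (\<lambda>p. X p f) \<in> C_inf M)}"

definition one_forms :: "'m smooth_structure \<Rightarrow> 'm oneform set" where
  "one_forms M = {\<alpha>. (\<forall>p. \<alpha> p \<in> cotangent M p) \<and>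
     (\<forall>X \<in> vector_fields M. (\<lambda>p. \<alpha> p (X p)) \<in> C_inf M)}"

definition bivector_fields :: "'m smooth_structure \<Rightarrow> ('m \<Rightarrow> 'm tvec set) \<Rightarrow> 'm bifield set" where
  "bivector_fields M W = {\<Theta>. (\<forall>p. \<Theta> p \<in> wedge2 M p (W p)) \<and>
     (\<forall>\<alpha> \<in> one_forms M. \<forall>\<beta> \<in> one_forms M. (\<lambda>p. \<Theta> p (\<alpha> p) (\<beta> p)) \<in> C_inf M)}"

definition differential :: "'m smooth_structure \<Rightarrow> ('m \<Rightarrow> real) \<Rightarrow> 'm oneform" where
  "differential M F = (\<lambda>p v. if v \<in> tangent M p then v F else 0)"

definition lie_bracket :: "'m vfield \<Rightarrow> 'm vfield \<Rightarrow> 'm vfield" where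
  "lie_bracket X Y = (\<lambda>p f. X p (\<lambda>q. Y q f) - Y p (\<lambda>q. X q f))"

definition lie_oneform :: "'m smooth_structure \<Rightarrow> 'm vfield \<Rightarrow> 'm oneform \<Rightarrow> 'm oneform" where
  "lie_oneform M Z \<alpha> = (THE \<omega>. \<omega> \<in> one_forms M \<and>
     (\<forall>X \<in> vector_fields M. \<forall>p. \<omega> p (X p) = Z p (\<lambda>q. \<alpha> q (X q)) - \<alpha> p (lie_bracket Z X p)))"

definition lie_bivector ::
  "'m smooth_structure \<Rightarrow> 'm vfield \<Rightarrow> 'm bifield \<Rightarrow> 'm oneform \<Rightarrow> 'm oneform \<Rightarrow> 'm \<Rightarrow> real" where
  "lie_bivector M Z \<Theta> \<alpha> \<beta> = (\<lambda>p. Z p (\<lambda>q. \<Theta> q (\<alpha> q) (\<beta> q))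
     - \<Theta> p (lie_oneform M Z \<alpha> p) (\<beta> p) - \<Theta> p (\<alpha> p) (lie_oneform M Z \<beta> p))"

definition sharp_at :: "'m smooth_structure \<Rightarrow> 'm \<Rightarrow> 'm bivec \<Rightarrow> 'm covec \<Rightarrow> 'm tvec" where
  "sharp_at M p \<Lambda> a = (THE v. v \<in> tangent M p \<and> (\<forall>b \<in> cotangent M p. b v = \<Lambda> a b))"

definition sharp :: "'m smooth_structure \<Rightarrow> 'm bifield \<Rightarrow> 'm oneform \<Rightarrow> 'm vfield" where
  "sharp M \<Theta> \<alpha> = (\<lambda>p. sharp_at M p (\<Theta> p) (\<alpha> p))"


section \<open>Poisson tensors\<close>

text \<open>The Schouten bracket \<open>[\<Theta>, \<Theta>]\<close> as a trivector field, up to a sign depending on conventions. The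
  cyclic sum is \<open>C\<^sup>\<infinity>\<close>-linear in each argument, and on exact forms
  \<open>\<langle>L\<^bsub>\<Theta>\<^sup>\<sharp>df\<^esub> dg, \<Theta>\<^sup>\<sharp>dh\<rangle> = {h, {f, g}}\<close> with \<open>{f, g} = \<Theta>(df, dg)\<close>.\<close>

definition schouten_self ::
  "'m smooth_structure \<Rightarrow> 'm bifield \<Rightarrow> 'm oneform \<Rightarrow> 'm oneform \<Rightarrow> 'm oneform \<Rightarrow> 'm \<Rightarrow> real" where
  "schouten_self M \<Theta> \<alpha> \<beta> \<delta> = (\<lambda>p. 2 *
     (lie_oneform M (sharp M \<Theta> \<alpha>) \<beta> p (sharp M \<Theta> \<delta> p) +
      lie_oneform M (sharp M \<Theta> \<beta>) \<delta> p (sharp M \<Theta> \<alpha> p) +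
      lie_oneform M (sharp M \<Theta> \<delta>) \<alpha> p (sharp M \<Theta> \<beta> p)))"

definition poisson_tensor :: "'m smooth_structure \<Rightarrow> 'm bifield \<Rightarrow> bool" where
  "poisson_tensor M \<Theta> \<longleftrightarrow> \<Theta> \<in> bivector_fields M (tangent M) \<and>
     (\<forall>\<alpha> \<in> one_forms M. \<forall>\<beta> \<in> one_forms M. \<forall>\<delta> \<in> one_forms M. schouten_self M \<Theta> \<alpha> \<beta> \<delta> = (\<lambda>p. 0))"

definition Poiss :: "'m smooth_structure \<Rightarrow> 'm bifield \<Rightarrow> 'm vfield set" where
  "Poiss M \<Theta> = {Z \<in> vector_fields M.
     \<forall>\<alpha> \<in> one_forms M. \<forall>\<beta> \<in> one_forms M. lie_bivector M Z \<Theta> \<alpha> \<beta> = (\<lambda>p. 0)}"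

definition Ham :: "'m smooth_structure \<Rightarrow> 'm bifield \<Rightarrow> 'm vfield set" where
  "Ham M \<Theta> = {sharp M \<Theta> (differential M F) | F. F \<in> C_inf M}"

definition Casim :: "'m smooth_structure \<Rightarrow> 'm bifield \<Rightarrow> ('m \<Rightarrow> real) set" where
  "Casim M \<Theta> = {F \<in> C_inf M. sharp M \<Theta> (differential M F) = 0}"


section \<open>Real vector spaces of functions, quotients, direct sums\<close>

text \<open>The multiplicative part of the module records is never used.\<close>

definition function_space :: "('x \<Rightarrow> 'y \<Rightarrow> real) set \<Rightarrow> (real, 'x \<Rightarrow> 'y \<Rightarrow> real) module" where
  "function_space S = \<lparr>carrier = S, mult = undefined, one = undefined,
     zero = 0, add = (+), smult = (\<lambda>c f x y. c * f x y)\<rparr>"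

definition quotient_space :: "(real, 'a) module \<Rightarrow> 'a set \<Rightarrow> (real, 'a set) module" where
  "quotient_space M N = \<lparr>carrier = A_RCOSETS M N, mult = undefined, one = undefined,
     zero = N, add = set_add M, smult = (\<lambda>c K. \<Union>k\<in>K. a_r_coset M N (smult M c k))\<rparr>"

definition direct_sum :: "(real, 'a) module \<Rightarrow> (real, 'b) module \<Rightarrow> (real, 'a \<times> 'b) module" where
  "direct_sum M N = \<lparr>carrier = carrier M \<times> carrier N, mult = undefined, one = undefined,
     zero = (\<zero>\<^bsub>M\<^esub>, \<zero>\<^bsub>N\<^esub>),
     add = (\<lambda>(x, y) (x', y'). (x \<oplus>\<^bsub>M\<^esub> x', y \<oplus>\<^bsub>N\<^esub> y')),
     smult = (\<lambda>c (x, y). (c \<odot>\<^bsub>M\<^esub> x, c \<odot>\<^bsub>N\<^esub> y))\<rparr>"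

definition linear_isos :: "(real, 'a) module \<Rightarrow> (real, 'b) module \<Rightarrow> ('a \<Rightarrow> 'b) set" where
  "linear_isos M N = {h. bij_betw h (carrier M) (carrier N) \<and>
     (\<forall>x \<in> carrier M. \<forall>y \<in> carrier M. h (x \<oplus>\<^bsub>M\<^esub> y) = h x \<oplus>\<^bsub>N\<^esub> h y) \<and>
     (\<forall>c. \<forall>x \<in> carrier M. h (c \<odot>\<^bsub>M\<^esub> x) = c \<odot>\<^bsub>N\<^esub> h x)}"

definition H1_Poisson :: "'m smooth_structure \<Rightarrow> 'm bifield \<Rightarrow> (real, 'm vfield set) module" where
  "H1_Poisson M \<Theta> = quotient_space (function_space (Poiss M \<Theta>)) (Ham M \<Theta>)"


section \<open>Fiber bundles and coupling tensors\<close>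

definition pushforward :: "'b smooth_structure \<Rightarrow> ('e \<Rightarrow> 'b) \<Rightarrow> 'e tvec \<Rightarrow> 'b tvec" where
  "pushforward B \<pi> v = (\<lambda>g. if g \<in> C_inf B then v (g \<circ> \<pi>) else 0)"

definition fiber_bundle ::
  "'e::{second_countable_topology, t2_space} smooth_structure \<Rightarrow>
   'b::{second_countable_topology, t2_space} smooth_structure \<Rightarrow> ('e \<Rightarrow> 'b) \<Rightarrow> bool" where
  "fiber_bundle E B \<pi> \<longleftrightarrow> smooth_manifold E \<and> smooth_manifold B \<and> smooth_map E B \<pi> \<and> surj \<pi> \<and>
     (\<forall>e. pushforward B \<pi> ` tangent E e = tangent B (\<pi> e))"

definition vertical :: "'e smooth_structure \<Rightarrow> 'b smooth_structure \<Rightarrow> ('e \<Rightarrow> 'b) \<Rightarrow> 'e \<Rightarrow> 'e tvec set" where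
  "vertical E B \<pi> e = {v \<in> tangent E e. pushforward B \<pi> v = 0}"

definition ann_vertical ::
  "'e smooth_structure \<Rightarrow> 'b smooth_structure \<Rightarrow> ('e \<Rightarrow> 'b) \<Rightarrow> 'e \<Rightarrow> 'e covec set" where
  "ann_vertical E B \<pi> e = {a \<in> cotangent E e. \<forall>v \<in> vertical E B \<pi> e. a v = 0}"

definition horizontal ::
  "'e smooth_structure \<Rightarrow> 'b smooth_structure \<Rightarrow> ('e \<Rightarrow> 'b) \<Rightarrow> 'e bifield \<Rightarrow> 'e \<Rightarrow> 'e tvec set" where
  "horizontal E B \<pi> \<Theta> e = sharp_at E e (\<Theta> e) ` ann_vertical E B \<pi> e"

definition coupling ::
  "'e smooth_structure \<Rightarrow> 'b smooth_structure \<Rightarrow> ('e \<Rightarrow> 'b) \<Rightarrow> 'e bifield \<Rightarrow> bool" where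
  "coupling E B \<pi> \<Theta> \<longleftrightarrow> (\<forall>e.
     tangent E e = {h + v | h v. h \<in> horizontal E B \<pi> \<Theta> e \<and> v \<in> vertical E B \<pi> e} \<and>
     horizontal E B \<pi> \<Theta> e \<inter> vertical E B \<pi> e = {0})"


section \<open>Forms on the base with coefficients on the total space\<close>

text \<open>A \<open>p\<close>-form at a point takes a list of \<open>p\<close> tangent vectors.\<close>

definition alt_forms_at :: "'b smooth_structure \<Rightarrow> nat \<Rightarrow> 'b \<Rightarrow> ('b tvec list \<Rightarrow> real) set" where
  "alt_forms_at B p b = {w.
     (\<forall>vs. \<not> (length vs = p \<and> set vs \<subseteq> tangent B b) \<longrightarrow> w vs = 0) \<and>
     (\<forall>vs i. length vs = p \<longrightarrow> set vs \<subseteq> tangent B b \<longrightarrow> i < p \<longrightarrow>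
        (\<forall>v \<in> tangent B b. \<forall>v' \<in> tangent B b.
           w (vs[i := v + v']) = w (vs[i := v]) + w (vs[i := v'])) \<and>
        (\<forall>c. \<forall>v \<in> tangent B b. w (vs[i := (\<lambda>f. c * v f)]) = c * w (vs[i := v]))) \<and>
     (\<forall>vs i j. length vs = p \<longrightarrow> set vs \<subseteq> tangent B b \<longrightarrow> i < j \<longrightarrow> j < p \<longrightarrow> vs ! i = vs ! j \<longrightarrow> w vs = 0)}"

definition base_forms :: "'b smooth_structure \<Rightarrow> nat \<Rightarrow> ('b \<Rightarrow> 'b tvec list \<Rightarrow> real) set" where
  "base_forms B p = {\<omega>. (\<forall>b. \<omega> b \<in> alt_forms_at B p b) \<and>
     (\<forall>us. length us = p \<and> set us \<subseteq> vector_fields B \<longrightarrow> (\<lambda>b. \<omega> b (map (\<lambda>u. u b) us)) \<in> C_inf B)}"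

text \<open>\<open>tensor_forms B \<pi> p A\<close> is the tensor product \<open>\<Omega>\<^sup>p(B) \<otimes> A\<close> over \<open>C\<^sup>\<infinity>(B)\<close> for a \<open>C\<^sup>\<infinity>(B)\<close>-submodule
  \<open>A\<close> of \<open>C\<^sup>\<infinity>(E)\<close>: the element \<open>\<omega> \<otimes> f\<close> is identified with the map taking a point \<open>e\<close> of \<open>E\<close> and
  vectors \<open>v\<^sub>1, \<dots>, v\<^sub>p\<close> of \<open>B\<close> at \<open>\<pi>(e)\<close> to \<open>f(e) \<omega>(v\<^sub>1, \<dots>, v\<^sub>p)\<close>. No information is lost, as
  \<open>\<Omega>\<^sup>p(B)\<close> is a projective module.\<close>

type_synonym ('e, 'b) bform = "'e \<Rightarrow> 'b tvec list \<Rightarrow> real"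

definition tensor_forms ::
  "'b smooth_structure \<Rightarrow> ('e \<Rightarrow> 'b) \<Rightarrow> nat \<Rightarrow> ('e \<Rightarrow> real) set \<Rightarrow> ('e, 'b) bform set" where
  "tensor_forms B \<pi> p A = {\<eta>. \<exists>(n::nat) \<omega> f. (\<forall>i<n. \<omega> i \<in> base_forms B p \<and> f i \<in> A) \<and>
     \<eta> = (\<lambda>e vs. \<Sum>i<n. f i e * \<omega> i (\<pi> e) vs)}"

definition Omega_B ::
  "'e smooth_structure \<Rightarrow> 'b smooth_structure \<Rightarrow> ('e \<Rightarrow> 'b) \<Rightarrow> nat \<Rightarrow> ('e, 'b) bform set" where
  "Omega_B E B \<pi> p = tensor_forms B \<pi> p (C_inf E)"

definition Cas_forms ::
  "'e smooth_structure \<Rightarrow> 'b smooth_structure \<Rightarrow> ('e \<Rightarrow> 'b) \<Rightarrow> 'e bifield \<Rightarrow> nat \<Rightarrow> ('e, 'b) bform set" where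
  "Cas_forms E B \<pi> P p = tensor_forms B \<pi> p (Casim E P)"

definition on_fields :: "('e \<Rightarrow> 'b) \<Rightarrow> ('e, 'b) bform \<Rightarrow> 'b vfield list \<Rightarrow> 'e \<Rightarrow> real" where
  "on_fields \<pi> \<eta> us = (\<lambda>e. \<eta> e (map (\<lambda>u. u (\<pi> e)) us))"

definition pullback ::
  "'b smooth_structure \<Rightarrow> ('e \<Rightarrow> 'b) \<Rightarrow> ('e, 'b) bform \<Rightarrow> 'e \<Rightarrow> 'e tvec list \<Rightarrow> real" where
  "pullback B \<pi> \<eta> = (\<lambda>e Xs. \<eta> e (map (pushforward B \<pi>) Xs))"


section \<open>Geometric data and the complex of Casimir-valued forms\<close>

definition geometric_data ::
  "'e smooth_structure \<Rightarrow> 'b smooth_structure \<Rightarrow> ('e \<Rightarrow> 'b) \<Rightarrow> 'e bifield \<Rightarrow>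
   ('e \<Rightarrow> 'e tvec \<Rightarrow> 'e tvec) \<Rightarrow> ('e, 'b) bform \<Rightarrow> 'e bifield \<Rightarrow> bool" where
  "geometric_data E B \<pi> \<Theta> \<gamma> \<sigma> P \<longleftrightarrow>
     (\<forall>e. \<forall>h \<in> horizontal E B \<pi> \<Theta> e. \<forall>v \<in> vertical E B \<pi> e. \<gamma> e (h + v) = v) \<and>
     P \<in> bivector_fields E (vertical E B \<pi>) \<and>
     \<sigma> \<in> Omega_B E B \<pi> 2 \<and>
     (\<exists>\<Theta>H \<in> bivector_fields E (horizontal E B \<pi> \<Theta>). \<Theta> = \<Theta>H + P \<and>
        (\<forall>e. \<forall>X \<in> horizontal E B \<pi> \<Theta> e. \<forall>Y \<in> tangent E e.
           pullback B \<pi> \<sigma> e [X, Y] =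
             - inv_into (ann_vertical E B \<pi> e) (sharp_at E e (\<Theta>H e)) X Y))"

definition hor ::
  "'e smooth_structure \<Rightarrow> 'b smooth_structure \<Rightarrow> ('e \<Rightarrow> 'b) \<Rightarrow> ('e \<Rightarrow> 'e tvec \<Rightarrow> 'e tvec) \<Rightarrow>
   'b vfield \<Rightarrow> 'e vfield" where
  "hor E B \<pi> \<gamma> u =
     (\<lambda>e. THE v. v \<in> tangent E e \<and> \<gamma> e v = 0 \<and> pushforward B \<pi> v = u (\<pi> e))"

text \<open>In \<^term>\<open>nths us (-{i})\<close> the \<open>i\<close>-th entry of the list is omitted, counting from \<open>0\<close>.\<close>

definition cov_deriv ::
  "'e smooth_structure \<Rightarrow> 'b smooth_structure \<Rightarrow> ('e \<Rightarrow> 'b) \<Rightarrow> ('e \<Rightarrow> 'e tvec \<Rightarrow> 'e tvec) \<Rightarrow> nat \<Rightarrow>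
   ('e, 'b) bform \<Rightarrow> ('e, 'b) bform" where
  "cov_deriv E B \<pi> \<gamma> p \<eta> = (THE \<zeta>. \<zeta> \<in> Omega_B E B \<pi> (Suc p) \<and>
     (\<forall>us. length us = Suc p \<and> set us \<subseteq> vector_fields B \<longrightarrow>
        on_fields \<pi> \<zeta> us = (\<lambda>e.
          (\<Sum>i\<le>p. (-1) ^ i * hor E B \<pi> \<gamma> (us ! i) e (on_fields \<pi> \<eta> (nths us (- {i})))) +
          (\<Sum>j\<le>p. \<Sum>i<j. (-1) ^ (i + j) *
             on_fields \<pi> \<eta> (lie_bracket (us ! i) (us ! j) # nths us (- {i, j})) e))))"

definition cocycles ::
  "'e smooth_structure \<Rightarrow> 'b smooth_structure \<Rightarrow> ('e \<Rightarrow> 'b) \<Rightarrow> ('e \<Rightarrow> 'e tvec \<Rightarrow> 'e tvec) \<Rightarrow>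
   'e bifield \<Rightarrow> nat \<Rightarrow> ('e, 'b) bform set" where
  "cocycles E B \<pi> \<gamma> P p = {\<eta> \<in> Cas_forms E B \<pi> P p. cov_deriv E B \<pi> \<gamma> p \<eta> = 0}"

definition coboundaries ::
  "'e smooth_structure \<Rightarrow> 'b smooth_structure \<Rightarrow> ('e \<Rightarrow> 'b) \<Rightarrow> ('e \<Rightarrow> 'e tvec \<Rightarrow> 'e tvec) \<Rightarrow>
   'e bifield \<Rightarrow> nat \<Rightarrow> ('e, 'b) bform set" where
  "coboundaries E B \<pi> \<gamma> P p =
     (case p of 0 \<Rightarrow> {0} | Suc q \<Rightarrow> cov_deriv E B \<pi> \<gamma> q ` Cas_forms E B \<pi> P q)"

definition cohomology ::
  "'e smooth_structure \<Rightarrow> 'b smooth_structure \<Rightarrow> ('e \<Rightarrow> 'b) \<Rightarrow> ('e \<Rightarrow> 'e tvec \<Rightarrow> 'e tvec) \<Rightarrow>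
   'e bifield \<Rightarrow> nat \<Rightarrow> (real, ('e, 'b) bform set) module" where
  "cohomology E B \<pi> \<gamma> P p =
     quotient_space (function_space (cocycles E B \<pi> \<gamma> P p)) (coboundaries E B \<pi> \<gamma> P p)"


section \<open>The map rho\<close>

definition Poiss_V ::
  "'e smooth_structure \<Rightarrow> 'b smooth_structure \<Rightarrow> ('e \<Rightarrow> 'b) \<Rightarrow> 'e bifield \<Rightarrow> 'e vfield set" where
  "Poiss_V E B \<pi> P = {Y \<in> Poiss E P. \<forall>e. Y e \<in> vertical E B \<pi> e}"

definition A_gamma ::
  "'e smooth_structure \<Rightarrow> 'b smooth_structure \<Rightarrow> ('e \<Rightarrow> 'b) \<Rightarrow> ('e \<Rightarrow> 'e tvec \<Rightarrow> 'e tvec) \<Rightarrow>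
   'e bifield \<Rightarrow> 'e vfield set" where
  "A_gamma E B \<pi> \<gamma> P = {Y \<in> Poiss_V E B \<pi> P.
     \<forall>u \<in> vector_fields B. lie_bracket (hor E B \<pi> \<gamma> u) Y \<in> Ham E P}"

definition beta ::
  "'e smooth_structure \<Rightarrow> 'b smooth_structure \<Rightarrow> ('e \<Rightarrow> 'b) \<Rightarrow> ('e \<Rightarrow> 'e tvec \<Rightarrow> 'e tvec) \<Rightarrow>
   'e bifield \<Rightarrow> 'e vfield \<Rightarrow> ('e, 'b) bform" where
  "beta E B \<pi> \<gamma> P Y = (SOME \<beta>. \<beta> \<in> Omega_B E B \<pi> 1 \<and>
     (\<forall>u \<in> vector_fields B.
        lie_bracket (hor E B \<pi> \<gamma> u) Y = - sharp E P (differential E (on_fields \<pi> \<beta> [u]))))"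

definition lie_bform ::
  "'e smooth_structure \<Rightarrow> 'b smooth_structure \<Rightarrow> ('e \<Rightarrow> 'b) \<Rightarrow> nat \<Rightarrow> 'e vfield \<Rightarrow>
   ('e, 'b) bform \<Rightarrow> ('e, 'b) bform" where
  "lie_bform E B \<pi> p Y \<eta> = (THE \<zeta>. \<zeta> \<in> Omega_B E B \<pi> p \<and>
     (\<forall>us. length us = p \<and> set us \<subseteq> vector_fields B \<longrightarrow>
        on_fields \<pi> \<zeta> us = (\<lambda>e. Y e (on_fields \<pi> \<eta> us))))"

definition tau ::
  "'e smooth_structure \<Rightarrow> 'b smooth_structure \<Rightarrow> ('e \<Rightarrow> 'b) \<Rightarrow> ('e \<Rightarrow> 'e tvec \<Rightarrow> 'e tvec) \<Rightarrow>
   ('e, 'b) bform \<Rightarrow> 'e bifield \<Rightarrow> 'e vfield \<Rightarrow> ('e, 'b) bform" where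
  "tau E B \<pi> \<gamma> \<sigma> P Y =
     cov_deriv E B \<pi> \<gamma> 1 (beta E B \<pi> \<gamma> P Y) + lie_bform E B \<pi> 2 Y \<sigma>"

definition rho ::
  "'e smooth_structure \<Rightarrow> 'b smooth_structure \<Rightarrow> ('e \<Rightarrow> 'b) \<Rightarrow> ('e \<Rightarrow> 'e tvec \<Rightarrow> 'e tvec) \<Rightarrow>
   ('e, 'b) bform \<Rightarrow> 'e bifield \<Rightarrow> 'e vfield \<Rightarrow> ('e, 'b) bform set" where
  "rho E B \<pi> \<gamma> \<sigma> P Y =
     a_r_coset (function_space (cocycles E B \<pi> \<gamma> P 2)) (coboundaries E B \<pi> \<gamma> P 2)
       (tau E B \<pi> \<gamma> \<sigma> P Y)"

definition ker_rho ::
  "'e smooth_structure \<Rightarrow> 'b smooth_structure \<Rightarrow> ('e \<Rightarrow> 'b) \<Rightarrow> ('e \<Rightarrow> 'e tvec \<Rightarrow> 'e tvec) \<Rightarrow>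
   ('e, 'b) bform \<Rightarrow> 'e bifield \<Rightarrow> 'e vfield set" where
  "ker_rho E B \<pi> \<gamma> \<sigma> P =
     {Y \<in> A_gamma E B \<pi> \<gamma> P. rho E B \<pi> \<gamma> \<sigma> P Y = \<zero>\<^bsub>cohomology E B \<pi> \<gamma> P 2\<^esub>}"

end

theory Submission
  imports Defs
begin

text \<open>
  \<^bold>\<open>Why the theorem holds.\<close> The coupling form \<open>\<sigma>\<close> is nondegenerate on the horizontal bundle \<open>H\<close>. So a
  form \<open>Q \<in> \<Omega>\<^sup>1\<^sup>,\<^sup>0\<close> determines a horizontal field \<open>X\<^sub>Q\<close> (\<open>hor_field\<close>) by \<open>\<sigma>(\<pi>\<^sub>* X\<^sub>Q, w) = Q(w)\<close>, and every
  vector field on \<open>E\<close> is \<open>X\<^sub>Q + Y\<close> for a unique \<open>Q\<close> and a unique vertical \<open>Y\<close> (\<open>field_decompose\<close>). The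
  bivector \<open>L\<^sub>Z \<Theta>\<close> of \<open>Z = X\<^sub>Q + Y\<close> has a vertical, a mixed and a horizontal component. They vanish if
  and only if, respectively,

  \<^item> \<open>L\<^sub>Y P = 0\<close>,
  \<^item> \<open>[hor w, Y] = - P\<^sup>\<sharp> d(Q(w))\<close> for all \<open>w\<close>, and
  \<^item> \<open>\<partial>Q + L\<^sub>Y \<sigma> = 0\<close>

  (\<open>Poiss_components\<close>). The second condition says that \<open>Q\<close> may serve as \<open>\<beta>\<^sub>Y\<close>. As two choices of \<open>\<beta>\<^sub>Y\<close>
  differ by a Casimir-valued form (\<open>compat_diff_Casimir\<close>), the third can be achieved by some such \<open>Q\<close>
  exactly when \<open>\<tau>\<^sub>Y\<close> is a coboundary. Hence the vertical parts of the Poisson fields of \<open>\<Theta>\<close> are the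
  elements of \<open>ker \<rho>\<close> (\<open>vert_part_Poiss\<close>), and \<open>X\<^sub>Q\<close> is a Poisson field if and only if \<open>Q\<close> is a cocycle
  (\<open>cocycles_iff\<close>). For the Hamiltonian field of \<open>F\<close> one finds \<open>Q = - \<partial>F\<close> and \<open>Y = P\<^sup>\<sharp> dF\<close>
  (\<open>base_form_ham\<close>, \<open>vert_part_ham\<close>). So the vertical parts of Hamiltonian fields are the elements of
  \<open>Ham(E, P)\<close>, and \<open>X\<^sub>Q\<close> is Hamiltonian if and only if \<open>Q\<close> is a coboundary. The result is a pair of
  exact sequences

  \<^item> \<open>0 \<rightarrow> Z\<^sup>1 \<rightarrow> Poiss(E, \<Theta>) \<rightarrow> ker \<rho> \<rightarrow> 0\<close>,
  \<^item> \<open>0 \<rightarrow> B\<^sup>1 \<rightarrow> Ham(E, \<Theta>) \<rightarrow> Ham(E, P) \<rightarrow> 0\<close>,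

  the second contained in the first. Bases adapted to the subspaces split both at once, which gives
  the isomorphism of the quotients (\<open>quotient_splits\<close>).

  \<^bold>\<open>How tensors become algebra.\<close> Every manifold has finitely many functions \<open>y\<^sub>a\<close> and vector fields \<open>u\<^sub>a\<close>
  with \<open>v = \<Sum>\<^sub>a v(y\<^sub>a) u\<^sub>a(p)\<close> for all tangent vectors \<open>v\<close> at \<open>p\<close> (\<open>global_frame\<close>): the tangent bundle is a
  direct summand of a trivial bundle. Over such a frame, vector fields, forms and bivector fields are
  finite combinations with smooth coefficients, and all identities above become identities between
  derivations of the algebra of smooth functions. In particular, the Poisson fields are the
  derivations of the bracket \<open>{f, g} = \<Theta>(df, dg)\<close> (\<open>Poiss_iff\<close>).

  \<^bold>\<open>Where the frame comes from.\<close> By Hadamard's lemma a derivation at a point is a combination of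
  coordinate derivatives (\<open>tangent_in_coordinates\<close>). A second countable manifold of dimension \<open>n\<close> is
  covered by \<open>3 \<cdot> 2\<^sup>n\<close> locally finite families of compact coordinate pieces, each family consisting of
  disjoint pieces (\<open>finely_coloured_cube\<close>, \<open>finely_coloured_Un\<close>, \<open>compact_exhaustion\<close>). A disjoint
  family can be treated as a single chart with \<open>n\<close> cut-off coordinates (\<open>partial_frame\<close>), and finitely
  many such families are put together with a partition of unity.
\<close>


section \<open>Smooth functions of several real variables\<close>

definition coord_box :: "nat \<Rightarrow> (nat \<Rightarrow> real) \<Rightarrow> real \<Rightarrow> (nat \<Rightarrow> real) set" where
  "coord_box n x e = {y \<in> topspace (Euclidean_space n). \<forall>i<n. \<bar>y i - x i\<bar> < e}"

lemma Euclidean_space_eq: "Euclidean_space n = top_of_set (topspace (Euclidean_space n))"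
  by (simp add: Euclidean_space_def euclidean_product_topology)

lemma continuous_map_Euclidean_subtopology:
  assumes "U \<subseteq> topspace (Euclidean_space n)"
  shows "continuous_map (subtopology (Euclidean_space n) U) euclideanreal f \<longleftrightarrow> continuous_on U f"
proof -
  have "subtopology (Euclidean_space n) U = top_of_set U"
    using assms by (metis Euclidean_space_eq inf.absorb_iff2 subtopology_subtopology)
  then show ?thesis by simp
qed

lemma open_Collect_coordinates:
  "open {y::nat \<Rightarrow> real. \<forall>i<n. \<bar>y i - x i\<bar> < e}"
proof -
  have "open {y::nat \<Rightarrow> real. \<forall>i\<in>{..<n}. y (id i) \<in> {z. \<bar>z - x i\<bar> < e}}"
  proof (rule product_topology_basis')
    show "open {z. \<bar>z - x i\<bar> < e}" for i
      by (intro open_Collect_less continuous_intros)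
  qed auto
  then show ?thesis by (simp add: Ball_def)
qed

lemma openin_box: "openin (Euclidean_space n) (coord_box n x e)"
proof -
  have "coord_box n x e = topspace (Euclidean_space n) \<inter> {y. \<forall>i<n. \<bar>y i - x i\<bar> < e}"
    by (auto simp: coord_box_def)
  then show ?thesis
    by (subst Euclidean_space_eq) (auto simp only: intro!: openin_open_Int open_Collect_coordinates)
qed

lemma centre_in_box: "x \<in> topspace (Euclidean_space n) \<Longrightarrow> e > 0 \<Longrightarrow> x \<in> coord_box n x e"
  by (auto simp: coord_box_def)

lemma openin_contains_box:
  assumes "openin (Euclidean_space n) U" "x \<in> U"
  obtains e where "e > 0" "coord_box n x e \<subseteq> U"
proof -
  obtain T where T: "open T" "U = topspace (Euclidean_space n) \<inter> T"
    using assms(1) Euclidean_space_eq[of n] openin_open by metis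
  then have "openin (product_topology (\<lambda>i. euclidean) UNIV) T" "x \<in> T"
    using assms(2) by (auto simp: open_fun_def)
  then obtain V where V: "finite {i. V i \<noteq> topspace euclideanreal}" "\<And>i. openin euclideanreal (V i)"
      "x \<in> Pi\<^sub>E UNIV V" "Pi\<^sub>E UNIV V \<subseteq> T"
    unfolding openin_product_topology_alt by auto
  have "\<exists>d>0. \<forall>z::real. \<bar>z - x i\<bar> < d \<longrightarrow> z \<in> V i" for i
    using V(2)[of i] V(3) by (auto simp: open_dist dist_real_def)
  then obtain d where d: "\<And>i. d i > 0" "\<And>i z. \<bar>z - x i\<bar> < d i \<Longrightarrow> z \<in> V i"
    by metis
  define e where "e = Min (insert 1 (d ` {..<n}))"
  have "e > 0" using d(1) by (auto simp: e_def)
  moreover have "coord_box n x e \<subseteq> U"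
  proof
    fix y assume y: "y \<in> coord_box n x e"
    have "y i \<in> V i" for i
    proof (cases "i < n")
      case True
      then have "e \<le> d i" by (auto simp: e_def)
      then show ?thesis using y True d(2)[of "y i" i] by (auto simp: coord_box_def)
    next
      case False
      have "x \<in> topspace (Euclidean_space n)" using assms openin_subset by blast
      then have "y i = x i" using y False by (auto simp: coord_box_def topspace_Euclidean_space)
      then show ?thesis using V(3) by auto
    qed
    then have "y \<in> Pi\<^sub>E UNIV V" by auto
    then show "y \<in> U" using V(4) T y by (auto simp: coord_box_def)
  qed
  ultimately show ?thesis using that by blast
qed

lemma eventually_fun_upd_in:
  assumes "openin (Euclidean_space n) U" "x \<in> U" "i < n"
  shows "\<forall>\<^sub>F t in nhds (x i). x(i := t) \<in> U"
proof -
  obtain e where e: "e > 0" "coord_box n x e \<subseteq> U"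
    using assms openin_contains_box by blast
  have "x \<in> topspace (Euclidean_space n)" using assms openin_subset by blast
  then have "x(i := t) \<in> U" if "dist t (x i) < e" for t
    using that assms(3) e by (auto simp: coord_box_def topspace_Euclidean_space dist_real_def subset_iff)
  then show ?thesis using e(1) by (auto simp: eventually_nhds_metric)
qed

lemma partial_cong:
  assumes "openin (Euclidean_space n) U" "\<And>x. x \<in> U \<Longrightarrow> f x = g x" "x \<in> U" "i < n"
  shows "partial i f x = partial i g x"
  unfolding partial_def
  by (rule deriv_cong_ev) (use eventually_fun_upd_in[OF assms(1,3,4)] assms(2) in \<open>auto elim: eventually_mono\<close>)

lemma Ck_on_cong:
  assumes "openin (Euclidean_space n) U" "\<And>x. x \<in> U \<Longrightarrow> f x = g x"
  shows "Ck_on n k U f \<Longrightarrow> Ck_on n k U g"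
  using assms(2)
proof (induction k arbitrary: f g)
  case 0
  then show ?case
    using openin_subset[OF assms(1)] by (simp add: continuous_map_Euclidean_subtopology)
next
  case (Suc k)
  have "(\<lambda>t. g (x(i := t))) differentiable at (x i)" if xi: "x \<in> U" "i < n" for x i
  proof -
    have "\<forall>\<^sub>F t in nhds (x i). f (x(i := t)) = g (x(i := t))"
      using eventually_fun_upd_in[OF assms(1) xi] by (rule eventually_mono) (rule Suc.prems(2))
    then obtain S where S: "open S" "x i \<in> S" "\<And>t. t \<in> S \<Longrightarrow> f (x(i := t)) = g (x(i := t))"
      unfolding eventually_nhds by blast
    obtain D where "((\<lambda>t. f (x(i := t))) has_derivative D) (at (x i))"
      using Suc.prems(1) xi unfolding differentiable_def Ck_on.simps by blast
    then have "((\<lambda>t. g (x(i := t))) has_derivative D) (at (x i))"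
      using S by (rule has_derivative_transform_within_open)
    then show ?thesis
      unfolding differentiable_def by blast
  qed
  moreover have "Ck_on n k U (partial i g)" if "i < n" for i
  proof (rule Suc.IH)
    show "Ck_on n k U (partial i f)" using Suc.prems(1) that by simp
    show "partial i f x = partial i g x" if "x \<in> U" for x
      using partial_cong[OF assms(1) Suc.prems(2) that \<open>i < n\<close>] .
  qed
  moreover have "continuous_map (subtopology (Euclidean_space n) U) euclideanreal g"
  proof -
    have "continuous_on U f"
      using Suc.prems(1) openin_subset[OF assms(1)] by (simp add: continuous_map_Euclidean_subtopology)
    then have "continuous_on U g"
      by (rule continuous_on_eq) (rule Suc.prems(2))
    then show ?thesis
      using openin_subset[OF assms(1)] by (simp add: continuous_map_Euclidean_subtopology)
  qed
  ultimately show ?case by simp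
qed

lemma Ck_on_continuous:
  "openin (Euclidean_space n) U \<Longrightarrow> Ck_on n k U f \<Longrightarrow> continuous_on U f"
  by (cases k) (auto simp: continuous_map_Euclidean_subtopology dest: openin_subset)

lemma Ck_on_0: "openin (Euclidean_space n) U \<Longrightarrow> Ck_on n 0 U f \<longleftrightarrow> continuous_on U f"
  by (auto simp: continuous_map_Euclidean_subtopology dest: openin_subset)

lemma Ck_on_mono_order: "openin (Euclidean_space n) U \<Longrightarrow> Ck_on n (Suc k) U f \<Longrightarrow> Ck_on n k U f"
  by (induction k arbitrary: f) auto

lemma Ck_on_1: "openin (Euclidean_space n) U \<Longrightarrow> Ck_on n (Suc k) U f \<Longrightarrow> Ck_on n (Suc 0) U f"
proof (induction k)
  case (Suc k)
  show ?case by (rule Suc.IH[OF Suc.prems(1) Ck_on_mono_order[OF Suc.prems]])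
qed

lemma Ck_on_partial: "Ck_on n (Suc k) U f \<Longrightarrow> i < n \<Longrightarrow> Ck_on n k U (partial i f)"
  by simp

lemma Ck_on_partial_deriv:
  assumes "Ck_on n (Suc k) U f" "x \<in> U" "i < n"
  shows "((\<lambda>t. f (x(i := t))) has_real_derivative partial i f x) (at (x i))"
proof -
  have "(\<lambda>t. f (x(i := t))) differentiable at (x i)" using assms by auto
  then show ?thesis
    unfolding partial_def
    using DERIV_deriv_iff_real_differentiable by blast
qed

lemma Ck_on_SucI:
  assumes "openin (Euclidean_space n) U" "continuous_on U f"
    and "\<And>i. i < n \<Longrightarrow> Ck_on n k U (f' i)"
    and "\<And>i x. i < n \<Longrightarrow> x \<in> U \<Longrightarrow> ((\<lambda>t. f (x(i := t))) has_real_derivative f' i x) (at (x i))"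
  shows "Ck_on n (Suc k) U f"
proof -
  have "partial i f x = f' i x" if "i < n" "x \<in> U" for i x
    unfolding partial_def using assms(4)[OF that] by (rule DERIV_imp_deriv)
  then have "Ck_on n k U (partial i f)" if "i < n" for i
    using Ck_on_cong[OF assms(1) _ assms(3)[OF that]] that by metis
  moreover have "(\<lambda>t. f (x(i := t))) differentiable at (x i)" if "i < n" "x \<in> U" for i x
    using assms(4)[OF that] real_differentiable_def by blast
  ultimately show ?thesis
    using assms(2) openin_subset[OF assms(1)] by (simp add: continuous_map_Euclidean_subtopology)
qed

declare Ck_on.simps [simp del]

lemma Ck_on_subset:
  assumes "Ck_on n k U f" "openin (Euclidean_space n) U" "openin (Euclidean_space n) V" "V \<subseteq> U"
  shows "Ck_on n k V f"
  using assms(1)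
proof (induction k arbitrary: f)
  case 0
  then show ?case using assms(2-4) by (simp only: Ck_on_0) (metis continuous_on_subset)
next
  case (Suc k)
  show ?case
  proof (rule Ck_on_SucI[OF assms(3)])
    show "continuous_on V f"
      using Ck_on_continuous[OF assms(2) Suc.prems] assms(4) continuous_on_subset by blast
    show "Ck_on n k V (partial i f)" if "i < n" for i
      by (rule Suc.IH) (rule Ck_on_partial[OF Suc.prems that])
    show "((\<lambda>t. f (x(i := t))) has_real_derivative partial i f x) (at (x i))"
      if "i < n" "x \<in> V" for i x
      using Ck_on_partial_deriv[OF Suc.prems] that assms(4) by blast
  qed
qed

text \<open>All the clauses in the definition of \<^const>\<open>Ck_on\<close> are local, so that the order can be raised one by
  one from the open sets \<open>V\<close> to \<open>U\<close>.\<close>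

lemma Ck_on_local:
  assumes "openin (Euclidean_space n) U"
    and "\<And>x. x \<in> U \<Longrightarrow> \<exists>V. openin (Euclidean_space n) V \<and> x \<in> V \<and> Ck_on n k V f"
  shows "Ck_on n k U f"
proof -
  have cont: "continuous_on U f" if loc: "\<And>x. x \<in> U \<Longrightarrow> \<exists>V. openin (Euclidean_space n) V \<and> x \<in> V \<and> Ck_on n k V f" for k f
  proof (rule continuous_on_eq_continuous_within[THEN iffD2], safe)
    fix x assume x: "x \<in> U"
    then obtain V where V: "openin (Euclidean_space n) V" "x \<in> V" "Ck_on n k V f"
      using loc[OF x] by blast
    then have "continuous_on V f" using Ck_on_continuous by blast
    moreover obtain T where T: "open T" "V = topspace (Euclidean_space n) \<inter> T"
      using V(1) Euclidean_space_eq[of n] openin_open by metis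
    moreover have "U \<subseteq> topspace (Euclidean_space n)" using assms(1) openin_subset by blast
    ultimately have "continuous_on (U \<inter> T) f"
      by (elim continuous_on_subset) blast
    moreover have "x \<in> T" using V(2) T(2) by blast
    ultimately have "continuous (at x within (U \<inter> T)) f"
      using x by (simp add: continuous_on_eq_continuous_within)
    moreover have "at x within U = at x within (U \<inter> T)"
      by (rule at_within_nhd[OF \<open>x \<in> T\<close> \<open>open T\<close>]) blast
    ultimately show "continuous (at x within U) f" by simp
  qed
  show ?thesis using assms(2)
  proof (induction k arbitrary: f)
    case 0
    then show ?case using cont[of 0 f] assms(1) by (simp only: Ck_on_0)
  next
    case (Suc k)
    show ?case
    proof (rule Ck_on_SucI[OF assms(1)])
      show "continuous_on U f" using cont Suc.prems .
      show "Ck_on n k U (partial i f)" if "i < n" for i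
      proof (rule Suc.IH)
        show "\<exists>V. openin (Euclidean_space n) V \<and> x \<in> V \<and> Ck_on n k V (partial i f)" if "x \<in> U" for x
          using Suc.prems[OF that] Ck_on_partial \<open>i < n\<close> by blast
      qed
      show "((\<lambda>t. f (x(i := t))) has_real_derivative partial i f x) (at (x i))"
        if "i < n" "x \<in> U" for i x
        using Suc.prems[OF that(2)] Ck_on_partial_deriv that(1) by blast
    qed
  qed
qed

lemma Ck_on_const: "openin (Euclidean_space n) U \<Longrightarrow> Ck_on n k U (\<lambda>x. c)"
proof (induction k arbitrary: c)
  case (Suc k)
  then show ?case by (intro Ck_on_SucI[where f' = "\<lambda>i x. 0"]) auto
qed (simp add: Ck_on_0)

lemma Ck_on_coordinate: "openin (Euclidean_space n) U \<Longrightarrow> Ck_on n k U (\<lambda>x. x j)"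
proof (cases k)
  case (Suc l)
  assume U: "openin (Euclidean_space n) U"
  show ?thesis
    unfolding Suc
  proof (rule Ck_on_SucI[where f' = "\<lambda>i x. if i = j then 1 else 0"])
    show "Ck_on n l U (\<lambda>x. if i = j then 1 else 0)" for i
      using Ck_on_const[OF U] by auto
    show "continuous_on U (\<lambda>x. x j)"
      by (rule continuous_on_subset[OF continuous_on_product_coordinates]) auto
  qed (use U in \<open>auto intro!: derivative_eq_intros\<close>)
next
  case 0
  assume U: "openin (Euclidean_space n) U"
  have "continuous_on U (\<lambda>x. x j)"
    by (rule continuous_on_subset[OF continuous_on_product_coordinates]) auto
  then show ?thesis using U 0 by (simp only: Ck_on_0)
qed

lemma Ck_on_add:
  assumes "openin (Euclidean_space n) U"
  shows "Ck_on n k U f \<Longrightarrow> Ck_on n k U g \<Longrightarrow> Ck_on n k U (\<lambda>x. f x + g x)"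
proof (induction k arbitrary: f g)
  case 0
  then show ?case using assms by (simp only: Ck_on_0) (intro continuous_intros)
next
  case (Suc k)
  show ?case
  proof (rule Ck_on_SucI[OF assms, where f' = "\<lambda>i x. partial i f x + partial i g x"])
    show "continuous_on U (\<lambda>x. f x + g x)"
      using Suc.prems Ck_on_continuous[OF assms] by (intro continuous_intros) blast+
    show "Ck_on n k U (\<lambda>x. partial i f x + partial i g x)" if "i < n" for i
      by (rule Suc.IH) (rule Ck_on_partial[OF _ that], rule Suc.prems)+
  qed (intro derivative_intros Ck_on_partial_deriv[OF Suc.prems(1)] Ck_on_partial_deriv[OF Suc.prems(2)])
qed

lemma Ck_on_mult:
  assumes "openin (Euclidean_space n) U"
  shows "Ck_on n k U f \<Longrightarrow> Ck_on n k U g \<Longrightarrow> Ck_on n k U (\<lambda>x. f x * g x)"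
proof (induction k arbitrary: f g)
  case 0
  then show ?case using assms by (simp only: Ck_on_0) (intro continuous_intros)
next
  case (Suc k)
  show ?case
  proof (rule Ck_on_SucI[OF assms, where f' = "\<lambda>i x. partial i f x * g x + f x * partial i g x"])
    show "continuous_on U (\<lambda>x. f x * g x)"
      using Suc.prems Ck_on_continuous[OF assms] by (intro continuous_intros) blast+
    show "Ck_on n k U (\<lambda>x. partial i f x * g x + f x * partial i g x)" if "i < n" for i
      by (intro Ck_on_add[OF assms] Suc.IH Ck_on_mono_order[OF assms Suc.prems(1)]
          Ck_on_mono_order[OF assms Suc.prems(2)] Ck_on_partial[OF _ that] Suc.prems)
    show "((\<lambda>t. f (x(i := t)) * g (x(i := t))) has_real_derivative
            partial i f x * g x + f x * partial i g x) (at (x i))" if "i < n" "x \<in> U" for i x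
      by (rule DERIV_cong[OF DERIV_mult[OF Ck_on_partial_deriv[OF Suc.prems(1) that(2,1)]
              Ck_on_partial_deriv[OF Suc.prems(2) that(2,1)]]]) (simp add: algebra_simps)
  qed
qed

lemma Ck_on_sum:
  assumes "openin (Euclidean_space n) U" "\<And>a. a \<in> A \<Longrightarrow> Ck_on n k U (f a)"
  shows "Ck_on n k U (\<lambda>x. \<Sum>a\<in>A. f a x)"
  using assms(2)
proof (induction A rule: infinite_finite_induct)
  case (insert a A)
  then show ?case by (simp add: Ck_on_add[OF assms(1)])
qed (simp_all add: Ck_on_const[OF assms(1)])

lemma Ck_on_prod:
  assumes "openin (Euclidean_space n) U" "\<And>a. a \<in> A \<Longrightarrow> Ck_on n k U (f a)"
  shows "Ck_on n k U (\<lambda>x. \<Prod>a\<in>A. f a x)"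
  using assms(2)
proof (induction A rule: infinite_finite_induct)
  case (insert a A)
  then show ?case by (simp add: Ck_on_mult[OF assms(1)])
qed (simp_all add: Ck_on_const[OF assms(1)])

lemma Ck_on_inverse:
  assumes U: "openin (Euclidean_space n) U" and nz: "\<And>x. x \<in> U \<Longrightarrow> f x \<noteq> 0"
  shows "Ck_on n k U f \<Longrightarrow> Ck_on n k U (\<lambda>x. inverse (f x))"
proof (induction k)
  case 0
  then show ?case using assms by (simp only: Ck_on_0) (intro continuous_intros, auto)
next
  case (Suc k)
  have IH: "Ck_on n k U (\<lambda>x. inverse (f x))"
    using Suc Ck_on_mono_order[OF U] by blast
  show ?case
  proof (rule Ck_on_SucI[OF U, where f' = "\<lambda>i x. (- 1 * partial i f x) * (inverse (f x) * inverse (f x))"])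
    show "continuous_on U (\<lambda>x. inverse (f x))"
      using Ck_on_continuous[OF U IH] .
    show "Ck_on n k U (\<lambda>x. (- 1 * partial i f x) * (inverse (f x) * inverse (f x)))" if "i < n" for i
      by (intro Ck_on_mult[OF U] IH Ck_on_const[OF U] Ck_on_partial[OF Suc.prems that])
    show "((\<lambda>t. inverse (f (x(i := t)))) has_real_derivative
            (- 1 * partial i f x) * (inverse (f x) * inverse (f x))) (at (x i))" if "i < n" "x \<in> U" for i x
      by (rule DERIV_cong[OF DERIV_inverse_fun[OF Ck_on_partial_deriv[OF Suc.prems that(2,1)]]])
        (use nz[OF that(2)] in \<open>simp_all add: algebra_simps\<close>)
  qed
qed

text \<open>The chain rule along a curve, from continuity of the partial derivatives alone: the increment of
  \<open>f\<close> is telescoped into increments in one coordinate, to each of which the mean value theorem applies.\<close>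

lemma partial_mean_value:
  assumes C: "Ck_on n (Suc 0) U f" and "coord_box n x e \<subseteq> U" "y \<in> coord_box n x e"
    and i: "i < n" and x: "x \<in> topspace (Euclidean_space n)" and e: "e > 0"
  defines "z \<equiv> \<lambda>j k. if k < j then y k else x k"
  shows "\<exists>w. w \<in> U \<and> (\<forall>k. \<bar>w k - x k\<bar> \<le> \<bar>y k - x k\<bar>) \<and>
     f (z (Suc i)) - f (z i) = partial i f w * (y i - x i)"
proof -
  have between: "(z i)(i := t) \<in> coord_box n x e" if "\<bar>t - x i\<bar> \<le> \<bar>y i - x i\<bar>" for t
    using that assms by (fastforce simp: coord_box_def topspace_Euclidean_space z_def)
  have z: "z (Suc i) = (z i)(i := y i)" "z i = (z i)(i := x i)"
    by (auto simp: z_def fun_eq_iff less_Suc_eq)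
  have D: "((\<lambda>t. f ((z i)(i := t))) has_real_derivative partial i f ((z i)(i := t))) (at t)"
    if "\<bar>t - x i\<bar> \<le> \<bar>y i - x i\<bar>" for t
    using Ck_on_partial_deriv[OF C, of "(z i)(i := t)" i] between[OF that] assms(2) i by auto
  have "\<exists>t. \<bar>t - x i\<bar> \<le> \<bar>y i - x i\<bar> \<and> f ((z i)(i := y i)) - f ((z i)(i := x i)) = partial i f ((z i)(i := t)) * (y i - x i)"
  proof (cases "y i" "x i" rule: linorder_cases)
    case equal
    then show ?thesis by (auto intro: exI[of _ "x i"])
  next
    case less
    obtain t where "y i < t" "t < x i" "f ((z i)(i := x i)) - f ((z i)(i := y i)) = (x i - y i) * partial i f ((z i)(i := t))"
      using MVT2[OF less, of "\<lambda>t. f ((z i)(i := t))" "\<lambda>t. partial i f ((z i)(i := t))"] D less by fastforce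
    then show ?thesis by (intro exI[of _ t]) (auto simp: algebra_simps)
  next
    case greater
    obtain t where "x i < t" "t < y i" "f ((z i)(i := y i)) - f ((z i)(i := x i)) = (y i - x i) * partial i f ((z i)(i := t))"
      using MVT2[OF greater, of "\<lambda>t. f ((z i)(i := t))" "\<lambda>t. partial i f ((z i)(i := t))"] D greater by fastforce
    then show ?thesis by (intro exI[of _ t]) (auto simp: algebra_simps)
  qed
  then obtain t where t: "\<bar>t - x i\<bar> \<le> \<bar>y i - x i\<bar>"
    "f ((z i)(i := y i)) - f ((z i)(i := x i)) = partial i f ((z i)(i := t)) * (y i - x i)" by blast
  have "f (z (Suc i)) - f (z i) = partial i f ((z i)(i := t)) * (y i - x i)"
    using t(2) z by metis
  moreover have "(z i)(i := t) \<in> U" using between[OF t(1)] assms(2) by blast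
  moreover have "\<forall>k. \<bar>((z i)(i := t)) k - x k\<bar> \<le> \<bar>y k - x k\<bar>"
    using t(1) by (auto simp: z_def)
  ultimately show ?thesis by blast
qed

lemma chain_rule_curve:
  fixes c :: "real \<Rightarrow> nat \<Rightarrow> real"
  assumes U: "openin (Euclidean_space n) U" and C: "Ck_on n (Suc 0) U f"
    and c0: "c t0 \<in> U" and cE: "\<And>t. c t \<in> topspace (Euclidean_space n)"
    and c': "\<And>i. i < n \<Longrightarrow> ((\<lambda>t. c t i) has_real_derivative c' i) (at t0)"
  shows "((\<lambda>t. f (c t)) has_real_derivative (\<Sum>i<n. partial i f (c t0) * c' i)) (at t0)"
proof -
  let ?x = "c t0"
  obtain e where e: "e > 0" "coord_box n ?x e \<subseteq> U" using openin_contains_box[OF U c0] .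
  define z where "z = (\<lambda>t (j::nat) k. if k < j then c t k else ?x k)"
  define good where "good = (\<lambda>i t w. w \<in> U \<and> (\<forall>k. \<bar>w k - ?x k\<bar> \<le> \<bar>c t k - ?x k\<bar>) \<and>
     f (z t (Suc i)) - f (z t i) = partial i f w * (c t i - ?x i))"
  define w where "w = (\<lambda>i t. if \<exists>w. good i t w then SOME w. good i t w else ?x)"
  have ex: "good i t (w i t)" if "c t \<in> coord_box n ?x e" "i < n" for i t
  proof -
    have "\<exists>w. good i t w"
      unfolding good_def z_def using partial_mean_value[OF C e(2) that(1,2) cE e(1)] by simp
    then show ?thesis unfolding w_def using someI_ex[of "good i t"] by presburger
  qed
  have lim: "((\<lambda>t. c t i) \<longlongrightarrow> ?x i) (at t0)" for i
  proof (cases "i < n")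
    case True
    then show ?thesis using DERIV_isCont[OF c'[OF True]] by (simp add: isCont_def)
  next
    case False
    then show ?thesis using cE by (simp add: topspace_Euclidean_space)
  qed
  have ev: "\<forall>\<^sub>F t in at t0. c t \<in> coord_box n ?x e"
  proof -
    have "\<forall>\<^sub>F t in at t0. \<forall>i\<in>{..<n}. \<bar>c t i - ?x i\<bar> < e"
    proof (rule eventually_ball_finite, safe)
      fix i
      show "\<forall>\<^sub>F t in at t0. \<bar>c t i - ?x i\<bar> < e"
        using tendstoD[OF lim[of i] e(1)] by (simp add: dist_real_def)
    qed
    then show ?thesis by (rule eventually_mono) (use cE in \<open>auto simp: coord_box_def\<close>)
  qed
  have wlim: "((\<lambda>t. partial i f (w i t)) \<longlongrightarrow> partial i f ?x) (at t0)" if i: "i < n" for i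
  proof -
    have near: "\<forall>\<^sub>F t in at t0. good i t (w i t)"
      using ev by eventually_elim (use ex i in blast)
    have "continuous_on U (partial i f)"
      using Ck_on_partial[OF C i] Ck_on_0[OF U] by blast
    moreover have wl: "(w i \<longlongrightarrow> ?x) (at t0)"
    proof -
      have "((\<lambda>t. w i t k) \<longlongrightarrow> ?x k) (at t0)" for k
      proof -
        have "((\<lambda>t. c t k - ?x k) \<longlongrightarrow> 0) (at t0)" using lim[of k] by (simp add: LIM_zero)
        then have "((\<lambda>t. w i t k - ?x k) \<longlongrightarrow> 0) (at t0)"
          by (rule Lim_null_comparison[rotated, OF tendsto_norm_zero])
            (rule eventually_mono[OF near], simp add: good_def)
        then show ?thesis by (simp add: LIM_zero_iff)
      qed
      then show ?thesis
        using limitin_componentwise[of "\<lambda>i. euclideanreal" UNIV "w i" ?x "at t0"]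
        by (simp add: euclidean_product_topology)
    qed
    moreover have "\<forall>\<^sub>F t in at t0. w i t \<in> U" using near by eventually_elim (auto simp: good_def)
    ultimately show ?thesis
      using c0 continuous_on_tendsto_compose by blast
  qed
  have "((\<lambda>t. (f (c t) - f ?x) / (t - t0)) \<longlongrightarrow> (\<Sum>i<n. partial i f ?x * c' i)) (at t0)"
  proof (rule Lim_transform_eventually)
    show "((\<lambda>t. \<Sum>i<n. partial i f (w i t) * ((c t i - ?x i) / (t - t0))) \<longlongrightarrow> (\<Sum>i<n. partial i f ?x * c' i)) (at t0)"
      using wlim c' by (intro tendsto_intros) (auto simp: has_field_derivative_iff)
    show "\<forall>\<^sub>F t in at t0. (\<Sum>i<n. partial i f (w i t) * ((c t i - ?x i) / (t - t0))) = (f (c t) - f ?x) / (t - t0)"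
      using ev
    proof eventually_elim
      case (elim t)
      have "z t n = c t" "z t 0 = ?x"
        using cE by (auto simp: z_def fun_eq_iff topspace_Euclidean_space)
      then have "f (c t) - f ?x = (\<Sum>i<n. f (z t (Suc i)) - f (z t i))"
        using sum_lessThan_telescope[of "\<lambda>i. f (z t i)" n] by simp
      also have "\<dots> = (\<Sum>i<n. partial i f (w i t) * (c t i - ?x i))"
        using ex[OF elim] by (auto simp: good_def)
      finally show ?case by (simp add: sum_divide_distrib)
    qed
  qed
  then show ?thesis by (simp add: has_field_derivative_iff)
qed

text \<open>Induction on the order: by the chain rule, the partial derivatives of the composition are sums of
  products of partial derivatives of \<open>g\<close> with compositions of partial derivatives of \<open>f\<close>, and all of these
  have lower order.\<close>

lemma Ck_on_compose:
  fixes g :: "(nat \<Rightarrow> real) \<Rightarrow> nat \<Rightarrow> real"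
  assumes U: "openin (Euclidean_space n) U" and V: "openin (Euclidean_space m) V"
    and gE: "\<And>x. x \<in> topspace (Euclidean_space n) \<Longrightarrow> g x \<in> topspace (Euclidean_space m)"
    and gV: "\<And>x. x \<in> U \<Longrightarrow> g x \<in> V"
  shows "Ck_on m k V f \<Longrightarrow> (\<And>i. i < m \<Longrightarrow> Ck_on n k U (\<lambda>x. g x i)) \<Longrightarrow> Ck_on n k U (\<lambda>x. f (g x))"
proof (induction k arbitrary: f)
  case (0 f)
  have *: "continuous_on U (\<lambda>x. g x i)" for i
  proof (cases "i < m")
    case True
    then show ?thesis using 0(2) U by (simp only: Ck_on_0)
  next
    case False
    then have "\<And>x. x \<in> U \<Longrightarrow> g x i = 0"
      using gE openin_subset[OF U] by (auto simp: topspace_Euclidean_space subset_iff)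
    then show ?thesis by (simp cong: continuous_on_cong)
  qed
  have "continuous_on U (\<lambda>x. f (g x))"
    by (rule continuous_on_compose2[OF Ck_on_continuous[OF V 0(1)] continuous_on_coordinatewise_then_product[OF *]])
      (use gV in auto)
  then show ?case using U by (simp only: Ck_on_0)
next
  case (Suc k)
  have down: "Ck_on n k U (\<lambda>x. g x i)" if "i < m" for i
    using Suc.prems(2)[OF that] Ck_on_mono_order[OF U] by blast
  show ?case
  proof (rule Ck_on_SucI[OF U, where f' = "\<lambda>j x. \<Sum>i<m. partial i f (g x) * partial j (\<lambda>x. g x i) x"])
    have "Ck_on n k U (\<lambda>x. f (g x))"
      using Suc.IH[OF Ck_on_mono_order[OF V Suc.prems(1)] down] .
    then show "continuous_on U (\<lambda>x. f (g x))" using Ck_on_continuous[OF U] by blast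
    show "Ck_on n k U (\<lambda>x. \<Sum>i<m. partial i f (g x) * partial j (\<lambda>x. g x i) x)" if "j < n" for j
    proof (rule Ck_on_sum[OF U], rule Ck_on_mult[OF U])
      fix i assume "i \<in> {..<m}"
      then have i: "i < m" by simp
      show "Ck_on n k U (\<lambda>x. partial i f (g x))"
        by (rule Suc.IH[OF Ck_on_partial[OF Suc.prems(1) i] down])
      show "Ck_on n k U (partial j (\<lambda>x. g x i))"
        by (rule Ck_on_partial[OF Suc.prems(2)[OF i] that])
    qed
    fix j x assume j: "j < n" and x: "x \<in> U"
    have xE: "x \<in> topspace (Euclidean_space n)" using x openin_subset[OF U] by blast
    have "Ck_on m (Suc 0) V f" using Ck_on_1[OF V Suc.prems(1)] .
    moreover have "\<And>t. g (x(j := t)) \<in> topspace (Euclidean_space m)"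
      using xE j by (intro gE) (auto simp: topspace_Euclidean_space)
    moreover have gx: "g (x(j := x j)) \<in> V" using gV[OF x] by simp
    ultimately have "((\<lambda>t. f (g (x(j := t)))) has_real_derivative
        (\<Sum>i<m. partial i f (g (x(j := x j))) * partial j (\<lambda>x. g x i) x)) (at (x j))"
      using chain_rule_curve[OF V, where c = "\<lambda>t. g (x(j := t))" and f = f and ?t0.0 = "x j"
          and c' = "\<lambda>i. partial j (\<lambda>x. g x i) x"] Ck_on_partial_deriv[OF Suc.prems(2) x j] by blast
    then show "((\<lambda>t. f (g (x(j := t)))) has_real_derivative
        (\<Sum>i<m. partial i f (g x) * partial j (\<lambda>x. g x i) x)) (at (x j))" by simp
  qed
qed

lemma smooth_on_compose:
  assumes U: "openin (Euclidean_space n) U" and V: "openin (Euclidean_space m) V"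
    and gV: "\<And>x. x \<in> U \<Longrightarrow> g x \<in> V"
    and f: "smooth_on m V f" and g: "\<And>i. i < m \<Longrightarrow> smooth_on n U (\<lambda>x. g x i)"
  shows "smooth_on n U (\<lambda>x. f (g x))"
  unfolding smooth_on_def
proof
  fix k
  \<comment> \<open>Outside \<open>U\<close> the values of \<open>g\<close> may leave the model space; they are replaced by the origin.\<close>
  define h where "h = (\<lambda>x. if x \<in> U then g x else (\<lambda>i. 0))"
  have "Ck_on n k U (\<lambda>x. f (h x))"
  proof (rule Ck_on_compose[OF U V, where g = h and f = f])
    show "h x \<in> topspace (Euclidean_space m)" for x
      using gV openin_subset[OF V] by (auto simp: h_def topspace_Euclidean_space)
    show "Ck_on n k U (\<lambda>x. h x i)" if "i < m" for i
      by (rule Ck_on_cong[OF U, of "\<lambda>x. g x i"]) (use g[OF that] in \<open>auto simp: h_def smooth_on_def\<close>)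
  qed (use f gV in \<open>auto simp: smooth_on_def h_def\<close>)
  then show "Ck_on n k U (\<lambda>x. f (g x))"
    by (rule Ck_on_cong[OF U, rotated]) (simp add: h_def)
qed

lemma smooth_onD: "smooth_on n U f \<Longrightarrow> Ck_on n k U f"
  by (simp add: smooth_on_def)

lemma smooth_on_cong:
  assumes "openin (Euclidean_space n) U" "\<And>x. x \<in> U \<Longrightarrow> f x = g x" "smooth_on n U f"
  shows "smooth_on n U g"
  unfolding smooth_on_def
proof
  fix k
  show "Ck_on n k U g"
    by (rule Ck_on_cong[OF assms(1,2)]) (use assms(3) in \<open>auto simp: smooth_on_def\<close>)
qed

lemma smooth_on_subset:
  assumes "smooth_on n U f" "openin (Euclidean_space n) U" "openin (Euclidean_space n) V" "V \<subseteq> U"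
  shows "smooth_on n V f"
  unfolding smooth_on_def by (rule allI, rule Ck_on_subset[OF smooth_onD[OF assms(1)] assms(2-4)])

lemma smooth_on_local:
  assumes "openin (Euclidean_space n) U"
    and "\<And>x. x \<in> U \<Longrightarrow> \<exists>V. openin (Euclidean_space n) V \<and> x \<in> V \<and> smooth_on n V f"
  shows "smooth_on n U f"
  unfolding smooth_on_def
proof
  fix k
  show "Ck_on n k U f"
  proof (rule Ck_on_local[OF assms(1)])
    fix x assume "x \<in> U"
    from assms(2)[OF this] show "\<exists>V. openin (Euclidean_space n) V \<and> x \<in> V \<and> Ck_on n k V f"
      unfolding smooth_on_def by blast
  qed
qed

lemma smooth_on_partial:
  assumes "smooth_on n U f" "i < n"
  shows "smooth_on n U (partial i f)"
  unfolding smooth_on_def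
  by (intro allI Ck_on_partial[OF smooth_onD[OF assms(1)] assms(2)])

lemma smooth_on_partial_deriv:
  assumes "smooth_on n U f" "x \<in> U" "i < n"
  shows "((\<lambda>t. f (x(i := t))) has_real_derivative partial i f x) (at (x i))"
  by (rule Ck_on_partial_deriv[OF smooth_onD[OF assms(1)] assms(2,3)])

lemma smooth_on_const: "openin (Euclidean_space n) U \<Longrightarrow> smooth_on n U (\<lambda>x. c)"
  by (simp add: smooth_on_def Ck_on_const)

lemma smooth_on_coordinate: "openin (Euclidean_space n) U \<Longrightarrow> smooth_on n U (\<lambda>x. x j)"
  by (simp add: smooth_on_def Ck_on_coordinate)

lemma smooth_on_add:
  "openin (Euclidean_space n) U \<Longrightarrow> smooth_on n U f \<Longrightarrow> smooth_on n U g \<Longrightarrow> smooth_on n U (\<lambda>x. f x + g x)"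
  by (simp add: smooth_on_def Ck_on_add)

lemma smooth_on_mult:
  "openin (Euclidean_space n) U \<Longrightarrow> smooth_on n U f \<Longrightarrow> smooth_on n U g \<Longrightarrow> smooth_on n U (\<lambda>x. f x * g x)"
  by (simp add: smooth_on_def Ck_on_mult)

lemma smooth_on_sum:
  "openin (Euclidean_space n) U \<Longrightarrow> (\<And>a. a \<in> A \<Longrightarrow> smooth_on n U (f a)) \<Longrightarrow> smooth_on n U (\<lambda>x. \<Sum>a\<in>A. f a x)"
  by (simp add: smooth_on_def Ck_on_sum)

lemma smooth_on_prod:
  "openin (Euclidean_space n) U \<Longrightarrow> (\<And>a. a \<in> A \<Longrightarrow> smooth_on n U (f a)) \<Longrightarrow> smooth_on n U (\<lambda>x. \<Prod>a\<in>A. f a x)"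
  by (simp add: smooth_on_def Ck_on_prod)

lemma smooth_on_inverse:
  "openin (Euclidean_space n) U \<Longrightarrow> (\<And>x. x \<in> U \<Longrightarrow> f x \<noteq> 0) \<Longrightarrow> smooth_on n U f \<Longrightarrow> smooth_on n U (\<lambda>x. inverse (f x))"
  by (simp add: smooth_on_def Ck_on_inverse)

section \<open>Bump functions in coordinates\<close>

text \<open>The functions \<open>x\<^sup>-\<^sup>k exp (- 1 / x)\<close>, extended by \<open>0\<close>; together they are closed under
  differentiation, which makes each of them smooth.\<close>

definition flat_exp :: "nat \<Rightarrow> real \<Rightarrow> real" where
  "flat_exp k x = (if x > 0 then inverse x ^ k * exp (- inverse x) else 0)"

lemma flat_exp_tendsto_0: "((\<lambda>x. flat_exp k x) \<longlongrightarrow> 0) (at 0)"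
proof -
  have "((\<lambda>x::real. inverse x ^ k * exp (- inverse x)) \<longlongrightarrow> 0) (at_right 0)"
  proof -
    have "((\<lambda>y::real. y ^ k / exp y) \<longlongrightarrow> 0) at_top"
      by (rule tendsto_power_div_exp_0)
    then have "((\<lambda>x::real. inverse x ^ k / exp (inverse x)) \<longlongrightarrow> 0) (at_right 0)"
      by (rule filterlim_compose) (rule filterlim_inverse_at_top_right)
    then show ?thesis by (simp add: exp_minus divide_inverse)
  qed
  then have "((\<lambda>x. flat_exp k x) \<longlongrightarrow> 0) (at_right 0)"
    by (rule Lim_transform_eventually)
      (auto simp: flat_exp_def eventually_at_filter)
  moreover have "((\<lambda>x. flat_exp k x) \<longlongrightarrow> 0) (at_left 0)"
    by (rule tendsto_eventually) (auto simp: flat_exp_def eventually_at_filter)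
  ultimately show ?thesis by (simp add: filterlim_split_at)
qed

lemma flat_exp_has_derivative:
  "(flat_exp k has_real_derivative (- real k * flat_exp (Suc k) x + flat_exp (Suc (Suc k)) x)) (at x)"
proof (cases x "0::real" rule: linorder_cases)
  case less
  have "((\<lambda>x. 0) has_real_derivative 0) (at x)" by simp
  then have "(flat_exp k has_real_derivative 0) (at x)"
    by (rule has_field_derivative_transform_within_open[of _ _ _ "{..<0}"])
      (use less in \<open>auto simp: flat_exp_def\<close>)
  then show ?thesis using less by (simp add: flat_exp_def)
next
  case equal
  have "((\<lambda>h. flat_exp (Suc k) h) \<longlongrightarrow> 0) (at 0)" by (rule flat_exp_tendsto_0)
  moreover have "flat_exp (Suc k) h = (flat_exp k h - flat_exp k 0) / (h - 0)" for h
    by (simp add: flat_exp_def divide_inverse mult_ac)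
  ultimately have "(flat_exp k has_real_derivative 0) (at 0)"
    by (simp add: has_field_derivative_iff)
  then show ?thesis using equal by (simp add: flat_exp_def)
next
  case greater
  have inv: "((\<lambda>x. inverse x) has_real_derivative - (inverse x * inverse x)) (at x)"
    using DERIV_inverse_fun[OF DERIV_ident, of x] greater by simp
  have "((\<lambda>x. inverse x ^ k * exp (- inverse x)) has_real_derivative
     (- real k * (inverse x ^ Suc k * exp (- inverse x)) + inverse x ^ Suc (Suc k) * exp (- inverse x))) (at x)"
  proof -
    have pow: "((\<lambda>x. inverse x ^ k) has_real_derivative real k * (- (inverse x * inverse x) * inverse x ^ (k - 1))) (at x)"
      using DERIV_power[OF inv, of k] by simp
    have exp: "((\<lambda>x. exp (- inverse x)) has_real_derivative exp (- inverse x) * (inverse x * inverse x)) (at x)"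
      using DERIV_fun_exp[OF DERIV_minus[OF inv]] by simp
    have "real k * (- (inverse x * inverse x) * inverse x ^ (k - 1)) = - real k * inverse x ^ Suc k"
      by (cases k) (simp_all add: algebra_simps)
    then show ?thesis
      by (intro DERIV_mult[OF pow exp, THEN DERIV_cong]) (simp only:, simp add: algebra_simps)
  qed
  then have "(flat_exp k has_real_derivative
     (- real k * (inverse x ^ Suc k * exp (- inverse x)) + inverse x ^ Suc (Suc k) * exp (- inverse x))) (at x)"
    by (rule has_field_derivative_transform_within_open[of _ _ _ "{0<..}"])
      (use greater in \<open>auto simp: flat_exp_def\<close>)
  then show ?thesis using greater by (simp add: flat_exp_def)
qed

lemma flat_exp_pos_iff: "flat_exp k x > 0 \<longleftrightarrow> x > 0" and flat_exp_nonneg: "flat_exp k x \<ge> 0"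
  and flat_exp_eq_0_iff: "flat_exp k x = 0 \<longleftrightarrow> x \<le> 0"
  by (auto simp: flat_exp_def)

lemma Ck_on_flat_exp:
  assumes U: "openin (Euclidean_space n) U"
  shows "Ck_on n m U (\<lambda>x. flat_exp k (a * x i + b))"
proof (induction m arbitrary: k)
  have cont: "continuous_on U (\<lambda>x. flat_exp k (a * x i + b))" for k
  proof -
    have "continuous_on UNIV (flat_exp k)"
      using flat_exp_has_derivative by (meson DERIV_isCont continuous_at_imp_continuous_on)
    moreover have "continuous_on U (\<lambda>x. a * x i + b)"
      by (intro continuous_intros continuous_on_subset[OF continuous_on_product_coordinates]) auto
    ultimately show ?thesis by (rule continuous_on_compose2) auto
  qed
  {
    case 0
    show ?case using cont U by (simp only: Ck_on_0)
  next
    case (Suc m)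
    define f' where "f' = (\<lambda>j x. if j = i then a * (- real k * flat_exp (Suc k) (a * x i + b) + flat_exp (Suc (Suc k)) (a * x i + b)) else 0)"
    show ?case
    proof (rule Ck_on_SucI[OF U cont, where f' = f'])
      show "Ck_on n m U (f' j)" for j
      proof (cases "j = i")
        case True
        have "Ck_on n m U (\<lambda>x. a * (- real k * flat_exp (Suc k) (a * x i + b) + flat_exp (Suc (Suc k)) (a * x i + b)))"
          by (intro Ck_on_mult[OF U] Ck_on_add[OF U] Ck_on_const[OF U] Suc.IH)
        then show ?thesis using True by (simp add: f'_def)
      qed (simp add: f'_def Ck_on_const[OF U])
      show "((\<lambda>t. flat_exp k (a * (x(j := t)) i + b)) has_real_derivative f' j x) (at (x j))" for j x
      proof (cases "j = i")
        case True
        have "((\<lambda>t. a * t + b) has_real_derivative a) (at (x i))"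
          by (auto intro!: derivative_eq_intros)
        then have "((\<lambda>t. flat_exp k (a * t + b)) has_real_derivative
            (- real k * flat_exp (Suc k) (a * x i + b) + flat_exp (Suc (Suc k)) (a * x i + b)) * a) (at (x i))"
          by (rule DERIV_chain2[where f = "flat_exp k" and g = "\<lambda>t. a * t + b" and x = "x i",
                OF flat_exp_has_derivative])
        then show ?thesis using True by (simp add: f'_def mult.commute)
      qed (simp add: f'_def)
    qed
  }
qed

lemma smooth_on_flat_exp: "openin (Euclidean_space n) U \<Longrightarrow> smooth_on n U (\<lambda>x. flat_exp k (a * x i + b))"
  by (simp add: smooth_on_def Ck_on_flat_exp)

text \<open>With \<open>g = exp (- 1 / x)\<close> for \<open>x > 0\<close> the bump is \<open>p / (p + r)\<close>, where \<open>p\<close> is positive exactly on the box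
  of radius \<open>2 e\<close> and \<open>r\<close> vanishes exactly on the closed box of radius \<open>e\<close>.\<close>

lemma coordinate_bump:
  assumes x: "x \<in> topspace (Euclidean_space n)" and e: "e > 0"
  obtains b where "smooth_on n (topspace (Euclidean_space n)) b"
    "\<And>y. 0 \<le> b y \<and> b y \<le> 1"
    "\<And>y. y \<in> coord_box n x e \<Longrightarrow> b y = 1"
    "\<And>y. y \<in> topspace (Euclidean_space n) \<Longrightarrow> y \<notin> coord_box n x (2 * e) \<Longrightarrow> b y = 0"
proof -
  define p where "p = (\<lambda>y::nat \<Rightarrow> real. \<Prod>i<n. flat_exp 0 (1 * y i + (2 * e - x i)) * flat_exp 0 ((-1) * y i + (2 * e + x i)))"
  define r where "r = (\<lambda>y::nat \<Rightarrow> real. \<Sum>i<n. flat_exp 0 (1 * y i + (- x i - e)) + flat_exp 0 ((-1) * y i + (x i - e)))"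
  have pos: "p y + r y > 0" for y
  proof (cases "\<forall>i<n. \<bar>y i - x i\<bar> < 2 * e")
    case True
    then have "p y > 0"
      unfolding p_def by (intro prod_pos) (auto intro!: mult_pos_pos simp: flat_exp_pos_iff)
    moreover have "r y \<ge> 0"
      unfolding r_def by (intro sum_nonneg add_nonneg_nonneg flat_exp_nonneg)
    ultimately show ?thesis by simp
  next
    case False
    then obtain i where i: "i < n" "\<bar>y i - x i\<bar> \<ge> 2 * e" by (auto simp: not_less)
    have "p y \<ge> 0"
      unfolding p_def by (intro prod_nonneg ballI mult_nonneg_nonneg flat_exp_nonneg)
    moreover have "0 < flat_exp 0 (1 * y i + (- x i - e)) + flat_exp 0 ((-1) * y i + (x i - e))"
    proof (cases "y i \<ge> x i")
      case True
      then show ?thesis using i(2) e flat_exp_nonneg[of 0 "(-1) * y i + (x i - e)"]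
        by (intro add_pos_nonneg) (auto simp: flat_exp_pos_iff)
    next
      case False
      then show ?thesis using i(2) e flat_exp_nonneg[of 0 "1 * y i + (- x i - e)"]
        by (intro add_nonneg_pos) (auto simp: flat_exp_pos_iff)
    qed
    then have "r y > 0"
      unfolding r_def using i(1)
      by (intro sum_pos2[of _ i]) (auto intro!: add_nonneg_nonneg flat_exp_nonneg)
    ultimately show ?thesis by simp
  qed
  have p0: "p y \<ge> 0" and r0: "r y \<ge> 0" for y
    unfolding p_def r_def by (intro prod_nonneg sum_nonneg ballI mult_nonneg_nonneg add_nonneg_nonneg flat_exp_nonneg)+
  have T: "openin (Euclidean_space n) (topspace (Euclidean_space n))" by simp
  have sp: "smooth_on n (topspace (Euclidean_space n)) p"
    unfolding p_def by (intro smooth_on_prod[OF T] smooth_on_mult[OF T] smooth_on_flat_exp[OF T])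
  have sr: "smooth_on n (topspace (Euclidean_space n)) r"
    unfolding r_def by (intro smooth_on_sum[OF T] smooth_on_add[OF T] smooth_on_flat_exp[OF T])
  show ?thesis
  proof (rule that[of "\<lambda>y. p y * inverse (p y + r y)"])
    show "smooth_on n (topspace (Euclidean_space n)) (\<lambda>y. p y * inverse (p y + r y))"
      by (rule smooth_on_mult[OF T sp smooth_on_inverse[OF T _ smooth_on_add[OF T sp sr]]])
        (use pos in \<open>metis less_irrefl\<close>)
    show "0 \<le> p y * inverse (p y + r y) \<and> p y * inverse (p y + r y) \<le> 1" for y
      using pos[of y] p0[of y] r0[of y] by (auto simp: field_simps)
    show "p y * inverse (p y + r y) = 1" if "y \<in> coord_box n x e" for y
    proof -
      have "r y = 0"
        unfolding r_def
      proof (intro sum.neutral ballI)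
        fix i assume "i \<in> {..<n}"
        then have "\<bar>y i - x i\<bar> < e" using that by (simp add: coord_box_def)
        then have "1 * y i + (- x i - e) \<le> 0" "(-1) * y i + (x i - e) \<le> 0" by linarith+
        then show "flat_exp 0 (1 * y i + (- x i - e)) + flat_exp 0 ((-1) * y i + (x i - e)) = 0"
          by (simp only: flat_exp_eq_0_iff[THEN iffD2] add_0)
      qed
      then show ?thesis using pos[of y] by simp
    qed
    show "p y * inverse (p y + r y) = 0" if "y \<in> topspace (Euclidean_space n)" "y \<notin> coord_box n x (2 * e)" for y
    proof -
      have "\<not> (\<forall>i<n. \<bar>y i - x i\<bar> < 2 * e)" using that by (simp add: coord_box_def)
      then obtain i where i: "i < n" "\<bar>y i - x i\<bar> \<ge> 2 * e" by (auto simp: not_less)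
      then have "1 * y i + (2 * e - x i) \<le> 0 \<or> (-1) * y i + (2 * e + x i) \<le> 0" by linarith
      then have "flat_exp 0 (1 * y i + (2 * e - x i)) * flat_exp 0 ((-1) * y i + (2 * e + x i)) = 0"
        by (simp only: mult_eq_0_iff flat_exp_eq_0_iff)
      then have "p y = 0" unfolding p_def using i(1) by (intro prod_zero) auto
      then show ?thesis by simp
    qed
  qed
qed

section \<open>Hadamard's lemma\<close>

lemma segment_in_coord_box:
  assumes x: "x \<in> coord_box n a e" and a: "a \<in> topspace (Euclidean_space n)" and t: "0 \<le> t" "t \<le> 1" and e: "e > 0"
  shows "(\<lambda>i. a i + t * (x i - a i)) \<in> coord_box n a e"
proof -
  have "\<bar>t * (x i - a i)\<bar> < e" if "i < n" for i
  proof -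
    have "\<bar>t * (x i - a i)\<bar> = t * \<bar>x i - a i\<bar>" using t by (simp add: abs_mult)
    also have "\<dots> \<le> \<bar>x i - a i\<bar>" using t by (simp add: mult_left_le_one_le)
    also have "\<dots> < e" using x that by (auto simp: coord_box_def)
    finally show ?thesis .
  qed
  then show ?thesis using x a by (auto simp: coord_box_def topspace_Euclidean_space)
qed

text \<open>Since \<open>f x - f a\<close> is the integral of \<open>\<Sum>i<n. (x i - a i) * partial i f\<close> along the segment from \<open>a\<close> to \<open>x\<close>,
  the coefficients in Hadamard's lemma are \<open>radial_mean a 0 (partial i f)\<close>. The exponent \<open>k\<close> makes these
  operators closed under differentiation: a partial derivative of \<open>radial_mean a k f\<close> is
  \<open>radial_mean a (Suc k)\<close> of that of \<open>f\<close>.\<close>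

definition radial_mean :: "(nat \<Rightarrow> real) \<Rightarrow> nat \<Rightarrow> ((nat \<Rightarrow> real) \<Rightarrow> real) \<Rightarrow> (nat \<Rightarrow> real) \<Rightarrow> real" where
  "radial_mean a k f x = integral {0..1} (\<lambda>t. t ^ k * f (\<lambda>i. a i + t * (x i - a i)))"

lemma continuous_on_radial:
  assumes "continuous_on (coord_box n a e) f" and a: "a \<in> topspace (Euclidean_space n)" and e: "e > 0"
  shows "continuous_on (coord_box n a e \<times> {0..1}) (\<lambda>(x, t). t ^ k * f (\<lambda>i. a i + t * (x i - a i)))"
proof -
  have "continuous_on (coord_box n a e \<times> {0..1}) (\<lambda>p i. a i + snd p * (fst p i - a i))"
  proof (rule continuous_on_coordinatewise_then_product)
    fix i
    have "continuous_on (coord_box n a e \<times> {0..1}) (\<lambda>p. fst p i)"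
      by (rule continuous_on_product_then_coordinatewise) (intro continuous_intros)
    then show "continuous_on (coord_box n a e \<times> {0..1}) (\<lambda>p. a i + snd p * (fst p i - a i))"
      by (intro continuous_intros)
  qed
  then have "continuous_on (coord_box n a e \<times> {0..1}) (\<lambda>p. f (\<lambda>i. a i + snd p * (fst p i - a i)))"
    by (rule continuous_on_compose2[OF assms(1)]) (use segment_in_coord_box[OF _ a _ _ e] in auto)
  then have "continuous_on (coord_box n a e \<times> {0..1}) (\<lambda>p. snd p ^ k * f (\<lambda>i. a i + snd p * (fst p i - a i)))"
    by (intro continuous_intros)
  then show ?thesis by (simp add: case_prod_unfold)
qed

lemma Ck_on_radial_mean:
  assumes a: "a \<in> topspace (Euclidean_space n)" and e: "e > 0"
  shows "Ck_on n m (coord_box n a e) f \<Longrightarrow> Ck_on n m (coord_box n a e) (radial_mean a k f)"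
proof (induction m arbitrary: f k)
  note W = openin_box[of n a e]
  have cont: "continuous_on (coord_box n a e) (radial_mean a k f)"
    if "continuous_on (coord_box n a e) f" for f k
  proof -
    have "continuous_on (coord_box n a e) (\<lambda>x. integral (cbox 0 1) (\<lambda>t. t ^ k * f (\<lambda>i. a i + t * (x i - a i))))"
      by (rule integral_continuous_on_param) (use continuous_on_radial[OF that a e, of k] in simp)
    then show ?thesis by (simp add: radial_mean_def[abs_def])
  qed
  {
    case 0
    then show ?case using cont W by (simp only: Ck_on_0)
  next
    case (Suc m)
    have cf: "continuous_on (coord_box n a e) f" using Ck_on_continuous[OF W Suc.prems] .
    show ?case
    proof (rule Ck_on_SucI[OF W cont[OF cf], where f' = "\<lambda>i. radial_mean a (Suc k) (partial i f)"])
      show "Ck_on n m (coord_box n a e) (radial_mean a (Suc k) (partial i f))" if "i < n" for i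
        by (rule Suc.IH[OF Ck_on_partial[OF Suc.prems that]])
      fix i x assume i: "i < n" and x: "x \<in> coord_box n a e"
      have cp: "continuous_on (coord_box n a e) (partial i f)"
        using Ck_on_continuous[OF W Ck_on_partial[OF Suc.prems i]] .
      define J where "J = {s. \<bar>s - a i\<bar> < e}"
      have J: "open J" "convex J" "x i \<in> J"
      proof -
        have "J = {a i - e <..< a i + e}" by (auto simp: J_def abs_less_iff)
        then show "open J" "convex J" by auto
        show "x i \<in> J" using x i by (auto simp: J_def coord_box_def)
      qed
      have upd: "x(i := s) \<in> coord_box n a e" if "s \<in> J" for s
        using x i that by (auto simp: J_def coord_box_def topspace_Euclidean_space)
      define y where "y = (\<lambda>s t. \<lambda>j. a j + t * ((x(i := s)) j - a j))"
      have y_upd: "y s t = (y s0 t)(i := a i + t * (s - a i))" for s s0 t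
        by (auto simp: y_def)
      have yx: "y (x i) t = (\<lambda>j. a j + t * (x j - a j))" for t
        unfolding y_def by (simp only: fun_upd_triv)
      have yW: "y s t \<in> coord_box n a e" if "s \<in> J" "t \<in> {0..1}" for s t
        unfolding y_def using segment_in_coord_box[OF upd[OF that(1)] a _ _ e] that(2) by auto
      have D: "((\<lambda>s. t ^ k * f (y s t)) has_real_derivative t ^ Suc k * partial i f (y s t)) (at s within J)"
        if "s \<in> J" "t \<in> cbox 0 1" for s t
      proof -
        have "((\<lambda>r. f ((y s t)(i := r))) has_real_derivative partial i f (y s t)) (at (y s t i))"
          by (rule Ck_on_partial_deriv[OF Suc.prems yW[OF that(1)] i]) (use that(2) in simp)
        moreover have "((\<lambda>r. a i + t * (r - a i)) has_real_derivative t) (at s)"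
          by (auto intro!: derivative_eq_intros)
        ultimately have "((\<lambda>r. f ((y s t)(i := a i + t * (r - a i)))) has_real_derivative partial i f (y s t) * t) (at s)"
          using DERIV_chain2[of "\<lambda>r. f ((y s t)(i := r))" _ "\<lambda>r. a i + t * (r - a i)" s t UNIV]
          by (simp add: y_def)
        then have "((\<lambda>r. f (y r t)) has_real_derivative partial i f (y s t) * t) (at s)"
          by (simp only: y_upd[of _ t s, symmetric])
        then have "((\<lambda>r. t ^ k * f (y r t)) has_real_derivative t ^ k * (partial i f (y s t) * t)) (at s)"
          by (rule DERIV_cmult)
        then have "((\<lambda>r. t ^ k * f (y r t)) has_real_derivative t ^ Suc k * partial i f (y s t)) (at s)"
          by (rule DERIV_cong) simp
        then show ?thesis by (rule has_field_derivative_at_within)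
      qed
      have slice: "continuous_on (J \<times> {0..1}) (\<lambda>(s, t). t ^ l * g (y s t))"
        if "continuous_on (coord_box n a e) g" for g l
      proof -
        have "continuous_on (J \<times> {0..1::real}) (\<lambda>p. (x(i := fst p), snd p))"
        proof (rule continuous_on_Pair)
          show "continuous_on (J \<times> {0..1::real}) snd"
            by (intro continuous_intros)
          show "continuous_on (J \<times> {0..1::real}) (\<lambda>p. x(i := fst p))"
          proof (rule continuous_on_coordinatewise_then_product)
            show "continuous_on (J \<times> {0..1::real}) (\<lambda>p. (x(i := fst p)) j)" for j
              by (cases "j = i") (auto intro!: continuous_intros)
          qed
        qed
        then have "continuous_on (J \<times> {0..1})
          (\<lambda>p. (\<lambda>(x, t). t ^ l * g (\<lambda>i. a i + t * (x i - a i))) (x(i := fst p), snd p))"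
          by (rule continuous_on_compose2[OF continuous_on_radial[OF that a e]]) (use upd in auto)
        then show ?thesis by (simp add: case_prod_unfold y_def)
      qed
      have int: "(\<lambda>t. t ^ k * f (y s t)) integrable_on cbox 0 1" if "s \<in> J" for s
      proof -
        have "continuous_on {0..1} (\<lambda>t. (\<lambda>(s, t). t ^ k * f (y s t)) (s, t))"
          by (rule continuous_on_compose2[OF slice[OF cf]]) (use that in \<open>auto intro!: continuous_intros\<close>)
        then show ?thesis by (intro integrable_continuous) simp
      qed
      have "((\<lambda>s. integral (cbox 0 1) (\<lambda>t. t ^ k * f (y s t))) has_real_derivative
          integral (cbox 0 1) (\<lambda>t. t ^ Suc k * partial i f (y (x i) t))) (at (x i) within J)"
        by (rule leibniz_rule_field_derivative[OF D int _ J(3,2)]) (use slice[OF cp, of "Suc k"] in auto)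
      then have "((\<lambda>s. integral (cbox 0 1) (\<lambda>t. t ^ k * f (y s t))) has_real_derivative
          integral (cbox 0 1) (\<lambda>t. t ^ Suc k * partial i f (y (x i) t))) (at (x i))"
        using at_within_open[OF J(3,1)] by simp
      then show "((\<lambda>t. radial_mean a k f (x(i := t))) has_real_derivative radial_mean a (Suc k) (partial i f) x) (at (x i))"
        unfolding radial_mean_def yx cbox_interval unfolding y_def .
    qed
  }
qed

lemma Hadamard:
  assumes a: "a \<in> topspace (Euclidean_space n)" and e: "e > 0" and f: "smooth_on n (coord_box n a e) f"
  obtains g where "\<And>i. i < n \<Longrightarrow> smooth_on n (coord_box n a e) (g i)"
    "\<And>x. x \<in> coord_box n a e \<Longrightarrow> f x = f a + (\<Sum>i<n. (x i - a i) * g i x)"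
    "\<And>i. i < n \<Longrightarrow> g i a = partial i f a"
proof (rule that[of "\<lambda>i. radial_mean a 0 (partial i f)"])
  note W = openin_box[of n a e]
  show "smooth_on n (coord_box n a e) (radial_mean a 0 (partial i f))" if "i < n" for i
    using smooth_on_partial[OF f that] by (simp add: smooth_on_def Ck_on_radial_mean[OF a e])
  show "radial_mean a 0 (partial i f) a = partial i f a" for i
    by (simp add: radial_mean_def)
  fix x assume x: "x \<in> coord_box n a e"
  define y where "y = (\<lambda>t j. a j + t * (x j - a j))"
  have C1: "Ck_on n (Suc 0) (coord_box n a e) f" using f by (simp only: smooth_on_def)
  have yW: "y t \<in> coord_box n a e" if "t \<in> {0..1}" for t
    unfolding y_def using segment_in_coord_box[OF x a _ _ e] that by auto
  have xE: "x \<in> topspace (Euclidean_space n)" using x by (simp add: coord_box_def)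
  have D: "((\<lambda>t. f (y t)) has_real_derivative (\<Sum>i<n. partial i f (y t) * (x i - a i))) (at t)" if "t \<in> {0..1}" for t
  proof (rule chain_rule_curve[OF W C1, where c = y and c' = "\<lambda>i. x i - a i"])
    show "y t \<in> coord_box n a e" using yW[OF that] .
    show "y t \<in> topspace (Euclidean_space n)" for t
      using a xE by (auto simp: y_def topspace_Euclidean_space)
    show "((\<lambda>t. y t i) has_real_derivative x i - a i) (at t)" for i
      unfolding y_def by (auto intro!: derivative_eq_intros)
  qed
  have "((\<lambda>t. \<Sum>i<n. partial i f (y t) * (x i - a i)) has_integral (f (y 1) - f (y 0))) {0..1}"
    by (rule fundamental_theorem_of_calculus)
      (use D in \<open>auto intro: has_field_derivative_at_within simp flip: has_real_derivative_iff_has_vector_derivative\<close>)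
  moreover have "y 1 = x" "y 0 = a" by (auto simp: y_def)
  ultimately have "f x - f a = integral {0..1} (\<lambda>t. \<Sum>i<n. partial i f (y t) * (x i - a i))"
    by (simp add: integral_unique)
  also have "\<dots> = (\<Sum>i<n. integral {0..1} (\<lambda>t. partial i f (y t) * (x i - a i)))"
  proof (rule integral_sum)
    fix i assume i: "i \<in> {..<n}"
    have "continuous_on (coord_box n a e) (partial i f)"
      using smooth_on_partial[OF f] i Ck_on_continuous[OF W] by (auto simp: smooth_on_def)
    then have "continuous_on {0..1} (\<lambda>t. partial i f (y t))"
      by (rule continuous_on_compose2)
        (use yW in \<open>auto simp: y_def intro!: continuous_on_coordinatewise_then_product continuous_intros\<close>)
    then show "(\<lambda>t. partial i f (y t) * (x i - a i)) integrable_on {0..1}"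
      by (intro integrable_continuous_real continuous_intros)
  qed simp
  also have "\<dots> = (\<Sum>i<n. (x i - a i) * radial_mean a 0 (partial i f) x)"
    by (simp add: radial_mean_def y_def mult.commute)
  finally show "f x = f a + (\<Sum>i<n. (x i - a i) * radial_mean a 0 (partial i f) x)" by simp
qed

section \<open>Smooth functions and tangent vectors on a manifold\<close>

lemma sum_fun_apply: "(\<Sum>a\<in>A. f a) x = (\<Sum>a\<in>A. f a x :: 'a::comm_monoid_add)"
  by (induction A rule: infinite_finite_induct) simp_all

lemma partial_unique:
  "((\<lambda>t. f (x(i := t))) has_real_derivative d) (at (x i)) \<Longrightarrow> partial i f x = d"
  unfolding partial_def by (rule DERIV_imp_deriv)

locale manifold =
  fixes M :: "'m::{second_countable_topology, t2_space} smooth_structure"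
  assumes smooth_manifold: "smooth_manifold M"
begin

abbreviation "C \<equiv> C_inf M"

lemma chart_open: "(U, \<phi>) \<in> charts M \<Longrightarrow> open U"
  and chart_homeomorphic: "(U, \<phi>) \<in> charts M \<Longrightarrow>
    homeomorphic_map (top_of_set U) (subtopology (Euclidean_space (mdim M)) (\<phi> ` U)) \<phi>"
  and chart_image: "(U, \<phi>) \<in> charts M \<Longrightarrow> openin (Euclidean_space (mdim M)) (\<phi> ` U)"
  using smooth_manifold unfolding smooth_manifold_def by blast+

lemma chart_at: obtains U \<phi> where "(U, \<phi>) \<in> charts M" "p \<in> U"
proof -
  have "p \<in> (\<Union>(U, \<phi>) \<in> charts M. U)" using smooth_manifold unfolding smooth_manifold_def by simp
  then show ?thesis using that by auto
qed

lemma transition_smooth: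
  "(U, \<phi>) \<in> charts M \<Longrightarrow> (V, \<psi>) \<in> charts M \<Longrightarrow> i < mdim M \<Longrightarrow>
    smooth_on (mdim M) (\<phi> ` (U \<inter> V)) (\<lambda>x. \<psi> (inv_into U \<phi> x) i)"
  using smooth_manifold unfolding smooth_manifold_def by blast

lemma chart_topology:
  assumes "(U, \<phi>) \<in> charts M"
  shows "subtopology (Euclidean_space (mdim M)) (\<phi> ` U) = top_of_set (\<phi> ` U)"
proof -
  have "\<phi> ` U \<subseteq> topspace (Euclidean_space (mdim M))"
    using chart_image[OF assms] openin_subset by blast
  then show ?thesis
    using Euclidean_space_eq[of "mdim M"] by (metis inf.absorb_iff2 subtopology_subtopology)
qed

lemma chart_inj: "(U, \<phi>) \<in> charts M \<Longrightarrow> inj_on \<phi> U"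
  using chart_homeomorphic homeomorphic_imp_injective_map by fastforce

lemma chart_inv [simp]: "(U, \<phi>) \<in> charts M \<Longrightarrow> p \<in> U \<Longrightarrow> inv_into U \<phi> (\<phi> p) = p"
  using chart_inj inv_into_f_f by metis

lemma chart_continuous: "(U, \<phi>) \<in> charts M \<Longrightarrow> continuous_on U \<phi>"
  using homeomorphic_imp_continuous_map[OF chart_homeomorphic[of U \<phi>]]
  by (simp add: chart_topology)

lemma chart_inv_continuous:
  assumes c: "(U, \<phi>) \<in> charts M"
  shows "continuous_on (\<phi> ` U) (inv_into U \<phi>)"
proof -
  obtain g where g: "homeomorphic_maps (top_of_set U) (top_of_set (\<phi> ` U)) \<phi> g"
    using chart_homeomorphic[OF c] chart_topology[OF c] homeomorphic_map_maps by metis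
  then have cont: "continuous_on (\<phi> ` U) g" and inv: "\<And>p. p \<in> U \<Longrightarrow> g (\<phi> p) = p"
    by (auto simp: homeomorphic_maps_def)
  show ?thesis
    by (rule continuous_on_eq[OF cont]) (use c inv in auto)
qed

lemma chart_open_image:
  assumes c: "(U, \<phi>) \<in> charts M" and "open N" "N \<subseteq> U"
  shows "openin (Euclidean_space (mdim M)) (\<phi> ` N)"
proof -
  have "openin (top_of_set U) N" using assms by (simp add: open_subset)
  then have "openin (subtopology (Euclidean_space (mdim M)) (\<phi> ` U)) (\<phi> ` N)"
    using homeomorphic_imp_open_map[OF chart_homeomorphic[OF c]] by (simp add: open_map_def)
  then show ?thesis using openin_trans_full chart_image[OF c] by blast
qed

lemma chart_open_preimage:
  assumes c: "(U, \<phi>) \<in> charts M" and "openin (Euclidean_space (mdim M)) W"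
  shows "open {p \<in> U. \<phi> p \<in> W}"
proof -
  obtain T where T: "open T" "W = topspace (Euclidean_space (mdim M)) \<inter> T"
    using assms(2) Euclidean_space_eq[of "mdim M"] openin_open by metis
  have "open (U \<inter> \<phi> -` T)"
    using continuous_open_preimage[OF chart_continuous[OF c] chart_open[OF c] T(1)] .
  moreover have "{p \<in> U. \<phi> p \<in> W} = U \<inter> \<phi> -` T"
    using T(2) chart_image[OF c] openin_subset by blast
  ultimately show ?thesis by simp
qed

lemma C_inf_smooth_on:
  assumes "f \<in> C" and c: "(U, \<phi>) \<in> charts M" and "open N" "N \<subseteq> U"
  shows "smooth_on (mdim M) (\<phi> ` N) (f \<circ> inv_into U \<phi>)"
proof -
  have "smooth_on (mdim M) (\<phi> ` U) (f \<circ> inv_into U \<phi>)"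
    using assms(1) c by (auto simp: C_inf_def)
  then show ?thesis
    by (rule smooth_on_subset[OF _ chart_image[OF c] chart_open_image[OF c assms(3,4)]]) (use assms in auto)
qed

text \<open>Smoothness near each point in one chart suffices, because the transition maps are smooth.\<close>

lemma C_inf_local:
  assumes "\<And>p. \<exists>U \<phi> N. (U, \<phi>) \<in> charts M \<and> open N \<and> p \<in> N \<and> N \<subseteq> U \<and>
     smooth_on (mdim M) (\<phi> ` N) (f \<circ> inv_into U \<phi>)"
  shows "f \<in> C"
proof -
  have "smooth_on (mdim M) (\<psi> ` V) (f \<circ> inv_into V \<psi>)" if d: "(V, \<psi>) \<in> charts M" for V \<psi>
  proof (rule smooth_on_local[OF chart_image[OF d]])
    fix x assume "x \<in> \<psi> ` V"
    then obtain p where p: "p \<in> V" "x = \<psi> p" by blast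
    obtain U \<phi> N where c: "(U, \<phi>) \<in> charts M" and N: "open N" "p \<in> N" "N \<subseteq> U"
      and sm: "smooth_on (mdim M) (\<phi> ` N) (f \<circ> inv_into U \<phi>)"
      using assms[of p] by blast
    have NV: "open (N \<inter> V)" using N chart_open[OF d] by blast
    have W: "openin (Euclidean_space (mdim M)) (\<psi> ` (N \<inter> V))"
      by (rule chart_open_image[OF d NV]) blast
    have UV: "openin (Euclidean_space (mdim M)) (\<psi> ` (V \<inter> U))"
      by (rule chart_open_image[OF d]) (use chart_open[OF c] chart_open[OF d] in auto)
    have "smooth_on (mdim M) (\<psi> ` (N \<inter> V)) (\<lambda>x. (f \<circ> inv_into U \<phi>) (\<phi> (inv_into V \<psi> x)))"
    proof (rule smooth_on_compose[OF W chart_open_image[OF c N(1,3)], where g = "\<lambda>x. \<phi> (inv_into V \<psi> x)", OF _ sm])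
      show "\<phi> (inv_into V \<psi> y) \<in> \<phi> ` N" if "y \<in> \<psi> ` (N \<inter> V)" for y
        using that d by auto
      show "smooth_on (mdim M) (\<psi> ` (N \<inter> V)) (\<lambda>x. \<phi> (inv_into V \<psi> x) i)" if "i < mdim M" for i
        by (rule smooth_on_subset[OF transition_smooth[OF d c that] UV W]) (use N in auto)
    qed
    then have "smooth_on (mdim M) (\<psi> ` (N \<inter> V)) (f \<circ> inv_into V \<psi>)"
      by (rule smooth_on_cong[OF W, rotated]) (use c d N in auto)
    then show "\<exists>W. openin (Euclidean_space (mdim M)) W \<and> x \<in> W \<and> smooth_on (mdim M) W (f \<circ> inv_into V \<psi>)"
      using W p N by blast
  qed
  then show ?thesis by (auto simp: C_inf_def)
qed

lemma C_inf_glue: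
  assumes "\<And>p. \<exists>N g. open N \<and> p \<in> N \<and> g \<in> C \<and> (\<forall>q\<in>N. f q = g q)"
  shows "f \<in> C"
proof (rule C_inf_local)
  fix p
  obtain U \<phi> where c: "(U, \<phi>) \<in> charts M" "p \<in> U" by (rule chart_at)
  obtain N g where N: "open N" "p \<in> N" "g \<in> C" "\<And>q. q \<in> N \<Longrightarrow> f q = g q" using assms[of p] by blast
  have NU: "open (N \<inter> U)" "N \<inter> U \<subseteq> U" using N(1) chart_open[OF c(1)] by auto
  have "smooth_on (mdim M) (\<phi> ` (N \<inter> U)) (f \<circ> inv_into U \<phi>)"
    by (rule smooth_on_cong[OF chart_open_image[OF c(1) NU] _ C_inf_smooth_on[OF N(3) c(1) NU]])
      (use c N(4) in auto)
  then show "\<exists>U \<phi> N. (U, \<phi>) \<in> charts M \<and> open N \<and> p \<in> N \<and> N \<subseteq> U \<and> smooth_on (mdim M) (\<phi> ` N) (f \<circ> inv_into U \<phi>)"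
    using c N NU by blast
qed

lemma C_infI: "(\<And>U \<phi>. (U, \<phi>) \<in> charts M \<Longrightarrow> smooth_on (mdim M) (\<phi> ` U) (\<lambda>x. f (inv_into U \<phi> x))) \<Longrightarrow> f \<in> C"
  by (auto simp: C_inf_def o_def)

lemma C_infD: "f \<in> C \<Longrightarrow> (U, \<phi>) \<in> charts M \<Longrightarrow> smooth_on (mdim M) (\<phi> ` U) (\<lambda>x. f (inv_into U \<phi> x))"
  by (auto simp: C_inf_def o_def)

lemma C_inf_const [simp]: "(\<lambda>p. c) \<in> C"
  by (rule C_infI, rule smooth_on_const[OF chart_image])

lemma C_inf_add_lambda: "f \<in> C \<Longrightarrow> g \<in> C \<Longrightarrow> (\<lambda>p. f p + g p) \<in> C"
  by (rule C_infI, rule smooth_on_add[OF chart_image]) (assumption, (rule C_infD, assumption+)+)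

lemma C_inf_mult_lambda: "f \<in> C \<Longrightarrow> g \<in> C \<Longrightarrow> (\<lambda>p. f p * g p) \<in> C"
  by (rule C_infI, rule smooth_on_mult[OF chart_image]) (assumption, (rule C_infD, assumption+)+)

lemma C_inf_add: "f \<in> C \<Longrightarrow> g \<in> C \<Longrightarrow> f + g \<in> C"
  and C_inf_mult: "f \<in> C \<Longrightarrow> g \<in> C \<Longrightarrow> f * g \<in> C"
  using C_inf_add_lambda C_inf_mult_lambda by (simp_all add: plus_fun_def times_fun_def)

lemma C_inf_scale: "f \<in> C \<Longrightarrow> (\<lambda>p. c * f p) \<in> C"
  by (rule C_inf_mult_lambda) simp_all

lemma C_inf_uminus: "f \<in> C \<Longrightarrow> - f \<in> C"
  using C_inf_scale[of f "-1"] by (simp add: fun_Compl_def)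

lemma C_inf_diff: "f \<in> C \<Longrightarrow> g \<in> C \<Longrightarrow> f - g \<in> C"
  using C_inf_add[OF _ C_inf_uminus] by (metis diff_conv_add_uminus)

lemma C_inf_0 [simp]: "0 \<in> C" and C_inf_1 [simp]: "1 \<in> C"
  using C_inf_const[of 0] C_inf_const[of 1] by (simp_all add: zero_fun_def one_fun_def)

lemma C_inf_sum_lambda: "(\<And>a. a \<in> A \<Longrightarrow> f a \<in> C) \<Longrightarrow> (\<lambda>p. \<Sum>a\<in>A. f a p) \<in> C"
  by (induction A rule: infinite_finite_induct) (simp_all add: C_inf_add_lambda)

lemma C_inf_sum: "(\<And>a. a \<in> A \<Longrightarrow> f a \<in> C) \<Longrightarrow> (\<Sum>a\<in>A. f a) \<in> C"
  by (induction A rule: infinite_finite_induct) (simp_all add: C_inf_add)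

lemma C_inf_prod_lambda: "(\<And>a. a \<in> A \<Longrightarrow> f a \<in> C) \<Longrightarrow> (\<lambda>p. \<Prod>a\<in>A. f a p) \<in> C"
  by (induction A rule: infinite_finite_induct) (simp_all add: C_inf_mult_lambda)

lemma C_inf_inverse: "f \<in> C \<Longrightarrow> (\<And>p. f p \<noteq> 0) \<Longrightarrow> (\<lambda>p. inverse (f p)) \<in> C"
  by (rule C_infI, rule smooth_on_inverse[OF chart_image]) (assumption, simp, rule C_infD)

text \<open>The compact set \<open>K\<close> is closed because \<open>M\<close> is a Hausdorff space. On its complement the extension is \<open>0\<close>,
  and on \<open>U\<close> it is smooth by assumption.\<close>

lemma C_inf_chart_extend:
  assumes c: "(U, \<phi>) \<in> charts M" and F: "smooth_on (mdim M) (\<phi> ` U) F"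
    and K: "compact K" "K \<subseteq> U" and z: "\<And>p. p \<in> U \<Longrightarrow> p \<notin> K \<Longrightarrow> F (\<phi> p) = 0"
  shows "(\<lambda>p. if p \<in> U then F (\<phi> p) else 0) \<in> C" (is "?f \<in> C")
proof (rule C_inf_local)
  fix p
  show "\<exists>U \<phi> N. (U, \<phi>) \<in> charts M \<and> open N \<and> p \<in> N \<and> N \<subseteq> U \<and> smooth_on (mdim M) (\<phi> ` N) (?f \<circ> inv_into U \<phi>)"
  proof (cases "p \<in> U")
    case True
    have "smooth_on (mdim M) (\<phi> ` U) (?f \<circ> inv_into U \<phi>)"
    proof (rule smooth_on_cong[OF chart_image[OF c] _ F])
      fix x assume "x \<in> \<phi> ` U"
      then obtain q where q: "q \<in> U" "x = \<phi> q" by blast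
      show "F x = (?f \<circ> inv_into U \<phi>) x" using chart_inv[OF c q(1)] q by simp
    qed
    then show ?thesis
      using c chart_open[OF c] True by (intro exI[of _ U] exI[of _ \<phi>]) simp
  next
    case False
    obtain V \<psi> where d: "(V, \<psi>) \<in> charts M" "p \<in> V" by (rule chart_at)
    have N: "open (V - K)" using chart_open[OF d(1)] K(1) by (simp add: compact_imp_closed open_Diff)
    have W: "openin (Euclidean_space (mdim M)) (\<psi> ` (V - K))"
      by (rule chart_open_image[OF d(1) N]) blast
    have "smooth_on (mdim M) (\<psi> ` (V - K)) (?f \<circ> inv_into V \<psi>)"
    proof (rule smooth_on_cong[OF W _ smooth_on_const[OF W, of 0]])
      fix x assume "x \<in> \<psi> ` (V - K)"
      then obtain q where q: "q \<in> V" "q \<notin> K" "x = \<psi> q" by blast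
      show "0 = (?f \<circ> inv_into V \<psi>) x" using chart_inv[OF d(1) q(1)] z[of q] q by simp
    qed
    then show ?thesis
      using d N False K(2) by (intro exI[of _ V] exI[of _ \<psi>] exI[of _ "V - K"]) (simp add: subset_iff, blast)
  qed
qed

lemma C_inf_cutoff:
  assumes c: "(U, \<phi>) \<in> charts M" and N: "open N" "N \<subseteq> U" and F: "smooth_on (mdim M) (\<phi> ` N) F"
    and \<theta>: "\<theta> \<in> C" and K: "compact K" "K \<subseteq> N" and z: "\<And>p. p \<notin> K \<Longrightarrow> \<theta> p = 0"
  shows "(\<lambda>p. if p \<in> N then \<theta> p * F (\<phi> p) else 0) \<in> C" (is "?f \<in> C")
proof (rule C_inf_local)
  fix p
  show "\<exists>U \<phi> N. (U, \<phi>) \<in> charts M \<and> open N \<and> p \<in> N \<and> N \<subseteq> U \<and> smooth_on (mdim M) (\<phi> ` N) (?f \<circ> inv_into U \<phi>)"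
  proof (cases "p \<in> N")
    case True
    note W = chart_open_image[OF c N]
    have "smooth_on (mdim M) (\<phi> ` N) (?f \<circ> inv_into U \<phi>)"
    proof (rule smooth_on_cong[OF W _ smooth_on_mult[OF W C_inf_smooth_on[OF \<theta> c N] F]])
      fix x assume "x \<in> \<phi> ` N"
      then obtain q where q: "q \<in> N" "x = \<phi> q" by blast
      then have "q \<in> U" using N by blast
      then show "(\<theta> \<circ> inv_into U \<phi>) x * F x = (?f \<circ> inv_into U \<phi>) x" using chart_inv[OF c] q by simp
    qed
    then show ?thesis
      using c N True by (intro exI[of _ U] exI[of _ \<phi>] exI[of _ N]) simp
  next
    case False
    obtain V \<psi> where d: "(V, \<psi>) \<in> charts M" "p \<in> V" by (rule chart_at)
    have N': "open (V - K)" using chart_open[OF d(1)] K(1) by (simp add: compact_imp_closed open_Diff)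
    have W: "openin (Euclidean_space (mdim M)) (\<psi> ` (V - K))"
      by (rule chart_open_image[OF d(1) N']) blast
    have "smooth_on (mdim M) (\<psi> ` (V - K)) (?f \<circ> inv_into V \<psi>)"
    proof (rule smooth_on_cong[OF W _ smooth_on_const[OF W, of 0]])
      fix x assume "x \<in> \<psi> ` (V - K)"
      then obtain q where q: "q \<in> V" "q \<notin> K" "x = \<psi> q" by blast
      show "0 = (?f \<circ> inv_into V \<psi>) x" using chart_inv[OF d(1) q(1)] z[of q] q by simp
    qed
    then show ?thesis
      using d N' False K(2) by (intro exI[of _ V] exI[of _ \<psi>] exI[of _ "V - K"]) (simp add: subset_iff, blast)
  qed
qed

end

lemma compact_closed_coord_box:
  "compact {y \<in> topspace (Euclidean_space n). \<forall>i<n. a i \<le> y i \<and> y i \<le> b i}"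
proof -
  define J where "J = (\<lambda>i. if i < n then {a i..b i} else {0::real})"
  have "compactin (product_topology (\<lambda>i. euclideanreal) UNIV) (Pi\<^sub>E UNIV J)"
    by (auto simp: compactin_PiE J_def)
  then have "compact (Pi\<^sub>E UNIV J)"
    by (simp add: euclidean_product_topology)
  moreover have "Pi\<^sub>E UNIV J = {y \<in> topspace (Euclidean_space n). \<forall>i<n. a i \<le> y i \<and> y i \<le> b i}"
  proof (rule Set.set_eqI)
    fix y
    have "(\<forall>i. y i \<in> J i) \<longleftrightarrow> (\<forall>i\<ge>n. y i = 0) \<and> (\<forall>i<n. a i \<le> y i \<and> y i \<le> b i)"
    proof (intro iffI conjI allI impI)
      assume "\<forall>i. y i \<in> J i"
      then have *: "y i \<in> J i" for i by blast
      show "y i = 0" if "i \<ge> n" for i using *[of i] that by (simp add: J_def)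
      show "a i \<le> y i" "y i \<le> b i" if "i < n" for i using *[of i] that by (simp_all add: J_def)
    next
      fix i
      assume "(\<forall>i\<ge>n. y i = 0) \<and> (\<forall>i<n. a i \<le> y i \<and> y i \<le> b i)"
      then show "y i \<in> J i" by (cases "i < n") (auto simp: J_def)
    qed
    then show "y \<in> Pi\<^sub>E UNIV J \<longleftrightarrow> y \<in> {y \<in> topspace (Euclidean_space n). \<forall>i<n. a i \<le> y i \<and> y i \<le> b i}"
      by (simp add: PiE_iff topspace_Euclidean_space)
  qed
  ultimately show ?thesis by simp
qed

context manifold begin

lemma bump_at_point:
  assumes "open W" "p \<in> W"
  obtains \<theta> N K where "\<theta> \<in> C" "open N" "p \<in> N" "compact K" "K \<subseteq> W" "\<And>q. 0 \<le> \<theta> q \<and> \<theta> q \<le> 1"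
    "\<And>q. q \<in> N \<Longrightarrow> \<theta> q = 1" "\<And>q. q \<notin> K \<Longrightarrow> \<theta> q = 0"
proof -
  obtain U \<phi> where c: "(U, \<phi>) \<in> charts M" "p \<in> U" by (rule chart_at)
  have UW: "openin (Euclidean_space (mdim M)) (\<phi> ` (U \<inter> W))"
    by (rule chart_open_image[OF c(1)]) (use assms chart_open[OF c(1)] in auto)
  obtain r where r: "r > 0" "coord_box (mdim M) (\<phi> p) r \<subseteq> \<phi> ` (U \<inter> W)"
    using openin_contains_box[OF UW, of "\<phi> p"] c assms by blast
  define e where "e = r / 3"
  have e: "e > 0" using r by (simp add: e_def)
  have pE: "\<phi> p \<in> topspace (Euclidean_space (mdim M))"
    using chart_image[OF c(1)] c openin_subset by blast
  obtain b where b: "smooth_on (mdim M) (topspace (Euclidean_space (mdim M))) b" "\<And>y. 0 \<le> b y \<and> b y \<le> 1"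
    "\<And>y. y \<in> coord_box (mdim M) (\<phi> p) e \<Longrightarrow> b y = 1"
    "\<And>y. y \<in> topspace (Euclidean_space (mdim M)) \<Longrightarrow> y \<notin> coord_box (mdim M) (\<phi> p) (2 * e) \<Longrightarrow> b y = 0"
    using coordinate_bump[OF pE e] by metis
  define Q where "Q = {y \<in> topspace (Euclidean_space (mdim M)). \<forall>i<mdim M. \<phi> p i - 2 * e \<le> y i \<and> y i \<le> \<phi> p i + 2 * e}"
  have Q: "compact Q" unfolding Q_def by (rule compact_closed_coord_box)
  have QW: "Q \<subseteq> \<phi> ` (U \<inter> W)"
  proof -
    have "Q \<subseteq> coord_box (mdim M) (\<phi> p) r"
      using r(1) by (fastforce simp: Q_def coord_box_def e_def abs_less_iff)
    then show ?thesis using r(2) by blast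
  qed
  define K where "K = inv_into U \<phi> ` Q"
  have K: "compact K" "K \<subseteq> U \<inter> W"
  proof -
    show "compact K"
      unfolding K_def
      by (rule compact_continuous_image[OF continuous_on_subset[OF chart_inv_continuous[OF c(1)]] Q]) (use QW in blast)
    show "K \<subseteq> U \<inter> W" using QW c(1) by (auto simp: K_def)
  qed
  have out: "b (\<phi> q) = 0" if "q \<in> U" "q \<notin> K" for q
  proof (rule b(4))
    show qE: "\<phi> q \<in> topspace (Euclidean_space (mdim M))" using that(1) chart_image[OF c(1)] openin_subset by blast
    show "\<phi> q \<notin> coord_box (mdim M) (\<phi> p) (2 * e)"
    proof
      assume "\<phi> q \<in> coord_box (mdim M) (\<phi> p) (2 * e)"
      then have "\<phi> q \<in> Q" by (fastforce simp: Q_def coord_box_def abs_less_iff)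
      then have "inv_into U \<phi> (\<phi> q) \<in> K" by (auto simp: K_def)
      then show False using that c(1) by simp
    qed
  qed
  show ?thesis
  proof (rule that[of "\<lambda>q. if q \<in> U then b (\<phi> q) else 0" "{q \<in> U. \<phi> q \<in> coord_box (mdim M) (\<phi> p) e}" K])
    show "(\<lambda>q. if q \<in> U then b (\<phi> q) else 0) \<in> C"
      by (rule C_inf_chart_extend[OF c(1) _ K(1)])
        (use K(2) out smooth_on_subset[OF b(1) _ chart_image[OF c(1)]] openin_subset[OF chart_image[OF c(1)]] in auto)
    show "open {q \<in> U. \<phi> q \<in> coord_box (mdim M) (\<phi> p) e}"
      by (rule chart_open_preimage[OF c(1) openin_box])
    show "p \<in> {q \<in> U. \<phi> q \<in> coord_box (mdim M) (\<phi> p) e}" using c pE e centre_in_box by blast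
    show "K \<subseteq> W" using K by blast
  qed (use K b out in auto)
qed

text \<open>Compactness gives finitely many bumps \<open>\<theta> p\<close> at points that equal \<open>1\<close> on sets covering \<open>V\<close>; then
  \<open>1 - (\<Prod>p. 1 - \<theta> p)\<close> is the required function.\<close>

lemma bump_on_compact:
  assumes "open W" "compact V" "V \<subseteq> W"
  obtains \<theta> N K where "\<theta> \<in> C" "open N" "V \<subseteq> N" "N \<subseteq> K" "compact K" "K \<subseteq> W"
    "\<And>q. 0 \<le> \<theta> q" "\<And>q. q \<in> N \<Longrightarrow> \<theta> q = 1" "\<And>q. q \<notin> K \<Longrightarrow> \<theta> q = 0"
proof -
  have "\<forall>p\<in>W. \<exists>\<theta> N K. \<theta> \<in> C \<and> open N \<and> p \<in> N \<and> compact K \<and> K \<subseteq> W \<and> (\<forall>q. 0 \<le> \<theta> q \<and> \<theta> q \<le> 1) \<and>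
    (\<forall>q\<in>N. \<theta> q = 1) \<and> (\<forall>q. q \<notin> K \<longrightarrow> \<theta> q = 0)"
  proof
    fix p assume "p \<in> W"
    show "\<exists>\<theta> N K. \<theta> \<in> C \<and> open N \<and> p \<in> N \<and> compact K \<and> K \<subseteq> W \<and> (\<forall>q. 0 \<le> \<theta> q \<and> \<theta> q \<le> 1) \<and>
      (\<forall>q\<in>N. \<theta> q = 1) \<and> (\<forall>q. q \<notin> K \<longrightarrow> \<theta> q = 0)"
      by (rule bump_at_point[OF assms(1) \<open>p \<in> W\<close>]) blast
  qed
  then obtain \<theta> N K where *: "\<forall>p\<in>W. \<theta> p \<in> C \<and> open (N p) \<and> p \<in> N p \<and> compact (K p) \<and> K p \<subseteq> W \<and>
      (\<forall>q. 0 \<le> \<theta> p q \<and> \<theta> p q \<le> 1) \<and> (\<forall>q\<in>N p. \<theta> p q = 1) \<and> (\<forall>q. q \<notin> K p \<longrightarrow> \<theta> p q = 0)"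
    unfolding bchoice_iff by blast
  obtain D where D: "D \<subseteq> V" "finite D" "V \<subseteq> (\<Union>p\<in>D. N p)"
    using compactE_image[OF assms(2), of V N] * assms(3) by blast
  have DW: "D \<subseteq> W" using D assms(3) by blast
  have fact01: "0 \<le> (\<Prod>p\<in>D. 1 - \<theta> p q)" "(\<Prod>p\<in>D. 1 - \<theta> p q) \<le> 1" for q
    using * DW by (auto intro!: prod_nonneg prod_le_1)
  have NK: "N p \<subseteq> K p" if "p \<in> D" for p
  proof
    fix q assume "q \<in> N p"
    moreover have "p \<in> W" using that DW by blast
    ultimately have "\<theta> p q = 1" "q \<notin> K p \<longrightarrow> \<theta> p q = 0" using * by blast+
    then show "q \<in> K p" by (cases "q \<in> K p") auto
  qed
  show ?thesis
  proof (rule that[of "\<lambda>q. 1 + (-1) * (\<Prod>p\<in>D. 1 + (-1) * \<theta> p q)" "\<Union>p\<in>D. N p" "\<Union>p\<in>D. K p"])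
    show "(\<lambda>q. 1 + (-1) * (\<Prod>p\<in>D. 1 + (-1) * \<theta> p q)) \<in> C"
    proof (rule C_inf_add_lambda[OF C_inf_const], rule C_inf_scale, rule C_inf_prod_lambda,
        rule C_inf_add_lambda[OF C_inf_const], rule C_inf_scale)
      show "\<theta> p \<in> C" if "p \<in> D" for p using * DW that by blast
    qed
    show "open (\<Union>p\<in>D. N p)" using * DW by blast
    show "compact (\<Union>p\<in>D. K p)" using * DW D(2) by blast
    show "(\<Union>p\<in>D. K p) \<subseteq> W" using * DW by blast
    show "(\<Union>p\<in>D. N p) \<subseteq> (\<Union>p\<in>D. K p)" using NK by blast
    show "0 \<le> 1 + (-1) * (\<Prod>p\<in>D. 1 + (-1) * \<theta> p q)" for q
      using fact01[of q] by simp
    show "1 + (-1) * (\<Prod>p\<in>D. 1 + (-1) * \<theta> p q) = 1" if q: "q \<in> (\<Union>p\<in>D. N p)" for q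
    proof -
      obtain p where p: "p \<in> D" "q \<in> N p" using q by blast
      then have "\<theta> p q = 1" using * DW by blast
      then have "(\<Prod>p\<in>D. 1 + (-1) * \<theta> p q) = 0"
        using p(1) by (intro prod_zero[OF D(2)] bexI[of _ p]) simp_all
      then show ?thesis by simp
    qed
    show "1 + (-1) * (\<Prod>p\<in>D. 1 + (-1) * \<theta> p q) = 0" if q: "q \<notin> (\<Union>p\<in>D. K p)" for q
    proof -
      have "\<theta> p q = 0" if "p \<in> D" for p using that q * DW by blast
      then have "(\<Prod>p\<in>D. 1 + (-1) * \<theta> p q) = 1" by simp
      then show ?thesis by simp
    qed
  qed (use D in auto)
qed

lemma tangent_add: "v \<in> tangent M p \<Longrightarrow> f \<in> C \<Longrightarrow> g \<in> C \<Longrightarrow> v (f + g) = v f + v g"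
  and tangent_scale: "v \<in> tangent M p \<Longrightarrow> f \<in> C \<Longrightarrow> v (\<lambda>x. c * f x) = c * v f"
  and tangent_mult: "v \<in> tangent M p \<Longrightarrow> f \<in> C \<Longrightarrow> g \<in> C \<Longrightarrow> v (f * g) = v f * g p + f p * v g"
  and tangent_outside: "v \<in> tangent M p \<Longrightarrow> f \<notin> C \<Longrightarrow> v f = 0"
  unfolding tangent_def by auto

lemma tangent_const: "v \<in> tangent M p \<Longrightarrow> v (\<lambda>x. c) = 0"
proof -
  assume v: "v \<in> tangent M p"
  have "v (1 * 1) = v 1 * 1 + 1 * v 1"
    using tangent_mult[OF v C_inf_1 C_inf_1] by simp
  then have "v 1 = 0" by simp
  then show "v (\<lambda>x. c) = 0"
    using tangent_scale[OF v C_inf_1, of c] by simp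
qed

lemma tangent_uminus: "v \<in> tangent M p \<Longrightarrow> f \<in> C \<Longrightarrow> v (- f) = - v f"
  using tangent_scale[of v p f "-1"] by (simp add: fun_Compl_def)

lemma tangent_diff: "v \<in> tangent M p \<Longrightarrow> f \<in> C \<Longrightarrow> g \<in> C \<Longrightarrow> v (f - g) = v f - v g"
  using tangent_add[of v p f "- g"] tangent_uminus[of v p g] C_inf_uminus[of g] by simp

lemma tangent_zero_fun: "v \<in> tangent M p \<Longrightarrow> v 0 = 0"
  using tangent_const[of v p 0] by (simp add: zero_fun_def)

lemma tangent_sum: "v \<in> tangent M p \<Longrightarrow> (\<And>a. a \<in> A \<Longrightarrow> f a \<in> C) \<Longrightarrow> v (\<Sum>a\<in>A. f a) = (\<Sum>a\<in>A. v (f a))"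
proof (induction A rule: infinite_finite_induct)
  case (insert a A)
  then show ?case using tangent_add[OF insert.prems(1), of "f a" "\<Sum>a\<in>A. f a"] C_inf_sum[of A f] by simp
qed (simp_all add: tangent_zero_fun)

lemma tangent_eqI:
  assumes "v \<in> tangent M p" "w \<in> tangent M p" "\<And>f. f \<in> C \<Longrightarrow> v f = w f"
  shows "v = w"
  using assms tangent_outside by (metis ext)

text \<open>By Hadamard's lemma a derivation is determined by its values on local coordinates.\<close>

lemma tangent_in_coordinates:
  assumes c: "(U, \<phi>) \<in> charts M" and v: "v \<in> tangent M p" and f: "f \<in> C"
    and N: "open N" "p \<in> N" "N \<subseteq> U"
    and y: "\<And>j. j < mdim M \<Longrightarrow> y j \<in> C" "\<And>j q. j < mdim M \<Longrightarrow> q \<in> N \<Longrightarrow> y j q = \<phi> q j"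
  shows "v f = (\<Sum>j<mdim M. v (y j) * partial j (f \<circ> inv_into U \<phi>) (\<phi> p))"
proof -
  let ?F = "f \<circ> inv_into U \<phi>"
  obtain r where r: "r > 0" "coord_box (mdim M) (\<phi> p) r \<subseteq> \<phi> ` N"
    using openin_contains_box[OF chart_open_image[OF c N(1,3)], of "\<phi> p"] N by blast
  define X where "X = {q \<in> U. \<phi> q \<in> coord_box (mdim M) (\<phi> p) r}"
  have pE: "\<phi> p \<in> topspace (Euclidean_space (mdim M))"
    using chart_image[OF c] N openin_subset by blast
  have X: "open X" "p \<in> X" "X \<subseteq> N"
  proof -
    show "open X" unfolding X_def by (rule chart_open_preimage[OF c openin_box])
    show "p \<in> X" using N centre_in_box[OF pE r(1)] by (auto simp: X_def)
    show "X \<subseteq> N"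
    proof
      fix q assume q: "q \<in> X"
      then obtain q' where "q' \<in> N" "\<phi> q = \<phi> q'" using r(2) by (auto simp: X_def)
      then show "q \<in> N" using q N(3) chart_inj[OF c] by (auto simp: X_def inj_on_def)
    qed
  qed
  have XU: "X \<subseteq> U" by (auto simp: X_def)
  have imX: "\<phi> ` X = coord_box (mdim M) (\<phi> p) r"
    using r(2) N(3) by (auto simp: X_def)
  obtain g where g: "\<And>i. i < mdim M \<Longrightarrow> smooth_on (mdim M) (coord_box (mdim M) (\<phi> p) r) (g i)"
    "\<And>x. x \<in> coord_box (mdim M) (\<phi> p) r \<Longrightarrow> ?F x = ?F (\<phi> p) + (\<Sum>i<mdim M. (x i - \<phi> p i) * g i x)"
    "\<And>i. i < mdim M \<Longrightarrow> g i (\<phi> p) = partial i ?F (\<phi> p)"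
    by (rule Hadamard[OF pE r(1)]) (use C_inf_smooth_on[OF f c X(1) XU] imX in \<open>simp, blast\<close>)
  obtain \<theta> N' K where \<theta>: "\<theta> \<in> C" "open N'" "p \<in> N'" "compact K" "K \<subseteq> X"
    "\<And>q. q \<in> N' \<Longrightarrow> \<theta> q = 1" "\<And>q. q \<notin> K \<Longrightarrow> \<theta> q = 0"
    by (rule bump_at_point[OF X(1,2)]) blast
  define k where "k = (\<lambda>i q. if q \<in> X then \<theta> q * g i (\<phi> q) else 0)"
  have k: "k i \<in> C" if "i < mdim M" for i
    unfolding k_def using C_inf_cutoff[OF c X(1) XU _ \<theta>(1,4,5,7), of "g i"] g(1)[OF that] imX by simp
  define l where "l = (\<lambda>i. \<theta> * (y i - (\<lambda>q. \<phi> p i)))"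
  have l: "l i \<in> C" if "i < mdim M" for i
    unfolding l_def by (intro C_inf_mult C_inf_diff \<theta>(1) y(1)[OF that] C_inf_const)
  have \<theta>p: "\<theta> p = 1" using \<theta> by blast
  have eq: "\<theta> * (\<theta> * f) = (\<lambda>q. f p * (\<theta> * \<theta>) q) + (\<Sum>i<mdim M. l i * k i)"
  proof
    fix q
    show "(\<theta> * (\<theta> * f)) q = ((\<lambda>q. f p * (\<theta> * \<theta>) q) + (\<Sum>i<mdim M. l i * k i)) q"
    proof (cases "q \<in> X")
      case True
      then have "f q = f p + (\<Sum>i<mdim M. (y i q - \<phi> p i) * g i (\<phi> q))"
        using g(2)[of "\<phi> q"] c XU X N y(2) by (auto simp: X_def subset_iff)
      then show ?thesis using True
        by (simp add: sum_fun_apply l_def k_def algebra_simps sum_distrib_left)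
    next
      case False
      then have "\<theta> q = 0" using \<theta> by blast
      then show ?thesis by (simp add: sum_fun_apply l_def)
    qed
  qed
  have "v (\<theta> * (\<theta> * f)) = v \<theta> * f p + (v \<theta> * f p + v f)"
    using tangent_mult[OF v \<theta>(1) C_inf_mult[OF \<theta>(1) f]] tangent_mult[OF v \<theta>(1) f] \<theta>p by simp
  moreover have "v (\<lambda>q. f p * (\<theta> * \<theta>) q) = f p * (v \<theta> + v \<theta>)"
    using tangent_scale[OF v C_inf_mult[OF \<theta>(1,1)], of "f p"] tangent_mult[OF v \<theta>(1,1)] \<theta>p by simp
  moreover have "v (l i * k i) = v (y i) * partial i ?F (\<phi> p)" if i: "i < mdim M" for i
  proof -
    have "l i p = 0" using y(2)[OF i N(2)] by (simp add: l_def)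
    moreover have "v (l i) = v (y i)"
      using tangent_mult[OF v \<theta>(1) C_inf_diff[OF y(1)[OF i] C_inf_const[of "\<phi> p i"]]]
        tangent_diff[OF v y(1)[OF i] C_inf_const[of "\<phi> p i"]] tangent_const[OF v] y(2)[OF i N(2)] \<theta>p
      by (simp add: l_def)
    moreover have "k i p = partial i ?F (\<phi> p)" using X(2) \<theta>p g(3)[OF i] by (simp add: k_def)
    ultimately show ?thesis using tangent_mult[OF v l[OF i] k[OF i]] by simp
  qed
  moreover have "v ((\<lambda>q. f p * (\<theta> * \<theta>) q) + (\<Sum>i<mdim M. l i * k i)) =
      v (\<lambda>q. f p * (\<theta> * \<theta>) q) + (\<Sum>i<mdim M. v (l i * k i))"
    using tangent_add[OF v C_inf_scale[OF C_inf_mult[OF \<theta>(1,1)]] C_inf_sum, of "{..<mdim M}" "\<lambda>i. l i * k i" "f p"]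
      tangent_sum[OF v, of "{..<mdim M}" "\<lambda>i. l i * k i"] l k C_inf_mult by simp
  ultimately have "v \<theta> * f p + (v \<theta> * f p + v f) = f p * (v \<theta> + v \<theta>) + (\<Sum>i<mdim M. v (y i) * partial i ?F (\<phi> p))"
    using eq by simp
  then show ?thesis by (simp add: algebra_simps)
qed

definition coordinate_vector :: "'m set \<Rightarrow> ('m \<Rightarrow> nat \<Rightarrow> real) \<Rightarrow> nat \<Rightarrow> 'm \<Rightarrow> 'm tvec" where
  "coordinate_vector U \<phi> j p = (\<lambda>f. if f \<in> C then partial j (f \<circ> inv_into U \<phi>) (\<phi> p) else 0)"

lemma coordinate_vector_tangent:
  assumes c: "(U, \<phi>) \<in> charts M" and p: "p \<in> U" and j: "j < mdim M"
  shows "coordinate_vector U \<phi> j p \<in> tangent M p"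
proof -
  have D: "((\<lambda>t. (f \<circ> inv_into U \<phi>) ((\<phi> p)(j := t))) has_real_derivative partial j (f \<circ> inv_into U \<phi>) (\<phi> p)) (at (\<phi> p j))"
    if "f \<in> C" for f
    using smooth_on_partial_deriv[OF C_inf_smooth_on[OF that c chart_open[OF c] order_refl] _ j] p by blast
  have "partial j ((f + g) \<circ> inv_into U \<phi>) (\<phi> p) =
      partial j (f \<circ> inv_into U \<phi>) (\<phi> p) + partial j (g \<circ> inv_into U \<phi>) (\<phi> p)" if "f \<in> C" "g \<in> C" for f g
    by (rule partial_unique) (use DERIV_add[OF D[OF that(1)] D[OF that(2)]] in \<open>simp add: o_def\<close>)
  moreover have "partial j ((\<lambda>x. a * f x) \<circ> inv_into U \<phi>) (\<phi> p) = a * partial j (f \<circ> inv_into U \<phi>) (\<phi> p)"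
    if "f \<in> C" for f a
    by (rule partial_unique) (use DERIV_cmult[OF D[OF that], of a] in \<open>simp add: o_def\<close>)
  moreover have "partial j ((f * g) \<circ> inv_into U \<phi>) (\<phi> p) =
      partial j (f \<circ> inv_into U \<phi>) (\<phi> p) * g p + f p * partial j (g \<circ> inv_into U \<phi>) (\<phi> p)" if "f \<in> C" "g \<in> C" for f g
    by (rule partial_unique) (use DERIV_mult[OF D[OF that(1)] D[OF that(2)]] c p in \<open>simp add: o_def mult.commute\<close>)
  ultimately show ?thesis
    by (simp add: tangent_def coordinate_vector_def C_inf_add C_inf_mult C_inf_scale)
qed

end

section \<open>Coloured covers by small compact sets\<close>

text \<open>A form of the statement that the covering dimension of \<open>K\<close> is less than the number of colours: every
  open cover is refined by finitely many compact pieces, and pieces of one colour are disjoint. The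
  pieces are compact, so those of one colour also have disjoint neighbourhoods. Their union is \<open>K\<close>
  itself, which allows them to be transported by an embedding of \<open>K\<close>.\<close>

definition finely_coloured :: "'c set \<Rightarrow> 'a::topological_space set \<Rightarrow> bool" where
  "finely_coloured I K \<longleftrightarrow> (\<forall>\<O>. (\<forall>T\<in>\<O>. open T) \<and> K \<subseteq> \<Union>\<O> \<longrightarrow>
     (\<exists>F. (\<forall>i\<in>I. finite (F i) \<and> pairwise disjnt (F i) \<and> (\<forall>V\<in>F i. compact V \<and> (\<exists>T\<in>\<O>. V \<subseteq> T))) \<and>
       (\<Union>i\<in>I. \<Union>(F i)) = K))"

lemma finely_colouredE:
  assumes "finely_coloured I K" "(\<forall>T\<in>\<O>. open T) \<and> K \<subseteq> \<Union>\<O>"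
  obtains F where "\<And>i. i \<in> I \<Longrightarrow> finite (F i)" "\<And>i. i \<in> I \<Longrightarrow> pairwise disjnt (F i)"
    "\<And>i V. i \<in> I \<Longrightarrow> V \<in> F i \<Longrightarrow> compact V \<and> (\<exists>T\<in>\<O>. V \<subseteq> T)" "(\<Union>i\<in>I. \<Union>(F i)) = K"
proof -
  have "\<exists>F. (\<forall>i\<in>I. finite (F i) \<and> pairwise disjnt (F i) \<and> (\<forall>V\<in>F i. compact V \<and> (\<exists>T\<in>\<O>. V \<subseteq> T))) \<and>
      (\<Union>i\<in>I. \<Union>(F i)) = K"
    using assms(1)[unfolded finely_coloured_def, THEN spec, THEN mp, OF assms(2)] .
  then obtain F where F: "(\<forall>i\<in>I. finite (F i) \<and> pairwise disjnt (F i) \<and> (\<forall>V\<in>F i. compact V \<and> (\<exists>T\<in>\<O>. V \<subseteq> T))) \<and>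
      (\<Union>i\<in>I. \<Union>(F i)) = K" ..
  show ?thesis
  proof (rule that[of F])
    show "(\<Union>i\<in>I. \<Union>(F i)) = K" using F by (rule conjunct2)
  qed (use F[THEN conjunct1] in blast)+
qed

lemma finely_coloured_empty: "finely_coloured I {}"
  unfolding finely_coloured_def by (intro allI impI exI[of _ "\<lambda>_. {}"]) auto

lemma separate_compact_pair:
  fixes S T :: "'a::t2_space set"
  assumes "compact S" "compact T" "S \<inter> T = {}"
  shows "\<exists>P Q. open P \<and> open Q \<and> S \<subseteq> P \<and> T \<subseteq> Q \<and> P \<inter> Q = {}"
proof -
  have "\<exists>U V. open U \<and> open V \<and> x \<in> U \<and> y \<in> V \<and> U \<inter> V = {}" if "x \<noteq> y" for x y :: 'a
    using hausdorff[OF that] by blast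
  then have "Hausdorff_space (euclidean :: 'a topology)"
    by (simp add: Hausdorff_space_def disjnt_def)
  then have "\<exists>U V. openin euclidean U \<and> openin euclidean V \<and> S \<subseteq> U \<and> T \<subseteq> V \<and> disjnt U V"
    using assms unfolding Hausdorff_space_compact_sets by (simp add: disjnt_def)
  then show ?thesis by (simp add: disjnt_def)
qed

lemma separate_compact_family:
  fixes F :: "'a::t2_space set set"
  assumes "finite F" "\<And>V. V \<in> F \<Longrightarrow> compact V" "pairwise disjnt F"
  obtains N where "\<And>V. V \<in> F \<Longrightarrow> open (N V) \<and> V \<subseteq> N V"
    "\<And>V W. V \<in> F \<Longrightarrow> W \<in> F \<Longrightarrow> V \<noteq> W \<Longrightarrow> N V \<inter> N W = {}"
proof -
  have "\<exists>P Q. open P \<and> open Q \<and> V \<subseteq> P \<and> W \<subseteq> Q \<and> P \<inter> Q = {}" if "V \<in> F" "W \<in> F" "V \<noteq> W" for V W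
    by (rule separate_compact_pair) (use assms that in \<open>auto simp: pairwise_def disjnt_def\<close>)
  then obtain P Q where PQ: "\<And>V W. V \<in> F \<Longrightarrow> W \<in> F \<Longrightarrow> V \<noteq> W \<Longrightarrow>
      open (P V W) \<and> open (Q V W) \<and> V \<subseteq> P V W \<and> W \<subseteq> Q V W \<and> P V W \<inter> Q V W = {}"
    by metis
  define N where "N = (\<lambda>V. \<Inter>W\<in>F - {V}. P V W \<inter> Q W V)"
  show ?thesis
  proof (rule that[of N])
    show "open (N V) \<and> V \<subseteq> N V" if "V \<in> F" for V
    proof
      show "open (N V)" unfolding N_def
      proof (rule open_INT)
        show "finite (F - {V})" using assms(1) by simp
        show "\<forall>W\<in>F - {V}. open (P V W \<inter> Q W V)" using PQ that by (intro ballI open_Int) auto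
      qed
      show "V \<subseteq> N V" unfolding N_def using PQ that by blast
    qed
    show "N V \<inter> N W = {}" if "V \<in> F" "W \<in> F" "V \<noteq> W" for V W
    proof -
      have "N V \<subseteq> P V W" "N W \<subseteq> Q V W" unfolding N_def using that by blast+
      then show ?thesis using PQ[OF that] by blast
    qed
  qed
qed

text \<open>The pieces of \<open>A\<close> are chosen so small that those of colour \<open>i\<close> touching a piece \<open>V\<close> of \<open>B\<close> of the same
  colour lie in a prescribed neighbourhood of \<open>V\<close>, and are absorbed into \<open>V\<close>. No new colour is needed.\<close>

lemma finely_coloured_Un:
  fixes A B :: "'a::t2_space set"
  assumes I: "finite I" and A: "finely_coloured I A" and B: "finely_coloured I B"
  shows "finely_coloured I (A \<union> B)"
  unfolding finely_coloured_def
proof (intro allI impI)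
  fix \<O> :: "'a set set" assume O: "(\<forall>T\<in>\<O>. open T) \<and> A \<union> B \<subseteq> \<Union>\<O>"
  then have OB: "(\<forall>T\<in>\<O>. open T) \<and> B \<subseteq> \<Union>\<O>" by blast
  obtain F where F: "\<And>i. i \<in> I \<Longrightarrow> finite (F i)" "\<And>i. i \<in> I \<Longrightarrow> pairwise disjnt (F i)"
      "\<And>i V. i \<in> I \<Longrightarrow> V \<in> F i \<Longrightarrow> compact V \<and> (\<exists>T\<in>\<O>. V \<subseteq> T)" "(\<Union>i\<in>I. \<Union>(F i)) = B"
    by (rule finely_colouredE[OF B OB]) blast
  have "\<exists>N. (\<forall>V\<in>F i. open (N V) \<and> V \<subseteq> N V \<and> (\<exists>T\<in>\<O>. N V \<subseteq> T)) \<and>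
      (\<forall>V\<in>F i. \<forall>W\<in>F i. V \<noteq> W \<longrightarrow> N V \<inter> N W = {})" if i: "i \<in> I" for i
  proof -
    obtain N where N: "\<And>V. V \<in> F i \<Longrightarrow> open (N V) \<and> V \<subseteq> N V"
      "\<And>V W. V \<in> F i \<Longrightarrow> W \<in> F i \<Longrightarrow> V \<noteq> W \<Longrightarrow> N V \<inter> N W = {}"
      by (rule separate_compact_family[OF F(1)[OF i] _ F(2)[OF i]]) (use F(3)[OF i] in blast)+
    obtain T where T: "\<And>V. V \<in> F i \<Longrightarrow> T V \<in> \<O> \<and> V \<subseteq> T V" using F(3)[OF i] by metis
    show ?thesis
    proof (intro exI[of _ "\<lambda>V. N V \<inter> T V"] conjI ballI impI)
      fix V assume V: "V \<in> F i"
      show "open (N V \<inter> T V)" using N(1)[OF V] T[OF V] O by blast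
      show "V \<subseteq> N V \<inter> T V" using N(1)[OF V] T[OF V] by blast
      show "\<exists>S\<in>\<O>. N V \<inter> T V \<subseteq> S" using T[OF V] by blast
      show "N V \<inter> T V \<inter> (N W \<inter> T W) = {}" if "W \<in> F i" "V \<noteq> W" for W using N(2)[OF V that] by blast
    qed
  qed
  then obtain N where N: "\<And>i V. i \<in> I \<Longrightarrow> V \<in> F i \<Longrightarrow> open (N i V) \<and> V \<subseteq> N i V \<and> (\<exists>T\<in>\<O>. N i V \<subseteq> T)"
    "\<And>i V W. i \<in> I \<Longrightarrow> V \<in> F i \<Longrightarrow> W \<in> F i \<Longrightarrow> V \<noteq> W \<Longrightarrow> N i V \<inter> N i W = {}"
    by metis
  obtain S where S: "\<And>a. a \<in> A \<Longrightarrow> a \<in> S a \<and> S a \<in> \<O>"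
  proof -
    have "\<forall>a\<in>A. \<exists>S. a \<in> S \<and> S \<in> \<O>" using O by blast
    from bchoice[OF this] show ?thesis using that by blast
  qed
  \<comment> \<open>A subset of \<open>W a\<close> that meets a piece \<open>V\<close> of \<open>B\<close> of colour \<open>i\<close> lies in \<open>N i V\<close>.\<close>
  define W where "W = (\<lambda>a. S a \<inter> (\<Inter>i\<in>I. \<Inter>V\<in>F i. if a \<in> V then N i V else - V))"
  have openW: "open (W a)" if "a \<in> A" for a
  proof -
    have "open (\<Inter>V\<in>F i. if a \<in> V then N i V else - V)" if i: "i \<in> I" for i
    proof (rule open_INT[OF F(1)[OF i]], safe)
      fix V assume V: "V \<in> F i"
      show "open (if a \<in> V then N i V else - V)"
        using N(1)[OF i V] F(3)[OF i V] compact_imp_closed[of V] by (simp add: open_Compl)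
    qed
    then have "open (\<Inter>i\<in>I. \<Inter>V\<in>F i. if a \<in> V then N i V else - V)"
      by (intro open_INT[OF I] ballI)
    moreover have "open (S a)" using S[OF that] O by blast
    ultimately show ?thesis unfolding W_def by (rule open_Int[rotated])
  qed
  have inW: "a \<in> W a" if "a \<in> A" for a
  proof -
    have "a \<in> (if a \<in> V then N i V else - V)" if "i \<in> I" "V \<in> F i" for i V
      using N(1)[OF that] by (cases "a \<in> V") auto
    then show ?thesis using S[OF that] unfolding W_def by blast
  qed
  have OA: "(\<forall>T\<in>W ` A. open T) \<and> A \<subseteq> \<Union>(W ` A)" using openW inW by blast
  obtain G where G: "\<And>i. i \<in> I \<Longrightarrow> finite (G i)" "\<And>i. i \<in> I \<Longrightarrow> pairwise disjnt (G i)"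
      "\<And>i V. i \<in> I \<Longrightarrow> V \<in> G i \<Longrightarrow> compact V \<and> (\<exists>T\<in>W ` A. V \<subseteq> T)" "(\<Union>i\<in>I. \<Union>(G i)) = A"
    by (rule finely_colouredE[OF A OA]) blast
  have touch: "U \<subseteq> N i V" if h: "i \<in> I" "U \<in> G i" "V \<in> F i" "U \<inter> V \<noteq> {}" for i U V
  proof -
    obtain a where a: "a \<in> A" "U \<subseteq> W a" using G(3)[OF h(1,2)] by blast
    have "W a \<subseteq> (if a \<in> V then N i V else - V)" unfolding W_def using h(1,3) by blast
    then have Ua: "U \<subseteq> (if a \<in> V then N i V else - V)" using a(2) by (rule subset_trans[rotated])
    show ?thesis
    proof (cases "a \<in> V")
      case True
      then show ?thesis using Ua by simp
    next
      case False
      then have "U \<subseteq> - V" using Ua by simp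
      then show ?thesis using h(4) by blast
    qed
  qed
  \<comment> \<open>Each piece of \<open>B\<close> absorbs the pieces of \<open>A\<close> of its colour that it meets; these lie in \<open>N i V\<close>.\<close>
  define E where "E = (\<lambda>i V. V \<union> \<Union>{U \<in> G i. U \<inter> V \<noteq> {}})"
  define H where "H = (\<lambda>i. E i ` F i \<union> {U \<in> G i. \<forall>V\<in>F i. U \<inter> V = {}})"
  have EN: "E i V \<subseteq> N i V" if "i \<in> I" "V \<in> F i" for i V
    using touch[OF that(1) _ that(2)] N(1)[OF that] unfolding E_def by blast
  have Edis: "E i V \<inter> U = {}" if h: "i \<in> I" "V \<in> F i" "U \<in> G i" "\<forall>V\<in>F i. U \<inter> V = {}" for i U V
  proof -
    have "U' \<inter> U = {}" if U': "U' \<in> G i" "U' \<inter> V \<noteq> {}" for U'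
    proof -
      have "U' \<noteq> U" using U'(2) h(2,4) by blast
      then have "disjnt U' U" using G(2)[OF h(1)] U'(1) h(3) by (simp add: pairwise_def)
      then show ?thesis by (simp add: disjnt_def)
    qed
    then show ?thesis using h(2,4) unfolding E_def by blast
  qed
  show "\<exists>F. (\<forall>i\<in>I. finite (F i) \<and> pairwise disjnt (F i) \<and> (\<forall>V\<in>F i. compact V \<and> (\<exists>T\<in>\<O>. V \<subseteq> T))) \<and>
       (\<Union>i\<in>I. \<Union>(F i)) = A \<union> B"
  proof (intro exI[of _ H] conjI ballI)
    fix i assume i: "i \<in> I"
    show "finite (H i)" unfolding H_def using F(1)[OF i] G(1)[OF i] by auto
    show "pairwise disjnt (H i)"
      unfolding pairwise_def
    proof (intro ballI impI)
      fix X Y assume X: "X \<in> H i" and Y: "Y \<in> H i" and ne: "X \<noteq> Y"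
      consider V V' where "V \<in> F i" "V' \<in> F i" "X = E i V" "Y = E i V'"
        | V where "V \<in> F i" "X = E i V" "Y \<in> G i" "\<forall>V\<in>F i. Y \<inter> V = {}"
        | V where "V \<in> F i" "Y = E i V" "X \<in> G i" "\<forall>V\<in>F i. X \<inter> V = {}"
        | "X \<in> G i" "Y \<in> G i"
        using X Y unfolding H_def by blast
      then show "disjnt X Y"
      proof cases
        case 1
        then have "N i V \<inter> N i V' = {}" using ne N(2)[OF i] by blast
        then show ?thesis using EN[OF i 1(1)] EN[OF i 1(2)] 1 by (auto simp: disjnt_def)
      next
        case 2
        then show ?thesis using Edis[OF i 2(1,3,4)] by (simp add: disjnt_def)
      next
        case 3
        then show ?thesis using Edis[OF i 3(1,3,4)] by (auto simp: disjnt_def)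
      next
        case 4
        then show ?thesis using G(2)[OF i] ne by (simp add: pairwise_def)
      qed
    qed
  next
    fix i X assume i: "i \<in> I" and X: "X \<in> H i"
    then consider V where "V \<in> F i" "X = E i V" | "X \<in> G i" unfolding H_def by blast
    then show "compact X"
    proof cases
      case 1
      have "compact (\<Union>{U \<in> G i. U \<inter> V \<noteq> {}})"
        by (rule compact_Union) (use G(1,3)[OF i] in auto)
      then show ?thesis using F(3)[OF i 1(1)] 1(2) by (auto simp: E_def intro: compact_Un)
    next
      case 2
      then show ?thesis using G(3)[OF i] by blast
    qed
    from i X consider V where "V \<in> F i" "X = E i V" | "X \<in> G i" unfolding H_def by blast
    then show "\<exists>T\<in>\<O>. X \<subseteq> T"
    proof cases
      case 1
      then show ?thesis using EN[OF i 1(1)] N(1)[OF i 1(1)] by blast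
    next
      case 2
      then obtain a where "a \<in> A" "X \<subseteq> W a" using G(3)[OF i 2] by blast
      then show ?thesis using S[of a] unfolding W_def by blast
    qed
  next
    have "\<Union>(H i) = \<Union>(F i) \<union> \<Union>(G i)" for i
    proof (rule subset_antisym)
      show "\<Union>(H i) \<subseteq> \<Union>(F i) \<union> \<Union>(G i)" unfolding H_def E_def by blast
      show "\<Union>(F i) \<union> \<Union>(G i) \<subseteq> \<Union>(H i)"
      proof
        fix x assume "x \<in> \<Union>(F i) \<union> \<Union>(G i)"
        then consider V where "V \<in> F i" "x \<in> V" | U where "U \<in> G i" "x \<in> U" by blast
        then show "x \<in> \<Union>(H i)"
        proof cases
          case 1
          then show ?thesis unfolding H_def E_def by blast
        next
          case 2
          show ?thesis
          proof (cases "\<forall>V\<in>F i. U \<inter> V = {}")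
            case True
            then show ?thesis using 2 unfolding H_def by blast
          next
            case False
            then obtain V where V: "V \<in> F i" "U \<inter> V \<noteq> {}" by blast
            then have "x \<in> E i V" using 2 unfolding E_def by blast
            then show ?thesis using V(1) unfolding H_def by blast
          qed
        qed
      qed
    qed
    then have "(\<Union>i\<in>I. \<Union>(H i)) = (\<Union>i\<in>I. \<Union>(F i)) \<union> (\<Union>i\<in>I. \<Union>(G i))"
      by (simp only: UN_Un_distrib)
    then show "(\<Union>i\<in>I. \<Union>(H i)) = A \<union> B" unfolding F(4) G(4) by (simp only: Un_commute)
  qed
qed

lemma finely_coloured_Union:
  fixes A :: "'b \<Rightarrow> 'a::t2_space set"
  assumes "finite I" "finite D" "\<And>d. d \<in> D \<Longrightarrow> finely_coloured I (A d)"
  shows "finely_coloured I (\<Union>d\<in>D. A d)"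
  using assms(2,3)
proof (induction D)
  case (insert d D)
  have "finely_coloured I (A d \<union> (\<Union>d\<in>D. A d))"
    by (rule finely_coloured_Un[OF assms(1) insert.prems insert.IH[OF insert.prems]]) auto
  then show ?case by simp
qed (simp add: finely_coloured_empty)

lemma finely_coloured_image:
  fixes f :: "'a::topological_space \<Rightarrow> 'b::topological_space"
  assumes K: "finely_coloured I K" and f: "continuous_on K f" "inj_on f K"
  shows "finely_coloured I (f ` K)"
  unfolding finely_coloured_def
proof (intro allI impI)
  fix \<O> :: "'b set set" assume O: "(\<forall>T\<in>\<O>. open T) \<and> f ` K \<subseteq> \<Union>\<O>"
  define \<O>' where "\<O>' = {S. open S \<and> (\<exists>T\<in>\<O>. f ` (K \<inter> S) \<subseteq> T)}"
  have "K \<subseteq> \<Union>\<O>'"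
  proof
    fix x assume x: "x \<in> K"
    then obtain T where T: "T \<in> \<O>" "f x \<in> T" using O by blast
    then obtain S where "open S" "S \<inter> K = f -` T \<inter> K"
      using f(1) O unfolding continuous_on_open_invariant by metis
    then have "S \<in> \<O>'" "x \<in> S" using T x unfolding \<O>'_def by blast+
    then show "x \<in> \<Union>\<O>'" by blast
  qed
  then have O': "(\<forall>T\<in>\<O>'. open T) \<and> K \<subseteq> \<Union>\<O>'" unfolding \<O>'_def by blast
  obtain F where F: "\<And>i. i \<in> I \<Longrightarrow> finite (F i)" "\<And>i. i \<in> I \<Longrightarrow> pairwise disjnt (F i)"
      "\<And>i V. i \<in> I \<Longrightarrow> V \<in> F i \<Longrightarrow> compact V \<and> (\<exists>T\<in>\<O>'. V \<subseteq> T)" "(\<Union>i\<in>I. \<Union>(F i)) = K"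
    by (rule finely_colouredE[OF K O']) blast
  have VK: "V \<subseteq> K" if "i \<in> I" "V \<in> F i" for i V using F(4) that by blast
  show "\<exists>F. (\<forall>i\<in>I. finite (F i) \<and> pairwise disjnt (F i) \<and> (\<forall>V\<in>F i. compact V \<and> (\<exists>T\<in>\<O>. V \<subseteq> T))) \<and>
       (\<Union>i\<in>I. \<Union>(F i)) = f ` K"
  proof (intro exI[of _ "\<lambda>i. (`) f ` F i"] conjI ballI)
    fix i assume i: "i \<in> I"
    show "finite ((`) f ` F i)" using F(1)[OF i] by simp
    show "pairwise disjnt ((`) f ` F i)"
      unfolding pairwise_def
    proof (intro ballI impI)
      fix X Y assume "X \<in> (`) f ` F i" "Y \<in> (`) f ` F i" "X \<noteq> Y"
      then obtain V W where VW: "V \<in> F i" "W \<in> F i" "X = f ` V" "Y = f ` W" "V \<noteq> W" by blast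
      then have "V \<inter> W = {}" using F(2)[OF i] by (auto simp: pairwise_def disjnt_def)
      then have "f ` V \<inter> f ` W = {}"
        using inj_on_image_Int[OF f(2) VK[OF i VW(1)] VK[OF i VW(2)]] by simp
      then show "disjnt X Y" using VW by (simp add: disjnt_def)
    qed
  next
    fix i X assume i: "i \<in> I" and "X \<in> (`) f ` F i"
    then obtain V where V: "V \<in> F i" "X = f ` V" by blast
    show "compact X"
      unfolding V(2)
      by (rule compact_continuous_image[OF continuous_on_subset[OF f(1) VK[OF i V(1)]]]) (use F(3)[OF i V(1)] in blast)
    show "\<exists>T\<in>\<O>. X \<subseteq> T"
    proof -
      obtain S where S: "S \<in> \<O>'" "V \<subseteq> S" using F(3)[OF i V(1)] by blast
      then obtain T where "T \<in> \<O>" "f ` (K \<inter> S) \<subseteq> T" unfolding \<O>'_def by blast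
      then show ?thesis using S VK[OF i V(1)] V(2) by blast
    qed
  next
    show "(\<Union>i\<in>I. \<Union>((`) f ` F i)) = f ` K" using F(4) by blast
  qed
qed

text \<open>Cells of a grid whose indices agree modulo \<open>2\<close> are disjoint; so \<open>2 ^ n\<close> colours suffice in
  dimension \<open>n\<close>.\<close>

lemma finely_coloured_cube:
  assumes r: "r > 0"
  shows "finely_coloured (Pow {..<n}) {y \<in> topspace (Euclidean_space n). \<forall>i<n. a i \<le> y i \<and> y i \<le> a i + r}"
    (is "finely_coloured _ ?Q")
  unfolding finely_coloured_def
proof (intro allI impI)
  fix \<O> :: "(nat \<Rightarrow> real) set set" assume O: "(\<forall>T\<in>\<O>. open T) \<and> ?Q \<subseteq> \<Union>\<O>"
  have "\<forall>x\<in>?Q. \<exists>e. e > 0 \<and> (\<exists>T\<in>\<O>. coord_box n x (2 * e) \<subseteq> T)"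
  proof
    fix x assume x: "x \<in> ?Q"
    obtain T where T: "T \<in> \<O>" "x \<in> T" using O x by blast
    have "openin (Euclidean_space n) (topspace (Euclidean_space n) \<inter> T)"
      by (subst Euclidean_space_eq) (use O T in \<open>auto intro: openin_open_Int\<close>)
    then obtain e where "e > 0" "coord_box n x e \<subseteq> topspace (Euclidean_space n) \<inter> T"
      using openin_contains_box x T by (metis (no_types, lifting) IntI mem_Collect_eq)
    then show "\<exists>e. e > 0 \<and> (\<exists>T\<in>\<O>. coord_box n x (2 * e) \<subseteq> T)"
      using T by (intro exI[of _ "e / 2"]) auto
  qed
  from bchoice[OF this] obtain e where
    eT: "\<And>x. x \<in> ?Q \<Longrightarrow> e x > 0 \<and> (\<exists>T\<in>\<O>. coord_box n x (2 * e x) \<subseteq> T)"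
    by blast
  have Qc: "compact ?Q" using compact_closed_coord_box[of n a "\<lambda>i. a i + r"] by simp
  obtain D where D: "D \<subseteq> ?Q" "finite D" "?Q \<subseteq> (\<Union>x\<in>D. {y. \<forall>i<n. \<bar>y i - x i\<bar> < e x})"
  proof (rule compactE_image[OF Qc, of ?Q "\<lambda>x. {y. \<forall>i<n. \<bar>y i - x i\<bar> < e x}"])
    show "?Q \<subseteq> (\<Union>x\<in>?Q. {y. \<forall>i<n. \<bar>y i - x i\<bar> < e x})"
    proof
      fix x assume x: "x \<in> ?Q"
      then have "x \<in> {y. \<forall>i<n. \<bar>y i - x i\<bar> < e x}" using eT[OF x] by simp
      then show "x \<in> (\<Union>x\<in>?Q. {y. \<forall>i<n. \<bar>y i - x i\<bar> < e x})" using x by blast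
    qed
  qed (auto intro: open_Collect_coordinates)
  \<comment> \<open>\<open>\<epsilon>\<close> is a Lebesgue number of the cover with respect to the maximum norm.\<close>
  define \<epsilon> where "\<epsilon> = Min (insert 1 (e ` D))"
  have \<epsilon>: "\<epsilon> > 0" using D eT by (auto simp: \<epsilon>_def subset_iff)
  have Leb: "\<exists>S\<in>\<O>. \<forall>y\<in>topspace (Euclidean_space n). (\<forall>i<n. \<bar>y i - z i\<bar> < \<epsilon>) \<longrightarrow> y \<in> S" if z: "z \<in> ?Q" for z
  proof -
    obtain x where x: "x \<in> D" "\<forall>i<n. \<bar>z i - x i\<bar> < e x" using D(3) z by blast
    have "\<epsilon> \<le> e x" using D(2) x by (auto simp: \<epsilon>_def)
    have near: "y \<in> coord_box n x (2 * e x)" if y: "y \<in> topspace (Euclidean_space n)" "\<forall>i<n. \<bar>y i - z i\<bar> < \<epsilon>" for y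
    proof -
      have "\<bar>y i - x i\<bar> < 2 * e x" if "i < n" for i
      proof -
        have "\<bar>y i - z i\<bar> < \<epsilon>" "\<bar>z i - x i\<bar> < e x" using y(2) x(2) that by blast+
        then show ?thesis using \<open>\<epsilon> \<le> e x\<close> by linarith
      qed
      then show ?thesis using y(1) by (simp add: coord_box_def)
    qed
    have "x \<in> ?Q" using x(1) D(1) by blast
    then obtain T where "T \<in> \<O>" "coord_box n x (2 * e x) \<subseteq> T" using eT by blast
    then show ?thesis using near by blast
  qed
  obtain m where m: "m > 0" "r / real m < \<epsilon>"
  proof -
    obtain m where "r / \<epsilon> < real m" using reals_Archimedean2 by blast
    moreover have "r / \<epsilon> > 0" using r \<epsilon> by simp
    ultimately have m0: "real m > 0" by linarith
    have "r < real m * \<epsilon>" using \<open>r / \<epsilon> < real m\<close> \<epsilon> by (simp add: pos_divide_less_eq)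
    then have "r / real m < \<epsilon>" using m0 by (simp add: pos_divide_less_eq mult.commute)
    then show ?thesis using m0 that[of m] by simp
  qed
  define h where "h = r / real m"
  have h: "h > 0" "h < \<epsilon>" "real m * h = r" using m r by (simp_all add: h_def)
  define cell where "cell = (\<lambda>k::nat \<Rightarrow> nat. {y \<in> topspace (Euclidean_space n).
     \<forall>i<n. a i + real (k i) * h \<le> y i \<and> y i \<le> a i + (real (k i) + 1) * h})"
  define X where "X = (\<Pi>\<^sub>E i\<in>{..<n}. {..<m})"
  \<comment> \<open>The colour of a cell is the set of coordinates in which its index is odd.\<close>
  define F where "F = (\<lambda>S. cell ` {k \<in> X. {i. i < n \<and> odd (k i)} = S})"
  have finX: "finite X" unfolding X_def by (intro finite_PiE) auto
  have cellQ: "cell k \<subseteq> ?Q" if k: "k \<in> X" for k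
  proof
    fix y assume y: "y \<in> cell k"
    have "a i \<le> y i \<and> y i \<le> a i + r" if i: "i < n" for i
    proof -
      have "k i < m" using k i by (auto simp: X_def)
      then have "(real (k i) + 1) * h \<le> real m * h" using h(1) by (intro mult_right_mono) auto
      moreover have "0 \<le> real (k i) * h" using h(1) by simp
      moreover have "a i + real (k i) * h \<le> y i" "y i \<le> a i + (real (k i) + 1) * h" using y i by (auto simp: cell_def)
      ultimately show ?thesis using h(3) by linarith
    qed
    then show "y \<in> ?Q" using y by (auto simp: cell_def)
  qed
  show "\<exists>F. (\<forall>i\<in>Pow {..<n}. finite (F i) \<and> pairwise disjnt (F i) \<and> (\<forall>V\<in>F i. compact V \<and> (\<exists>T\<in>\<O>. V \<subseteq> T))) \<and>
       (\<Union>i\<in>Pow {..<n}. \<Union>(F i)) = ?Q"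
  proof (intro exI[of _ F] conjI ballI)
    fix S assume "S \<in> Pow {..<n}"
    show "finite (F S)" unfolding F_def using finX by auto
    show "pairwise disjnt (F S)"
      unfolding pairwise_def
    proof (intro ballI impI)
      fix V W assume "V \<in> F S" "W \<in> F S" and ne: "V \<noteq> W"
      then obtain k l where kl: "k \<in> X" "l \<in> X" "V = cell k" "W = cell l"
        "{i. i < n \<and> odd (k i)} = {i. i < n \<and> odd (l i)}" by (auto simp: F_def)
      have "k \<noteq> l" using kl(3,4) ne by blast
      then obtain i where i: "i < n" "k i \<noteq> l i" using kl(1,2) PiE_ext unfolding X_def by blast
      have par: "odd (k i) \<longleftrightarrow> odd (l i)" using kl(5) i(1) by blast
      have far: "\<not> (a i + real k' * h \<le> t \<and> t \<le> a i + (real k' + 1) * h \<and> a i + real l' * h \<le> t \<and> t \<le> a i + (real l' + 1) * h)"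
        if "k' + 2 \<le> l'" for k' l' :: nat and t
      proof -
        have "(real k' + 2) * h \<le> real l' * h" using that h(1) by (intro mult_right_mono) linarith+
        then have "real k' * h + 2 * h \<le> real l' * h" by (simp add: distrib_right)
        moreover have "(real k' + 1) * h = real k' * h + h" by (simp add: distrib_right)
        ultimately show ?thesis using h(1) by linarith
      qed
      have "k i + 2 \<le> l i \<or> l i + 2 \<le> k i" using par i(2) by presburger
      have "t \<notin> cell k \<or> t \<notin> cell l" for t
      proof (rule ccontr)
        assume "\<not> (t \<notin> cell k \<or> t \<notin> cell l)"
        then have both: "a i + real (k i) * h \<le> t i \<and> t i \<le> a i + (real (k i) + 1) * h \<and>
            a i + real (l i) * h \<le> t i \<and> t i \<le> a i + (real (l i) + 1) * h"
          using i(1) by (simp add: cell_def)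
        from \<open>k i + 2 \<le> l i \<or> l i + 2 \<le> k i\<close> show False
        proof
          assume "k i + 2 \<le> l i"
          from far[OF this, of "t i"] both show False by blast
        next
          assume "l i + 2 \<le> k i"
          from far[OF this, of "t i"] both show False by blast
        qed
      qed
      then show "disjnt V W" unfolding kl(3,4) disjnt_def by blast
    qed
  next
    fix S V assume "S \<in> Pow {..<n}" "V \<in> F S"
    then obtain k where k: "k \<in> X" "V = cell k" by (auto simp: F_def)
    show "compact V" unfolding k(2) cell_def by (rule compact_closed_coord_box)
    define z where "z = (\<lambda>i. if i < n then a i + real (k i) * h else 0)"
    have z: "z \<in> cell k" using h(1) by (auto simp: cell_def z_def topspace_Euclidean_space)
    then obtain T where T: "T \<in> \<O>" "\<forall>y\<in>topspace (Euclidean_space n). (\<forall>i<n. \<bar>y i - z i\<bar> < \<epsilon>) \<longrightarrow> y \<in> T"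
      using Leb cellQ[OF k(1)] by blast
    have "y \<in> T" if y: "y \<in> cell k" for y
    proof -
      have "\<bar>y i - z i\<bar> < \<epsilon>" if "i < n" for i
      proof -
        have "a i + real (k i) * h \<le> y i" "y i \<le> a i + (real (k i) + 1) * h" using y that by (auto simp: cell_def)
        moreover have "(real (k i) + 1) * h = real (k i) * h + h" by (simp add: distrib_right)
        ultimately have "\<bar>y i - (a i + real (k i) * h)\<bar> < \<epsilon>" using h(1,2) by linarith
        then show ?thesis using that by (simp add: z_def)
      qed
      then show ?thesis using T(2) y by (auto simp: cell_def)
    qed
    then show "\<exists>T\<in>\<O>. V \<subseteq> T" using T(1) k(2) by blast
  next
    show "(\<Union>i\<in>Pow {..<n}. \<Union>(F i)) = ?Q"
    proof
      show "(\<Union>i\<in>Pow {..<n}. \<Union>(F i)) \<subseteq> ?Q" using cellQ unfolding F_def by blast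
      show "?Q \<subseteq> (\<Union>i\<in>Pow {..<n}. \<Union>(F i))"
      proof
        fix y assume y: "y \<in> ?Q"
        have "\<exists>k<m. a i + real k * h \<le> y i \<and> y i \<le> a i + (real k + 1) * h" if i: "i < n" for i
        proof -
          define q where "q = nat \<lfloor>(y i - a i) / h\<rfloor>"
          have yi: "a i \<le> y i" "y i \<le> a i + r" using y i by simp_all
          have nn: "(y i - a i) / h \<ge> 0" using yi h(1) by simp
          have q: "real q \<le> (y i - a i) / h" "(y i - a i) / h < real q + 1"
            using nn unfolding q_def by linarith+
          then have q': "real q * h \<le> y i - a i" "y i - a i < (real q + 1) * h"
            using h(1) by (simp_all add: pos_le_divide_eq pos_divide_less_eq)
          show ?thesis
          proof (cases "q < m")
            case True
            then show ?thesis using q' by (intro exI[of _ q]) simp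
          next
            case False
            have "real m * h \<le> real q * h" using False h(1) by (intro mult_right_mono) simp_all
            then have "y i = a i + real m * h" using q'(1) h(3) yi(2) by linarith
            moreover have "real (m - 1) + 1 = real m" using m(1) by simp
            moreover have "real (m - 1) * h \<le> real m * h" using h(1) by (intro mult_right_mono) simp_all
            ultimately have "m - 1 < m \<and> a i + real (m - 1) * h \<le> y i \<and> y i \<le> a i + (real (m - 1) + 1) * h"
              using m(1) by simp
            then show ?thesis by blast
          qed
        qed
        then have "\<forall>i\<in>{..<n}. \<exists>k. k < m \<and> a i + real k * h \<le> y i \<and> y i \<le> a i + (real k + 1) * h" by blast
        from bchoice[OF this] obtain k where
          k: "\<And>i. i < n \<Longrightarrow> k i < m \<and> a i + real (k i) * h \<le> y i \<and> y i \<le> a i + (real (k i) + 1) * h"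
          by blast
        define k' where "k' = restrict k {..<n}"
        have "k' \<in> X" using k by (auto simp: X_def k'_def)
        moreover have "y \<in> cell k'" using k y by (auto simp: cell_def k'_def)
        ultimately have "y \<in> \<Union>(F {i. i < n \<and> odd (k' i)})" unfolding F_def by blast
        moreover have "{i. i < n \<and> odd (k' i)} \<in> Pow {..<n}" by auto
        ultimately show "y \<in> (\<Union>i\<in>Pow {..<n}. \<Union>(F i))" by (rule UN_I[rotated])
      qed
    qed
  qed
qed

context manifold begin

text \<open>Finitely many closed coordinate cubes inside \<open>W\<close> cover \<open>K\<close>. Their union \<open>K'\<close> inherits the colouring,
  whereas \<open>K\<close> itself could be an arbitrarily complicated compact set.\<close>

lemma finely_coloured_near_compact:
  fixes K W :: "'m set"
  assumes "compact K" "open W" "K \<subseteq> W"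
  obtains K' where "K \<subseteq> K'" "K' \<subseteq> W" "finely_coloured (Pow {..<mdim M}) K'"
proof -
  have "\<exists>N Q. open N \<and> p \<in> N \<and> N \<subseteq> Q \<and> Q \<subseteq> W \<and> finely_coloured (Pow {..<mdim M}) Q" if p: "p \<in> W" for p
  proof -
    obtain U \<phi> where c: "(U, \<phi>) \<in> charts M" "p \<in> U" by (rule chart_at)
    have UW: "openin (Euclidean_space (mdim M)) (\<phi> ` (U \<inter> W))"
      by (rule chart_open_image[OF c(1)]) (use assms(2) chart_open[OF c(1)] in auto)
    obtain r where r: "r > 0" "coord_box (mdim M) (\<phi> p) r \<subseteq> \<phi> ` (U \<inter> W)"
      using openin_contains_box[OF UW, of "\<phi> p"] c p by blast
    define R where "R = {y \<in> topspace (Euclidean_space (mdim M)). \<forall>i<mdim M. \<phi> p i - r / 2 \<le> y i \<and> y i \<le> (\<phi> p i - r / 2) + r}"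
    have R: "R \<subseteq> \<phi> ` (U \<inter> W)"
    proof -
      have "\<bar>y i - \<phi> p i\<bar> < r" if "y \<in> R" "i < mdim M" for y i
      proof -
        have "\<phi> p i - r / 2 \<le> y i" "y i \<le> (\<phi> p i - r / 2) + r" using that by (simp_all add: R_def)
        then show ?thesis using r(1) by linarith
      qed
      then have "R \<subseteq> coord_box (mdim M) (\<phi> p) r" by (auto simp: R_def coord_box_def)
      then show ?thesis using r(2) by blast
    qed
    define N where "N = {q \<in> U. \<phi> q \<in> coord_box (mdim M) (\<phi> p) (r / 2)}"
    have "\<phi> p \<in> topspace (Euclidean_space (mdim M))"
      using chart_image[OF c(1)] c openin_subset by blast
    then have "p \<in> N" using c centre_in_box r(1) by (simp add: N_def)
    moreover have "open N" unfolding N_def by (rule chart_open_preimage[OF c(1) openin_box])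
    moreover have "N \<subseteq> inv_into U \<phi> ` R"
    proof
      fix q assume q: "q \<in> N"
      have "\<phi> p i - r / 2 \<le> \<phi> q i \<and> \<phi> q i \<le> (\<phi> p i - r / 2) + r" if "i < mdim M" for i
      proof -
        have "\<bar>\<phi> q i - \<phi> p i\<bar> < r / 2" using q that by (simp add: N_def coord_box_def)
        then show ?thesis by linarith
      qed
      then have "\<phi> q \<in> R" using q by (simp add: N_def R_def coord_box_def)
      moreover have "q = inv_into U \<phi> (\<phi> q)" using q c(1) by (simp add: N_def)
      ultimately show "q \<in> inv_into U \<phi> ` R" by blast
    qed
    moreover have "inv_into U \<phi> ` R \<subseteq> W" using R c(1) by auto
    moreover have "finely_coloured (Pow {..<mdim M}) (inv_into U \<phi> ` R)"
    proof (rule finely_coloured_image)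
      show "finely_coloured (Pow {..<mdim M}) R" unfolding R_def by (rule finely_coloured_cube[OF r(1)])
      show "continuous_on R (inv_into U \<phi>)"
        by (rule continuous_on_subset[OF chart_inv_continuous[OF c(1)]]) (use R in blast)
      show "inj_on (inv_into U \<phi>) R"
        by (rule inj_on_subset[OF inj_on_inv_into[of "\<phi> ` U"]]) (use R in auto)
    qed
    ultimately show ?thesis by blast
  qed
  then obtain N Q where NQ: "\<And>p. p \<in> W \<Longrightarrow> open (N p) \<and> p \<in> N p \<and> N p \<subseteq> Q p \<and> Q p \<subseteq> W \<and> finely_coloured (Pow {..<mdim M}) (Q p)"
    by metis
  obtain D where D: "D \<subseteq> K" "finite D" "K \<subseteq> (\<Union>p\<in>D. N p)"
    by (rule compactE_image[OF assms(1), of K N]) (use NQ assms(3) in blast)+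
  show ?thesis
  proof (rule that[of "\<Union>p\<in>D. Q p"])
    show "K \<subseteq> (\<Union>p\<in>D. Q p)" using D NQ assms(3) by blast
    show "(\<Union>p\<in>D. Q p) \<subseteq> W" using D NQ assms(3) by blast
    show "finely_coloured (Pow {..<mdim M}) (\<Union>p\<in>D. Q p)"
      by (rule finely_coloured_Union) (use D NQ assms(3) in auto)
  qed
qed

lemma coloured_chart_pieces:
  fixes K W :: "'m set"
  assumes "compact K" "open W" "K \<subseteq> W"
  shows "\<exists>F. (\<forall>c\<in>Pow {..<mdim M}. finite (F c) \<and> pairwise disjnt (F c) \<and>
      (\<forall>V\<in>F c. compact V \<and> V \<subseteq> W \<and> (\<exists>(U, \<phi>)\<in>charts M. V \<subseteq> U))) \<and> K \<subseteq> (\<Union>c\<in>Pow {..<mdim M}. \<Union>(F c))"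
proof -
  obtain K' where K': "K \<subseteq> K'" "K' \<subseteq> W" "finely_coloured (Pow {..<mdim M}) K'"
    by (rule finely_coloured_near_compact[OF assms])
  define \<O> where "\<O> = (\<lambda>(U, \<phi>). U) ` charts M"
  have O: "(\<forall>T\<in>\<O>. open T) \<and> K' \<subseteq> \<Union>\<O>"
  proof
    show "\<forall>T\<in>\<O>. open T"
    proof
      fix T assume "T \<in> \<O>"
      then obtain U \<phi> where "(U, \<phi>) \<in> charts M" "T = U" unfolding \<O>_def by auto
      then show "open T" using chart_open[of U \<phi>] by simp
    qed
    show "K' \<subseteq> \<Union>\<O>"
    proof
      fix p assume "p \<in> K'"
      obtain U \<phi> where "(U, \<phi>) \<in> charts M" "p \<in> U" by (rule chart_at)
      moreover have "U \<in> \<O>" unfolding \<O>_def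
        by (rule image_eqI[of _ _ "(U, \<phi>)"]) (simp_all add: \<open>(U, \<phi>) \<in> charts M\<close>)
      ultimately show "p \<in> \<Union>\<O>" by blast
    qed
  qed
  obtain F where F: "\<And>c. c \<in> Pow {..<mdim M} \<Longrightarrow> finite (F c)" "\<And>c. c \<in> Pow {..<mdim M} \<Longrightarrow> pairwise disjnt (F c)"
      "\<And>c V. c \<in> Pow {..<mdim M} \<Longrightarrow> V \<in> F c \<Longrightarrow> compact V \<and> (\<exists>T\<in>\<O>. V \<subseteq> T)"
      "(\<Union>c\<in>Pow {..<mdim M}. \<Union>(F c)) = K'"
    by (rule finely_colouredE[OF K'(3) O]) blast
  show ?thesis
  proof (intro exI[of _ F] conjI ballI)
    fix c assume c: "c \<in> Pow {..<mdim M}"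
    show "finite (F c)" "pairwise disjnt (F c)" using F(1,2)[OF c] by blast+
    fix V assume V: "V \<in> F c"
    show "compact V" using F(3)[OF c V] by blast
    show "V \<subseteq> W" using F(4) K'(2) c V by blast
    obtain T where T: "T \<in> \<O>" "V \<subseteq> T" using F(3)[OF c V] by blast
    then obtain U \<phi> where "(U, \<phi>) \<in> charts M" "V \<subseteq> U" unfolding \<O>_def by auto
    then show "\<exists>(U, \<phi>)\<in>charts M. V \<subseteq> U" by blast
  qed (use F(4) K'(1) in blast)
qed

text \<open>Two empty sets are put in front, so that every point lies in a shell
  \<open>L (s + 2) - interior (L (s + 1))\<close>.\<close>

lemma compact_exhaustion:
  obtains L :: "nat \<Rightarrow> 'm set" where "L 0 = {}" "L 1 = {}" "\<And>s. compact (L s)" "\<And>s. L s \<subseteq> interior (L (Suc s))"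
    "\<And>p. \<exists>s. p \<in> L s"
proof -
  have nbhd: "\<exists>N K. open N \<and> p \<in> N \<and> N \<subseteq> K \<and> compact K" for p :: 'm
  proof -
    obtain \<theta> N K where "\<theta> \<in> C" "open N" "p \<in> N" "compact K" "\<And>q. q \<in> N \<Longrightarrow> \<theta> q = 1" "\<And>q. q \<notin> K \<Longrightarrow> \<theta> q = 0"
      by (rule bump_at_point[OF open_UNIV, of p]) blast+
    then show ?thesis by (metis subsetI zero_neq_one)
  qed
  then obtain N Q where NQ: "\<And>p::'m. open (N p) \<and> p \<in> N p \<and> N p \<subseteq> Q p \<and> compact (Q p)" by metis
  have grow: "\<exists>K'. compact K' \<and> K \<subseteq> interior K'" if K: "compact K" for K :: "'m set"
  proof -
    obtain D where D: "D \<subseteq> K" "finite D" "K \<subseteq> (\<Union>p\<in>D. N p)"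
      by (rule compactE_image[OF K, of K N]) (use NQ in blast)+
    have "(\<Union>p\<in>D. N p) \<subseteq> (\<Union>p\<in>D. Q p)" "open (\<Union>p\<in>D. N p)" using NQ by blast+
    then have sub: "(\<Union>p\<in>D. N p) \<subseteq> interior (\<Union>p\<in>D. Q p)" by (rule interior_maximal)
    have comp: "compact (\<Union>p\<in>D. Q p)" by (rule compact_UN[OF D(2)]) (use NQ in simp)
    from comp subset_trans[OF D(3) sub] show ?thesis by (intro exI conjI)
  qed
  then have "\<forall>K::'m set. \<exists>K'. compact K \<longrightarrow> compact K' \<and> K \<subseteq> interior K'" by blast
  from choice[OF this] obtain G where G: "\<And>K::'m set. compact K \<Longrightarrow> compact (G K) \<and> K \<subseteq> interior (G K)" by blast
  have openN: "open S" if "S \<in> range N" for S using that NQ by auto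
  obtain \<N> where \<N>: "\<N> \<subseteq> range N" "countable \<N>" "\<Union>\<N> = \<Union>(range N)"
    by (rule Lindelof[of "range N", OF openN])
  have UN: "\<Union>\<N> = UNIV" unfolding \<N>(3) using NQ by blast
  then have ne: "\<N> \<noteq> {}" by blast
  have "\<exists>q. from_nat_into \<N> s = N q" for s
    using from_nat_into[OF ne, of s] \<N>(1) by blast
  then obtain q where q: "\<And>s. from_nat_into \<N> s = N (q s)" by metis
  define L where "L = rec_nat {} (\<lambda>s X. if s = 0 then {} else G (X \<union> Q (q (s - 1))))"
  have L0: "L 0 = {}" and L1: "L 1 = {}" and LS: "L (Suc (Suc s)) = G (L (Suc s) \<union> Q (q s))" for s
    by (simp_all add: L_def)
  have comp: "compact (L s)" for s
  proof (induction s rule: nat_less_induct)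
    case (1 s)
    consider "s = 0" | "s = 1" | t where "s = Suc (Suc t)" by (metis One_nat_def not0_implies_Suc)
    then show ?case
    proof cases
      case 3
      then show ?thesis using 1 G LS NQ by (metis compact_Un lessI)
    qed (use L0 L1 in simp_all)
  qed
  have grown: "L (Suc s) \<union> Q (q s) \<subseteq> interior (G (L (Suc s) \<union> Q (q s)))" for s
  proof -
    have "compact (L (Suc s) \<union> Q (q s))" using comp NQ by (intro compact_Un) simp_all
    then show ?thesis using G by blast
  qed
  show ?thesis
  proof (rule that[of L, OF L0 L1 comp])
    show "L s \<subseteq> interior (L (Suc s))" for s
    proof (cases s)
      case (Suc t)
      show ?thesis using grown[of t] Suc LS by simp
    qed (simp add: L0)
    show "\<exists>s. p \<in> L s" for p
    proof -
      have "p \<in> \<Union>\<N>" unfolding UN by simp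
      then obtain S where S: "S \<in> \<N>" "p \<in> S" by blast
      obtain s where s: "from_nat_into \<N> s = S" using from_nat_into_surj[OF \<N>(2) S(1)] by blast
      have "p \<in> N (q s)" using S(2) s q[of s] by simp
      then have "p \<in> Q (q s)" using NQ[of "q s"] by blast
      moreover have "L (Suc s) \<union> Q (q s) \<subseteq> L (Suc (Suc s))"
        unfolding LS by (rule subset_trans[OF grown interior_subset])
      ultimately show ?thesis by blast
    qed
  qed
qed

end

section \<open>A finite global frame\<close>

context manifold begin

text \<open>Since the sets \<open>N j\<close> are disjoint, at most one summand is present at each point.\<close>

lemma C_inf_disjoint_sum:
  fixes N :: "'j \<Rightarrow> 'm set"
  assumes "\<And>j. j \<in> J \<Longrightarrow> open (N j)"
    and disj: "\<And>i j. i \<in> J \<Longrightarrow> j \<in> J \<Longrightarrow> i \<noteq> j \<Longrightarrow> N i \<inter> N j = {}"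
    and lf: "\<And>p. \<exists>W. open W \<and> p \<in> W \<and> finite {j \<in> J. N j \<inter> W \<noteq> {}}"
    and K: "\<And>j. j \<in> J \<Longrightarrow> compact (K j) \<and> K j \<subseteq> N j"
    and g: "\<And>j. j \<in> J \<Longrightarrow> g j \<in> C" "\<And>j p. j \<in> J \<Longrightarrow> p \<in> N j \<Longrightarrow> p \<notin> K j \<Longrightarrow> g j p = 0"
  shows "(\<lambda>p. \<Sum>j | j \<in> J \<and> p \<in> N j. g j p) \<in> C" (is "?G \<in> C")
proof (rule C_inf_glue)
  fix p
  have single: "?G q = g j q" if "j \<in> J" "q \<in> N j" for j q
  proof -
    have "{i. i \<in> J \<and> q \<in> N i} = {j}" using disj that by blast
    then show ?thesis by simp
  qed
  show "\<exists>A h. open A \<and> p \<in> A \<and> h \<in> C \<and> (\<forall>q\<in>A. ?G q = h q)"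
  proof (cases "\<exists>j\<in>J. p \<in> N j")
    case True
    then obtain j where "j \<in> J" "p \<in> N j" by blast
    then show ?thesis using assms(1) g(1) single by (intro exI[of _ "N j"] exI[of _ "g j"]) simp
  next
    case False
    obtain W where W: "open W" "p \<in> W" "finite {j \<in> J. N j \<inter> W \<noteq> {}}" using lf by blast
    let ?A = "W - (\<Union>j\<in>{j \<in> J. N j \<inter> W \<noteq> {}}. K j)"
    have "closed (\<Union>j\<in>{j \<in> J. N j \<inter> W \<noteq> {}}. K j)"
    proof (rule closed_UN[OF W(3)], intro ballI)
      fix j assume "j \<in> {j \<in> J. N j \<inter> W \<noteq> {}}"
      then show "closed (K j)" using K[of j] compact_imp_closed[of "K j"] by simp
    qed
    then have "open ?A" using W(1) by (rule open_Diff[rotated])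
    moreover have "p \<in> ?A"
    proof -
      have "p \<notin> K j" if "j \<in> J" for j using K[OF that] False that by blast
      then show ?thesis using W(2) by simp
    qed
    moreover have "?G q = 0" if q: "q \<in> ?A" for q
    proof (cases "\<exists>j\<in>J. q \<in> N j")
      case True
      then obtain j where j: "j \<in> J" "q \<in> N j" by blast
      then have "N j \<inter> W \<noteq> {}" using q by blast
      then have "q \<notin> K j" using q j(1) by blast
      then show ?thesis using single[OF j] g(2)[OF j] by simp
    next
      case False
      then have "{j. j \<in> J \<and> q \<in> N j} = {}" by blast
      then show ?thesis by (simp only: sum.empty)
    qed
    ultimately have "open ?A \<and> p \<in> ?A \<and> (\<lambda>q. 0) \<in> C \<and> (\<forall>q\<in>?A. ?G q = (\<lambda>q. 0) q)"
      using C_inf_const[of 0] by blast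
    then show ?thesis by (intro exI)
  qed
qed

lemma tangent_scaled:
  assumes v: "v \<in> tangent M p"
  shows "(\<lambda>f. c * v f) \<in> tangent M p"
  using assms by (simp add: tangent_def algebra_simps)

lemma tangent_plus:
  assumes "v \<in> tangent M p" "w \<in> tangent M p"
  shows "v + w \<in> tangent M p"
  using assms by (simp add: tangent_def algebra_simps)

lemma tangent_0: "0 \<in> tangent M p"
  by (simp add: tangent_def)

lemma tangent_sum_vectors: "(\<And>a. a \<in> A \<Longrightarrow> v a \<in> tangent M p) \<Longrightarrow> (\<Sum>a\<in>A. v a) \<in> tangent M p"
  by (induction A rule: infinite_finite_induct) (simp_all add: tangent_0 tangent_plus)

text \<open>A locally finite disjoint union of coordinate domains behaves like one coordinate domain: with
  cut-off functions \<open>\<theta>\<close> near the \<open>V j\<close>, the products of \<open>\<theta>\<close> with the coordinate fields and the cut-off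
  coordinates resolve the identity of the tangent spaces up to the factor \<open>\<theta>\<close>.\<close>

lemma partial_frame:
  fixes N V :: "'j \<Rightarrow> 'm set"
  assumes c: "\<And>j. j \<in> J \<Longrightarrow> (U j, \<phi> j) \<in> charts M"
    and N: "\<And>j. j \<in> J \<Longrightarrow> open (N j) \<and> V j \<subseteq> N j \<and> N j \<subseteq> U j \<and> compact (V j)"
    and disj: "\<And>i j. i \<in> J \<Longrightarrow> j \<in> J \<Longrightarrow> i \<noteq> j \<Longrightarrow> N i \<inter> N j = {}"
    and lf: "\<And>p. \<exists>W. open W \<and> p \<in> W \<and> finite {j \<in> J. N j \<inter> W \<noteq> {}}"
  shows "\<exists>\<theta> y u. \<theta> \<in> C \<and> (\<forall>p. \<theta> p \<ge> 0) \<and> (\<forall>j\<in>J. \<forall>p\<in>V j. \<theta> p > 0) \<and>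
    (\<forall>i<mdim M. y i \<in> C \<and> u i \<in> vector_fields M) \<and>
    (\<forall>p. \<forall>v\<in>tangent M p. \<forall>f\<in>C. \<theta> p * v f = (\<Sum>i<mdim M. v (y i) * u i p f))"
proof -
  let ?n = "mdim M"
  have "\<exists>\<kappa> \<psi> N' K K'. \<kappa> \<in> C \<and> \<psi> \<in> C \<and> open N' \<and> N' \<subseteq> N j \<and> compact K \<and> K \<subseteq> N j \<and> compact K' \<and> K' \<subseteq> N' \<and>
      (\<forall>q\<in>N'. \<kappa> q = 1) \<and> (\<forall>q. q \<notin> K \<longrightarrow> \<kappa> q = 0) \<and> (\<forall>q. 0 \<le> \<psi> q) \<and> (\<forall>q\<in>V j. \<psi> q = 1) \<and> (\<forall>q. q \<notin> K' \<longrightarrow> \<psi> q = 0)"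
    if j: "j \<in> J" for j
  proof -
    have Vj: "open (N j)" "compact (V j)" "V j \<subseteq> N j" using N[OF j] by simp_all
    obtain \<kappa> N' K where 1: "\<kappa> \<in> C" "open N'" "V j \<subseteq> N'" "N' \<subseteq> K" "compact K" "K \<subseteq> N j"
      "\<And>q. 0 \<le> \<kappa> q" "\<And>q. q \<in> N' \<Longrightarrow> \<kappa> q = 1" "\<And>q. q \<notin> K \<Longrightarrow> \<kappa> q = 0"
      by (rule bump_on_compact[OF Vj]) (rule that)
    obtain \<psi> N'' K' where 2: "\<psi> \<in> C" "open N''" "V j \<subseteq> N''" "N'' \<subseteq> K'" "compact K'" "K' \<subseteq> N'"
      "\<And>q. 0 \<le> \<psi> q" "\<And>q. q \<in> N'' \<Longrightarrow> \<psi> q = 1" "\<And>q. q \<notin> K' \<Longrightarrow> \<psi> q = 0"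
      by (rule bump_on_compact[OF 1(2) Vj(2) 1(3)]) (rule that)
    have "N' \<subseteq> N j" using 1(4,6) by blast
    moreover have "\<forall>q\<in>V j. \<psi> q = 1" using 2(3,8) by blast
    ultimately show ?thesis
      by (intro exI[of _ \<kappa>] exI[of _ \<psi>] exI[of _ N'] exI[of _ K] exI[of _ K']) (use 1 2 in simp)
  qed
  then have "\<forall>j\<in>J. \<exists>t. case t of (\<kappa>, \<psi>, N', K, K') \<Rightarrow> \<kappa> \<in> C \<and> \<psi> \<in> C \<and> open N' \<and> N' \<subseteq> N j \<and> compact K \<and> K \<subseteq> N j \<and> compact K' \<and> K' \<subseteq> N' \<and>
      (\<forall>q\<in>N'. \<kappa> q = 1) \<and> (\<forall>q. q \<notin> K \<longrightarrow> \<kappa> q = 0) \<and> (\<forall>q. 0 \<le> \<psi> q) \<and> (\<forall>q\<in>V j. \<psi> q = 1) \<and> (\<forall>q. q \<notin> K' \<longrightarrow> \<psi> q = 0)"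
    by simp
  from bchoice[OF this] obtain t where t: "\<forall>j\<in>J. case t j of (\<kappa>, \<psi>, N', K, K') \<Rightarrow> \<kappa> \<in> C \<and> \<psi> \<in> C \<and> open N' \<and> N' \<subseteq> N j \<and> compact K \<and> K \<subseteq> N j \<and> compact K' \<and> K' \<subseteq> N' \<and>
      (\<forall>q\<in>N'. \<kappa> q = 1) \<and> (\<forall>q. q \<notin> K \<longrightarrow> \<kappa> q = 0) \<and> (\<forall>q. 0 \<le> \<psi> q) \<and> (\<forall>q\<in>V j. \<psi> q = 1) \<and> (\<forall>q. q \<notin> K' \<longrightarrow> \<psi> q = 0)" ..
  \<comment> \<open>\<open>\<kappa> j\<close> cuts off the coordinates and is \<open>1\<close> on \<open>N' j\<close>; \<open>\<psi> j\<close> cuts off the coordinate fields and vanishes outside \<open>N' j\<close>.\<close>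
  define \<kappa> where "\<kappa> = (\<lambda>j. fst (t j))"
  define \<psi> where "\<psi> = (\<lambda>j. fst (snd (t j)))"
  define N' where "N' = (\<lambda>j. fst (snd (snd (t j))))"
  define K where "K = (\<lambda>j. fst (snd (snd (snd (t j)))))"
  define K' where "K' = (\<lambda>j. snd (snd (snd (snd (t j)))))"
  have b: "\<kappa> j \<in> C" "\<psi> j \<in> C" "open (N' j)" "N' j \<subseteq> N j" "compact (K j)" "K j \<subseteq> N j" "compact (K' j)" "K' j \<subseteq> N' j"
    "\<forall>q\<in>N' j. \<kappa> j q = 1" "\<forall>q. q \<notin> K j \<longrightarrow> \<kappa> j q = 0" "\<forall>q. 0 \<le> \<psi> j q" "\<forall>q\<in>V j. \<psi> j q = 1" "\<forall>q. q \<notin> K' j \<longrightarrow> \<psi> j q = 0"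
    if "j \<in> J" for j
    using bspec[OF t that] unfolding \<kappa>_def \<psi>_def N'_def K_def K'_def by (simp_all add: case_prod_unfold)
  have oN: "open (N j)" and NU: "N j \<subseteq> U j" if "j \<in> J" for j using N[OF that] by simp_all
  define \<theta> where "\<theta> = (\<lambda>p. \<Sum>j | j \<in> J \<and> p \<in> N j. \<psi> j p)"
  define y where "y = (\<lambda>i p. \<Sum>j | j \<in> J \<and> p \<in> N j. (if p \<in> N j then \<kappa> j p * \<phi> j p i else 0))"
  define u where "u = (\<lambda>i p. \<Sum>j | j \<in> J \<and> p \<in> N j. (\<lambda>f. \<psi> j p * coordinate_vector (U j) (\<phi> j) i p f))"
  have at: "{i. i \<in> J \<and> p \<in> N i} = {j}" if "j \<in> J" "p \<in> N j" for j p using disj that by blast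
  have out: "{i. i \<in> J \<and> p \<in> N i} = {}" if "\<not> (\<exists>j\<in>J. p \<in> N j)" for p using that by blast
  have K'N: "K' j \<subseteq> N j" if "j \<in> J" for j using b(4,8)[OF that] by blast
  have \<theta>C: "\<theta> \<in> C"
    unfolding \<theta>_def
    by (rule C_inf_disjoint_sum[OF oN disj lf, where K = K']) (use b K'N in auto)
  have yC: "y i \<in> C" for i
    unfolding y_def
  proof (rule C_inf_disjoint_sum[OF oN disj lf, where K = K])
    show "compact (K j) \<and> K j \<subseteq> N j" if "j \<in> J" for j using b(5,6)[OF that] by simp
    show "(\<lambda>p. if p \<in> N j then \<kappa> j p * \<phi> j p i else 0) \<in> C" if j: "j \<in> J" for j
      using C_inf_cutoff[OF c[OF j] oN[OF j] NU[OF j]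
          smooth_on_coordinate[OF chart_open_image[OF c[OF j] oN[OF j] NU[OF j]]] b(1,5,6)[OF j], of i] b(10)[OF j] by simp
    show "(if p \<in> N j then \<kappa> j p * \<phi> j p i else 0) = 0" if "j \<in> J" "p \<notin> K j" for j p
      using b(10)[OF that(1)] that(2) by simp
  qed
  have u_at: "u i p f = \<psi> j p * coordinate_vector (U j) (\<phi> j) i p f" if "j \<in> J" "p \<in> N j" for i p f j
    unfolding u_def at[OF that] by simp
  have u_out: "u i p = 0" if "\<not> (\<exists>j\<in>J. p \<in> N j)" for i p
    unfolding u_def out[OF that] by simp
  have uV: "u i \<in> vector_fields M" if i: "i < ?n" for i
    unfolding vector_fields_def
  proof (intro CollectI conjI allI ballI)
    fix p
    show "u i p \<in> tangent M p"
      unfolding u_def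
    proof (rule tangent_sum_vectors)
      fix j assume "j \<in> {j. j \<in> J \<and> p \<in> N j}"
      then have j: "j \<in> J" "p \<in> N j" by simp_all
      have "p \<in> U j" using NU[OF j(1)] j(2) by blast
      then show "(\<lambda>f. \<psi> j p * coordinate_vector (U j) (\<phi> j) i p f) \<in> tangent M p"
        by (intro tangent_scaled coordinate_vector_tangent[OF c[OF j(1)] _ i])
    qed
  next
    fix f assume f: "f \<in> C"
    have eq: "(\<lambda>p. u i p f) = (\<lambda>p. \<Sum>j | j \<in> J \<and> p \<in> N j.
        (if p \<in> N j then \<psi> j p * partial i (f \<circ> inv_into (U j) (\<phi> j)) (\<phi> j p) else 0))"
    proof
      fix p
      show "u i p f = (\<Sum>j | j \<in> J \<and> p \<in> N j.
        (if p \<in> N j then \<psi> j p * partial i (f \<circ> inv_into (U j) (\<phi> j)) (\<phi> j p) else 0))"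
        unfolding u_def sum_fun_apply by (rule sum.cong) (use f in \<open>simp_all add: coordinate_vector_def\<close>)
    qed
    show "(\<lambda>p. u i p f) \<in> C"
      unfolding eq
    proof (rule C_inf_disjoint_sum[OF oN disj lf, where K = K'])
      show "compact (K' j) \<and> K' j \<subseteq> N j" if "j \<in> J" for j using b(7)[OF that] K'N[OF that] by simp
      show "(\<lambda>p. if p \<in> N j then \<psi> j p * partial i (f \<circ> inv_into (U j) (\<phi> j)) (\<phi> j p) else 0) \<in> C" if j: "j \<in> J" for j
        using C_inf_cutoff[OF c[OF j] oN[OF j] NU[OF j]
          smooth_on_partial[OF C_inf_smooth_on[OF f c[OF j] oN[OF j] NU[OF j]] i] b(2,7)[OF j] K'N[OF j]] b(13)[OF j] by simp
      show "(if p \<in> N j then \<psi> j p * partial i (f \<circ> inv_into (U j) (\<phi> j)) (\<phi> j p) else 0) = 0" if "j \<in> J" "p \<notin> K' j" for j p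
        using b(13)[OF that(1)] that(2) by simp
    qed
  qed
  have \<theta>_at: "\<theta> p = \<psi> j p" if "j \<in> J" "p \<in> N j" for p j
    unfolding \<theta>_def at[OF that] by simp
  have \<theta>_out: "\<theta> p = 0" if "\<not> (\<exists>j\<in>J. p \<in> N j)" for p
    unfolding \<theta>_def out[OF that] by simp
  have resolve: "\<theta> p * v f = (\<Sum>i<?n. v (y i) * u i p f)" if v: "v \<in> tangent M p" and f: "f \<in> C" for p v f
  proof (cases "\<exists>j\<in>J. p \<in> N j")
    case True
    then obtain j where j: "j \<in> J" "p \<in> N j" by blast
    show ?thesis
    proof (cases "p \<in> N' j")
      case True
      have N'U: "N' j \<subseteq> U j" using b(4)[OF j(1)] NU[OF j(1)] by blast
      have yq: "y i q = \<phi> j q i" if q: "q \<in> N' j" for i q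
      proof -
        have qN: "q \<in> N j" using b(4)[OF j(1)] q by blast
        show ?thesis unfolding y_def at[OF j(1) qN] using qN b(9)[OF j(1)] q by simp
      qed
      have "v f = (\<Sum>i<?n. v (y i) * partial i (f \<circ> inv_into (U j) (\<phi> j)) (\<phi> j p))"
        by (rule tangent_in_coordinates[OF c[OF j(1)] v f b(3)[OF j(1)] True N'U yC yq])
      then show ?thesis
        using f by (simp add: \<theta>_at[OF j] u_at[OF j] coordinate_vector_def sum_distrib_left mult_ac)
    next
      case False
      then have "\<psi> j p = 0" using b(8,13)[OF j(1)] by blast
      then show ?thesis by (simp add: \<theta>_at[OF j] u_at[OF j])
    qed
  next
    case False
    then show ?thesis by (simp add: \<theta>_out[OF False] u_out[OF False])
  qed
  have pos: "\<theta> p \<ge> 0" for p unfolding \<theta>_def by (rule sum_nonneg) (use b(11) in simp)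
  have V1: "\<theta> p > 0" if "j \<in> J" "p \<in> V j" for j p
  proof -
    have "p \<in> N j" using N[OF that(1)] that(2) by blast
    then show ?thesis using \<theta>_at[OF that(1)] b(12)[OF that(1)] that(2) by simp
  qed
  show ?thesis
    by (intro exI[of _ \<theta>] exI[of _ y] exI[of _ u]) (use \<theta>C pos V1 yC uV resolve in simp)
qed

text \<open>The tangent bundle is a direct summand of a trivial bundle, whose rank is in general
  larger than the dimension. Pieces of the shells \<open>L (s + 2) - int (L (s + 1))\<close> of an exhaustion meet only if the indices
  differ by less than \<open>3\<close>. So a pair of a colour and a residue of \<open>s\<close> modulo \<open>3\<close> determines a disjoint family.\<close>

theorem global_frame:
  obtains n :: nat and y u where "\<And>a. a < n \<Longrightarrow> y a \<in> C" "\<And>a. a < n \<Longrightarrow> u a \<in> vector_fields M"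
    "\<And>p v. v \<in> tangent M p \<Longrightarrow> v = (\<lambda>f. \<Sum>a<n. v (y a) * u a p f)"
proof -
  obtain L :: "nat \<Rightarrow> 'm set" where L: "L 0 = {}" "L 1 = {}" "\<And>s. compact (L s)" "\<And>s. L s \<subseteq> interior (L (Suc s))"
    "\<And>p. \<exists>s. p \<in> L s"
    by (rule compact_exhaustion) (rule that)
  have Lstep: "L s \<subseteq> L (Suc s)" for s using L(4)[of s] interior_subset by blast
  have Lmono: "L s \<subseteq> L t" if "s \<le> t" for s t using lift_Suc_mono_le[of L, OF Lstep that] .
  define Out where "Out = (\<lambda>s. interior (L (s + 3)) - L s)"
  define A where "A = (\<lambda>s. L (s + 2) - interior (L (s + 1)))"
  have Out: "open (Out s)" for s unfolding Out_def using L(3) compact_imp_closed by (intro open_Diff) auto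
  have A: "compact (A s)" "A s \<subseteq> Out s" for s
  proof -
    show "compact (A s)" unfolding A_def using L(3) by (intro compact_diff) auto
    have "L (s + 2) \<subseteq> interior (L (s + 3))" using L(4)[of "s + 2"] by (simp add: numeral_eq_Suc)
    moreover have "L s \<subseteq> interior (L (s + 1))" using L(4)[of s] by simp
    ultimately show "A s \<subseteq> Out s" unfolding A_def Out_def by blast
  qed
  have far: "Out s \<inter> Out t = {}" if "s + 3 \<le> t" for s t
    using Lmono[OF that] interior_subset[of "L (s + 3)"] unfolding Out_def by blast
  let ?I = "Pow {..<mdim M}"
  have "\<forall>s. \<exists>F. (\<forall>c\<in>?I. finite (F c) \<and> pairwise disjnt (F c) \<and>
      (\<forall>V\<in>F c. compact V \<and> V \<subseteq> Out s \<and> (\<exists>(U, \<phi>)\<in>charts M. V \<subseteq> U))) \<and> A s \<subseteq> (\<Union>c\<in>?I. \<Union>(F c))"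
    using coloured_chart_pieces[OF A(1) Out A(2)] by (rule allI)
  from choice[OF this] obtain F where F: "\<forall>s. (\<forall>c\<in>?I. finite (F s c) \<and> pairwise disjnt (F s c) \<and>
      (\<forall>V\<in>F s c. compact V \<and> V \<subseteq> Out s \<and> (\<exists>(U, \<phi>)\<in>charts M. V \<subseteq> U))) \<and> A s \<subseteq> (\<Union>c\<in>?I. \<Union>(F s c))" ..
  have Ffin: "finite (F s c)" and Fdis: "pairwise disjnt (F s c)" if "c \<in> ?I" for s c
    using F that by blast+
  have FV: "compact V" "V \<subseteq> Out s" "\<exists>U\<phi>. U\<phi> \<in> charts M \<and> V \<subseteq> fst U\<phi>" if "c \<in> ?I" "V \<in> F s c" for s c V
  proof -
    have *: "compact V \<and> V \<subseteq> Out s \<and> (\<exists>(U, \<phi>)\<in>charts M. V \<subseteq> U)" using F that by blast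
    then show "compact V" "V \<subseteq> Out s" by blast+
    from * obtain x where "x \<in> charts M" "case x of (U, \<phi>) \<Rightarrow> V \<subseteq> U" by blast
    then show "\<exists>U\<phi>. U\<phi> \<in> charts M \<and> V \<subseteq> fst U\<phi>" by (intro exI[of _ x]) (simp add: case_prod_unfold)
  qed
  have Fcov: "A s \<subseteq> (\<Union>c\<in>?I. \<Union>(F s c))" for s using F[THEN spec, of s] by (rule conjunct2)
  define frame where "frame = (\<lambda>\<theta> y u. \<theta> \<in> C \<and> (\<forall>p. \<theta> p \<ge> (0::real)) \<and>
    (\<forall>i<mdim M. y i \<in> C \<and> u i \<in> vector_fields M) \<and>
    (\<forall>p. \<forall>v\<in>tangent M p. \<forall>f\<in>C. \<theta> p * v f = (\<Sum>i<mdim M. v (y i) * u i p f)))"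
  have cls: "\<exists>t. frame (fst t) (fst (snd t)) (snd (snd t)) \<and> (\<forall>s V. s mod 3 = r \<and> V \<in> F s c \<longrightarrow> (\<forall>p\<in>V. fst t p > 0))"
    if cI: "c \<in> ?I" for c and r :: nat
  proof -
    have "\<forall>s. \<exists>N. (\<forall>V\<in>F s c. open (N V) \<and> V \<subseteq> N V) \<and> (\<forall>V\<in>F s c. \<forall>W\<in>F s c. V \<noteq> W \<longrightarrow> N V \<inter> N W = {})"
    proof
      fix s
      obtain N where N: "\<And>V. V \<in> F s c \<Longrightarrow> open (N V) \<and> V \<subseteq> N V"
        "\<And>V W. V \<in> F s c \<Longrightarrow> W \<in> F s c \<Longrightarrow> V \<noteq> W \<Longrightarrow> N V \<inter> N W = {}"
        by (rule separate_compact_family[of "F s c", OF Ffin[OF cI] FV(1)[OF cI, where s = s] Fdis[OF cI]])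
          (assumption, rule that)
      show "\<exists>N. (\<forall>V\<in>F s c. open (N V) \<and> V \<subseteq> N V) \<and> (\<forall>V\<in>F s c. \<forall>W\<in>F s c. V \<noteq> W \<longrightarrow> N V \<inter> N W = {})"
        by (intro exI[of _ N] conjI ballI impI) (use N in blast)+
    qed
    from choice[OF this] obtain N0 where N0: "\<forall>s. (\<forall>V\<in>F s c. open (N0 s V) \<and> V \<subseteq> N0 s V) \<and>
        (\<forall>V\<in>F s c. \<forall>W\<in>F s c. V \<noteq> W \<longrightarrow> N0 s V \<inter> N0 s W = {})" ..
    define J where "J = {(s, V). s mod 3 = r \<and> V \<in> F s c}"
    have "\<forall>j\<in>J. \<exists>U\<phi>. U\<phi> \<in> charts M \<and> snd j \<subseteq> fst U\<phi>"
    proof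
      fix j assume "j \<in> J"
      then have "snd j \<in> F (fst j) c" by (auto simp: J_def)
      from FV(3)[OF cI this] show "\<exists>U\<phi>. U\<phi> \<in> charts M \<and> snd j \<subseteq> fst U\<phi>" .
    qed
    from bchoice[OF this] obtain ch where ch: "\<forall>j\<in>J. ch j \<in> charts M \<and> snd j \<subseteq> fst (ch j)" ..
    define N where "N = (\<lambda>j. N0 (fst j) (snd j) \<inter> Out (fst j) \<inter> fst (ch j))"
    have J: "fst j mod 3 = r" "snd j \<in> F (fst j) c" if "j \<in> J" for j using that by (auto simp: J_def)
    have chart: "(fst (ch j), snd (ch j)) \<in> charts M" if "j \<in> J" for j using ch that by simp
    have NOut: "N j \<subseteq> Out (fst j)" for j unfolding N_def by blast
    have "\<exists>\<theta> y u. \<theta> \<in> C \<and> (\<forall>p. \<theta> p \<ge> 0) \<and> (\<forall>j\<in>J. \<forall>p\<in>snd j. \<theta> p > 0) \<and>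
      (\<forall>i<mdim M. y i \<in> C \<and> u i \<in> vector_fields M) \<and>
      (\<forall>p. \<forall>v\<in>tangent M p. \<forall>f\<in>C. \<theta> p * v f = (\<Sum>i<mdim M. v (y i) * u i p f))"
    proof (rule partial_frame[where J = J and N = N and V = snd and U = "\<lambda>j. fst (ch j)" and \<phi> = "\<lambda>j. snd (ch j)", OF chart])
      show "open (N j) \<and> snd j \<subseteq> N j \<and> N j \<subseteq> fst (ch j) \<and> compact (snd j)" if j: "j \<in> J" for j
      proof (intro conjI)
        have N0j: "open (N0 (fst j) (snd j))" "snd j \<subseteq> N0 (fst j) (snd j)" using N0 J[OF j] by blast+
        show "open (N j)" unfolding N_def by (intro open_Int N0j Out chart_open[OF chart[OF j]])
        have "snd j \<subseteq> fst (ch j)" using ch j by blast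
        then show "snd j \<subseteq> N j" unfolding N_def using N0j(2) FV(2)[OF cI J(2)[OF j]] by blast
        show "N j \<subseteq> fst (ch j)" unfolding N_def by blast
        show "compact (snd j)" using FV(1)[OF cI J(2)[OF j]] .
      qed
      show "N i \<inter> N j = {}" if i: "i \<in> J" and j: "j \<in> J" and ne: "i \<noteq> j" for i j
      proof (cases "fst i = fst j")
        case True
        then have "snd i \<noteq> snd j" using ne by (simp add: prod_eq_iff)
        then have "N0 (fst i) (snd i) \<inter> N0 (fst i) (snd j) = {}"
          using N0 J(2)[OF i] J(2)[OF j] True by simp
        then show ?thesis unfolding N_def using True by auto
      next
        case False
        have "fst i mod 3 = fst j mod 3" using J(1)[OF i] J(1)[OF j] by simp
        then have "fst i + 3 \<le> fst j \<or> fst j + 3 \<le> fst i" using False by presburger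
        then have "Out (fst i) \<inter> Out (fst j) = {}" using far by blast
        then show ?thesis using NOut by blast
      qed
      show "\<exists>W. open W \<and> p \<in> W \<and> finite {j \<in> J. N j \<inter> W \<noteq> {}}" for p
      proof -
        obtain t where "p \<in> L t" using L(5) by blast
        then have p: "p \<in> interior (L (Suc t))" using L(4) by blast
        have "{j \<in> J. N j \<inter> interior (L (Suc t)) \<noteq> {}} \<subseteq> Sigma {..t} (\<lambda>s. F s c)"
        proof
          fix j assume "j \<in> {j \<in> J. N j \<inter> interior (L (Suc t)) \<noteq> {}}"
          then have j: "j \<in> J" "N j \<inter> interior (L (Suc t)) \<noteq> {}" by simp_all
          have "fst j \<le> t"
          proof (rule ccontr)
            assume "\<not> fst j \<le> t"
            then have "L (Suc t) \<subseteq> L (fst j)" by (intro Lmono) simp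
            then show False using j(2) NOut[of j] interior_subset[of "L (Suc t)"] unfolding Out_def by blast
          qed
          then show "j \<in> Sigma {..t} (\<lambda>s. F s c)" using J(2)[OF j(1)] by (simp add: mem_Sigma_iff[of "fst j" "snd j", simplified])
        qed
        moreover have "finite (Sigma {..t} (\<lambda>s. F s c))" using Ffin[OF cI] by (intro finite_SigmaI) auto
        ultimately show ?thesis using p by (intro exI[of _ "interior (L (Suc t))"]) (simp add: finite_subset)
      qed
    qed
    then obtain \<theta> y u where fr: "\<theta> \<in> C \<and> (\<forall>p. \<theta> p \<ge> 0) \<and> (\<forall>j\<in>J. \<forall>p\<in>snd j. \<theta> p > 0) \<and>
      (\<forall>i<mdim M. y i \<in> C \<and> u i \<in> vector_fields M) \<and>
      (\<forall>p. \<forall>v\<in>tangent M p. \<forall>f\<in>C. \<theta> p * v f = (\<Sum>i<mdim M. v (y i) * u i p f))" by (elim exE)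
    have "\<theta> p > 0" if "s mod 3 = r" "V \<in> F s c" "p \<in> V" for s V p
    proof -
      have "(s, V) \<in> J" using that by (simp add: J_def)
      then show ?thesis using fr that(3) by fastforce
    qed
    then have "\<forall>s V. s mod 3 = r \<and> V \<in> F s c \<longrightarrow> (\<forall>p\<in>V. \<theta> p > 0)" by blast
    moreover have "frame \<theta> y u" unfolding frame_def using fr by blast
    ultimately show ?thesis by (intro exI[of _ "(\<theta>, y, u)"]) (simp only: fst_conv snd_conv simp_thms)
  qed
  define Idx where "Idx = ?I \<times> {..<3::nat}"
  have "\<forall>k\<in>Idx. \<exists>t. frame (fst t) (fst (snd t)) (snd (snd t)) \<and>
      (\<forall>s V. s mod 3 = snd k \<and> V \<in> F s (fst k) \<longrightarrow> (\<forall>p\<in>V. fst t p > 0))"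
  proof
    fix k assume "k \<in> Idx"
    then have "fst k \<in> ?I" by (auto simp: Idx_def)
    from cls[OF this, of "snd k"] show "\<exists>t. frame (fst t) (fst (snd t)) (snd (snd t)) \<and>
      (\<forall>s V. s mod 3 = snd k \<and> V \<in> F s (fst k) \<longrightarrow> (\<forall>p\<in>V. fst t p > 0))" .
  qed
  from bchoice[OF this] obtain t where t: "\<forall>k\<in>Idx. frame (fst (t k)) (fst (snd (t k))) (snd (snd (t k))) \<and>
      (\<forall>s V. s mod 3 = snd k \<and> V \<in> F s (fst k) \<longrightarrow> (\<forall>p\<in>V. fst (t k) p > 0))" ..
  define \<theta> where "\<theta> = (\<lambda>k. fst (t k))"
  define y where "y = (\<lambda>k. fst (snd (t k)))"
  define u where "u = (\<lambda>k. snd (snd (t k)))"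
  have fr: "frame (\<theta> k) (y k) (u k)" if "k \<in> Idx" for k using t that by (simp add: \<theta>_def y_def u_def)
  have \<theta>: "\<theta> k \<in> C" "\<theta> k p \<ge> 0" if "k \<in> Idx" for k p using fr[OF that] by (simp_all add: frame_def)
  have yu: "y k i \<in> C" "u k i \<in> vector_fields M" if "k \<in> Idx" "i < mdim M" for k i
    using fr[OF that(1)] that(2) by (simp_all add: frame_def)
  have res: "\<theta> k p * v f = (\<Sum>i<mdim M. v (y k i) * u k i p f)" if "k \<in> Idx" "v \<in> tangent M p" "f \<in> C" for k p v f
    using fr[OF that(1)] that(2,3) by (simp add: frame_def)
  have finI: "finite Idx" by (simp add: Idx_def)
  \<comment> \<open>The functions \<open>\<theta> k / S\<close> form a partition of unity; dividing the fields by \<open>S\<close> yields the frame.\<close>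
  define S where "S = (\<lambda>p. \<Sum>k\<in>Idx. \<theta> k p)"
  have SC: "S \<in> C" unfolding S_def by (rule C_inf_sum_lambda) (rule \<theta>)
  have Spos: "S p > 0" for p
  proof -
    obtain s where s: "p \<in> L s" "\<And>s'. s' < s \<Longrightarrow> p \<notin> L s'"
      using L(5)[of p] exists_least_iff[of "\<lambda>s. p \<in> L s"] by blast
    \<comment> \<open>For the least \<open>s\<close> with \<open>p \<in> L s\<close>, the point lies in the shell of index \<open>s - 2\<close>.\<close>
    have "s \<noteq> 0" using s(1) L(1) by (metis empty_iff)
    moreover have "s \<noteq> 1" using s(1) L(2) by (metis empty_iff)
    ultimately have "s = (s - 2) + 2" by simp
    then obtain q where q: "s = q + 2" by blast
    have "p \<notin> interior (L (q + 1))" using s(2)[of "q + 1"] q interior_subset by auto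
    then have "p \<in> A q" using s(1) q by (simp add: A_def)
    then obtain c V where cV: "c \<in> ?I" "V \<in> F q c" "p \<in> V" using Fcov by blast
    have kI: "(c, q mod 3) \<in> Idx" using cV(1) by (simp add: Idx_def)
    have "fst (t (c, q mod 3)) p > 0"
      using bspec[OF t kI] cV(2,3) by simp
    then have "\<theta> (c, q mod 3) p > 0" by (simp add: \<theta>_def)
    then show ?thesis unfolding S_def using kI \<theta>(2) by (intro sum_pos2[OF finI]) auto
  qed
  define K where "K = Idx \<times> {..<mdim M}"
  have finK: "finite K" by (simp add: K_def finI)
  obtain h where h: "bij_betw h {..<card K} K" using ex_bij_betw_nat_finite[OF finK] by (auto simp: atLeast0LessThan)
  have hK: "fst (h a) \<in> Idx" "snd (h a) < mdim M" if "a < card K" for a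
    using bij_betwE[OF h] that by (force simp: K_def)+
  define Y where "Y = (\<lambda>a. y (fst (h a)) (snd (h a)))"
  define X where "X = (\<lambda>a p f. inverse (S p) * u (fst (h a)) (snd (h a)) p f)"
  show ?thesis
  proof (rule that[of "card K" Y X])
    show "Y a \<in> C" if "a < card K" for a unfolding Y_def by (rule yu(1)[OF hK[OF that]])
    show "X a \<in> vector_fields M" if "a < card K" for a
    proof -
      have "u (fst (h a)) (snd (h a)) \<in> vector_fields M" by (rule yu(2)[OF hK[OF that]])
      moreover have "(\<lambda>p. inverse (S p)) \<in> C" using C_inf_inverse[OF SC] Spos by (simp add: less_imp_neq[symmetric])
      ultimately show ?thesis
        unfolding vector_fields_def X_def using tangent_scaled C_inf_mult_lambda by blast
    qed
    fix p v assume v: "v \<in> tangent M p"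
    show "v = (\<lambda>f. \<Sum>a<card K. v (Y a) * X a p f)"
    proof
      fix f
      show "v f = (\<Sum>a<card K. v (Y a) * X a p f)"
      proof (cases "f \<in> C")
        case True
        have "S p * v f = (\<Sum>k\<in>Idx. \<Sum>i<mdim M. v (y k i) * u k i p f)"
          unfolding S_def sum_distrib_right by (rule sum.cong) (use res[OF _ v True] in simp_all)
        also have "\<dots> = (\<Sum>x\<in>K. v (y (fst x) (snd x)) * u (fst x) (snd x) p f)"
          unfolding K_def by (simp add: sum.cartesian_product case_prod_unfold)
        also have "\<dots> = (\<Sum>a<card K. v (Y a) * u (fst (h a)) (snd (h a)) p f)"
          unfolding Y_def using sum.reindex_bij_betw[OF h, of "\<lambda>x. v (y (fst x) (snd x)) * u (fst x) (snd x) p f"] by simp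
        finally have "inverse (S p) * (S p * v f) = (\<Sum>a<card K. v (Y a) * X a p f)"
          unfolding X_def by (simp add: sum_distrib_left mult_ac)
        moreover have "inverse (S p) * (S p * v f) = v f" using Spos[of p] by simp
        ultimately show ?thesis by (simp only:)
      next
        case False
        have "X a p f = 0" if "a < card K" for a
          using yu(2)[OF hK[OF that]] tangent_outside[OF _ False, of _ p] by (simp add: X_def vector_fields_def)
        then show ?thesis using tangent_outside[OF v False] by simp
      qed
    qed
  qed
qed

end

section \<open>Vector fields, one-forms and bivector fields over a frame\<close>

definition app :: "'m vfield \<Rightarrow> ('m \<Rightarrow> real) \<Rightarrow> 'm \<Rightarrow> real" where
  "app X f = (\<lambda>p. X p f)"

definition fscale :: "('m \<Rightarrow> real) \<Rightarrow> 'm vfield \<Rightarrow> 'm vfield" where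
  "fscale g X = (\<lambda>p f. g p * X p f)"

lemma app_fscale [simp]: "app (fscale g X) f = g * app X f"
  and app_plus [simp]: "app (X + Y) f = app X f + app Y f"
  and app_minus [simp]: "app (X - Y) f = app X f - app Y f"
  and app_neg [simp]: "app (- X) f = - app X f"
  and app_zero [simp]: "app 0 f = 0"
  and app_bracket: "app (lie_bracket X Y) f = app X (app Y f) - app Y (app X f)"
  by (auto simp: app_def fscale_def lie_bracket_def fun_eq_iff)

lemma app_sum_fields [simp]: "app (\<Sum>a\<in>A. X a) f = (\<Sum>a\<in>A. app (X a) f)"
  by (auto simp: app_def sum_fun_apply fun_eq_iff)

context manifold begin

lemma vector_field_tangent: "X \<in> vector_fields M \<Longrightarrow> X p \<in> tangent M p"
  by (simp add: vector_fields_def)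

lemma app_C [simp]: "X \<in> vector_fields M \<Longrightarrow> f \<in> C \<Longrightarrow> app X f \<in> C"
  by (simp add: vector_fields_def app_def)

lemma vector_fieldI: "(\<And>p. X p \<in> tangent M p) \<Longrightarrow> (\<And>f. f \<in> C \<Longrightarrow> app X f \<in> C) \<Longrightarrow> X \<in> vector_fields M"
  by (simp add: vector_fields_def app_def)

lemma app_add: "X \<in> vector_fields M \<Longrightarrow> f \<in> C \<Longrightarrow> g \<in> C \<Longrightarrow> app X (f + g) = app X f + app X g"
  and app_diff: "X \<in> vector_fields M \<Longrightarrow> f \<in> C \<Longrightarrow> g \<in> C \<Longrightarrow> app X (f - g) = app X f - app X g"
  and app_uminus: "X \<in> vector_fields M \<Longrightarrow> f \<in> C \<Longrightarrow> app X (- f) = - app X f"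
  and app_mult: "X \<in> vector_fields M \<Longrightarrow> f \<in> C \<Longrightarrow> g \<in> C \<Longrightarrow> app X (f * g) = app X f * g + f * app X g"
  and app_0: "X \<in> vector_fields M \<Longrightarrow> app X 0 = 0"
  by (auto simp: app_def fun_eq_iff tangent_add[OF vector_field_tangent] tangent_diff[OF vector_field_tangent]
      tangent_uminus[OF vector_field_tangent] tangent_mult[OF vector_field_tangent] tangent_zero_fun[OF vector_field_tangent])

lemma app_sum: "X \<in> vector_fields M \<Longrightarrow> (\<And>a. a \<in> A \<Longrightarrow> f a \<in> C) \<Longrightarrow> app X (\<Sum>a\<in>A. f a) = (\<Sum>a\<in>A. app X (f a))"
  by (auto simp: app_def fun_eq_iff tangent_sum[OF vector_field_tangent] sum_fun_apply)

lemma app_sum_mult: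
  assumes "X \<in> vector_fields M" "\<And>a. a \<in> A \<Longrightarrow> f a \<in> C" "\<And>a. a \<in> A \<Longrightarrow> g a \<in> C"
  shows "app X (\<Sum>a\<in>A. f a * g a) = (\<Sum>a\<in>A. app X (f a) * g a + f a * app X (g a))"
proof -
  have "app X (\<Sum>a\<in>A. f a * g a) = (\<Sum>a\<in>A. app X (f a * g a))"
    by (rule app_sum[OF assms(1)]) (rule C_inf_mult[OF assms(2,3)])
  also have "\<dots> = (\<Sum>a\<in>A. app X (f a) * g a + f a * app X (g a))"
    by (rule sum.cong[OF refl], rule app_mult[OF assms(1) assms(2,3)])
  finally show ?thesis .
qed

lemma vector_field_eqI:
  assumes "X \<in> vector_fields M" "Y \<in> vector_fields M" "\<And>f. f \<in> C \<Longrightarrow> app X f = app Y f"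
  shows "X = Y"
proof
  fix p
  show "X p = Y p"
    by (rule tangent_eqI[of _ p]) (use assms vector_field_tangent in \<open>auto simp: app_def fun_eq_iff\<close>)
qed

lemma vector_field_fscale: "g \<in> C \<Longrightarrow> X \<in> vector_fields M \<Longrightarrow> fscale g X \<in> vector_fields M"
  by (rule vector_fieldI) (simp_all add: C_inf_mult, simp add: fscale_def tangent_scaled vector_field_tangent)

lemma vector_field_add: "X \<in> vector_fields M \<Longrightarrow> Y \<in> vector_fields M \<Longrightarrow> X + Y \<in> vector_fields M"
  by (rule vector_fieldI) (simp_all add: C_inf_add tangent_plus vector_field_tangent)

lemma vector_field_0: "0 \<in> vector_fields M"
  by (rule vector_fieldI) (simp_all add: tangent_0)

lemma tangent_neg: "v \<in> tangent M p \<Longrightarrow> - v \<in> tangent M p"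
  using tangent_scaled[of v p "-1"] by (simp add: fun_Compl_def)

lemma vector_field_uminus: "X \<in> vector_fields M \<Longrightarrow> - X \<in> vector_fields M"
  by (rule vector_fieldI) (simp_all add: C_inf_uminus tangent_neg vector_field_tangent)

lemma tangent_minus: "v \<in> tangent M p \<Longrightarrow> w \<in> tangent M p \<Longrightarrow> v - w \<in> tangent M p"
  using tangent_plus[of v p "- w"] tangent_neg[of w p] by simp

lemma vector_field_diff: "X \<in> vector_fields M \<Longrightarrow> Y \<in> vector_fields M \<Longrightarrow> X - Y \<in> vector_fields M"
  by (rule vector_fieldI) (simp_all add: C_inf_diff tangent_minus vector_field_tangent)

lemma vector_field_sum: "(\<And>a. a \<in> A \<Longrightarrow> X a \<in> vector_fields M) \<Longrightarrow> (\<Sum>a\<in>A. X a) \<in> vector_fields M"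
  by (induction A rule: infinite_finite_induct) (simp_all add: vector_field_0 vector_field_add)

lemma vector_field_bracket:
  assumes X: "X \<in> vector_fields M" and Y: "Y \<in> vector_fields M"
  shows "lie_bracket X Y \<in> vector_fields M"
proof (rule vector_fieldI)
  show "app (lie_bracket X Y) f \<in> C" if "f \<in> C" for f
    using X Y that by (simp add: app_bracket C_inf_diff)
  fix p
  note X' = tangent_add[OF vector_field_tangent[OF X]] tangent_mult[OF vector_field_tangent[OF X]]
    tangent_scale[OF vector_field_tangent[OF X]] tangent_zero_fun[OF vector_field_tangent[OF X]]
  note Y' = tangent_add[OF vector_field_tangent[OF Y]] tangent_mult[OF vector_field_tangent[OF Y]]
    tangent_scale[OF vector_field_tangent[OF Y]] tangent_zero_fun[OF vector_field_tangent[OF Y]]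
  have eq: "lie_bracket X Y p f = X p (app Y f) - Y p (app X f)" for f
    by (simp add: lie_bracket_def app_def)
  have sc: "app X (\<lambda>x. c * f x) = (\<lambda>x. c * app X f x)" "app Y (\<lambda>x. c * f x) = (\<lambda>x. c * app Y f x)" if "f \<in> C" for c f
    using that by (simp_all add: app_def X' Y')
  have out: "app X f = 0" "app Y f = 0" if "f \<notin> C" for f
    using tangent_outside[OF vector_field_tangent[OF X] that] tangent_outside[OF vector_field_tangent[OF Y] that]
    by (simp_all add: app_def fun_eq_iff)
  show "lie_bracket X Y p \<in> tangent M p"
    unfolding tangent_def
  proof (intro CollectI conjI allI impI ballI)
    show "lie_bracket X Y p f = 0" if "f \<notin> C" for f
      unfolding eq using out[OF that] by (simp add: X' Y')
    show "lie_bracket X Y p (f + g) = lie_bracket X Y p f + lie_bracket X Y p g" if "f \<in> C" "g \<in> C" for f g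
      unfolding eq using that X Y by (simp add: app_add X' Y')
    show "lie_bracket X Y p (\<lambda>x. c * f x) = c * lie_bracket X Y p f" if "f \<in> C" for c f
      unfolding eq using that X Y by (simp add: sc X' Y' algebra_simps)
    show "lie_bracket X Y p (f * g) = lie_bracket X Y p f * g p + f p * lie_bracket X Y p g" if "f \<in> C" "g \<in> C" for f g
    proof -
      have Xp: "X p h = app X h p" "Y p h = app Y h p" for h by (simp_all add: app_def)
      show ?thesis
        unfolding eq using that X Y
        by (simp add: app_mult X' Y' C_inf_mult, simp add: Xp algebra_simps)
    qed
  qed
qed

lemma cotangent_add: "a \<in> cotangent M p \<Longrightarrow> v \<in> tangent M p \<Longrightarrow> w \<in> tangent M p \<Longrightarrow> a (v + w) = a v + a w"
  and cotangent_scale: "a \<in> cotangent M p \<Longrightarrow> v \<in> tangent M p \<Longrightarrow> a (\<lambda>f. c * v f) = c * a v"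
  and cotangent_outside: "a \<in> cotangent M p \<Longrightarrow> v \<notin> tangent M p \<Longrightarrow> a v = 0"
  by (auto simp: cotangent_def)

lemma cotangent_0: "a \<in> cotangent M p \<Longrightarrow> a 0 = 0"
  using cotangent_scale[of a p 0 0] tangent_0 by (simp add: zero_fun_def)

lemma cotangent_sum:
  assumes "a \<in> cotangent M p" "\<And>i. i \<in> I \<Longrightarrow> v i \<in> tangent M p"
  shows "a (\<Sum>i\<in>I. (\<lambda>f. c i * v i f)) = (\<Sum>i\<in>I. c i * a (v i))"
  using assms(2)
proof (induction I rule: infinite_finite_induct)
  case (insert i I)
  have "(\<Sum>i\<in>I. (\<lambda>f. c i * v i f)) \<in> tangent M p"
    by (intro tangent_sum_vectors tangent_scaled) (use insert.prems in simp)
  then have "a ((\<lambda>f. c i * v i f) + (\<Sum>i\<in>I. (\<lambda>f. c i * v i f))) = a (\<lambda>f. c i * v i f) + a (\<Sum>i\<in>I. (\<lambda>f. c i * v i f))"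
    by (intro cotangent_add[OF assms(1)] tangent_scaled insert.prems insertI1)
  moreover have "a (\<lambda>f. c i * v i f) = c i * a (v i)"
    by (intro cotangent_scale[OF assms(1)] insert.prems insertI1)
  moreover have "a (\<Sum>i\<in>I. (\<lambda>f. c i * v i f)) = (\<Sum>i\<in>I. c i * a (v i))"
    by (rule insert.IH) (rule insert.prems, rule insertI2)
  ultimately show ?case by (simp only: sum.insert[OF insert.hyps])
qed (simp_all add: cotangent_0[OF assms(1)])

lemma differential_apply [simp]: "v \<in> tangent M p \<Longrightarrow> differential M f p v = v f"
  by (simp add: differential_def)

lemma differential_cotangent: "differential M f p \<in> cotangent M p"
  by (auto simp: cotangent_def differential_def tangent_plus tangent_scaled)

lemma differential_one_form: "f \<in> C \<Longrightarrow> differential M f \<in> one_forms M"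
  by (simp add: one_forms_def differential_cotangent vector_field_tangent) (simp add: vector_fields_def)

lemma cotangent_eqI:
  "a \<in> cotangent M p \<Longrightarrow> b \<in> cotangent M p \<Longrightarrow> (\<And>v. v \<in> tangent M p \<Longrightarrow> a v = b v) \<Longrightarrow> a = b"
  using cotangent_outside by (metis ext)

lemma tangent_eq_by_cotangent:
  assumes "v \<in> tangent M p" "w \<in> tangent M p" "\<And>b. b \<in> cotangent M p \<Longrightarrow> b v = b w"
  shows "v = w"
proof (rule tangent_eqI[OF assms(1,2)])
  show "v f = w f" for f using assms(3)[OF differential_cotangent[of f p]] assms(1,2) by simp
qed

text \<open>Bivectors at a point: \<open>sharp_at M p \<Lambda> a\<close> is the contraction with \<open>a\<close>, read off from any
  presentation of \<open>\<Lambda>\<close> as a sum of decomposable bivectors.\<close>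

lemma wedge2_sharp:
  assumes L: "\<Lambda> \<in> wedge2 M p W" and W: "W \<subseteq> tangent M p"
    and W0: "0 \<in> W" and Wp: "\<And>v w. v \<in> W \<Longrightarrow> w \<in> W \<Longrightarrow> v + w \<in> W" and Ws: "\<And>c v. v \<in> W \<Longrightarrow> (\<lambda>f. c * v f) \<in> W"
  shows "sharp_at M p \<Lambda> a \<in> W"
    and "b \<in> cotangent M p \<Longrightarrow> b (sharp_at M p \<Lambda> a) = \<Lambda> a b"
    and "\<Lambda> a b = - \<Lambda> b a"
proof -
  obtain n :: nat and v w where vw: "\<forall>i<n. v i \<in> W \<and> w i \<in> W"
    "\<Lambda> = (\<lambda>a b. if a \<in> cotangent M p \<and> b \<in> cotangent M p then (\<Sum>i<n. a (v i) * b (w i) - a (w i) * b (v i)) else 0)"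
    using L unfolding wedge2_def by blast
  have Wsum: "(\<Sum>i\<in>I. t i) \<in> W" if "\<And>i. i \<in> I \<Longrightarrow> t i \<in> W" for I :: "nat set" and t
    using that by (induction I rule: infinite_finite_induct) (simp_all add: W0 Wp)
  define s where "s = (if a \<in> cotangent M p then (\<Sum>i<n. (\<lambda>f. a (v i) * w i f)) + (\<Sum>i<n. (\<lambda>f. (- a (w i)) * v i f)) else 0)"
  have part: "(\<Sum>i<n. (\<lambda>f. a (v i) * w i f)) \<in> W" "(\<Sum>i<n. (\<lambda>f. (- a (w i)) * v i f)) \<in> W"
    by (rule Wsum, rule Ws, use vw(1) in simp)+
  have sW: "s \<in> W" unfolding s_def using part W0 Wp by simp
  have vT: "v i \<in> tangent M p" "w i \<in> tangent M p" if "i < n" for i using vw(1) that W by auto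
  have eval: "b s = \<Lambda> a b" if b: "b \<in> cotangent M p" for b
  proof (cases "a \<in> cotangent M p")
    case True
    have "b s = (\<Sum>i<n. a (v i) * b (w i)) + (\<Sum>i<n. (- a (w i)) * b (v i))"
      using True cotangent_add[OF b subsetD[OF W part(1)] subsetD[OF W part(2)]]
        cotangent_sum[OF b, of "{..<n}" w "\<lambda>i. a (v i)"] cotangent_sum[OF b, of "{..<n}" v "\<lambda>i. - a (w i)"] vT
      by (simp add: s_def)
    then show ?thesis using True b by (simp add: vw(2) sum_subtractf sum_negf)
  next
    case False
    then show ?thesis using b by (simp add: s_def vw(2) cotangent_0[OF b])
  qed
  have "sharp_at M p \<Lambda> a = s"
    unfolding sharp_at_def
  proof (rule the_equality)
    show "s \<in> tangent M p \<and> (\<forall>b\<in>cotangent M p. b s = \<Lambda> a b)" using sW W eval by blast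
    show "v = s" if "v \<in> tangent M p \<and> (\<forall>b\<in>cotangent M p. b v = \<Lambda> a b)" for v
      by (rule tangent_eq_by_cotangent[of _ p]) (use that sW W eval in auto)
  qed
  then show "sharp_at M p \<Lambda> a \<in> W" "b \<in> cotangent M p \<Longrightarrow> b (sharp_at M p \<Lambda> a) = \<Lambda> a b"
    using sW eval by simp_all
  show "\<Lambda> a b = - \<Lambda> b a"
    by (simp add: vw(2) sum_negf[symmetric] algebra_simps)
qed

lemma wedge2_mono: "W \<subseteq> W' \<Longrightarrow> wedge2 M p W \<subseteq> wedge2 M p W'"
  unfolding wedge2_def by blast

lemma bivector_fields_mono: "(\<And>p. W p \<subseteq> W' p) \<Longrightarrow> bivector_fields M W \<subseteq> bivector_fields M W'"
proof
  fix \<Theta> assume W: "\<And>p. W p \<subseteq> W' p" and T: "\<Theta> \<in> bivector_fields M W"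
  have "\<Theta> p \<in> wedge2 M p (W' p)" for p
    using T subsetD[OF wedge2_mono[OF W]] by (simp add: bivector_fields_def)
  then show "\<Theta> \<in> bivector_fields M W'" using T by (simp add: bivector_fields_def)
qed

lemma wedge2_sharp_tangent:
  assumes "\<Lambda> \<in> wedge2 M p (tangent M p)"
  shows "sharp_at M p \<Lambda> a \<in> tangent M p"
    and "b \<in> cotangent M p \<Longrightarrow> b (sharp_at M p \<Lambda> a) = \<Lambda> a b"
    and "\<Lambda> a b = - \<Lambda> b a"
proof -
  show "sharp_at M p \<Lambda> a \<in> tangent M p"
    by (rule wedge2_sharp(1)[OF assms order_refl tangent_0]) (rule tangent_plus tangent_scaled; assumption)+
  show "b (sharp_at M p \<Lambda> a) = \<Lambda> a b" if "b \<in> cotangent M p"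
    by (rule wedge2_sharp(2)[OF assms order_refl tangent_0 _ _ that]) (rule tangent_plus tangent_scaled; assumption)+
  show "\<Lambda> a b = - \<Lambda> b a"
    by (rule wedge2_sharp(3)[OF assms order_refl tangent_0]) (rule tangent_plus tangent_scaled; assumption)+
qed

end

locale bivector = manifold M for M :: "'m::{second_countable_topology, t2_space} smooth_structure" +
  fixes \<Theta> :: "'m bifield"
  assumes bivector_field: "\<Theta> \<in> bivector_fields M (tangent M)"
begin

lemma wedge: "\<Theta> p \<in> wedge2 M p (tangent M p)"
  using bivector_field by (simp add: bivector_fields_def)

definition ham :: "('m \<Rightarrow> real) \<Rightarrow> 'm vfield" where
  "ham f = sharp M \<Theta> (differential M f)"

lemma sharp_tangent: "sharp M \<Theta> \<alpha> p \<in> tangent M p"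
  unfolding sharp_def by (rule wedge2_sharp_tangent(1)[OF wedge])

lemma sharp_eval: "b \<in> cotangent M p \<Longrightarrow> b (sharp M \<Theta> \<alpha> p) = \<Theta> p (\<alpha> p) b"
  unfolding sharp_def by (rule wedge2_sharp_tangent(2)[OF wedge])

lemma skew: "\<Theta> p a b = - \<Theta> p b a"
  by (rule wedge2_sharp_tangent(3)[OF wedge])

lemma sharp_apply: "sharp M \<Theta> \<alpha> p f = \<Theta> p (\<alpha> p) (differential M f p)"
  using sharp_eval[OF differential_cotangent, of f p \<alpha>] sharp_tangent by simp

lemma sharp_vector_field: "\<alpha> \<in> one_forms M \<Longrightarrow> sharp M \<Theta> \<alpha> \<in> vector_fields M"
  by (rule vector_fieldI) (use sharp_tangent bivector_field differential_one_form in
      \<open>auto simp: app_def sharp_apply bivector_fields_def\<close>)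

lemma ham_vector_field [simp]: "f \<in> C \<Longrightarrow> ham f \<in> vector_fields M"
  unfolding ham_def by (rule sharp_vector_field[OF differential_one_form])

lemma ham_apply: "ham f p g = \<Theta> p (differential M f p) (differential M g p)"
  unfolding ham_def by (rule sharp_apply)

lemma ham_skew: "app (ham f) g = - app (ham g) f"
proof
  fix p
  show "app (ham f) g p = (- app (ham g) f) p"
    unfolding app_def uminus_apply ham_apply by (rule skew)
qed

lemma ham_add: "f \<in> C \<Longrightarrow> g \<in> C \<Longrightarrow> h \<in> C \<Longrightarrow> app (ham (f + g)) h = app (ham f) h + app (ham g) h"
  by (simp add: ham_skew[of _ h] app_add)

lemma ham_uminus: "f \<in> C \<Longrightarrow> h \<in> C \<Longrightarrow> app (ham (- f)) h = - app (ham f) h"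
  by (simp add: ham_skew[of _ h] app_uminus)

lemma ham_mult: "f \<in> C \<Longrightarrow> g \<in> C \<Longrightarrow> h \<in> C \<Longrightarrow> app (ham (f * g)) h = app (ham f) h * g + f * app (ham g) h"
  by (simp add: ham_skew[of _ h] app_mult)

lemma ham_sum: "(\<And>a. a \<in> A \<Longrightarrow> f a \<in> C) \<Longrightarrow> h \<in> C \<Longrightarrow> app (ham (\<Sum>a\<in>A. f a)) h = (\<Sum>a\<in>A. app (ham (f a)) h)"
  by (simp add: ham_skew[of _ h] app_sum sum_negf)

lemma ham_const:
  assumes "h \<in> C"
  shows "app (ham (\<lambda>x. c)) h = 0"
proof -
  have "app (ham h) (\<lambda>x. c) p = 0" for p
    unfolding app_def by (rule tangent_const[OF vector_field_tangent[OF ham_vector_field[OF assms]]])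
  then have "app (ham h) (\<lambda>x. c) = 0" by (simp add: fun_eq_iff)
  then show ?thesis using ham_skew[of "\<lambda>x. c" h] by simp
qed

lemma contraction:
  obtains s where "s \<in> tangent M p" "\<And>d. d \<in> cotangent M p \<Longrightarrow> \<Theta> p a d = d s"
    "\<And>d. d \<in> cotangent M p \<Longrightarrow> \<Theta> p d a = - d s"
proof (rule that[of "sharp_at M p (\<Theta> p) a"])
  show "sharp_at M p (\<Theta> p) a \<in> tangent M p" by (rule wedge2_sharp_tangent(1)[OF wedge])
  show ev: "\<Theta> p a d = d (sharp_at M p (\<Theta> p) a)" if "d \<in> cotangent M p" for d
    by (rule wedge2_sharp_tangent(2)[OF wedge that, symmetric])
  show "\<Theta> p d a = - d (sharp_at M p (\<Theta> p) a)" if "d \<in> cotangent M p" for d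
    unfolding ev[OF that, symmetric] by (rule skew)
qed

text \<open>The failure of a vector field to be a derivation of the bracket \<open>{f, g} = \<Theta>(df, dg)\<close>.\<close>

definition defect :: "'m vfield \<Rightarrow> ('m \<Rightarrow> real) \<Rightarrow> ('m \<Rightarrow> real) \<Rightarrow> 'm \<Rightarrow> real" where
  "defect Z f g = app Z (app (ham f) g) - app (ham (app Z f)) g - app (ham f) (app Z g)"

lemma defect_skew: "Z \<in> vector_fields M \<Longrightarrow> f \<in> C \<Longrightarrow> g \<in> C \<Longrightarrow> defect Z f g = - defect Z g f"
  unfolding defect_def
  using ham_skew[of f g] ham_skew[of "app Z f" g] ham_skew[of f "app Z g"] app_uminus[of Z "app (ham g) f"]
  by simp

lemma defect_add:
  "Z \<in> vector_fields M \<Longrightarrow> Z' \<in> vector_fields M \<Longrightarrow> f \<in> C \<Longrightarrow> g \<in> C \<Longrightarrow>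
    defect (Z + Z') f g = defect Z f g + defect Z' f g"
  by (simp add: defect_def ham_add app_add)

lemma defect_sum:
  "(\<And>a. a \<in> A \<Longrightarrow> Z a \<in> vector_fields M) \<Longrightarrow> f \<in> C \<Longrightarrow> g \<in> C \<Longrightarrow>
    defect (\<Sum>a\<in>A. Z a) f g = (\<Sum>a\<in>A. defect (Z a) f g)"
  by (simp add: defect_def ham_sum app_sum sum_subtractf)

lemma defect_fscale:
  assumes "Z \<in> vector_fields M" "q \<in> C" "f \<in> C" "g \<in> C"
  shows "defect (fscale q Z) f g = q * defect Z f g - app Z f * app (ham q) g - app Z g * app (ham f) q"
  using assms by (simp add: defect_def ham_mult app_mult algebra_simps)

end

text \<open>The maps \<open>v \<mapsto> (v (y a))\<^sub>a\<close> embed the tangent bundle into a trivial bundle of rank \<open>r\<close>, and the \<open>u a\<close>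
  define a projection onto it. Such data exist on every manifold by \<open>global_frame\<close>.\<close>

locale framed_manifold = manifold M for M :: "'m::{second_countable_topology, t2_space} smooth_structure" +
  fixes r :: nat and y :: "nat \<Rightarrow> 'm \<Rightarrow> real" and u :: "nat \<Rightarrow> 'm vfield"
  assumes frame_C [simp]: "a < r \<Longrightarrow> y a \<in> C"
    and frame_vf [simp]: "a < r \<Longrightarrow> u a \<in> vector_fields M"
    and frame: "v \<in> tangent M p \<Longrightarrow> v = (\<lambda>f. \<Sum>a<r. v (y a) * u a p f)"
begin

lemma frame_sum:
  assumes "v \<in> tangent M p"
  shows "v = (\<Sum>a<r. (\<lambda>f. v (y a) * u a p f))"
proof
  fix f
  show "v f = (\<Sum>a<r. (\<lambda>f. v (y a) * u a p f)) f"
    unfolding sum_fun_apply by (rule fun_cong[OF frame[OF assms], of f])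
qed

lemma frame_tangent: "a < r \<Longrightarrow> u a p \<in> tangent M p"
  using frame_vf vector_field_tangent by blast

lemma frame_app:
  assumes "X \<in> vector_fields M"
  shows "app X f = (\<Sum>a<r. app X (y a) * app (u a) f)"
proof
  fix p
  show "app X f p = (\<Sum>a<r. app X (y a) * app (u a) f) p"
    unfolding sum_fun_apply times_fun_apply app_def
    by (rule fun_cong[OF frame[OF vector_field_tangent[OF assms, of p]], of f])
qed

lemma frame_covector: "b \<in> cotangent M p \<Longrightarrow> v \<in> tangent M p \<Longrightarrow> b v = (\<Sum>a<r. b (u a p) * v (y a))"
proof -
  assume b: "b \<in> cotangent M p" and v: "v \<in> tangent M p"
  have "b v = b (\<Sum>a<r. (\<lambda>f. v (y a) * u a p f))" by (rule arg_cong[OF frame_sum[OF v]])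
  also have "\<dots> = (\<Sum>a<r. v (y a) * b (u a p))"
    by (rule cotangent_sum[OF b]) (simp add: frame_tangent)
  finally show ?thesis by (simp add: mult.commute)
qed

lemma extend_tangent:
  assumes "v \<in> tangent M p"
  obtains X where "X \<in> vector_fields M" "X p = v"
proof (rule that[of "\<Sum>a<r. fscale (\<lambda>q. v (y a)) (u a)"])
  show "(\<Sum>a<r. fscale (\<lambda>q. v (y a)) (u a)) \<in> vector_fields M"
    by (intro vector_field_sum vector_field_fscale) simp_all
  show "(\<Sum>a<r. fscale (\<lambda>q. v (y a)) (u a)) p = v"
    by (simp add: sum_fun_apply fscale_def fun_eq_iff frame[OF assms, THEN fun_cong, symmetric])
qed

lemma one_form_app: "\<alpha> \<in> one_forms M \<Longrightarrow> X \<in> vector_fields M \<Longrightarrow> (\<lambda>q. \<alpha> q (X q)) \<in> C"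
  by (simp add: one_forms_def)

text \<open>The right-hand side is the frame expression of \<open>\<Sum>\<^sub>a Z(A\<^sub>a) dy\<^sub>a + A\<^sub>a d(Z y\<^sub>a)\<close> for \<open>\<alpha> = \<Sum>\<^sub>a A\<^sub>a dy\<^sub>a\<close>. It has the
  characteristic property of the Lie derivative. It is the only such form, because every tangent vector
  is the value of a vector field.\<close>

lemma lie_oneform_formula:
  assumes Z: "Z \<in> vector_fields M" and \<alpha>: "\<alpha> \<in> one_forms M"
  defines "A \<equiv> \<lambda>a q. \<alpha> q (u a q)"
  shows "lie_oneform M Z \<alpha> = (\<lambda>p v. if v \<in> tangent M p
    then \<Sum>a<r. app Z (A a) p * v (y a) + A a p * v (app Z (y a)) else 0)" (is "_ = ?\<omega>")
proof -
  have AC: "A a \<in> C" if "a < r" for a unfolding A_def by (rule one_form_app[OF \<alpha>]) (simp add: that)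
  have cot: "\<alpha> p \<in> cotangent M p" for p using \<alpha> by (simp add: one_forms_def)
  have \<omega>cot: "?\<omega> p \<in> cotangent M p" for p
    by (auto simp: cotangent_def tangent_plus tangent_scaled sum.distrib[symmetric] sum_distrib_left algebra_simps
        intro!: sum.cong)
  have \<omega>app: "(\<lambda>q. ?\<omega> q (X q)) = (\<Sum>a<r. app Z (A a) * app X (y a) + A a * app X (app Z (y a)))"
    if "X \<in> vector_fields M" for X
    using vector_field_tangent[OF that] by (simp add: fun_eq_iff app_def sum_fun_apply)
  have \<omega>: "?\<omega> \<in> one_forms M"
    unfolding one_forms_def using \<omega>cot \<omega>app Z AC
    by (auto intro!: C_inf_sum C_inf_add C_inf_mult)
  have \<alpha>X: "(\<lambda>q. \<alpha> q (X q)) = (\<Sum>a<r. A a * app X (y a))" if "X \<in> vector_fields M" for X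
    using frame_covector[OF cot vector_field_tangent[OF that]] by (simp add: fun_eq_iff A_def app_def sum_fun_apply)
  have val: "?\<omega> p (X p) = Z p (\<lambda>q. \<alpha> q (X q)) - \<alpha> p (lie_bracket Z X p)" if X: "X \<in> vector_fields M" for X p
  proof -
    have "app Z (\<lambda>q. \<alpha> q (X q)) = (\<Sum>a<r. app Z (A a) * app X (y a) + A a * app Z (app X (y a)))"
      unfolding \<alpha>X[OF X] by (rule app_sum_mult[OF Z]) (simp_all add: AC X)
    moreover have "(\<lambda>q. \<alpha> q (lie_bracket Z X q)) = (\<Sum>a<r. A a * (app Z (app X (y a)) - app X (app Z (y a))))"
      unfolding \<alpha>X[OF vector_field_bracket[OF Z X]] by (simp add: app_bracket)
    ultimately have "app Z (\<lambda>q. \<alpha> q (X q)) - (\<lambda>q. \<alpha> q (lie_bracket Z X q)) = (\<lambda>q. ?\<omega> q (X q))"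
      unfolding \<omega>app[OF X] by (simp add: sum_subtractf[symmetric] algebra_simps)
    then show ?thesis by (simp add: fun_eq_iff app_def)
  qed
  show ?thesis
    unfolding lie_oneform_def
  proof (rule the_equality)
    show "?\<omega> \<in> one_forms M \<and> (\<forall>X\<in>vector_fields M. \<forall>p. ?\<omega> p (X p) = Z p (\<lambda>q. \<alpha> q (X q)) - \<alpha> p (lie_bracket Z X p))"
      using \<omega> val by blast
    fix \<omega>' assume *: "\<omega>' \<in> one_forms M \<and> (\<forall>X\<in>vector_fields M. \<forall>p. \<omega>' p (X p) = Z p (\<lambda>q. \<alpha> q (X q)) - \<alpha> p (lie_bracket Z X p))"
    show "\<omega>' = ?\<omega>"
    proof
      fix p
      show "\<omega>' p = ?\<omega> p"
      proof (rule cotangent_eqI[of _ p])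
        show "\<omega>' p \<in> cotangent M p" using * by (simp add: one_forms_def)
        show "?\<omega> p \<in> cotangent M p" by (rule \<omega>cot)
        fix v assume "v \<in> tangent M p"
        then obtain X where X: "X \<in> vector_fields M" "X p = v" by (rule extend_tangent)
        have "\<omega>' p (X p) = Z p (\<lambda>q. \<alpha> q (X q)) - \<alpha> p (lie_bracket Z X p)" using * X(1) by blast
        then have "\<omega>' p (X p) = ?\<omega> p (X p)" unfolding val[OF X(1)] .
        then show "\<omega>' p v = ?\<omega> p v" unfolding X(2) .
      qed
    qed
  qed
qed

lemma lie_oneform_differential:
  assumes Z: "Z \<in> vector_fields M" and f: "f \<in> C"
  shows "lie_oneform M Z (differential M f) = differential M (app Z f)"
proof -
  have A: "(\<lambda>q. differential M f q (u a q)) = app (u a) f" if "a < r" for a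
    using frame_tangent[OF that] by (simp add: app_def fun_eq_iff)
  have "(\<Sum>a<r. app Z (\<lambda>q. differential M f q (u a q)) p * v (y a) + differential M f p (u a p) * v (app Z (y a))) = v (app Z f)"
    if v: "v \<in> tangent M p" for p v
  proof -
    obtain X where X: "X \<in> vector_fields M" "X p = v" using extend_tangent[OF v] by blast
    have Xv: "v h = app X h p" for h using X(2) by (simp add: app_def)
    have fX: "app W f = (\<Sum>a<r. app (u a) f * app W (y a))" if "W \<in> vector_fields M" for W
      by (subst frame_app[OF that]) (simp only: mult.commute)
    have "app Z (app X f) = (\<Sum>a<r. app Z (app (u a) f) * app X (y a) + app (u a) f * app Z (app X (y a)))"
      by (subst fX[OF X(1)], rule app_sum_mult[OF Z]) (simp_all add: f X(1))
    moreover have "app (lie_bracket Z X) f = (\<Sum>a<r. app (u a) f * (app Z (app X (y a)) - app X (app Z (y a))))"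
      by (subst fX[OF vector_field_bracket[OF Z X(1)]]) (simp add: app_bracket)
    ultimately have "app X (app Z f) = (\<Sum>a<r. app Z (app (u a) f) * app X (y a) + app (u a) f * app X (app Z (y a)))"
      by (simp add: app_bracket sum_subtractf sum.distrib algebra_simps)
    then have "app X (app Z f) p = (\<Sum>a<r. app Z (app (u a) f) p * app X (y a) p + app (u a) f p * app X (app Z (y a)) p)"
      by (simp add: sum_fun_apply)
    moreover have "differential M f p (u a p) = app (u a) f p" if "a < r" for a
      using frame_tangent[OF that] by (simp add: app_def)
    ultimately show ?thesis by (simp add: A Xv)
  qed
  then show ?thesis
    unfolding lie_oneform_formula[OF Z differential_one_form[OF f]]
    by (auto simp: differential_def[of M "app Z f"] fun_eq_iff)
qed

end

locale framed_bivector = framed_manifold M r y u + bivector M \<Theta>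
  for M :: "'m::{second_countable_topology, t2_space} smooth_structure" and r y u \<Theta>
begin

lemma lie_bivector_exact:
  assumes Z: "Z \<in> vector_fields M" and "f \<in> C" "g \<in> C"
  shows "lie_bivector M Z \<Theta> (differential M f) (differential M g) = defect Z f g"
  using assms by (simp add: lie_bivector_def lie_oneform_differential defect_def fun_eq_iff ham_apply[symmetric] app_def)

text \<open>The Lie derivative of a bivector field is bilinear over the smooth functions, although its three terms
  are not. So it is determined by its values on the forms \<open>dy\<^sub>a\<close>.\<close>

lemma lie_bivector_formula:
  assumes Z: "Z \<in> vector_fields M" and \<alpha>: "\<alpha> \<in> one_forms M" and \<beta>: "\<beta> \<in> one_forms M"
  shows "lie_bivector M Z \<Theta> \<alpha> \<beta> = (\<Sum>a<r. \<Sum>c<r. (\<lambda>q. \<alpha> q (u a q)) * (\<lambda>q. \<beta> q (u c q)) * defect Z (y a) (y c))"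
proof -
  define A where "A = (\<lambda>a q. \<alpha> q (u a q))"
  define B where "B = (\<lambda>a q. \<beta> q (u a q))"
  have AC: "A a \<in> C" "B a \<in> C" if "a < r" for a
    unfolding A_def B_def using that by (auto intro: one_form_app[OF \<alpha>] one_form_app[OF \<beta>])
  have cot: "\<alpha> p \<in> cotangent M p" "\<beta> p \<in> cotangent M p" for p using \<alpha> \<beta> by (simp_all add: one_forms_def)
  note dcot = differential_cotangent
  have \<alpha>d: "\<Theta> p (\<alpha> p) b = (\<Sum>a<r. A a p * \<Theta> p (differential M (y a) p) b)" for p b
  proof -
    obtain s where s: "s \<in> tangent M p" "\<And>d. d \<in> cotangent M p \<Longrightarrow> \<Theta> p d b = - d s"
      by (rule contraction[where p = p and a = b]) (rule that)
    then show ?thesis by (simp add: cot dcot frame_covector[OF cot(1) s(1)] A_def sum_negf)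
  qed
  have \<beta>d: "\<Theta> p b (\<beta> p) = (\<Sum>a<r. B a p * \<Theta> p b (differential M (y a) p))" for p b
  proof -
    obtain s where s: "s \<in> tangent M p" "\<And>d. d \<in> cotangent M p \<Longrightarrow> \<Theta> p b d = d s"
      by (rule contraction[where p = p and a = b]) (rule that)
    then show ?thesis by (simp add: cot dcot frame_covector[OF cot(2) s(1)] B_def)
  qed
  have Lcot: "lie_oneform M Z \<omega> p \<in> cotangent M p" if "\<omega> \<in> one_forms M" for \<omega> p
    unfolding lie_oneform_formula[OF Z that]
    by (auto simp: cotangent_def tangent_plus tangent_scaled sum.distrib[symmetric] sum_distrib_left algebra_simps
        intro!: sum.cong)
  have L: "\<Theta> p (lie_oneform M Z \<alpha> p) b = (\<Sum>a<r. app Z (A a) p * \<Theta> p (differential M (y a) p) b +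
      A a p * \<Theta> p (differential M (app Z (y a)) p) b)" for p b
  proof -
    obtain s where s: "s \<in> tangent M p" "\<And>d. d \<in> cotangent M p \<Longrightarrow> \<Theta> p d b = - d s"
      by (rule contraction[where p = p and a = b]) (rule that)
    have "lie_oneform M Z \<alpha> p s = (\<Sum>a<r. app Z (A a) p * s (y a) + A a p * s (app Z (y a)))"
      unfolding lie_oneform_formula[OF Z \<alpha>] A_def using s(1) by simp
    then show ?thesis using s(1) by (simp add: s(2) Lcot[OF \<alpha>] dcot sum_negf[symmetric])
  qed
  have R: "\<Theta> p b (lie_oneform M Z \<beta> p) = (\<Sum>a<r. app Z (B a) p * \<Theta> p b (differential M (y a) p) +
      B a p * \<Theta> p b (differential M (app Z (y a)) p))" for p b
  proof -
    obtain s where s: "s \<in> tangent M p" "\<And>d. d \<in> cotangent M p \<Longrightarrow> \<Theta> p b d = d s"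
      by (rule contraction[where p = p and a = b]) (rule that)
    have "lie_oneform M Z \<beta> p s = (\<Sum>a<r. app Z (B a) p * s (y a) + B a p * s (app Z (y a)))"
      unfolding lie_oneform_formula[OF Z \<beta>] B_def using s(1) by simp
    then show ?thesis using s(1) by (simp add: s(2) Lcot[OF \<beta>] dcot)
  qed
  have hm: "\<Theta> p (differential M f p) (differential M g p) = app (ham f) g p" for p f g
    by (simp add: app_def ham_apply)
  define m where "m = (\<lambda>a c. app (ham (y a)) (y c))"
  have mC: "m a c \<in> C" if "a < r" "c < r" for a c using that by (simp add: m_def)
  have T: "(\<lambda>q. \<Theta> q (\<alpha> q) (\<beta> q)) = (\<Sum>a<r. A a * (\<Sum>c<r. B c * m a c))"
  proof
    fix q
    show "\<Theta> q (\<alpha> q) (\<beta> q) = (\<Sum>a<r. A a * (\<Sum>c<r. B c * m a c)) q"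
      unfolding \<alpha>d unfolding \<beta>d hm by (simp add: sum_fun_apply m_def)
  qed
  have inner: "(\<Sum>c<r. B c * m a c) \<in> C" if "a < r" for a
    by (rule C_inf_sum, rule C_inf_mult) (simp_all add: AC mC that)
  have "app Z (\<lambda>q. \<Theta> q (\<alpha> q) (\<beta> q)) =
      (\<Sum>a<r. app Z (A a) * (\<Sum>c<r. B c * m a c) + A a * app Z (\<Sum>c<r. B c * m a c))"
    unfolding T by (rule app_sum_mult[OF Z]) (simp_all add: AC inner)
  also have "\<dots> = (\<Sum>a<r. app Z (A a) * (\<Sum>c<r. B c * m a c) +
      A a * (\<Sum>c<r. app Z (B c) * m a c + B c * app Z (m a c)))"
    by (rule sum.cong[OF refl], subst app_sum_mult[OF Z]) (simp_all add: AC mC)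
  also have "\<dots> = (\<Sum>a<r. \<Sum>c<r. (app Z (A a) * B c + A a * app Z (B c)) * m a c + A a * B c * app Z (m a c))"
    by (simp only: sum_distrib_left sum.distrib[symmetric] distrib_left distrib_right mult.assoc add.assoc)
  finally have 1: "app Z (\<lambda>q. \<Theta> q (\<alpha> q) (\<beta> q)) =
      (\<Sum>a<r. \<Sum>c<r. (app Z (A a) * B c + A a * app Z (B c)) * m a c + A a * B c * app Z (m a c))" .
  have 2: "(\<lambda>p. \<Theta> p (lie_oneform M Z \<alpha> p) (\<beta> p)) =
      (\<Sum>a<r. \<Sum>c<r. app Z (A a) * B c * m a c + A a * B c * app (ham (app Z (y a))) (y c))"
  proof
    fix p
    show "\<Theta> p (lie_oneform M Z \<alpha> p) (\<beta> p) =
      (\<Sum>a<r. \<Sum>c<r. app Z (A a) * B c * m a c + A a * B c * app (ham (app Z (y a))) (y c)) p"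
      unfolding L unfolding \<beta>d hm
      by (simp only: sum_fun_apply m_def plus_fun_apply times_fun_apply sum_distrib_left sum.distrib mult.assoc)
  qed
  have 3: "(\<lambda>p. \<Theta> p (\<alpha> p) (lie_oneform M Z \<beta> p)) =
      (\<Sum>a<r. \<Sum>c<r. A a * app Z (B c) * m a c + A a * B c * app (ham (y a)) (app Z (y c)))"
  proof
    fix p
    show "\<Theta> p (\<alpha> p) (lie_oneform M Z \<beta> p) =
      (\<Sum>a<r. \<Sum>c<r. A a * app Z (B c) * m a c + A a * B c * app (ham (y a)) (app Z (y c))) p"
      unfolding \<alpha>d unfolding R hm
      by (simp only: sum_fun_apply m_def plus_fun_apply times_fun_apply sum_distrib_left sum.distrib distrib_left mult.assoc)
  qed
  have "app Z (\<lambda>q. \<Theta> q (\<alpha> q) (\<beta> q)) - (\<lambda>p. \<Theta> p (lie_oneform M Z \<alpha> p) (\<beta> p)) - (\<lambda>p. \<Theta> p (\<alpha> p) (lie_oneform M Z \<beta> p)) =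
      (\<Sum>a<r. \<Sum>c<r. A a * B c * defect Z (y a) (y c))"
    unfolding 1 2 3 defect_def m_def sum_subtractf[symmetric]
    by (intro sum.cong refl) (simp add: algebra_simps)
  then show ?thesis by (simp add: lie_bivector_def app_def fun_eq_iff A_def B_def)
qed

text \<open>The defect is the value of \<open>L\<^sub>Z \<Theta>\<close> on exact forms, and these determine it. So the vector fields
  preserving a bivector field are the derivations of its bracket.\<close>

lemma Poiss_iff: "Z \<in> Poiss M \<Theta> \<longleftrightarrow> Z \<in> vector_fields M \<and> (\<forall>f\<in>C. \<forall>g\<in>C. defect Z f g = 0)"
proof
  assume Z: "Z \<in> Poiss M \<Theta>"
  then have ZV: "Z \<in> vector_fields M" by (simp add: Poiss_def)
  have "defect Z f g = 0" if "f \<in> C" "g \<in> C" for f g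
    using Z lie_bivector_exact[OF ZV that] differential_one_form that by (simp add: Poiss_def zero_fun_def)
  then show "Z \<in> vector_fields M \<and> (\<forall>f\<in>C. \<forall>g\<in>C. defect Z f g = 0)" using ZV by blast
next
  assume Z: "Z \<in> vector_fields M \<and> (\<forall>f\<in>C. \<forall>g\<in>C. defect Z f g = 0)"
  then have "lie_bivector M Z \<Theta> \<alpha> \<beta> = (\<lambda>p. 0)" if "\<alpha> \<in> one_forms M" "\<beta> \<in> one_forms M" for \<alpha> \<beta>
  proof -
    have "lie_bivector M Z \<Theta> \<alpha> \<beta> = 0"
      using lie_bivector_formula[OF conjunct1[OF Z] that] Z by simp
    then show ?thesis unfolding zero_fun_def .
  qed
  then show "Z \<in> Poiss M \<Theta>" using Z by (simp add: Poiss_def)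
qed

lemma Ham_eq: "Ham M \<Theta> = ham ` C"
  by (auto simp: Ham_def ham_def image_def)

lemma Casim_iff: "F \<in> Casim M \<Theta> \<longleftrightarrow> F \<in> C \<and> ham F = 0"
  unfolding Casim_def ham_def by (rule mem_Collect_eq)

text \<open>On exact forms the cyclic sum that defines the Schouten bracket is the Jacobiator, which is the defect of
  a Hamiltonian field.\<close>

lemma Jacobi:
  assumes "poisson_tensor M \<Theta>" "f \<in> C" "g \<in> C" "h \<in> C"
  shows "defect (ham f) g h = 0"
proof -
  have "schouten_self M \<Theta> (differential M f) (differential M g) (differential M h) = (\<lambda>p. 0)"
    using assms differential_one_form by (simp add: poisson_tensor_def)
  moreover have "lie_oneform M (ham a) (differential M b) p (ham c p) = app (ham c) (app (ham a) b) p"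
    if "a \<in> C" "b \<in> C" "c \<in> C" for a b c p
    using that vector_field_tangent[OF ham_vector_field[OF that(3)]]
    by (simp add: lie_oneform_differential app_def)
  ultimately have *: "\<forall>x. 2 * (app (ham h) (app (ham f) g) x + app (ham f) (app (ham g) h) x + app (ham g) (app (ham h) f) x) = 0"
    using assms by (simp add: schouten_self_def ham_def[symmetric] fun_eq_iff)
  have "app (ham h) (app (ham f) g) + app (ham f) (app (ham g) h) + app (ham g) (app (ham h) f) = 0"
  proof
    fix x
    show "(app (ham h) (app (ham f) g) + app (ham f) (app (ham g) h) + app (ham g) (app (ham h) f)) x = 0 x"
      using *[THEN spec, of x] by (simp only: plus_fun_apply zero_fun_apply mult_eq_0_iff) simp
  qed
  moreover have "app (ham h) (app (ham f) g) = - app (ham (app (ham f) g)) h" by (rule ham_skew)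
  moreover have "app (ham g) (app (ham h) f) = - app (ham g) (app (ham f) h)"
    using assms app_uminus[of "ham g" "app (ham f) h"] ham_skew[of h f] by simp
  ultimately show ?thesis by (simp add: defect_def)
qed

end

section \<open>Pull-back of functions\<close>

lemma smooth_map_comp:
  fixes E :: "'e::{second_countable_topology, t2_space} smooth_structure"
    and B :: "'b::{second_countable_topology, t2_space} smooth_structure"
  assumes E: "smooth_manifold E" and B: "smooth_manifold B" and h: "smooth_map E B h" and g: "g \<in> C_inf B"
  shows "g \<circ> h \<in> C_inf E"
proof -
  interpret E: manifold E by unfold_locales (rule E)
  interpret B: manifold B by unfold_locales (rule B)
  show ?thesis
  proof (rule E.C_inf_local)
    fix p
    obtain U \<phi> where c: "(U, \<phi>) \<in> charts E" "p \<in> U" by (rule E.chart_at)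
    obtain V \<psi> where d: "(V, \<psi>) \<in> charts B" "h p \<in> V" by (rule B.chart_at)
    define N where "N = U \<inter> h -` V"
    have "open (h -` V)"
      using h B.chart_open[OF d(1)] open_vimage[of V h] by (simp add: smooth_map_def)
    then have N: "open N" "p \<in> N" "N \<subseteq> U"
      using E.chart_open[OF c(1)] c(2) d(2) by (auto simp: N_def)
    have W: "openin (Euclidean_space (mdim E)) (\<phi> ` N)" by (rule E.chart_open_image[OF c(1) N(1,3)])
    have comp: "smooth_on (mdim E) (\<phi> ` N) (\<lambda>x. \<psi> (h (inv_into U \<phi> x)) i)" if "i < mdim B" for i
      using h c(1) d(1) that unfolding smooth_map_def N_def by blast
    have "smooth_on (mdim E) (\<phi> ` N) (\<lambda>x. (\<lambda>z. g (inv_into V \<psi> z)) (\<psi> (h (inv_into U \<phi> x))))"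
    proof (rule smooth_on_compose[OF W B.chart_image[OF d(1)], where g = "\<lambda>x. \<psi> (h (inv_into U \<phi> x))",
          OF _ B.C_infD[OF g d(1)] comp])
      fix x assume "x \<in> \<phi> ` N"
      then obtain q where q: "q \<in> N" "x = \<phi> q" by blast
      then have "inv_into U \<phi> x = q" using c N by auto
      then show "\<psi> (h (inv_into U \<phi> x)) \<in> \<psi> ` V" using q by (auto simp: N_def)
    qed
    then have "smooth_on (mdim E) (\<phi> ` N) ((g \<circ> h) \<circ> inv_into U \<phi>)"
    proof (rule smooth_on_cong[OF W, rotated])
      fix x assume "x \<in> \<phi> ` N"
      then obtain q where q: "q \<in> N" "x = \<phi> q" by blast
      then have "inv_into U \<phi> x = q" using c N by auto
      moreover have "inv_into V \<psi> (\<psi> (h q)) = h q" using q d(1) by (auto simp: N_def)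
      ultimately show "g (inv_into V \<psi> (\<psi> (h (inv_into U \<phi> x)))) = ((g \<circ> h) \<circ> inv_into U \<phi>) x" by simp
    qed
    with c N have "(U, \<phi>) \<in> charts E \<and> open N \<and> p \<in> N \<and> N \<subseteq> U \<and>
        smooth_on (mdim E) (\<phi> ` N) ((g \<circ> h) \<circ> inv_into U \<phi>)" by (intro conjI)
    then show "\<exists>U \<phi> N. (U, \<phi>) \<in> charts E \<and> open N \<and> p \<in> N \<and> N \<subseteq> U \<and>
        smooth_on (mdim E) (\<phi> ` N) ((g \<circ> h) \<circ> inv_into U \<phi>)" by (intro exI)
  qed
qed

section \<open>Forms on the base in degrees at most two\<close>

context framed_manifold begin

lemma alt1_add:
  assumes "w \<in> alt_forms_at M 1 b" "v \<in> tangent M b" "v' \<in> tangent M b"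
  shows "w [v + v'] = w [v] + w [v']"
proof -
  have "\<forall>vs i. length vs = 1 \<longrightarrow> set vs \<subseteq> tangent M b \<longrightarrow> i < 1 \<longrightarrow>
     (\<forall>v \<in> tangent M b. \<forall>v' \<in> tangent M b. w (vs[i := v + v']) = w (vs[i := v]) + w (vs[i := v']))"
    using assms(1) unfolding alt_forms_at_def by simp
  from this[THEN spec, of "[v]", THEN spec, of 0] show ?thesis using assms(2,3) by simp
qed

lemma alt1_scale:
  assumes "w \<in> alt_forms_at M 1 b" "v \<in> tangent M b"
  shows "w [(\<lambda>f. c * v f)] = c * w [v]"
proof -
  have "\<forall>vs i. length vs = 1 \<longrightarrow> set vs \<subseteq> tangent M b \<longrightarrow> i < 1 \<longrightarrow>
     (\<forall>c. \<forall>v \<in> tangent M b. w (vs[i := (\<lambda>f. c * v f)]) = c * w (vs[i := v]))"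
    using assms(1) unfolding alt_forms_at_def by simp
  from this[THEN spec, of "[v]", THEN spec, of 0] show ?thesis using assms(2) by simp
qed

lemma alt2:
  assumes "w \<in> alt_forms_at M 2 b"
  shows "v \<in> tangent M b \<Longrightarrow> v' \<in> tangent M b \<Longrightarrow> z \<in> tangent M b \<Longrightarrow> w [v + v', z] = w [v, z] + w [v', z]"
    and "v \<in> tangent M b \<Longrightarrow> z \<in> tangent M b \<Longrightarrow> w [(\<lambda>f. c * v f), z] = c * w [v, z]"
    and "v \<in> tangent M b \<Longrightarrow> v' \<in> tangent M b \<Longrightarrow> z \<in> tangent M b \<Longrightarrow> w [z, v + v'] = w [z, v] + w [z, v']"
    and "v \<in> tangent M b \<Longrightarrow> w [v, v] = 0"
proof -
  have add: "\<forall>vs i. length vs = 2 \<longrightarrow> set vs \<subseteq> tangent M b \<longrightarrow> i < 2 \<longrightarrow>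
     (\<forall>v \<in> tangent M b. \<forall>v' \<in> tangent M b. w (vs[i := v + v']) = w (vs[i := v]) + w (vs[i := v']))"
    and sc: "\<forall>vs i. length vs = 2 \<longrightarrow> set vs \<subseteq> tangent M b \<longrightarrow> i < 2 \<longrightarrow>
     (\<forall>c. \<forall>v \<in> tangent M b. w (vs[i := (\<lambda>f. c * v f)]) = c * w (vs[i := v]))"
    and alt: "\<forall>vs i j. length vs = 2 \<longrightarrow> set vs \<subseteq> tangent M b \<longrightarrow> i < j \<longrightarrow> j < 2 \<longrightarrow> vs ! i = vs ! j \<longrightarrow> w vs = 0"
    using assms unfolding alt_forms_at_def by simp_all
  show "w [v + v', z] = w [v, z] + w [v', z]" if "v \<in> tangent M b" "v' \<in> tangent M b" "z \<in> tangent M b"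
    using add[THEN spec, of "[v, z]", THEN spec, of 0] that by simp
  show "w [(\<lambda>f. c * v f), z] = c * w [v, z]" if "v \<in> tangent M b" "z \<in> tangent M b"
    using sc[THEN spec, of "[v, z]", THEN spec, of 0] that by simp
  show "w [z, v + v'] = w [z, v] + w [z, v']" if "v \<in> tangent M b" "v' \<in> tangent M b" "z \<in> tangent M b"
    using add[THEN spec, of "[z, v]", THEN spec, of 1] that by simp
  show "w [v, v] = 0" if "v \<in> tangent M b"
    using alt[THEN spec, of "[v, v]", THEN spec, of 0, THEN spec, of 1] that by simp
qed

lemma alt2_skew:
  assumes w: "w \<in> alt_forms_at M 2 b" and v: "v \<in> tangent M b" "z \<in> tangent M b"
  shows "w [v, z] = - w [z, v]"
proof -
  have "w [v + z, v + z] = 0" by (rule alt2(4)[OF w tangent_plus[OF v]])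
  moreover have "w [v + z, v + z] = w [v, v] + w [v, z] + (w [z, v] + w [z, z])"
    using alt2(1)[OF w v tangent_plus[OF v]] alt2(3)[OF w v v(1)] alt2(3)[OF w v v(2)] by simp
  ultimately show ?thesis using alt2(4)[OF w v(1)] alt2(4)[OF w v(2)] by simp
qed

lemma alt1_sum:
  assumes "w \<in> alt_forms_at M 1 b" "\<And>i. i \<in> I \<Longrightarrow> v i \<in> tangent M b"
  shows "w [\<Sum>i\<in>I. (\<lambda>f. c i * v i f)] = (\<Sum>i\<in>I. c i * w [v i])"
  using assms(2)
proof (induction I rule: infinite_finite_induct)
  case (insert i I)
  have S: "(\<Sum>i\<in>I. (\<lambda>f. c i * v i f)) \<in> tangent M b"
    by (intro tangent_sum_vectors tangent_scaled insert.prems insertI2)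
  have vi: "v i \<in> tangent M b" by (rule insert.prems) simp
  have "w [(\<lambda>f. c i * v i f) + (\<Sum>i\<in>I. (\<lambda>f. c i * v i f))] = c i * w [v i] + w [\<Sum>i\<in>I. (\<lambda>f. c i * v i f)]"
    by (simp only: alt1_add[OF assms(1) tangent_scaled[OF vi] S] alt1_scale[OF assms(1) vi])
  moreover have "w [\<Sum>i\<in>I. (\<lambda>f. c i * v i f)] = (\<Sum>i\<in>I. c i * w [v i])"
    by (rule insert.IH) (rule insert.prems, rule insertI2)
  ultimately show ?case by (simp only: sum.insert[OF insert.hyps])
next
  case (infinite I)
  then show ?case using alt1_scale[OF assms(1) tangent_0, of 0] by (simp add: zero_fun_def)
next
  case empty
  then show ?case using alt1_scale[OF assms(1) tangent_0, of 0] by (simp add: zero_fun_def)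
qed

lemma alt2_sum_left:
  assumes "w \<in> alt_forms_at M 2 b" "\<And>i. i \<in> I \<Longrightarrow> v i \<in> tangent M b" and z: "z \<in> tangent M b"
  shows "w [\<Sum>i\<in>I. (\<lambda>f. c i * v i f), z] = (\<Sum>i\<in>I. c i * w [v i, z])"
  using assms(2)
proof (induction I rule: infinite_finite_induct)
  case (insert i I)
  have S: "(\<Sum>i\<in>I. (\<lambda>f. c i * v i f)) \<in> tangent M b"
    by (intro tangent_sum_vectors tangent_scaled insert.prems insertI2)
  have vi: "v i \<in> tangent M b" by (rule insert.prems) simp
  have "w [(\<lambda>f. c i * v i f) + (\<Sum>i\<in>I. (\<lambda>f. c i * v i f)), z] = c i * w [v i, z] + w [\<Sum>i\<in>I. (\<lambda>f. c i * v i f), z]"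
    by (simp only: alt2(1)[OF assms(1) tangent_scaled[OF vi] S z] alt2(2)[OF assms(1) vi z])
  moreover have "w [\<Sum>i\<in>I. (\<lambda>f. c i * v i f), z] = (\<Sum>i\<in>I. c i * w [v i, z])"
    by (rule insert.IH) (rule insert.prems, rule insertI2)
  ultimately show ?case by (simp only: sum.insert[OF insert.hyps])
next
  case (infinite I)
  then show ?case using alt2(2)[OF assms(1) tangent_0 z, of 0] by (simp add: zero_fun_def)
next
  case empty
  then show ?case using alt2(2)[OF assms(1) tangent_0 z, of 0] by (simp add: zero_fun_def)
qed

lemma alt_forms_0: "(\<lambda>vs. 0) \<in> alt_forms_at M p b"
  by (simp add: alt_forms_at_def)

lemma alt_forms_add: "w \<in> alt_forms_at M p b \<Longrightarrow> w' \<in> alt_forms_at M p b \<Longrightarrow> (\<lambda>vs. w vs + w' vs) \<in> alt_forms_at M p b"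
  by (simp add: alt_forms_at_def algebra_simps)

lemma alt_forms_scale: "w \<in> alt_forms_at M p b \<Longrightarrow> (\<lambda>vs. c * w vs) \<in> alt_forms_at M p b"
  by (simp add: alt_forms_at_def algebra_simps)

lemma alt_forms_sum: "(\<And>i. i \<in> I \<Longrightarrow> w i \<in> alt_forms_at M p b) \<Longrightarrow> (\<lambda>vs. \<Sum>i\<in>I. w i vs) \<in> alt_forms_at M p b"
proof (induction I rule: infinite_finite_induct)
  case (insert i I)
  have "(\<lambda>vs. w i vs + (\<Sum>i\<in>I. w i vs)) \<in> alt_forms_at M p b"
    by (rule alt_forms_add) (use insert in simp_all)
  then show ?case by (simp only: sum.insert[OF insert.hyps])
qed (simp_all add: alt_forms_0)

lemma tensor_form_alt:
  assumes "\<eta> \<in> tensor_forms M \<pi> p A"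
  shows "\<eta> e \<in> alt_forms_at M p (\<pi> e)"
proof -
  obtain n :: nat and \<omega> f where *: "\<forall>i<n. \<omega> i \<in> base_forms M p \<and> f i \<in> A" "\<eta> = (\<lambda>e vs. \<Sum>i<n. f i e * \<omega> i (\<pi> e) vs)"
    using assms unfolding tensor_forms_def by blast
  show ?thesis unfolding *(2)
    by (intro alt_forms_sum alt_forms_scale) (use *(1) in \<open>simp add: base_forms_def\<close>)
qed

lemma alt_forms_outside: "w \<in> alt_forms_at M p b \<Longrightarrow> \<not> (length vs = p \<and> set vs \<subseteq> tangent M b) \<Longrightarrow> w vs = 0"
  by (simp add: alt_forms_at_def)

text \<open>Every list of tangent vectors of \<open>M\<close> is the list of values of some vector fields. So a form is determined
  by its values on vector fields, and the definite descriptions of derivatives of forms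
  have at most one solution.\<close>

lemma form_eqI:
  assumes \<eta>: "\<And>e. \<eta> e \<in> alt_forms_at M p (\<pi> e)" and \<zeta>: "\<And>e. \<zeta> e \<in> alt_forms_at M p (\<pi> e)"
    and eq: "\<And>us. length us = p \<Longrightarrow> set us \<subseteq> vector_fields M \<Longrightarrow> on_fields \<pi> \<eta> us = on_fields \<pi> \<zeta> us"
  shows "\<eta> = \<zeta>"
proof (intro ext)
  fix e vs
  show "\<eta> e vs = \<zeta> e vs"
  proof (cases "length vs = p \<and> set vs \<subseteq> tangent M (\<pi> e)")
    case True
    define ext where "ext = (\<lambda>v. SOME X. X \<in> vector_fields M \<and> X (\<pi> e) = v)"
    have ext: "ext v \<in> vector_fields M \<and> ext v (\<pi> e) = v" if v: "v \<in> tangent M (\<pi> e)" for v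
    proof -
      obtain X where X: "X \<in> vector_fields M" "X (\<pi> e) = v" using extend_tangent[OF v] by blast
      then have "\<exists>X. X \<in> vector_fields M \<and> X (\<pi> e) = v" by blast
      then show ?thesis unfolding ext_def by (rule someI_ex)
    qed
    have "length (map ext vs) = p" "set (map ext vs) \<subseteq> vector_fields M" using True ext by auto
    from eq[OF this] have "\<eta> e (map (\<lambda>u. u (\<pi> e)) (map ext vs)) = \<zeta> e (map (\<lambda>u. u (\<pi> e)) (map ext vs))"
      by (simp only: on_fields_def fun_eq_iff)
    moreover have "map (\<lambda>u. u (\<pi> e)) (map ext vs) = vs"
      unfolding map_map using True ext by (intro map_idI) auto
    ultimately show ?thesis by simp
  next
    case False
    then show ?thesis using alt_forms_outside[OF \<eta> False] alt_forms_outside[OF \<zeta> False] by simp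
  qed
qed

definition dform :: "('m \<Rightarrow> real) \<Rightarrow> 'm \<Rightarrow> 'm tvec list \<Rightarrow> real" where
  "dform f = (\<lambda>b vs. if length vs = 1 \<and> set vs \<subseteq> tangent M b then (vs ! 0) f else 0)"

definition dwedge :: "('m \<Rightarrow> real) \<Rightarrow> ('m \<Rightarrow> real) \<Rightarrow> 'm \<Rightarrow> 'm tvec list \<Rightarrow> real" where
  "dwedge f g = (\<lambda>b vs. if length vs = 2 \<and> set vs \<subseteq> tangent M b
     then (vs ! 0) f * (vs ! 1) g - (vs ! 0) g * (vs ! 1) f else 0)"

lemma length1: "length vs = 1 \<Longrightarrow> \<exists>a. vs = [a]" by (auto simp: length_Suc_conv)
lemma length2: "length vs = 2 \<Longrightarrow> \<exists>a b. vs = [a, b]" by (auto simp: numeral_2_eq_2 length_Suc_conv)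

lemma dform_base: "f \<in> C \<Longrightarrow> dform f \<in> base_forms M 1"
proof -
  assume f: "f \<in> C"
  have "dform f b \<in> alt_forms_at M 1 b" for b
    unfolding alt_forms_at_def
  proof (intro CollectI conjI allI impI ballI)
    fix vs :: "'m tvec list" and i :: nat assume h: "length vs = 1" "set vs \<subseteq> tangent M b" "i < 1"
    obtain a0 where a0: "vs = [a0]" using length1[OF h(1)] by blast
    have a: "vs = [a0]" "i = 0" "a0 \<in> tangent M b" using a0 h by simp_all
    show "dform f b (vs[i := v + v']) = dform f b (vs[i := v]) + dform f b (vs[i := v'])"
      if "v \<in> tangent M b" "v' \<in> tangent M b" for v v'
      using a that tangent_plus[OF that] by (simp add: dform_def)
    show "dform f b (vs[i := (\<lambda>f. c * v f)]) = c * dform f b (vs[i := v])" if "v \<in> tangent M b" for c v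
      using a that tangent_scaled[OF that, of c] by (simp add: dform_def)
  qed (auto simp: dform_def)
  moreover have "(\<lambda>b. dform f b (map (\<lambda>u. u b) us)) \<in> C" if us: "length us = 1" "set us \<subseteq> vector_fields M" for us
  proof -
    obtain X where "us = [X]" using length1[OF us(1)] by blast
    then have X: "us = [X]" "X \<in> vector_fields M" using us(2) by simp_all
    then have "(\<lambda>b. dform f b (map (\<lambda>u. u b) us)) = app X f"
      using vector_field_tangent[OF X(2)] by (simp add: dform_def app_def)
    then show ?thesis using X f by simp
  qed
  ultimately show ?thesis by (simp add: base_forms_def)
qed

lemma dwedge_base: "f \<in> C \<Longrightarrow> g \<in> C \<Longrightarrow> dwedge f g \<in> base_forms M 2"
proof -
  assume f: "f \<in> C" and g: "g \<in> C"
  have out: "dwedge f g b vs = 0" if "\<not> (length vs = 2 \<and> set vs \<subseteq> tangent M b)" for b vs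
    unfolding dwedge_def using that by (rule if_not_P)
  have lin: "dwedge f g b (vs[i := v + v']) = dwedge f g b (vs[i := v]) + dwedge f g b (vs[i := v']) \<and>
      dwedge f g b (vs[i := (\<lambda>f. c * v f)]) = c * dwedge f g b (vs[i := v])"
    if h: "length vs = 2" "set vs \<subseteq> tangent M b" "i < 2" and v: "v \<in> tangent M b" "v' \<in> tangent M b"
    for b vs i v v' c
  proof -
    obtain a0 a1 where a0: "vs = [a0, a1]" using length2[OF h(1)] by blast
    have a: "a0 \<in> tangent M b" "a1 \<in> tangent M b" using a0 h(2) by simp_all
    have "i = 0 \<or> i = 1" using h(3) by linarith
    then show ?thesis
      using a v tangent_plus[OF v] tangent_scaled[OF v(1), of c] unfolding a0
      by (elim disjE) (simp_all add: dwedge_def algebra_simps)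
  qed
  have alt: "dwedge f g b vs = 0" if "vs ! 0 = vs ! 1" for b vs
    unfolding dwedge_def that by simp
  have "dwedge f g b \<in> alt_forms_at M 2 b" for b
    unfolding alt_forms_at_def
  proof (rule CollectI, intro conjI)
    show "\<forall>vs. \<not> (length vs = 2 \<and> set vs \<subseteq> tangent M b) \<longrightarrow> dwedge f g b vs = 0"
      using out by blast
    show "\<forall>vs i. length vs = 2 \<longrightarrow> set vs \<subseteq> tangent M b \<longrightarrow> i < 2 \<longrightarrow>
        (\<forall>v\<in>tangent M b. \<forall>v'\<in>tangent M b. dwedge f g b (vs[i := v + v']) = dwedge f g b (vs[i := v]) + dwedge f g b (vs[i := v'])) \<and>
        (\<forall>c. \<forall>v\<in>tangent M b. dwedge f g b (vs[i := (\<lambda>f. c * v f)]) = c * dwedge f g b (vs[i := v]))"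
      using lin by simp
    show "\<forall>vs i j. length vs = 2 \<longrightarrow> set vs \<subseteq> tangent M b \<longrightarrow> i < j \<longrightarrow> j < 2 \<longrightarrow> vs ! i = vs ! j \<longrightarrow> dwedge f g b vs = 0"
    proof (intro allI impI)
      fix vs :: "'m tvec list" and i j :: nat assume h: "i < j" "j < 2" "vs ! i = vs ! j"
      have ij: "i = 0" "j = 1" using h(1,2) by linarith+
      show "dwedge f g b vs = 0" by (rule alt) (use h(3) in \<open>simp only: ij\<close>)
    qed
  qed
  moreover have "(\<lambda>b. dwedge f g b (map (\<lambda>u. u b) us)) \<in> C" if us: "length us = 2" "set us \<subseteq> vector_fields M" for us
  proof -
    obtain X X' where "us = [X, X']" using length2[OF us(1)] by blast
    then have X: "us = [X, X']" "X \<in> vector_fields M" "X' \<in> vector_fields M" using us(2) by simp_all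
    then have "(\<lambda>b. dwedge f g b (map (\<lambda>u. u b) us)) = app X f * app X' g - app X g * app X' f"
      using vector_field_tangent[OF X(2)] vector_field_tangent[OF X(3)] by (simp add: dwedge_def app_def fun_eq_iff)
    then show ?thesis using X f g by (simp add: C_inf_diff C_inf_mult)
  qed
  ultimately show ?thesis by (simp add: base_forms_def)
qed

lemma tensor_formsI:
  assumes "\<And>i. i < n \<Longrightarrow> \<omega> i \<in> base_forms M p" "\<And>i. i < (n::nat) \<Longrightarrow> f i \<in> A"
  shows "(\<lambda>e vs. \<Sum>i<n. f i e * \<omega> i (\<pi> e) vs) \<in> tensor_forms M \<pi> p A"
  unfolding tensor_forms_def using assms by blast

lemma tensor_forms_finite:
  assumes "finite I" "\<And>i. i \<in> I \<Longrightarrow> \<omega> i \<in> base_forms M p" "\<And>i. i \<in> I \<Longrightarrow> f i \<in> A"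
  shows "(\<lambda>e vs. \<Sum>i\<in>I. f i e * \<omega> i (\<pi> e) vs) \<in> tensor_forms M \<pi> p A"
proof -
  obtain h where h: "bij_betw h {..<card I} I" using ex_bij_betw_nat_finite[OF assms(1)] by (auto simp: atLeast0LessThan)
  have hI: "h i \<in> I" if "i < card I" for i using bij_betwE[OF h] that by auto
  have "(\<lambda>e vs. \<Sum>i<card I. f (h i) e * \<omega> (h i) (\<pi> e) vs) \<in> tensor_forms M \<pi> p A"
    by (rule tensor_formsI[where \<omega> = "\<lambda>i. \<omega> (h i)" and f = "\<lambda>i. f (h i)"]) (use assms(2,3) hI in blast)+
  moreover have "(\<Sum>i<card I. f (h i) e * \<omega> (h i) (\<pi> e) vs) = (\<Sum>i\<in>I. f i e * \<omega> i (\<pi> e) vs)" for e vs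
    by (rule sum.reindex_bij_betw[OF h])
  ultimately show ?thesis by simp
qed

end

section \<open>The dictionary between a coupling tensor and its geometric data\<close>

text \<open>The frames of the total space and of the base are auxiliary data, on which the spaces and maps of
  the theorem do not depend.\<close>

locale coupling_bundle = E: framed_manifold E rE yE uE + B: framed_manifold B r y u
  for E :: "'e::{second_countable_topology, t2_space} smooth_structure" and rE yE uE
    and B :: "'b::{second_countable_topology, t2_space} smooth_structure" and r y u +
  fixes \<pi> :: "'e \<Rightarrow> 'b" and \<Theta> :: "'e bifield" and \<gamma> :: "'e \<Rightarrow> 'e tvec \<Rightarrow> 'e tvec"
    and \<sigma> :: "('e, 'b) bform" and P :: "'e bifield"
  assumes fib: "fiber_bundle E B \<pi>" and poisson: "poisson_tensor E \<Theta>"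
    and coupling: "coupling E B \<pi> \<Theta>" and data: "geometric_data E B \<pi> \<Theta> \<gamma> \<sigma> P"
begin

abbreviation "Vert \<equiv> vertical E B \<pi>"
abbreviation "Hz \<equiv> horizontal E B \<pi> \<Theta>"
abbreviation "Ann \<equiv> ann_vertical E B \<pi>"
abbreviation "push \<equiv> pushforward B \<pi>"
abbreviation "Hor \<equiv> hor E B \<pi> \<gamma>"

lemma pullback_C [simp]: "g \<in> C_inf B \<Longrightarrow> g \<circ> \<pi> \<in> C_inf E"
  using fib smooth_map_comp by (auto simp: fiber_bundle_def)

lemma push_tangent: "v \<in> tangent E e \<Longrightarrow> push v \<in> tangent B (\<pi> e)"
  using fib by (auto simp: fiber_bundle_def)

lemma push_apply: "g \<in> C_inf B \<Longrightarrow> push v g = v (g \<circ> \<pi>)"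
  by (simp add: pushforward_def)

lemma vertical_iff: "v \<in> Vert e \<longleftrightarrow> v \<in> tangent E e \<and> (\<forall>g\<in>C_inf B. v (g \<circ> \<pi>) = 0)"
  by (auto simp: vertical_def pushforward_def fun_eq_iff)

lemma vertical_tangent: "v \<in> Vert e \<Longrightarrow> v \<in> tangent E e"
  by (simp add: vertical_iff)

lemma vertical_0: "0 \<in> Vert e"
  by (simp add: vertical_iff E.tangent_0)

lemma vertical_add: "v \<in> Vert e \<Longrightarrow> w \<in> Vert e \<Longrightarrow> v + w \<in> Vert e"
  by (simp add: vertical_iff E.tangent_plus)

lemma vertical_scale: "v \<in> Vert e \<Longrightarrow> (\<lambda>f. c * v f) \<in> Vert e"
  by (simp add: vertical_iff E.tangent_scaled)

lemma T_biv: "\<Theta> \<in> bivector_fields E (tangent E)"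
  using poisson by (simp add: poisson_tensor_def)

lemma P_vert: "P \<in> bivector_fields E Vert"
  using data by (simp add: geometric_data_def)

lemma P_biv: "P \<in> bivector_fields E (tangent E)"
proof -
  have "bivector_fields E Vert \<subseteq> bivector_fields E (tangent E)"
    by (rule E.bivector_fields_mono) (rule subsetI, rule vertical_tangent)
  then show ?thesis using P_vert by blast
qed

end

sublocale coupling_bundle \<subseteq> T: framed_bivector E rE yE uE \<Theta>
  by unfold_locales (rule T_biv)

sublocale coupling_bundle \<subseteq> V: framed_bivector E rE yE uE P
  by unfold_locales (rule P_biv)

context coupling_bundle begin

lemma P_wedge: "P e \<in> wedge2 E e (Vert e)"
  using P_vert by (simp add: bivector_fields_def)

lemma P_sharp_vertical: "sharp_at E e (P e) a \<in> Vert e"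
  by (rule E.wedge2_sharp(1)[OF P_wedge _ vertical_0])
    (blast intro: vertical_tangent vertical_add vertical_scale)+

lemma ham_P_vertical: "V.ham f e \<in> Vert e"
  unfolding V.ham_def sharp_def by (rule P_sharp_vertical)

lemma Ann_cot: "a \<in> Ann e \<Longrightarrow> a \<in> cotangent E e"
  by (simp add: ann_vertical_def)

lemma Ann_vert: "a \<in> Ann e \<Longrightarrow> v \<in> Vert e \<Longrightarrow> a v = 0"
  by (simp add: ann_vertical_def)

lemma P_Ann: "a \<in> Ann e \<Longrightarrow> P e b a = 0" "a \<in> Ann e \<Longrightarrow> P e a b = 0"
proof -
  show *: "P e b a = 0" if "a \<in> Ann e" for a b
    using E.wedge2_sharp_tangent(2)[OF V.wedge Ann_cot[OF that], of b] Ann_vert[OF that P_sharp_vertical] by simp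
  show "P e a b = 0" if "a \<in> Ann e" for a b
    using *[OF that, of b] V.skew[of e a b] by simp
qed

lemma differential_Ann: "g \<in> C_inf B \<Longrightarrow> differential E (g \<circ> \<pi>) e \<in> Ann e"
  unfolding ann_vertical_def using E.differential_cotangent by (auto simp: vertical_iff)

lemma Hz_tangent: "h \<in> Hz e \<Longrightarrow> h \<in> tangent E e"
  unfolding horizontal_def using E.wedge2_sharp_tangent(1)[OF T.wedge] by blast

text \<open>The contraction of \<open>\<Theta>\<close> with a combination of covectors is the combination of the contractions: linearity
  in the first argument follows from linearity in the second by skew-symmetry.\<close>

lemma Hz_sum:
  assumes "\<And>i. i \<in> I \<Longrightarrow> h i \<in> Hz e"
  shows "(\<Sum>i\<in>I. (\<lambda>f. c i * h i f)) \<in> Hz e"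
proof -
  have "\<forall>i\<in>I. \<exists>a. a \<in> Ann e \<and> h i = sharp_at E e (\<Theta> e) a"
    using assms unfolding horizontal_def by blast
  from bchoice[OF this] obtain a where a: "\<forall>i\<in>I. a i \<in> Ann e \<and> h i = sharp_at E e (\<Theta> e) (a i)" ..
  define A where "A = (\<lambda>v. \<Sum>i\<in>I. c i * a i v)"
  have ai: "a i \<in> cotangent E e" if "i \<in> I" for i using a that Ann_cot by blast
  have Acot: "A \<in> cotangent E e"
    unfolding cotangent_def A_def
  proof (intro CollectI conjI allI impI ballI)
    show "(\<Sum>i\<in>I. c i * a i v) = 0" if "v \<notin> tangent E e" for v
      by (rule sum.neutral) (simp add: E.cotangent_outside[OF ai that])
    show "(\<Sum>i\<in>I. c i * a i (v + w)) = (\<Sum>i\<in>I. c i * a i v) + (\<Sum>i\<in>I. c i * a i w)"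
      if "v \<in> tangent E e" "w \<in> tangent E e" for v w
      unfolding sum.distrib[symmetric]
      by (rule sum.cong[OF refl]) (simp add: E.cotangent_add[OF ai that] distrib_left)
    show "(\<Sum>i\<in>I. c i * a i (\<lambda>f. k * v f)) = k * (\<Sum>i\<in>I. c i * a i v)" if "v \<in> tangent E e" for k v
      unfolding sum_distrib_left
      by (rule sum.cong[OF refl]) (simp add: E.cotangent_scale[OF ai that])
  qed
  have "A \<in> Ann e"
    unfolding ann_vertical_def using Acot a Ann_vert by (auto simp: A_def intro!: sum.neutral)
  moreover have "(\<Sum>i\<in>I. (\<lambda>f. c i * h i f)) = sharp_at E e (\<Theta> e) A"
  proof (rule E.tangent_eq_by_cotangent[of _ e])
    show "(\<Sum>i\<in>I. (\<lambda>f. c i * h i f)) \<in> tangent E e"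
      by (intro E.tangent_sum_vectors E.tangent_scaled Hz_tangent assms)
    show "sharp_at E e (\<Theta> e) A \<in> tangent E e" by (rule E.wedge2_sharp_tangent(1)[OF T.wedge])
    fix b assume b: "b \<in> cotangent E e"
    obtain s where s: "s \<in> tangent E e" "\<And>d. d \<in> cotangent E e \<Longrightarrow> \<Theta> e d b = - d s"
      by (rule T.contraction[where p = e and a = b]) (rule that)
    have "b (\<Sum>i\<in>I. (\<lambda>f. c i * h i f)) = (\<Sum>i\<in>I. c i * b (h i))"
      by (rule E.cotangent_sum[OF b]) (rule Hz_tangent[OF assms])
    also have "\<dots> = (\<Sum>i\<in>I. c i * - (a i s))"
    proof (rule sum.cong[OF refl])
      fix i assume i: "i \<in> I"
      have "b (h i) = \<Theta> e (a i) b" using a i E.wedge2_sharp_tangent(2)[OF T.wedge b, of "a i"] by simp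
      then show "c i * b (h i) = c i * - (a i s)" using s(2)[OF ai[OF i]] by simp
    qed
    also have "\<dots> = - A s" by (simp add: A_def sum_negf)
    also have "\<dots> = \<Theta> e A b" using s(2)[OF Acot] by simp
    also have "\<dots> = b (sharp_at E e (\<Theta> e) A)" using E.wedge2_sharp_tangent(2)[OF T.wedge b] by simp
    finally show "b (\<Sum>i\<in>I. (\<lambda>f. c i * h i f)) = b (sharp_at E e (\<Theta> e) A)" .
  qed
  ultimately show ?thesis unfolding horizontal_def by blast
qed

lemma Hz_0: "0 \<in> Hz e"
  using Hz_sum[of "{}" undefined e undefined] by simp

lemma Hz_scale: "h \<in> Hz e \<Longrightarrow> (\<lambda>f. c * h f) \<in> Hz e"
  using Hz_sum[of "{0::nat}" "\<lambda>_. h" e "\<lambda>_. c"] by simp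

lemma Hz_add: "h \<in> Hz e \<Longrightarrow> h' \<in> Hz e \<Longrightarrow> h + h' \<in> Hz e"
  using Hz_sum[of "UNIV :: bool set" "\<lambda>b. if b then h else h'" e "\<lambda>_. 1"] by (simp add: UNIV_bool add.commute)

lemma Hz_neg: "h \<in> Hz e \<Longrightarrow> - h \<in> Hz e"
  using Hz_scale[of h e "-1"] by (simp add: fun_Compl_def)

lemma Hz_minus: "h \<in> Hz e \<Longrightarrow> h' \<in> Hz e \<Longrightarrow> h - h' \<in> Hz e"
  using Hz_add[of h e "- h'"] Hz_neg[of h' e] by (simp only: add_uminus_conv_diff)

lemma decompose:
  assumes "v \<in> tangent E e"
  obtains h w where "h \<in> Hz e" "w \<in> Vert e" "v = h + w"
proof -
  have "tangent E e = {h + v | h v. h \<in> Hz e \<and> v \<in> Vert e}"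
    using coupling[unfolded coupling_def, THEN spec, of e] by (rule conjunct1)
  then have "v \<in> {h + v | h v. h \<in> Hz e \<and> v \<in> Vert e}" using assms by (simp only:)
  then obtain h w where "v = h + w \<and> h \<in> Hz e \<and> w \<in> Vert e" unfolding mem_Collect_eq by (elim exE)
  then show ?thesis using that[of h w] by blast
qed

lemma Hz_Vert_0:
  assumes "h \<in> Hz e" "h \<in> Vert e"
  shows "h = 0"
proof -
  have "Hz e \<inter> Vert e = {0}"
    using coupling[unfolded coupling_def, THEN spec, of e] by (rule conjunct2)
  moreover have "h \<in> Hz e \<inter> Vert e" using assms by (rule IntI)
  ultimately show ?thesis by simp
qed

lemma Hz_eqI:
  assumes "h \<in> Hz e" "h' \<in> Hz e" "\<And>g. g \<in> C_inf B \<Longrightarrow> h (g \<circ> \<pi>) = h' (g \<circ> \<pi>)"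
  shows "h = h'"
proof -
  have "h - h' \<in> Vert e"
    using assms(3) E.tangent_minus[OF Hz_tangent[OF assms(1)] Hz_tangent[OF assms(2)]] by (simp add: vertical_iff)
  then have "h - h' = 0" by (rule Hz_Vert_0[OF Hz_minus[OF assms(1,2)]])
  then show ?thesis by simp
qed

text \<open>By skew-symmetry \<open>a (\<Theta>\<^sup>\<sharp> b) = - b (\<Theta>\<^sup>\<sharp> a)\<close>. So \<open>\<Theta>\<^sup>\<sharp> a\<close> determines the values of \<open>a\<close> on horizontal vectors;
  on vertical vectors \<open>a\<close> vanishes.\<close>

lemma sharp_inj_Ann:
  assumes "a \<in> Ann e" "a' \<in> Ann e" "sharp_at E e (\<Theta> e) a = sharp_at E e (\<Theta> e) a'"
  shows "a = a'"
proof (rule E.cotangent_eqI[OF Ann_cot[OF assms(1)] Ann_cot[OF assms(2)]])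
  fix v assume "v \<in> tangent E e"
  then obtain h w where hw: "h \<in> Hz e" "w \<in> Vert e" "v = h + w" by (rule decompose)
  obtain b where b: "b \<in> Ann e" "h = sharp_at E e (\<Theta> e) b" using hw(1) unfolding horizontal_def by blast
  have ev: "d h = - b (sharp_at E e (\<Theta> e) d)" if "d \<in> Ann e" for d
    using E.wedge2_sharp_tangent(2)[OF T.wedge Ann_cot[OF that], of b] E.wedge2_sharp_tangent(2)[OF T.wedge Ann_cot[OF b(1)], of d]
      T.skew[of e b d] b(2) by simp
  have "a h = a' h" using ev[OF assms(1)] ev[OF assms(2)] assms(3) by simp
  then show "a v = a' v"
    using E.cotangent_add[OF Ann_cot[OF assms(1)] Hz_tangent[OF hw(1)] vertical_tangent[OF hw(2)]]
      E.cotangent_add[OF Ann_cot[OF assms(2)] Hz_tangent[OF hw(1)] vertical_tangent[OF hw(2)]]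
      Ann_vert[OF assms(1) hw(2)] Ann_vert[OF assms(2) hw(2)] hw(3) by simp
qed

lemma horizontal_part:
  obtains \<Theta>H where "\<And>e. \<Theta>H e \<in> wedge2 E e (Hz e)" "\<And>e a b. \<Theta> e a b = \<Theta>H e a b + P e a b"
    "\<And>e X Y. X \<in> Hz e \<Longrightarrow> Y \<in> tangent E e \<Longrightarrow>
      \<sigma> e [push X, push Y] = - inv_into (Ann e) (sharp_at E e (\<Theta>H e)) X Y"
proof -
  obtain \<Theta>H where *: "\<Theta>H \<in> bivector_fields E Hz" "\<Theta> = \<Theta>H + P"
    "\<forall>e. \<forall>X \<in> Hz e. \<forall>Y \<in> tangent E e. pullback B \<pi> \<sigma> e [X, Y] = - inv_into (Ann e) (sharp_at E e (\<Theta>H e)) X Y"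
    using data unfolding geometric_data_def by blast
  show ?thesis
  proof (rule that[of \<Theta>H])
    show "\<Theta>H e \<in> wedge2 E e (Hz e)" for e using *(1) by (simp add: bivector_fields_def)
    show "\<Theta> e a b = \<Theta>H e a b + P e a b" for e a b by (simp add: *(2))
    show "\<sigma> e [push X, push Y] = - inv_into (Ann e) (sharp_at E e (\<Theta>H e)) X Y"
      if "X \<in> Hz e" "Y \<in> tangent E e" for e X Y
      using *(3) that by (simp add: pullback_def)
  qed
qed

text \<open>The tensors \<open>\<Theta>\<close> and \<open>\<Theta>H\<close> have the same contraction with a covector that annihilates vertical vectors,
  as \<open>P\<close> contributes nothing. Hence \<open>\<sigma>\<close> can be expressed by \<open>\<Theta>\<close> itself.\<close>

lemma sigma_representation:
  assumes X: "X \<in> Hz e"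
  obtains a where "a \<in> Ann e" "X = sharp_at E e (\<Theta> e) a" "\<And>Y. Y \<in> tangent E e \<Longrightarrow> a Y = - \<sigma> e [push X, push Y]"
proof -
  obtain \<Theta>H where H: "\<And>e. \<Theta>H e \<in> wedge2 E e (Hz e)" "\<And>e a b. \<Theta> e a b = \<Theta>H e a b + P e a b"
    "\<And>e X Y. X \<in> Hz e \<Longrightarrow> Y \<in> tangent E e \<Longrightarrow>
      \<sigma> e [push X, push Y] = - inv_into (Ann e) (sharp_at E e (\<Theta>H e)) X Y"
    by (rule horizontal_part) (rule that)
  have same: "sharp_at E e (\<Theta>H e) a = sharp_at E e (\<Theta> e) a" if "a \<in> Ann e" for a
    unfolding sharp_at_def H(2) P_Ann(2)[OF that] by simp
  have "X \<in> sharp_at E e (\<Theta>H e) ` Ann e"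
    using X same unfolding horizontal_def by (metis (no_types, lifting) image_cong)
  then have "inv_into (Ann e) (sharp_at E e (\<Theta>H e)) X \<in> Ann e"
    "sharp_at E e (\<Theta>H e) (inv_into (Ann e) (sharp_at E e (\<Theta>H e)) X) = X"
    by (rule inv_into_into, rule f_inv_into_f)
  then show ?thesis using H(3)[OF X] same by (intro that[of "inv_into (Ann e) (sharp_at E e (\<Theta>H e)) X"]) simp_all
qed

lemma ham_pullback_Hz: "g \<in> C_inf B \<Longrightarrow> T.ham (g \<circ> \<pi>) e \<in> Hz e"
  unfolding T.ham_def sharp_def horizontal_def by (rule imageI[OF differential_Ann])

lemma sigma_ham:
  assumes "g \<in> C_inf B" "Y \<in> tangent E e"
  shows "\<sigma> e [push (T.ham (g \<circ> \<pi>) e), push Y] = - Y (g \<circ> \<pi>)"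
proof -
  obtain a where a: "a \<in> Ann e" "T.ham (g \<circ> \<pi>) e = sharp_at E e (\<Theta> e) a"
    "\<And>Y. Y \<in> tangent E e \<Longrightarrow> a Y = - \<sigma> e [push (T.ham (g \<circ> \<pi>) e), push Y]"
    by (rule sigma_representation[OF ham_pullback_Hz[OF assms(1)]]) (rule that)
  have "a = differential E (g \<circ> \<pi>) e"
    by (rule sharp_inj_Ann[OF a(1) differential_Ann[OF assms(1)]]) (simp add: a(2)[symmetric] T.ham_def sharp_def)
  then show ?thesis using a(3)[OF assms(2)] assms(2) by simp
qed

text \<open>A lift of \<open>w\<close> exists because \<open>\<pi>\<close> is a submersion; its horizontal part is again a lift. Two horizontal
  lifts differ by a vector that is both horizontal and vertical, hence \<open>0\<close>.\<close>

lemma Hor: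
  assumes w: "w \<in> vector_fields B"
  shows "Hor w e \<in> Hz e" "push (Hor w e) = w (\<pi> e)"
proof -
  have \<gamma>: "\<gamma> e (h + v) = v" if "h \<in> Hz e" "v \<in> Vert e" for h v
    using data that by (simp add: geometric_data_def)
  have "push ` tangent E e = tangent B (\<pi> e)" using fib unfolding fiber_bundle_def by blast
  then have "w (\<pi> e) \<in> push ` tangent E e" using B.vector_field_tangent[OF w, of "\<pi> e"] by (simp only:)
  then obtain v where v0: "w (\<pi> e) = push v" "v \<in> tangent E e" by (rule imageE)
  have v: "v \<in> tangent E e" "push v = w (\<pi> e)" using v0 by (simp_all only:)
  obtain h x where hx: "h \<in> Hz e" "x \<in> Vert e" "v = h + x" using v(1) by (rule decompose)
  have push_h: "push h = w (\<pi> e)"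
  proof -
    have "push h g = push v g" for g
      using hx(2) unfolding hx(3) by (cases "g \<in> C_inf B") (simp_all add: pushforward_def vertical_iff)
    then have "push h = push v" by (rule ext)
    then show ?thesis unfolding v(2) .
  qed
  have "Hor w e = h"
    unfolding hor_def
  proof (rule the_equality)
    show "h \<in> tangent E e \<and> \<gamma> e h = 0 \<and> push h = w (\<pi> e)"
      using Hz_tangent[OF hx(1)] push_h \<gamma>[OF hx(1) vertical_0] by simp
    fix v' assume v': "v' \<in> tangent E e \<and> \<gamma> e v' = 0 \<and> push v' = w (\<pi> e)"
    then have "v' \<in> tangent E e" by simp
    then obtain h' x' where h': "h' \<in> Hz e" "x' \<in> Vert e" "v' = h' + x'" by (rule decompose)
    have "x' = 0" using v' \<gamma>[OF h'(1,2)] h'(3) by simp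
    then have v'h: "v' = h'" using h'(3) by simp
    show "v' = h"
    proof (rule Hz_eqI)
      show "v' \<in> Hz e" using v'h h'(1) by simp
      show "h \<in> Hz e" by (rule hx(1))
      show "v' (g \<circ> \<pi>) = h (g \<circ> \<pi>)" if "g \<in> C_inf B" for g
        using v' push_h push_apply[OF that, of v'] push_apply[OF that, of h] by simp
    qed
  qed
  then show "Hor w e \<in> Hz e" "push (Hor w e) = w (\<pi> e)" using hx(1) push_h by simp_all
qed

lemma Hor_tangent: "w \<in> vector_fields B \<Longrightarrow> Hor w e \<in> tangent E e"
  by (rule Hz_tangent[OF Hor(1)])

lemma Hor_pullback:
  assumes w: "w \<in> vector_fields B" and g: "g \<in> C_inf B"
  shows "app (Hor w) (g \<circ> \<pi>) = app w g \<circ> \<pi>"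
proof
  fix e
  have "push (Hor w e) g = Hor w e (g \<circ> \<pi>)" by (rule push_apply[OF g])
  then show "app (Hor w) (g \<circ> \<pi>) e = (app w g \<circ> \<pi>) e"
    unfolding Hor(2)[OF w] app_def comp_def by (rule sym)
qed

text \<open>The functions \<open>ba a\<close> and fields \<open>Ha a\<close> are the lifts of the frame \<open>y a\<close>, \<open>u a\<close> of the base. They play the role
  of a frame for the horizontal bundle.\<close>

definition ba :: "nat \<Rightarrow> 'e \<Rightarrow> real" where "ba a = y a \<circ> \<pi>"
definition Ha :: "nat \<Rightarrow> 'e vfield" where "Ha a = Hor (u a)"

lemma ba_C [simp]: "a < r \<Longrightarrow> ba a \<in> C_inf E" by (simp add: ba_def)

lemma push_frame: "v \<in> tangent E e \<Longrightarrow> push v = (\<Sum>a<r. (\<lambda>g. v (ba a) * u a (\<pi> e) g))"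
proof -
  assume v: "v \<in> tangent E e"
  have "push v = (\<Sum>a<r. (\<lambda>g. push v (y a) * u a (\<pi> e) g))" by (rule B.frame_sum[OF push_tangent[OF v]])
  also have "\<dots> = (\<Sum>a<r. (\<lambda>g. v (ba a) * u a (\<pi> e) g))"
    by (rule sum.cong[OF refl]) (simp add: push_apply ba_def)
  finally show ?thesis .
qed

lemma Hz_frame:
  assumes h: "h \<in> Hz e"
  shows "h f = (\<Sum>a<r. h (ba a) * Ha a e f)"
proof -
  have "h = (\<Sum>a<r. (\<lambda>f. h (ba a) * Ha a e f))"
  proof (rule Hz_eqI[OF h])
    show "(\<Sum>a<r. (\<lambda>f. h (ba a) * Ha a e f)) \<in> Hz e"
      by (rule Hz_sum) (simp add: Ha_def Hor(1))
    fix g assume g: "g \<in> C_inf B"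
    have "Ha a e (g \<circ> \<pi>) = u a (\<pi> e) g" if "a < r" for a
      using push_apply[OF g, of "Ha a e"] Hor(2)[of "u a" e] that by (simp add: Ha_def)
    then show "h (g \<circ> \<pi>) = (\<Sum>a<r. (\<lambda>f. h (ba a) * Ha a e f)) (g \<circ> \<pi>)"
      using fun_cong[OF push_frame[OF Hz_tangent[OF h]], of g] by (simp add: push_apply[OF g] sum_fun_apply)
  qed
  from fun_cong[OF this, of f] show ?thesis unfolding sum_fun_apply .
qed

lemma vertical_part:
  assumes v: "v \<in> tangent E e"
  shows "v - (\<Sum>a<r. (\<lambda>f. v (ba a) * Ha a e f)) \<in> Vert e"
proof -
  have t: "(\<Sum>a<r. (\<lambda>f. v (ba a) * Ha a e f)) \<in> tangent E e"
    by (intro E.tangent_sum_vectors E.tangent_scaled) (simp add: Ha_def Hor_tangent)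
  have "v (g \<circ> \<pi>) = (\<Sum>a<r. (\<lambda>f. v (ba a) * Ha a e f)) (g \<circ> \<pi>)" if g: "g \<in> C_inf B" for g
  proof -
    have "Ha a e (g \<circ> \<pi>) = u a (\<pi> e) g" if "a < r" for a
      using push_apply[OF g, of "Ha a e"] Hor(2)[of "u a" e] that by (simp add: Ha_def)
    then show ?thesis
      using fun_cong[OF push_frame[OF v], of g] by (simp add: push_apply[OF g] sum_fun_apply)
  qed
  then show ?thesis using E.tangent_minus[OF v t] by (simp add: vertical_iff)
qed

definition sg :: "'b vfield \<Rightarrow> 'b vfield \<Rightarrow> 'e \<Rightarrow> real" where
  "sg w z = on_fields \<pi> \<sigma> [w, z]"

lemma sg_apply: "sg w z e = \<sigma> e [w (\<pi> e), z (\<pi> e)]"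
  by (simp add: sg_def on_fields_def)

lemma sigma_form: "\<sigma> \<in> Omega_B E B \<pi> 2"
  using data by (simp add: geometric_data_def)

lemma sigma_alt: "\<sigma> e \<in> alt_forms_at B 2 (\<pi> e)"
  by (rule B.tensor_form_alt[OF sigma_form[unfolded Omega_B_def]])

lemma sg_skew:
  assumes "w \<in> vector_fields B" "z \<in> vector_fields B"
  shows "sg w z = - sg z w"
proof
  fix e
  show "sg w z e = (- sg z w) e"
    unfolding sg_apply uminus_apply
    by (rule B.alt2_skew[OF sigma_alt B.vector_field_tangent[OF assms(1)] B.vector_field_tangent[OF assms(2)]])
qed

lemma sigma_push_left:
  assumes "v \<in> tangent E e" "z \<in> tangent B (\<pi> e)"
  shows "\<sigma> e [push v, z] = (\<Sum>a<r. v (ba a) * \<sigma> e [u a (\<pi> e), z])"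
  unfolding push_frame[OF assms(1)]
  by (rule B.alt2_sum_left[OF sigma_alt _ assms(2)]) (simp add: B.frame_tangent)

lemma sg_expand:
  assumes "w \<in> vector_fields B" "z \<in> vector_fields B"
  shows "sg w z = (\<Sum>a<r. (app w (y a) \<circ> \<pi>) * sg (u a) z)"
proof
  fix e
  have "w (\<pi> e) = push (Hor w e)" by (rule Hor(2)[OF assms(1), symmetric])
  moreover have "Hor w e (ba a) = app w (y a) (\<pi> e)" if "a < r" for a
    using fun_cong[OF Hor_pullback[OF assms(1) B.frame_C[OF that]], of e] by (simp add: ba_def app_def)
  ultimately show "sg w z e = (\<Sum>a<r. (app w (y a) \<circ> \<pi>) * sg (u a) z) e"
    using sigma_push_left[OF Hor_tangent[OF assms(1)] B.vector_field_tangent[OF assms(2)], of e]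
    by (simp add: sg_apply sum_fun_apply)
qed

text \<open>Each of the two following identities says that \<open>\<sigma>\<close> inverts the horizontal part of \<open>\<Theta>\<close>.\<close>

lemma Hor_by_ham:
  assumes w: "w \<in> vector_fields B"
  shows "app (Hor w) f = - (\<Sum>a<r. sg w (u a) * app (T.ham (ba a)) f)"
proof
  fix e
  obtain a where a: "a \<in> Ann e" "Hor w e = sharp_at E e (\<Theta> e) a"
    "\<And>Y. Y \<in> tangent E e \<Longrightarrow> a Y = - \<sigma> e [push (Hor w e), push Y]"
    by (rule sigma_representation[OF Hor(1)[OF w]]) (rule that)
  let ?d = "differential E f e"
  define s where "s = T.ham f e"
  have s: "s \<in> tangent E e" unfolding s_def T.ham_def by (rule T.sharp_tangent)
  have "Hor w e f = ?d (sharp_at E e (\<Theta> e) a)" using Hor_tangent[OF w] a(2) by (metis E.differential_apply)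
  also have "\<dots> = \<Theta> e a ?d" by (rule E.wedge2_sharp_tangent(2)[OF T.wedge E.differential_cotangent])
  also have "\<dots> = - \<Theta> e ?d a" by (rule T.skew)
  also have "\<Theta> e ?d a = a s"
    unfolding s_def T.ham_def by (rule T.sharp_eval[OF Ann_cot[OF a(1)], symmetric])
  also have "a s = - \<sigma> e [w (\<pi> e), push s]" using a(3)[OF s] Hor(2)[OF w] by simp
  also have "- (- \<sigma> e [w (\<pi> e), push s]) = - \<sigma> e [push s, w (\<pi> e)]"
    using B.alt2_skew[OF sigma_alt B.vector_field_tangent[OF w] push_tangent[OF s]] by simp
  also have "\<sigma> e [push s, w (\<pi> e)] = (\<Sum>a<r. s (ba a) * \<sigma> e [u a (\<pi> e), w (\<pi> e)])"
    by (rule sigma_push_left[OF s B.vector_field_tangent[OF w]])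
  also have "\<dots> = (\<Sum>a<r. sg w (u a) e * app (T.ham (ba a)) f e)"
  proof (rule sum.cong[OF refl])
    fix a assume "a \<in> {..<r}"
    then have a: "a < r" by simp
    have "s (ba a) = - app (T.ham (ba a)) f e"
      using fun_cong[OF T.ham_skew[of f "ba a"], of e] by (simp add: s_def app_def)
    moreover have "\<sigma> e [u a (\<pi> e), w (\<pi> e)] = - sg w (u a) e"
      using fun_cong[OF sg_skew[OF w B.frame_vf[OF a]], of e] by (simp add: sg_apply)
    ultimately show "s (ba a) * \<sigma> e [u a (\<pi> e), w (\<pi> e)] = sg w (u a) e * app (T.ham (ba a)) f e" by simp
  qed
  finally show "app (Hor w) f e = (- (\<Sum>a<r. sg w (u a) * app (T.ham (ba a)) f)) e"
    by (simp add: app_def sum_fun_apply)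
qed

lemma ham_sigma:
  assumes "g \<in> C_inf B" "w \<in> vector_fields B"
  shows "(\<Sum>a<r. app (T.ham (g \<circ> \<pi>)) (ba a) * sg (u a) w) = - (app w g \<circ> \<pi>)"
proof
  fix e
  have t: "T.ham (g \<circ> \<pi>) e \<in> tangent E e" by (rule Hz_tangent[OF ham_pullback_Hz[OF assms(1)]])
  have "\<sigma> e [push (T.ham (g \<circ> \<pi>) e), push (Hor w e)] = - Hor w e (g \<circ> \<pi>)"
    by (rule sigma_ham[OF assms(1) Hor_tangent[OF assms(2)]])
  moreover have "Hor w e (g \<circ> \<pi>) = app w g (\<pi> e)"
    using fun_cong[OF Hor_pullback[OF assms(2,1)], of e] by (simp add: app_def)
  moreover have "\<sigma> e [push (T.ham (g \<circ> \<pi>) e), w (\<pi> e)] = (\<Sum>a<r. T.ham (g \<circ> \<pi>) e (ba a) * \<sigma> e [u a (\<pi> e), w (\<pi> e)])"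
    by (rule sigma_push_left[OF t B.vector_field_tangent[OF assms(2)]])
  ultimately show "(\<Sum>a<r. app (T.ham (g \<circ> \<pi>)) (ba a) * sg (u a) w) e = (- (app w g \<circ> \<pi>)) e"
    by (simp add: Hor(2)[OF assms(2)] sum_fun_apply app_def sg_apply)
qed

lemma ham_pullback_frame: "g \<in> C_inf B \<Longrightarrow> app (T.ham (g \<circ> \<pi>)) f = (\<Sum>a<r. app (T.ham (g \<circ> \<pi>)) (ba a) * app (Ha a) f)"
proof
  fix e assume "g \<in> C_inf B"
  from Hz_frame[OF ham_pullback_Hz[OF this], of e f]
  show "app (T.ham (g \<circ> \<pi>)) f e = (\<Sum>a<r. app (T.ham (g \<circ> \<pi>)) (ba a) * app (Ha a) f) e"
    unfolding app_def sum_fun_apply times_fun_apply .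
qed

lemma Hor_frame:
  assumes w: "w \<in> vector_fields B"
  shows "app (Hor w) f = (\<Sum>a<r. (app w (y a) \<circ> \<pi>) * app (Ha a) f)"
proof
  fix e
  have "Hor w e f = (\<Sum>a<r. Hor w e (ba a) * Ha a e f)" by (rule Hz_frame[OF Hor(1)[OF w]])
  also have "\<dots> = (\<Sum>a<r. app w (y a) (\<pi> e) * Ha a e f)"
  proof (rule sum.cong[OF refl])
    fix a assume "a \<in> {..<r}"
    then have "app (Hor w) (y a \<circ> \<pi>) = app w (y a) \<circ> \<pi>" by (intro Hor_pullback[OF w]) simp
    from fun_cong[OF this, of e] show "Hor w e (ba a) * Ha a e f = app w (y a) (\<pi> e) * Ha a e f"
      by (simp add: ba_def app_def)
  qed
  finally show "app (Hor w) f e = (\<Sum>a<r. (app w (y a) \<circ> \<pi>) * app (Ha a) f) e"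
    by (simp add: app_def sum_fun_apply)
qed

lemma ham_P_pullback:
  assumes "g \<in> C_inf B"
  shows "app (V.ham f) (g \<circ> \<pi>) = 0"
proof
  fix e
  show "app (V.ham f) (g \<circ> \<pi>) e = 0 e"
    using ham_P_vertical[of f e] assms unfolding vertical_iff app_def zero_fun_apply by blast
qed

text \<open>The coefficients of the horizontal part are forced by testing on pulled-back functions. The remaining
  vertical part sees only the component \<open>P\<close> of \<open>\<Theta>\<close>.\<close>

lemma ham_decompose:
  "app (T.ham f) g = app (V.ham f) g + (\<Sum>c<r. app (T.ham f) (ba c) * app (Ha c) g)"
proof
  fix e
  obtain \<Theta>H where H: "\<And>e. \<Theta>H e \<in> wedge2 E e (Hz e)" "\<And>e a b. \<Theta> e a b = \<Theta>H e a b + P e a b"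
    by (rule horizontal_part) (rule that)
  let ?d = "\<lambda>g. differential E g e"
  define s where "s = sharp_at E e (\<Theta>H e) (?d f)"
  have sub: "Hz e \<subseteq> tangent E e" by (rule subsetI, rule Hz_tangent)
  have sH: "s \<in> Hz e" unfolding s_def
    by (rule E.wedge2_sharp(1)[OF H(1) sub Hz_0]) (rule Hz_add Hz_scale; assumption)+
  have ev: "s g = \<Theta>H e (?d f) (?d g)" for g
  proof -
    have "?d g s = \<Theta>H e (?d f) (?d g)" unfolding s_def
      by (rule E.wedge2_sharp(2)[OF H(1) sub Hz_0 _ _ E.differential_cotangent]) (rule Hz_add Hz_scale; assumption)+
    then show ?thesis using Hz_tangent[OF sH] by simp
  qed
  have split: "T.ham f e g = V.ham f e g + s g" for g
    by (simp add: T.ham_apply V.ham_apply ev H(2))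
  have "s (ba c) = T.ham f e (ba c)" if "c < r" for c
    using split[of "ba c"] ham_P_vertical[of f e] that by (simp add: vertical_iff ba_def)
  then have "(\<Sum>c<r. s (ba c) * Ha c e g) = (\<Sum>c<r. T.ham f e (ba c) * Ha c e g)" by simp
  moreover have "s g = (\<Sum>c<r. s (ba c) * Ha c e g)" by (rule Hz_frame[OF sH])
  ultimately show "app (T.ham f) g e = (app (V.ham f) g + (\<Sum>c<r. app (T.ham f) (ba c) * app (Ha c) g)) e"
    using split[of g] by (simp only: app_def sum_fun_apply plus_fun_apply times_fun_apply)
qed

end

section \<open>Forms with coefficients and the covariant derivative\<close>

context coupling_bundle begin

text \<open>The Casimir functions of \<open>P\<close> are a module over the functions pulled back from the base, but in general
  not an ideal of \<^term>\<open>C_inf E\<close>.\<close>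

definition submod :: "('e \<Rightarrow> real) set \<Rightarrow> bool" where
  "submod A \<longleftrightarrow> A \<subseteq> C_inf E \<and> 0 \<in> A \<and> (\<forall>f\<in>A. \<forall>g\<in>A. f + g \<in> A) \<and> (\<forall>f\<in>A. \<forall>g\<in>C_inf B. f * (g \<circ> \<pi>) \<in> A)"

lemma submod_C: "submod (C_inf E)"
  unfolding submod_def by (simp add: E.C_inf_add E.C_inf_mult)

lemma Casim_app_iff: "F \<in> Casim E P \<longleftrightarrow> F \<in> C_inf E \<and> (\<forall>h\<in>C_inf E. app (V.ham F) h = 0)"
proof
  assume "F \<in> Casim E P"
  then have "F \<in> C_inf E" "V.ham F = 0" by (simp_all add: V.Casim_iff)
  then show "F \<in> C_inf E \<and> (\<forall>h\<in>C_inf E. app (V.ham F) h = 0)" by simp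
next
  assume F: "F \<in> C_inf E \<and> (\<forall>h\<in>C_inf E. app (V.ham F) h = 0)"
  have "V.ham F = 0"
    by (rule E.vector_field_eqI[OF _ E.vector_field_0]) (use F V.ham_vector_field in simp_all)
  then show "F \<in> Casim E P" using F by (simp add: V.Casim_iff)
qed

lemma ham_P_pullback_left:
  assumes "g \<in> C_inf B"
  shows "app (V.ham (g \<circ> \<pi>)) h = 0"
  using V.ham_skew[of "g \<circ> \<pi>" h] ham_P_pullback[OF assms, of h] by simp

lemma submod_Casim: "submod (Casim E P)"
  unfolding submod_def
proof (intro conjI subsetI ballI)
  show "f \<in> C_inf E" if "f \<in> Casim E P" for f using that by (simp add: Casim_app_iff)
  show "0 \<in> Casim E P" using V.ham_const[of _ 0] by (simp add: Casim_app_iff zero_fun_def)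
  show "f + g \<in> Casim E P" if "f \<in> Casim E P" "g \<in> Casim E P" for f g
    using that by (simp add: Casim_app_iff E.C_inf_add V.ham_add)
  show "f * (g \<circ> \<pi>) \<in> Casim E P" if "f \<in> Casim E P" "g \<in> C_inf B" for f g
    using that by (simp add: Casim_app_iff E.C_inf_mult V.ham_mult ham_P_pullback_left)
qed

lemma submod_sum: "submod A \<Longrightarrow> (\<And>i. i \<in> I \<Longrightarrow> f i \<in> A) \<Longrightarrow> (\<Sum>i\<in>I. f i) \<in> A"
  by (induction I rule: infinite_finite_induct) (simp_all add: submod_def)

lemma on_fields_tensor:
  assumes A: "submod A" and \<eta>: "\<eta> \<in> tensor_forms B \<pi> p A" and us: "length us = p" "set us \<subseteq> vector_fields B"
  shows "on_fields \<pi> \<eta> us \<in> A"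
proof -
  obtain n :: nat and \<omega> f where *: "\<forall>i<n. \<omega> i \<in> base_forms B p \<and> f i \<in> A" "\<eta> = (\<lambda>e vs. \<Sum>i<n. f i e * \<omega> i (\<pi> e) vs)"
    using \<eta> unfolding tensor_forms_def by blast
  have "on_fields \<pi> \<eta> us = (\<Sum>i<n. f i * ((\<lambda>b. \<omega> i b (map (\<lambda>u. u b) us)) \<circ> \<pi>))"
    by (simp add: on_fields_def *(2) fun_eq_iff sum_fun_apply)
  moreover have "f i * ((\<lambda>b. \<omega> i b (map (\<lambda>u. u b) us)) \<circ> \<pi>) \<in> A" if "i < n" for i
  proof -
    have "(\<lambda>b. \<omega> i b (map (\<lambda>u. u b) us)) \<in> C_inf B" using *(1) that us by (simp add: base_forms_def)
    then show ?thesis using A *(1) that unfolding submod_def by blast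
  qed
  ultimately show ?thesis using submod_sum[OF A, of "{..<n}"] by simp
qed

definition ev :: "('e, 'b) bform \<Rightarrow> 'b vfield \<Rightarrow> 'e \<Rightarrow> real" where
  "ev \<eta> w = on_fields \<pi> \<eta> [w]"

lemma ev_apply: "ev \<eta> w e = \<eta> e [w (\<pi> e)]"
  by (simp add: ev_def on_fields_def)

lemma ev_tensor: "submod A \<Longrightarrow> \<eta> \<in> tensor_forms B \<pi> 1 A \<Longrightarrow> w \<in> vector_fields B \<Longrightarrow> ev \<eta> w \<in> A"
  unfolding ev_def by (rule on_fields_tensor) simp_all

lemma ev_C: "\<eta> \<in> Omega_B E B \<pi> 1 \<Longrightarrow> w \<in> vector_fields B \<Longrightarrow> ev \<eta> w \<in> C_inf E"
  unfolding Omega_B_def by (rule ev_tensor[OF submod_C])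

lemma ev_expand:
  assumes \<eta>: "\<And>e. \<eta> e \<in> alt_forms_at B 1 (\<pi> e)" and w: "w \<in> vector_fields B"
  shows "ev \<eta> w = (\<Sum>c<r. ev \<eta> (u c) * (app w (y c) \<circ> \<pi>))"
proof
  fix e
  have "\<eta> e [w (\<pi> e)] = \<eta> e [\<Sum>c<r. (\<lambda>f. w (\<pi> e) (y c) * u c (\<pi> e) f)]"
    by (rule arg_cong[OF B.frame_sum[OF B.vector_field_tangent[OF w]]])
  also have "\<dots> = (\<Sum>c<r. w (\<pi> e) (y c) * \<eta> e [u c (\<pi> e)])"
    by (rule B.alt1_sum[OF \<eta>]) (simp add: B.frame_tangent)
  finally show "ev \<eta> w e = (\<Sum>c<r. ev \<eta> (u c) * (app w (y c) \<circ> \<pi>)) e"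
    by (simp add: ev_apply sum_fun_apply app_def mult.commute)
qed

text \<open>The frame makes every form of degree \<open>1\<close> with values in a submodule \<open>A\<close> a finite sum of products,
  hence an element of the tensor product.\<close>

definition form_of_coeffs :: "(nat \<Rightarrow> 'e \<Rightarrow> real) \<Rightarrow> ('e, 'b) bform" where
  "form_of_coeffs q = (\<lambda>e vs. \<Sum>c<r. q c e * B.dform (y c) (\<pi> e) vs)"

lemma form_of_coeffs_tensor: "(\<And>c. c < r \<Longrightarrow> q c \<in> A) \<Longrightarrow> form_of_coeffs q \<in> tensor_forms B \<pi> 1 A"
  unfolding form_of_coeffs_def by (rule B.tensor_formsI) (rule B.dform_base, simp_all)

lemma ev_form_of_coeffs:
  assumes w: "w \<in> vector_fields B"
  shows "ev (form_of_coeffs q) w = (\<Sum>c<r. q c * (app w (y c) \<circ> \<pi>))"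
proof
  fix e
  have "B.dform (y c) (\<pi> e) [w (\<pi> e)] = app w (y c) (\<pi> e)" for c
    using B.vector_field_tangent[OF w] by (simp add: B.dform_def app_def)
  then show "ev (form_of_coeffs q) w e = (\<Sum>c<r. q c * (app w (y c) \<circ> \<pi>)) e"
    by (simp add: ev_apply form_of_coeffs_def sum_fun_apply)
qed

lemma list1: "length us = 1 \<Longrightarrow> set us \<subseteq> S \<Longrightarrow> \<exists>w\<in>S. us = [w]" by (auto simp: length_Suc_conv)

lemma form1_eqI:
  assumes "\<And>e. \<eta> e \<in> alt_forms_at B 1 (\<pi> e)" "\<And>e. \<zeta> e \<in> alt_forms_at B 1 (\<pi> e)"
    and eq: "\<And>w. w \<in> vector_fields B \<Longrightarrow> ev \<eta> w = ev \<zeta> w"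
  shows "\<eta> = \<zeta>"
proof (rule B.form_eqI[of _ 1 \<pi>, OF assms(1,2)])
  fix us :: "'b vfield list" assume "length us = 1" "set us \<subseteq> vector_fields B"
  then obtain w where "w \<in> vector_fields B" "us = [w]" using list1 by blast
  then show "on_fields \<pi> \<eta> us = on_fields \<pi> \<zeta> us" using eq by (simp add: ev_def)
qed

lemma tensor_alt1: "\<eta> \<in> tensor_forms B \<pi> 1 A \<Longrightarrow> \<eta> e \<in> alt_forms_at B 1 (\<pi> e)"
  by (rule B.tensor_form_alt)

lemma form1I:
  assumes \<eta>: "\<And>e. \<eta> e \<in> alt_forms_at B 1 (\<pi> e)" and A: "\<And>w. w \<in> vector_fields B \<Longrightarrow> ev \<eta> w \<in> A"
  shows "\<eta> \<in> tensor_forms B \<pi> 1 A"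
proof -
  have t: "form_of_coeffs (\<lambda>c. ev \<eta> (u c)) \<in> tensor_forms B \<pi> 1 A" by (rule form_of_coeffs_tensor) (simp add: A)
  have "\<eta> = form_of_coeffs (\<lambda>c. ev \<eta> (u c))"
  proof (rule form1_eqI[OF \<eta> tensor_alt1[OF t]])
    fix w assume w: "w \<in> vector_fields B"
    show "ev \<eta> w = ev (form_of_coeffs (\<lambda>c. ev \<eta> (u c))) w"
      unfolding ev_form_of_coeffs[OF w] by (rule ev_expand[OF \<eta> w])
  qed
  then show ?thesis using t by simp
qed

lemma Omega_alt1: "\<eta> \<in> Omega_B E B \<pi> 1 \<Longrightarrow> \<eta> e \<in> alt_forms_at B 1 (\<pi> e)"
  unfolding Omega_B_def by (rule tensor_alt1)

lemma Cas_Omega: "\<eta> \<in> Cas_forms E B \<pi> P 1 \<Longrightarrow> \<eta> \<in> Omega_B E B \<pi> 1"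
  unfolding Cas_forms_def Omega_B_def tensor_forms_def by (auto simp: Casim_def)

text \<open>A form whose values are Casimir functions is a combination of products with Casimir coefficients,
  because the coefficients with respect to the frame are values of the form.\<close>

lemma Cas_forms1_iff:
  "\<eta> \<in> Cas_forms E B \<pi> P 1 \<longleftrightarrow> \<eta> \<in> Omega_B E B \<pi> 1 \<and> (\<forall>w\<in>vector_fields B. ev \<eta> w \<in> Casim E P)"
proof
  assume \<eta>: "\<eta> \<in> Cas_forms E B \<pi> P 1"
  then have "ev \<eta> w \<in> Casim E P" if "w \<in> vector_fields B" for w
    using ev_tensor[OF submod_Casim _ that] unfolding Cas_forms_def by blast
  then show "\<eta> \<in> Omega_B E B \<pi> 1 \<and> (\<forall>w\<in>vector_fields B. ev \<eta> w \<in> Casim E P)" using Cas_Omega[OF \<eta>] by blast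
next
  assume "\<eta> \<in> Omega_B E B \<pi> 1 \<and> (\<forall>w\<in>vector_fields B. ev \<eta> w \<in> Casim E P)"
  then show "\<eta> \<in> Cas_forms E B \<pi> P 1" unfolding Cas_forms_def by (intro form1I Omega_alt1) simp_all
qed

text \<open>Forms of degree \<open>0\<close> are evaluated on the empty list only.\<close>

definition function_form :: "('e \<Rightarrow> real) \<Rightarrow> ('e, 'b) bform" where
  "function_form F = (\<lambda>e vs. if vs = [] then F e else 0)"

lemma Cas_forms0: "Cas_forms E B \<pi> P 0 = function_form ` Casim E P"
proof
  show "Cas_forms E B \<pi> P 0 \<subseteq> function_form ` Casim E P"
  proof
    fix \<eta> assume "\<eta> \<in> Cas_forms E B \<pi> P 0"
    then have \<eta>: "\<eta> \<in> tensor_forms B \<pi> 0 (Casim E P)" by (simp add: Cas_forms_def)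
    have "on_fields \<pi> \<eta> [] \<in> Casim E P" by (rule on_fields_tensor[OF submod_Casim \<eta>]) simp_all
    moreover have "\<eta> = function_form (on_fields \<pi> \<eta> [])"
    proof (intro ext)
      fix e vs
      show "\<eta> e vs = function_form (on_fields \<pi> \<eta> []) e vs"
        using B.alt_forms_outside[OF B.tensor_form_alt[OF \<eta>], of vs e] by (cases "vs = []") (simp_all add: function_form_def on_fields_def)
    qed
    ultimately show "\<eta> \<in> function_form ` Casim E P" by blast
  qed
  show "function_form ` Casim E P \<subseteq> Cas_forms E B \<pi> P 0"
  proof
    fix \<eta> assume "\<eta> \<in> function_form ` Casim E P"
    then obtain F where F: "F \<in> Casim E P" "\<eta> = function_form F" by blast
    have "(\<lambda>b vs. if vs = [] then 1 else 0) \<in> base_forms B 0"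
      by (auto simp: base_forms_def alt_forms_at_def)
    then have "(\<lambda>e vs. \<Sum>i<1::nat. F e * (if vs = [] then 1 else 0)) \<in> tensor_forms B \<pi> 0 (Casim E P)"
      using B.tensor_formsI[of 1 "\<lambda>i b vs. if vs = [] then 1 else 0" 0 "\<lambda>i. F" "Casim E P" \<pi>] F(1) by simp
    moreover have "(\<lambda>e vs. \<Sum>i<1::nat. F e * (if vs = [] then 1 else 0)) = \<eta>"
      by (simp add: F(2) function_form_def fun_eq_iff)
    ultimately show "\<eta> \<in> Cas_forms E B \<pi> P 0" by (simp add: Cas_forms_def)
  qed
qed

lemma Ha_vf: "c < r \<Longrightarrow> Ha c \<in> vector_fields E" and Hor_vf: "w \<in> vector_fields B \<Longrightarrow> Hor w \<in> vector_fields E"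
proof -
  have sgC: "sg w z \<in> C_inf E" if "w \<in> vector_fields B" "z \<in> vector_fields B" for w z
    unfolding sg_def using on_fields_tensor[OF submod_C sigma_form[unfolded Omega_B_def], of "[w, z]"] that by simp
  show *: "Hor w \<in> vector_fields E" if w: "w \<in> vector_fields B" for w
  proof (rule E.vector_fieldI[OF Hor_tangent[OF w]])
    fix f assume f: "f \<in> C_inf E"
    have "(\<Sum>a<r. sg w (u a) * app (T.ham (ba a)) f) \<in> C_inf E"
      by (rule E.C_inf_sum, rule E.C_inf_mult) (simp_all add: sgC w f)
    then show "app (Hor w) f \<in> C_inf E" unfolding Hor_by_ham[OF w] by (rule E.C_inf_uminus)
  qed
  show "Ha c \<in> vector_fields E" if "c < r" unfolding Ha_def by (rule *) (simp add: that)
qed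

lemma sg_C: "w \<in> vector_fields B \<Longrightarrow> z \<in> vector_fields B \<Longrightarrow> sg w z \<in> C_inf E"
  unfolding sg_def using on_fields_tensor[OF submod_C sigma_form[unfolded Omega_B_def], of "[w, z]"] by simp

text \<open>The frame expression of the differential lies in the space of forms and has the required values; by
  uniqueness it is the covariant derivative.\<close>

lemma cov0:
  assumes F: "F \<in> C_inf E"
  shows "cov_deriv E B \<pi> \<gamma> 0 (function_form F) \<in> Omega_B E B \<pi> 1"
    and "w \<in> vector_fields B \<Longrightarrow> ev (cov_deriv E B \<pi> \<gamma> 0 (function_form F)) w = app (Hor w) F"
proof -
  define \<zeta> where "\<zeta> = form_of_coeffs (\<lambda>c. app (Ha c) F)"
  have \<zeta>: "\<zeta> \<in> Omega_B E B \<pi> 1" unfolding Omega_B_def \<zeta>_def by (rule form_of_coeffs_tensor) (simp add: Ha_vf F)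
  have ev\<zeta>: "ev \<zeta> w = app (Hor w) F" if "w \<in> vector_fields B" for w
    unfolding \<zeta>_def ev_form_of_coeffs[OF that] Hor_frame[OF that] by (simp only: mult.commute)
  have rhs: "(\<lambda>e. (\<Sum>i\<le>0. (-1) ^ i * Hor (us ! i) e (on_fields \<pi> (function_form F) (nths us (- {i})))) +
          (\<Sum>j\<le>0. \<Sum>i<j. (-1) ^ (i + j) * on_fields \<pi> (function_form F) (lie_bracket (us ! i) (us ! j) # nths us (- {i, j})) e))
      = app (Hor w) F" if "us = [w]" for us and w
  proof -
    have "on_fields \<pi> (function_form F) [] = F" by (simp add: on_fields_def function_form_def)
    then show ?thesis unfolding that by (simp add: nths_Cons app_def)
  qed
  have "cov_deriv E B \<pi> \<gamma> 0 (function_form F) = \<zeta>"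
    unfolding cov_deriv_def
  proof (rule the_equality)
    show "\<zeta> \<in> Omega_B E B \<pi> (Suc 0) \<and> (\<forall>us. length us = Suc 0 \<and> set us \<subseteq> vector_fields B \<longrightarrow> on_fields \<pi> \<zeta> us =
       (\<lambda>e. (\<Sum>i\<le>0. (-1) ^ i * Hor (us ! i) e (on_fields \<pi> (function_form F) (nths us (- {i})))) +
          (\<Sum>j\<le>0. \<Sum>i<j. (-1) ^ (i + j) * on_fields \<pi> (function_form F) (lie_bracket (us ! i) (us ! j) # nths us (- {i, j})) e)))"
    proof (intro conjI allI impI)
      show "\<zeta> \<in> Omega_B E B \<pi> (Suc 0)" using \<zeta> by simp
      fix us assume us: "length us = Suc 0 \<and> set us \<subseteq> vector_fields B"
      then obtain w where w: "w \<in> vector_fields B" "us = [w]" using list1[of us "vector_fields B"] by auto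
      show "on_fields \<pi> \<zeta> us = (\<lambda>e. (\<Sum>i\<le>0. (-1) ^ i * Hor (us ! i) e (on_fields \<pi> (function_form F) (nths us (- {i})))) +
          (\<Sum>j\<le>0. \<Sum>i<j. (-1) ^ (i + j) * on_fields \<pi> (function_form F) (lie_bracket (us ! i) (us ! j) # nths us (- {i, j})) e))"
        unfolding rhs[OF w(2)] unfolding w(2) using ev\<zeta>[OF w(1)] by (simp only: ev_def)
    qed
    fix \<zeta>' assume h: "\<zeta>' \<in> Omega_B E B \<pi> (Suc 0) \<and> (\<forall>us. length us = Suc 0 \<and> set us \<subseteq> vector_fields B \<longrightarrow> on_fields \<pi> \<zeta>' us =
       (\<lambda>e. (\<Sum>i\<le>0. (-1) ^ i * Hor (us ! i) e (on_fields \<pi> (function_form F) (nths us (- {i})))) +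
          (\<Sum>j\<le>0. \<Sum>i<j. (-1) ^ (i + j) * on_fields \<pi> (function_form F) (lie_bracket (us ! i) (us ! j) # nths us (- {i, j})) e)))"
    have \<zeta>': "\<zeta>' \<in> Omega_B E B \<pi> 1" using h by simp
    show "\<zeta>' = \<zeta>"
    proof (rule form1_eqI[OF Omega_alt1[OF \<zeta>'] Omega_alt1[OF \<zeta>]])
      fix w assume w: "w \<in> vector_fields B"
      have "on_fields \<pi> \<zeta>' [w] = app (Hor w) F"
        using conjunct2[OF h, THEN spec, of "[w]"] w unfolding rhs[of "[w]" w, OF refl] by simp
      then show "ev \<zeta>' w = ev \<zeta> w" unfolding ev\<zeta>[OF w] by (simp only: ev_def)
    qed
  qed
  then show "cov_deriv E B \<pi> \<gamma> 0 (function_form F) \<in> Omega_B E B \<pi> 1"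
    "w \<in> vector_fields B \<Longrightarrow> ev (cov_deriv E B \<pi> \<gamma> 0 (function_form F)) w = app (Hor w) F"
    using \<zeta> ev\<zeta> by simp_all
qed

definition ev2 :: "('e, 'b) bform \<Rightarrow> 'b vfield \<Rightarrow> 'b vfield \<Rightarrow> 'e \<Rightarrow> real" where
  "ev2 \<eta> w z = on_fields \<pi> \<eta> [w, z]"

lemma list2: "length us = 2 \<Longrightarrow> set us \<subseteq> S \<Longrightarrow> \<exists>w\<in>S. \<exists>z\<in>S. us = [w, z]"
  by (auto simp: numeral_2_eq_2 length_Suc_conv)

lemma form2_alt_eqI:
  assumes "\<And>e. \<eta> e \<in> alt_forms_at B 2 (\<pi> e)" "\<And>e. \<zeta> e \<in> alt_forms_at B 2 (\<pi> e)"
    and eq: "\<And>w z. w \<in> vector_fields B \<Longrightarrow> z \<in> vector_fields B \<Longrightarrow> ev2 \<eta> w z = ev2 \<zeta> w z"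
  shows "\<eta> = \<zeta>"
proof (rule B.form_eqI[OF assms(1,2)])
  fix us :: "'b vfield list" assume "length us = 2" "set us \<subseteq> vector_fields B"
  then obtain w z where "w \<in> vector_fields B" "z \<in> vector_fields B" "us = [w, z]" using list2 by blast
  then show "on_fields \<pi> \<eta> us = on_fields \<pi> \<zeta> us" using eq by (simp add: ev2_def)
qed

lemma form2_eqI:
  assumes "\<eta> \<in> Omega_B E B \<pi> 2" "\<zeta> \<in> Omega_B E B \<pi> 2"
    and eq: "\<And>w z. w \<in> vector_fields B \<Longrightarrow> z \<in> vector_fields B \<Longrightarrow> ev2 \<eta> w z = ev2 \<zeta> w z"
  shows "\<eta> = \<zeta>"
  by (rule form2_alt_eqI[OF _ _ eq]) (rule B.tensor_form_alt, use assms(1,2) in \<open>simp add: Omega_B_def\<close>)+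

text \<open>The classical formula for \<open>(\<partial>\<eta>)(w, z)\<close>.\<close>

definition cov_diff :: "('e, 'b) bform \<Rightarrow> 'b vfield \<Rightarrow> 'b vfield \<Rightarrow> 'e \<Rightarrow> real" where
  "cov_diff \<eta> w z = app (Hor w) (ev \<eta> z) - app (Hor z) (ev \<eta> w) - ev \<eta> (lie_bracket w z)"

lemma cov_diff_expand:
  assumes \<eta>: "\<eta> \<in> Omega_B E B \<pi> 1" and w: "w \<in> vector_fields B" and z: "z \<in> vector_fields B"
  shows "cov_diff \<eta> w z = (\<Sum>d<r. app (Hor w) (ev \<eta> (u d)) * (app z (y d) \<circ> \<pi>) - (app w (y d) \<circ> \<pi>) * app (Hor z) (ev \<eta> (u d)))"
proof -
  note exp = ev_expand[OF Omega_alt1[OF \<eta>]]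
  have q: "ev \<eta> (u d) \<in> C_inf E" if "d < r" for d using ev_C[OF \<eta>] that by simp
  have half: "app (Hor v) (ev \<eta> v') = (\<Sum>d<r. app (Hor v) (ev \<eta> (u d)) * (app v' (y d) \<circ> \<pi>) + ev \<eta> (u d) * (app v (app v' (y d)) \<circ> \<pi>))"
    if v: "v \<in> vector_fields B" "v' \<in> vector_fields B" for v v'
  proof -
    have "app (Hor v) (ev \<eta> v') = (\<Sum>d<r. app (Hor v) (ev \<eta> (u d)) * (app v' (y d) \<circ> \<pi>) + ev \<eta> (u d) * app (Hor v) (app v' (y d) \<circ> \<pi>))"
      unfolding exp[OF v(2)] by (rule E.app_sum_mult[OF Hor_vf[OF v(1)]]) (simp_all add: q v)
    also have "\<dots> = (\<Sum>d<r. app (Hor v) (ev \<eta> (u d)) * (app v' (y d) \<circ> \<pi>) + ev \<eta> (u d) * (app v (app v' (y d)) \<circ> \<pi>))"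
    proof (rule sum.cong[OF refl])
      fix d assume "d \<in> {..<r}"
      then have "app v' (y d) \<in> C_inf B" using v(2) by simp
      from Hor_pullback[OF v(1) this]
      show "app (Hor v) (ev \<eta> (u d)) * (app v' (y d) \<circ> \<pi>) + ev \<eta> (u d) * app (Hor v) (app v' (y d) \<circ> \<pi>) =
          app (Hor v) (ev \<eta> (u d)) * (app v' (y d) \<circ> \<pi>) + ev \<eta> (u d) * (app v (app v' (y d)) \<circ> \<pi>)" by (simp only:)
    qed
    finally show ?thesis .
  qed
  have br: "ev \<eta> (lie_bracket w z) = (\<Sum>d<r. ev \<eta> (u d) * ((app w (app z (y d)) \<circ> \<pi>) - (app z (app w (y d)) \<circ> \<pi>)))"
    unfolding exp[OF B.vector_field_bracket[OF w z]] app_bracket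
    by (rule sum.cong[OF refl]) (simp add: fun_eq_iff)
  show ?thesis
    unfolding cov_diff_def half[OF w z] half[OF z w] br sum_subtractf[symmetric]
    by (rule sum.cong[OF refl]) (simp add: algebra_simps)
qed

text \<open>In the formula for \<open>\<partial>\<eta>\<close> the derivatives of the components of \<open>w\<close> and \<open>z\<close> cancel (\<open>cov_diff_expand\<close>).
  Therefore \<open>\<partial>\<eta>\<close> is the combination of the forms \<open>dy\<^sub>c \<and> dy\<^sub>d\<close> with coefficients \<open>hor(u\<^sub>c)(\<eta>(u\<^sub>d))\<close>.\<close>

lemma cov1:
  assumes \<eta>: "\<eta> \<in> Omega_B E B \<pi> 1"
  shows "cov_deriv E B \<pi> \<gamma> 1 \<eta> \<in> Omega_B E B \<pi> 2"
    and "w \<in> vector_fields B \<Longrightarrow> z \<in> vector_fields B \<Longrightarrow> ev2 (cov_deriv E B \<pi> \<gamma> 1 \<eta>) w z = cov_diff \<eta> w z"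
proof -
  define q where "q = (\<lambda>d. ev \<eta> (u d))"
  have q: "q d \<in> C_inf E" if "d < r" for d using ev_C[OF \<eta>] that by (simp add: q_def)
  define \<zeta> where "\<zeta> = (\<lambda>e vs. \<Sum>x\<in>{..<r} \<times> {..<r}. app (Ha (snd x)) (q (fst x)) e * B.dwedge (y (snd x)) (y (fst x)) (\<pi> e) vs)"
  have \<zeta>: "\<zeta> \<in> Omega_B E B \<pi> 2"
    unfolding Omega_B_def \<zeta>_def
  proof (rule B.tensor_forms_finite)
    show "B.dwedge (y (snd x)) (y (fst x)) \<in> base_forms B 2" if "x \<in> {..<r} \<times> {..<r}" for x
      by (rule B.dwedge_base) (use that in auto)
    show "app (Ha (snd x)) (q (fst x)) \<in> C_inf E" if "x \<in> {..<r} \<times> {..<r}" for x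
      using that by (intro E.app_C Ha_vf q) auto
  qed simp
  have ev\<zeta>: "ev2 \<zeta> w z = cov_diff \<eta> w z" if w: "w \<in> vector_fields B" and z: "z \<in> vector_fields B" for w z
  proof -
    have wd: "B.dwedge (y c) (y d) (\<pi> e) [w (\<pi> e), z (\<pi> e)] =
        ((app w (y c) \<circ> \<pi>) * (app z (y d) \<circ> \<pi>) - (app w (y d) \<circ> \<pi>) * (app z (y c) \<circ> \<pi>)) e" for c d e
      using B.vector_field_tangent[OF w, of "\<pi> e"] B.vector_field_tangent[OF z, of "\<pi> e"]
      by (simp add: B.dwedge_def app_def)
    have "ev2 \<zeta> w z = (\<Sum>x\<in>{..<r} \<times> {..<r}. app (Ha (snd x)) (q (fst x)) *
        ((app w (y (snd x)) \<circ> \<pi>) * (app z (y (fst x)) \<circ> \<pi>) - (app w (y (fst x)) \<circ> \<pi>) * (app z (y (snd x)) \<circ> \<pi>)))"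
    proof
      fix e
      show "ev2 \<zeta> w z e = (\<Sum>x\<in>{..<r} \<times> {..<r}. app (Ha (snd x)) (q (fst x)) *
        ((app w (y (snd x)) \<circ> \<pi>) * (app z (y (fst x)) \<circ> \<pi>) - (app w (y (fst x)) \<circ> \<pi>) * (app z (y (snd x)) \<circ> \<pi>))) e"
        unfolding ev2_def on_fields_def \<zeta>_def list.map wd sum_fun_apply times_fun_apply ..
    qed
    also have "\<dots> = (\<Sum>d<r. \<Sum>c<r. app (Ha c) (q d) *
        ((app w (y c) \<circ> \<pi>) * (app z (y d) \<circ> \<pi>) - (app w (y d) \<circ> \<pi>) * (app z (y c) \<circ> \<pi>)))"
      unfolding sum.cartesian_product by (rule sum.cong[OF refl]) (simp only: case_prod_unfold)
    also have "\<dots> = (\<Sum>d<r. (\<Sum>c<r. (app w (y c) \<circ> \<pi>) * app (Ha c) (q d)) * (app z (y d) \<circ> \<pi>) -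
        (app w (y d) \<circ> \<pi>) * (\<Sum>c<r. (app z (y c) \<circ> \<pi>) * app (Ha c) (q d)))"
      unfolding sum_distrib_left sum_distrib_right sum_subtractf[symmetric]
      by (intro sum.cong refl) (simp add: algebra_simps)
    also have "\<dots> = cov_diff \<eta> w z"
      unfolding cov_diff_expand[OF \<eta> w z] Hor_frame[OF w] Hor_frame[OF z] q_def ..
    finally show ?thesis .
  qed
  have rhs: "(\<lambda>e. (\<Sum>i\<le>1. (-1) ^ i * Hor (us ! i) e (on_fields \<pi> \<eta> (nths us (- {i})))) +
          (\<Sum>j\<le>1. \<Sum>i<j. (-1) ^ (i + j) * on_fields \<pi> \<eta> (lie_bracket (us ! i) (us ! j) # nths us (- {i, j})) e))
      = cov_diff \<eta> w z" if "us = [w, z]" for us w z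
  proof -
    have n0: "nths [w, z] (- {0}) = [z]" and n1: "nths [w, z] (- {1}) = [w]" and n01: "nths [w, z] (- {0, 1}) = []"
      by (simp_all add: nths_Cons)
    have s: "{..1::nat} = {0, 1}" "{..<1::nat} = {0}" "{..<0::nat} = {}" by auto
    show ?thesis
    proof
      fix e
      show "(\<Sum>i\<le>1. (-1) ^ i * Hor (us ! i) e (on_fields \<pi> \<eta> (nths us (- {i})))) +
          (\<Sum>j\<le>1. \<Sum>i<j. (-1) ^ (i + j) * on_fields \<pi> \<eta> (lie_bracket (us ! i) (us ! j) # nths us (- {i, j})) e) = cov_diff \<eta> w z e"
        unfolding that s cov_diff_def ev_def app_def by (simp add: s n0 n1[simplified] n01[simplified])
    qed
  qed
  have "cov_deriv E B \<pi> \<gamma> 1 \<eta> = \<zeta>"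
    unfolding cov_deriv_def
  proof (rule the_equality)
    have 2: "Suc 1 = 2" by simp
    show "\<zeta> \<in> Omega_B E B \<pi> (Suc 1) \<and> (\<forall>us. length us = Suc 1 \<and> set us \<subseteq> vector_fields B \<longrightarrow> on_fields \<pi> \<zeta> us =
       (\<lambda>e. (\<Sum>i\<le>1. (-1) ^ i * Hor (us ! i) e (on_fields \<pi> \<eta> (nths us (- {i})))) +
          (\<Sum>j\<le>1. \<Sum>i<j. (-1) ^ (i + j) * on_fields \<pi> \<eta> (lie_bracket (us ! i) (us ! j) # nths us (- {i, j})) e)))"
    proof (intro conjI allI impI)
      show "\<zeta> \<in> Omega_B E B \<pi> (Suc 1)" unfolding 2 by (rule \<zeta>)
      fix us assume us: "length us = Suc 1 \<and> set us \<subseteq> vector_fields B"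
      then obtain w z where w: "w \<in> vector_fields B" "z \<in> vector_fields B" "us = [w, z]"
        using list2[of us "vector_fields B"] unfolding 2 by blast
      show "on_fields \<pi> \<zeta> us = (\<lambda>e. (\<Sum>i\<le>1. (-1) ^ i * Hor (us ! i) e (on_fields \<pi> \<eta> (nths us (- {i})))) +
          (\<Sum>j\<le>1. \<Sum>i<j. (-1) ^ (i + j) * on_fields \<pi> \<eta> (lie_bracket (us ! i) (us ! j) # nths us (- {i, j})) e))"
        unfolding rhs[OF w(3)] unfolding w(3) using ev\<zeta>[OF w(1,2)] by (simp only: ev2_def)
    qed
    fix \<zeta>' assume h: "\<zeta>' \<in> Omega_B E B \<pi> (Suc 1) \<and> (\<forall>us. length us = Suc 1 \<and> set us \<subseteq> vector_fields B \<longrightarrow> on_fields \<pi> \<zeta>' us =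
       (\<lambda>e. (\<Sum>i\<le>1. (-1) ^ i * Hor (us ! i) e (on_fields \<pi> \<eta> (nths us (- {i})))) +
          (\<Sum>j\<le>1. \<Sum>i<j. (-1) ^ (i + j) * on_fields \<pi> \<eta> (lie_bracket (us ! i) (us ! j) # nths us (- {i, j})) e)))"
    have \<zeta>': "\<zeta>' \<in> Omega_B E B \<pi> 2" using conjunct1[OF h] unfolding 2 .
    show "\<zeta>' = \<zeta>"
    proof (rule form2_eqI[OF \<zeta>' \<zeta>])
      fix w z assume w: "w \<in> vector_fields B" and z: "z \<in> vector_fields B"
      have "on_fields \<pi> \<zeta>' [w, z] = cov_diff \<eta> w z"
        using conjunct2[OF h, THEN spec, of "[w, z]"] w z unfolding rhs[of "[w, z]" w z, OF refl] by simp
      then show "ev2 \<zeta>' w z = ev2 \<zeta> w z" unfolding ev\<zeta>[OF w z] by (simp only: ev2_def)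
    qed
  qed
  then show "cov_deriv E B \<pi> \<gamma> 1 \<eta> \<in> Omega_B E B \<pi> 2"
    "w \<in> vector_fields B \<Longrightarrow> z \<in> vector_fields B \<Longrightarrow> ev2 (cov_deriv E B \<pi> \<gamma> 1 \<eta>) w z = cov_diff \<eta> w z"
    using \<zeta> ev\<zeta> by simp_all
qed

definition vert :: "'e vfield \<Rightarrow> bool" where
  "vert Y \<longleftrightarrow> Y \<in> vector_fields E \<and> (\<forall>e. Y e \<in> Vert e)"

lemma vert_vf: "vert Y \<Longrightarrow> Y \<in> vector_fields E" by (simp add: vert_def)

lemma vert_pullback: "vert Y \<Longrightarrow> g \<in> C_inf B \<Longrightarrow> app Y (g \<circ> \<pi>) = 0"
  by (simp add: vert_def vertical_iff app_def fun_eq_iff)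

lemma lie_bform_sigma:
  assumes Y: "vert Y"
  shows "lie_bform E B \<pi> 2 Y \<sigma> \<in> Omega_B E B \<pi> 2"
    and "w \<in> vector_fields B \<Longrightarrow> z \<in> vector_fields B \<Longrightarrow> ev2 (lie_bform E B \<pi> 2 Y \<sigma>) w z = app Y (sg w z)"
proof -
  note YV = vert_vf[OF Y]
  obtain n :: nat and \<omega> f where *: "\<forall>i<n. \<omega> i \<in> base_forms B 2 \<and> f i \<in> C_inf E" "\<sigma> = (\<lambda>e vs. \<Sum>i<n. f i e * \<omega> i (\<pi> e) vs)"
    using sigma_form unfolding Omega_B_def tensor_forms_def by blast
  define \<zeta> where "\<zeta> = (\<lambda>e vs. \<Sum>i<n. app Y (f i) e * \<omega> i (\<pi> e) vs)"
  have \<zeta>: "\<zeta> \<in> Omega_B E B \<pi> 2"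
    unfolding Omega_B_def \<zeta>_def by (rule B.tensor_formsI) (use *(1) YV in simp_all)
  have ev\<zeta>: "on_fields \<pi> \<zeta> us = app Y (on_fields \<pi> \<sigma> us)" if us: "length us = 2" "set us \<subseteq> vector_fields B" for us
  proof -
    define g where "g = (\<lambda>i b. \<omega> i b (map (\<lambda>u. u b) us))"
    have g: "g i \<in> C_inf B" if "i < n" for i using *(1) us that by (simp add: base_forms_def g_def)
    have s: "on_fields \<pi> \<sigma> us = (\<Sum>i<n. f i * (g i \<circ> \<pi>))"
      by (simp add: on_fields_def *(2) g_def fun_eq_iff sum_fun_apply)
    have t: "on_fields \<pi> \<zeta> us = (\<Sum>i<n. app Y (f i) * (g i \<circ> \<pi>))"
      by (simp add: on_fields_def \<zeta>_def g_def fun_eq_iff sum_fun_apply)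
    have "app Y (on_fields \<pi> \<sigma> us) = (\<Sum>i<n. app Y (f i) * (g i \<circ> \<pi>) + f i * app Y (g i \<circ> \<pi>))"
      unfolding s by (rule E.app_sum_mult[OF YV]) (use *(1) g in simp_all)
    also have "\<dots> = on_fields \<pi> \<zeta> us"
      unfolding t by (rule sum.cong[OF refl]) (simp add: vert_pullback[OF Y] g)
    finally show ?thesis by (rule sym)
  qed
  have eq: "lie_bform E B \<pi> 2 Y \<sigma> = \<zeta>"
    unfolding lie_bform_def
  proof (rule the_equality)
    show "\<zeta> \<in> Omega_B E B \<pi> 2 \<and> (\<forall>us. length us = 2 \<and> set us \<subseteq> vector_fields B \<longrightarrow>
        on_fields \<pi> \<zeta> us = (\<lambda>e. Y e (on_fields \<pi> \<sigma> us)))"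
      using \<zeta> ev\<zeta> unfolding app_def by blast
    fix \<zeta>' assume h: "\<zeta>' \<in> Omega_B E B \<pi> 2 \<and> (\<forall>us. length us = 2 \<and> set us \<subseteq> vector_fields B \<longrightarrow>
        on_fields \<pi> \<zeta>' us = (\<lambda>e. Y e (on_fields \<pi> \<sigma> us)))"
    show "\<zeta>' = \<zeta>"
    proof (rule form2_eqI[OF conjunct1[OF h] \<zeta>])
      fix w z assume w: "w \<in> vector_fields B" "z \<in> vector_fields B"
      have us: "length [w, z] = 2" "set [w, z] \<subseteq> vector_fields B" using w by simp_all
      show "ev2 \<zeta>' w z = ev2 \<zeta> w z"
        unfolding ev2_def ev\<zeta>[OF us] app_def using conjunct2[OF h] us by blast
    qed
  qed
  show "lie_bform E B \<pi> 2 Y \<sigma> \<in> Omega_B E B \<pi> 2" unfolding eq by (rule \<zeta>)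
  show "ev2 (lie_bform E B \<pi> 2 Y \<sigma>) w z = app Y (sg w z)" if "w \<in> vector_fields B" "z \<in> vector_fields B"
    unfolding eq ev2_def sg_def by (rule ev\<zeta>) (use that in simp_all)
qed

section \<open>Infinitesimal automorphisms of a coupling tensor\<close>

text \<open>The horizontal field \<open>X\<close> with \<open>\<sigma>(\<pi>\<^sub>* X, w) = Q(w)\<close>; see \<open>base_form_hor_field\<close>. Writing it as a combination of
  Hamiltonian fields of pulled-back functions has the advantage that these preserve \<open>\<Theta>\<close>, so that its
  defect involves derivatives of the coefficients only.\<close>

definition hor_field :: "('e, 'b) bform \<Rightarrow> 'e vfield" where
  "hor_field Q = (\<Sum>a<r. fscale (- ev Q (u a)) (T.ham (ba a)))"

lemma hor_field_vf: "Q \<in> Omega_B E B \<pi> 1 \<Longrightarrow> hor_field Q \<in> vector_fields E"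
  unfolding hor_field_def by (intro E.vector_field_sum E.vector_field_fscale) (simp_all add: E.C_inf_uminus ev_C)

lemma app_hor_field: "app (hor_field Q) f = (\<Sum>a<r. (- ev Q (u a)) * app (T.ham (ba a)) f)"
  by (simp add: hor_field_def)

lemma app_pullback_expand:
  assumes X: "X \<in> vector_fields E" and g: "g \<in> C_inf B"
  shows "app X (g \<circ> \<pi>) = (\<Sum>c<r. app X (ba c) * (app (u c) g \<circ> \<pi>))"
proof
  fix e
  have "X e (g \<circ> \<pi>) = push (X e) g" by (rule push_apply[OF g, symmetric])
  also have "\<dots> = (\<Sum>a<r. (\<lambda>g. X e (ba a) * u a (\<pi> e) g)) g"
    by (rule fun_cong[OF push_frame[OF E.vector_field_tangent[OF X]]])
  finally show "app X (g \<circ> \<pi>) e = (\<Sum>c<r. app X (ba c) * (app (u c) g \<circ> \<pi>)) e"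
    by (simp add: app_def sum_fun_apply)
qed

text \<open>Pulled-back functions are Casimir functions of \<open>P\<close>, hence constants for its Hamiltonian fields.\<close>

lemma ham_P_combination:
  assumes F: "\<And>a. a < r \<Longrightarrow> F a \<in> C_inf E" and w: "w \<in> vector_fields B" and g: "g \<in> C_inf E"
  shows "app (V.ham (\<Sum>a<r. F a * (app w (y a) \<circ> \<pi>))) g = (\<Sum>a<r. (app w (y a) \<circ> \<pi>) * app (V.ham (F a)) g)"
proof -
  have W: "app w (y a) \<circ> \<pi> \<in> C_inf E" if "a < r" for a using w that by simp
  have "app (V.ham (\<Sum>a<r. F a * (app w (y a) \<circ> \<pi>))) g = (\<Sum>a<r. app (V.ham (F a * (app w (y a) \<circ> \<pi>))) g)"
    by (rule V.ham_sum[OF _ g], rule E.C_inf_mult) (simp_all add: F w)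
  also have "\<dots> = (\<Sum>a<r. (app w (y a) \<circ> \<pi>) * app (V.ham (F a)) g)"
  proof (rule sum.cong[OF refl])
    fix a assume "a \<in> {..<r}"
    then have a: "a < r" by simp
    have "app w (y a) \<in> C_inf B" using w a by simp
    from ham_P_pullback_left[OF this]
    show "app (V.ham (F a * (app w (y a) \<circ> \<pi>))) g = (app w (y a) \<circ> \<pi>) * app (V.ham (F a)) g"
      unfolding V.ham_mult[OF F[OF a] W[OF a] g] by (simp add: mult.commute)
  qed
  finally show ?thesis .
qed

text \<open>A vertical field does not differentiate pulled-back functions, so that its bracket with horizontal lifts
  is linear over the functions on the base.\<close>

lemma bracket_Hor_frame:
  assumes w: "w \<in> vector_fields B" and Y: "vert Y" and g: "g \<in> C_inf E"
  shows "app (lie_bracket (Hor w) Y) g = (\<Sum>a<r. (app w (y a) \<circ> \<pi>) * app (lie_bracket (Ha a) Y) g)"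
proof -
  have W: "app w (y a) \<circ> \<pi> \<in> C_inf E" if "a < r" for a using w that by simp
  have HC: "app (Ha a) g \<in> C_inf E" if "a < r" for a using Ha_vf[OF that] g by simp
  have "app (lie_bracket (Hor w) Y) g = (\<Sum>a<r. (app w (y a) \<circ> \<pi>) * app (Ha a) (app Y g)) - app Y (\<Sum>a<r. (app w (y a) \<circ> \<pi>) * app (Ha a) g)"
    unfolding app_bracket Hor_frame[OF w] ..
  also have "app Y (\<Sum>a<r. (app w (y a) \<circ> \<pi>) * app (Ha a) g) =
      (\<Sum>a<r. app Y (app w (y a) \<circ> \<pi>) * app (Ha a) g + (app w (y a) \<circ> \<pi>) * app Y (app (Ha a) g))"
    by (rule E.app_sum_mult[OF vert_vf[OF Y]]) (simp_all add: W HC)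
  also have "\<dots> = (\<Sum>a<r. (app w (y a) \<circ> \<pi>) * app Y (app (Ha a) g))"
    by (rule sum.cong[OF refl]) (simp add: vert_pullback[OF Y] w)
  finally show ?thesis unfolding app_bracket sum_subtractf[symmetric] right_diff_distrib .
qed

context
  fixes Q Y
  assumes Q: "Q \<in> Omega_B E B \<pi> 1" and Y: "vert Y"
begin

text \<open>In the frame, \<open>q\<close> gives the coefficients of \<open>X\<^sub>Q\<close>, \<open>m\<close> the horizontal part of \<open>\<Theta>\<close>, \<open>D\<close> the bivector \<open>L\<^sub>Z \<Theta>\<close> of
  \<open>Z = X\<^sub>Q + Y\<close>, and \<open>Er a\<close> the mixed component of \<open>D\<close>, as a vertical field for each \<open>a\<close>.\<close>

definition q where "q a = - ev Q (u a)"
definition m where "m a c = app (T.ham (ba a)) (ba c)"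
definition D where "D f g = T.defect (hor_field Q + Y) f g"
definition Er where "Er a g = app (V.ham (q a)) g - app (lie_bracket (Ha a) Y) g"

lemma qC: "a < r \<Longrightarrow> q a \<in> C_inf E" unfolding q_def by (intro E.C_inf_uminus ev_C[OF Q]) simp

lemma mC: "a < r \<Longrightarrow> c < r \<Longrightarrow> m a c \<in> C_inf E" unfolding m_def by simp

lemma m_skew: "m a c = - m c a" unfolding m_def by (rule T.ham_skew)

lemma YV: "Y \<in> vector_fields E" by (rule vert_vf[OF Y])

lemma Yba: "a < r \<Longrightarrow> app Y (ba a) = 0" unfolding ba_def by (rule vert_pullback[OF Y]) simp

lemma ham_ba: "a < r \<Longrightarrow> app (T.ham (ba a)) g = (\<Sum>c<r. m a c * app (Ha c) g)"
  unfolding m_def ba_def[of a] by (rule ham_pullback_frame) simp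

lemma defect_hor_field:
  assumes f: "f \<in> C_inf E" and g: "g \<in> C_inf E"
  shows "T.defect (hor_field Q) f g = (\<Sum>a<r. app (T.ham (ba a)) g * app (T.ham (q a)) f - app (T.ham (ba a)) f * app (T.ham (q a)) g)"
proof -
  have "T.defect (hor_field Q) f g = (\<Sum>a<r. T.defect (fscale (q a) (T.ham (ba a))) f g)"
    unfolding hor_field_def q_def
    by (rule T.defect_sum[OF _ f g]) (intro E.vector_field_fscale E.C_inf_uminus ev_C[OF Q], simp_all)
  also have "\<dots> = (\<Sum>a<r. app (T.ham (ba a)) g * app (T.ham (q a)) f - app (T.ham (ba a)) f * app (T.ham (q a)) g)"
  proof (rule sum.cong[OF refl])
    fix a assume "a \<in> {..<r}"
    then have a: "a < r" by simp
    have "T.defect (fscale (q a) (T.ham (ba a))) f g =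
        q a * T.defect (T.ham (ba a)) f g - app (T.ham (ba a)) f * app (T.ham (q a)) g - app (T.ham (ba a)) g * app (T.ham f) (q a)"
      by (rule T.defect_fscale[OF T.ham_vector_field[OF ba_C[OF a]] qC[OF a] f g])
    moreover have "T.defect (T.ham (ba a)) f g = 0" by (rule T.Jacobi[OF poisson ba_C[OF a] f g])
    moreover have "app (T.ham f) (q a) = - app (T.ham (q a)) f" by (rule T.ham_skew)
    ultimately show "T.defect (fscale (q a) (T.ham (ba a))) f g =
        app (T.ham (ba a)) g * app (T.ham (q a)) f - app (T.ham (ba a)) f * app (T.ham (q a)) g"
      by (simp only: mult_zero_right mult_minus_right) simp
  qed
  finally show ?thesis .
qed

lemma D_split: "f \<in> C_inf E \<Longrightarrow> g \<in> C_inf E \<Longrightarrow> D f g = T.defect (hor_field Q) f g + T.defect Y f g"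
  unfolding D_def by (rule T.defect_add[OF hor_field_vf[OF Q] YV])

text \<open>The second argument is split into its horizontal and its vertical part. The horizontal part contributes
  the values of \<open>D\<close> on pulled-back functions; the vertical part contributes \<open>L\<^sub>Y P\<close> and the mixed component.\<close>

lemma D_second_argument:
  assumes f: "f \<in> C_inf E" and g: "g \<in> C_inf E"
  shows "D f g = (\<Sum>c<r. D f (ba c) * app (Ha c) g) + V.defect Y f g - (\<Sum>a<r. app (T.ham (ba a)) f * Er a g)"
proof -
  have X: "T.defect (hor_field Q) f g = (\<Sum>c<r. T.defect (hor_field Q) f (ba c) * app (Ha c) g) -
      (\<Sum>a<r. app (T.ham (ba a)) f * app (V.ham (q a)) g)"
  proof -
    have "T.defect (hor_field Q) f g = (\<Sum>a<r. (\<Sum>c<r. m a c * app (Ha c) g) * app (T.ham (q a)) f -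
        app (T.ham (ba a)) f * (app (V.ham (q a)) g + (\<Sum>c<r. app (T.ham (q a)) (ba c) * app (Ha c) g)))"
      unfolding defect_hor_field[OF f g]
    proof (rule sum.cong[OF refl])
      fix a assume "a \<in> {..<r}"
      then have a: "a < r" by simp
      show "app (T.ham (ba a)) g * app (T.ham (q a)) f - app (T.ham (ba a)) f * app (T.ham (q a)) g =
          (\<Sum>c<r. m a c * app (Ha c) g) * app (T.ham (q a)) f -
          app (T.ham (ba a)) f * (app (V.ham (q a)) g + (\<Sum>c<r. app (T.ham (q a)) (ba c) * app (Ha c) g))"
        by (simp only: ham_ba[OF a, of g, symmetric] ham_decompose[of "q a" g, symmetric])
    qed
    also have "\<dots> = (\<Sum>a<r. \<Sum>c<r. (m a c * app (T.ham (q a)) f - app (T.ham (ba a)) f * app (T.ham (q a)) (ba c)) * app (Ha c) g) -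
        (\<Sum>a<r. app (T.ham (ba a)) f * app (V.ham (q a)) g)"
      by (simp add: sum_subtractf sum.distrib sum_distrib_left sum_distrib_right algebra_simps)
    also have "(\<Sum>a<r. \<Sum>c<r. (m a c * app (T.ham (q a)) f - app (T.ham (ba a)) f * app (T.ham (q a)) (ba c)) * app (Ha c) g) =
        (\<Sum>c<r. \<Sum>a<r. (m a c * app (T.ham (q a)) f - app (T.ham (ba a)) f * app (T.ham (q a)) (ba c)) * app (Ha c) g)"
      by (rule sum.swap)
    also have "\<dots> = (\<Sum>c<r. T.defect (hor_field Q) f (ba c) * app (Ha c) g)"
      by (rule sum.cong[OF refl]) (simp add: defect_hor_field[OF f] sum_distrib_right m_def)
    finally show ?thesis .
  qed
  have Yd: "T.defect Y f g = (\<Sum>c<r. T.defect Y f (ba c) * app (Ha c) g) + V.defect Y f g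
      + (\<Sum>a<r. app (T.ham (ba a)) f * app (lie_bracket (Ha a) Y) g)"
  proof -
    define k where "k = (\<lambda>c. app (T.ham f) (ba c))"
    have kC: "k c \<in> C_inf E" if "c < r" for c unfolding k_def using f that by simp
    have HC: "app (Ha c) g \<in> C_inf E" if "c < r" for c using Ha_vf[OF that] g by simp
    have "app Y (app (T.ham f) g) = app Y (app (V.ham f) g) + app Y (\<Sum>c<r. k c * app (Ha c) g)"
      unfolding ham_decompose[of f g] k_def
      by (rule E.app_add[OF YV], simp add: f g, rule E.C_inf_sum, rule E.C_inf_mult) (use f HC in simp_all)
    also have "app Y (\<Sum>c<r. k c * app (Ha c) g) = (\<Sum>c<r. app Y (k c) * app (Ha c) g + k c * app Y (app (Ha c) g))"
      by (rule E.app_sum_mult[OF YV]) (simp_all add: kC HC)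
    finally have 1: "app Y (app (T.ham f) g) = app Y (app (V.ham f) g) + (\<Sum>c<r. app Y (k c) * app (Ha c) g + k c * app Y (app (Ha c) g))" .
    have 2: "T.defect Y f (ba c) = app Y (k c) - app (T.ham (app Y f)) (ba c)" if "c < r" for c
      unfolding T.defect_def Yba[OF that] k_def using E.app_0[OF T.ham_vector_field[OF f]] by simp
    have 3: "app (T.ham (ba a)) f = - k a" for a unfolding k_def by (rule T.ham_skew)
    have "T.defect Y f g = app Y (app (V.ham f) g) + (\<Sum>c<r. app Y (k c) * app (Ha c) g + k c * app Y (app (Ha c) g))
        - (app (V.ham (app Y f)) g + (\<Sum>c<r. app (T.ham (app Y f)) (ba c) * app (Ha c) g))
        - (app (V.ham f) (app Y g) + (\<Sum>c<r. k c * app (Ha c) (app Y g)))"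
      unfolding T.defect_def 1 ham_decompose[of "app Y f" g] ham_decompose[of f "app Y g"] k_def ..
    also have "\<dots> = V.defect Y f g + (\<Sum>c<r. (app Y (k c) - app (T.ham (app Y f)) (ba c)) * app (Ha c) g
        + (- k c) * (app (Ha c) (app Y g) - app Y (app (Ha c) g)))"
      unfolding V.defect_def by (simp add: sum.distrib sum_subtractf sum_negf algebra_simps)
    also have "(\<Sum>c<r. (app Y (k c) - app (T.ham (app Y f)) (ba c)) * app (Ha c) g
        + (- k c) * (app (Ha c) (app Y g) - app Y (app (Ha c) g))) =
      (\<Sum>c<r. T.defect Y f (ba c) * app (Ha c) g) + (\<Sum>a<r. app (T.ham (ba a)) f * app (lie_bracket (Ha a) Y) g)"
      unfolding sum.distrib[symmetric]
      by (rule sum.cong[OF refl]) (simp only: 2 3 app_bracket lessThan_iff)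
    finally show ?thesis by (simp only: add.assoc add.commute add.left_commute)
  qed
  have "(\<Sum>c<r. D f (ba c) * app (Ha c) g) = (\<Sum>c<r. T.defect (hor_field Q) f (ba c) * app (Ha c) g) + (\<Sum>c<r. T.defect Y f (ba c) * app (Ha c) g)"
    unfolding sum.distrib[symmetric] by (rule sum.cong[OF refl]) (simp add: D_split[OF f] distrib_right)
  moreover have "(\<Sum>a<r. app (T.ham (ba a)) f * Er a g) = (\<Sum>a<r. app (T.ham (ba a)) f * app (V.ham (q a)) g) -
      (\<Sum>a<r. app (T.ham (ba a)) f * app (lie_bracket (Ha a) Y) g)"
    unfolding Er_def sum_subtractf[symmetric] by (rule sum.cong[OF refl]) (simp only: right_diff_distrib)
  ultimately show ?thesis unfolding D_split[OF f g] X Yd by (simp add: algebra_simps)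
qed

text \<open>The matrices of \<open>\<sigma>\<close> and of the horizontal part of \<open>\<Theta>\<close> are inverse to each other up to sign, as
  maps between the tangent and cotangent spaces of the base.\<close>

lemma sg_m:
  assumes w: "w \<in> vector_fields B" and a: "a < r"
  shows "(\<Sum>c<r. sg w (u c) * m c a) = - (app w (y a) \<circ> \<pi>)" and "(\<Sum>c<r. sg w (u c) * m a c) = app w (y a) \<circ> \<pi>"
proof -
  have "app (Hor w) (ba a) = app w (y a) \<circ> \<pi>" unfolding ba_def by (rule Hor_pullback[OF w]) (simp add: a)
  then have "- (\<Sum>c<r. sg w (u c) * m c a) = app w (y a) \<circ> \<pi>" unfolding Hor_by_ham[OF w] m_def .
  then show 1: "(\<Sum>c<r. sg w (u c) * m c a) = - (app w (y a) \<circ> \<pi>)" by (simp add: minus_equation_iff)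
  have "(\<Sum>c<r. sg w (u c) * m a c) = - (\<Sum>c<r. sg w (u c) * m c a)"
    unfolding sum_negf[symmetric] by (rule sum.cong[OF refl]) (simp only: m_skew[of a] mult_minus_right)
  then show "(\<Sum>c<r. sg w (u c) * m a c) = app w (y a) \<circ> \<pi>" unfolding 1 by simp
qed

text \<open>The mixed component is \<open>[hor w, Y] + P\<^sup>\<sharp>d(Q(w))\<close> up to sign.\<close>

lemma Er_sum:
  assumes w: "w \<in> vector_fields B" and g: "g \<in> C_inf E"
  shows "(\<Sum>a<r. (app w (y a) \<circ> \<pi>) * Er a g) = - app (V.ham (ev Q w)) g - app (lie_bracket (Hor w) Y) g"
proof -
  have "app (V.ham (\<Sum>a<r. q a * (app w (y a) \<circ> \<pi>))) g = (\<Sum>a<r. (app w (y a) \<circ> \<pi>) * app (V.ham (q a)) g)"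
    by (rule ham_P_combination) (simp_all add: qC w g)
  moreover have "(\<Sum>a<r. q a * (app w (y a) \<circ> \<pi>)) = - ev Q w"
    unfolding ev_expand[OF Omega_alt1[OF Q] w] q_def by (simp add: sum_negf)
  ultimately have 1: "(\<Sum>a<r. (app w (y a) \<circ> \<pi>) * app (V.ham (q a)) g) = - app (V.ham (ev Q w)) g"
    using V.ham_uminus[OF ev_C[OF Q w] g] by simp
  show ?thesis unfolding Er_def right_diff_distrib sum_subtractf 1 bracket_Hor_frame[OF w Y g] ..
qed

lemma D_base:
  assumes a: "a < r" and c: "c < r"
  shows "D (ba a) (ba c) = app Y (m a c) + (\<Sum>d<r. m d c * app (T.ham (q d)) (ba a) - m d a * app (T.ham (q d)) (ba c))"
proof -
  have "T.defect Y (ba a) (ba c) = app Y (m a c)"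
    unfolding T.defect_def Yba[OF a] Yba[OF c] m_def
    using T.ham_const[of "ba c" 0] E.app_0[OF T.ham_vector_field[OF ba_C[OF a]]] c by (simp add: zero_fun_def[symmetric])
  then show ?thesis
    unfolding D_split[OF ba_C[OF a] ba_C[OF c]] defect_hor_field[OF ba_C[OF a] ba_C[OF c]] m_def by (simp only: add.commute)
qed

text \<open>Contraction with \<open>\<sigma>\<close> in both arguments turns the horizontal bivector into a form on the base. In \<open>D_base\<close>, the
  derivative of \<open>m\<close> along \<open>Y\<close> becomes that of the inverse matrix \<open>\<sigma>\<close> with opposite sign, and the other terms
  become \<open>\<partial>Q\<close>.\<close>

lemma D_contract:
  assumes w: "w \<in> vector_fields B" and z: "z \<in> vector_fields B"
  shows "(\<Sum>a<r. \<Sum>c<r. sg w (u a) * sg z (u c) * D (ba a) (ba c)) = - (cov_diff Q w z + app Y (sg w z))"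
proof -
  define s where "s = (\<lambda>a. sg w (u a))"
  define t where "t = (\<lambda>c. sg z (u c))"
  define \<omega> where "\<omega> = (\<lambda>a. app w (y a) \<circ> \<pi>)"
  define \<zeta> where "\<zeta> = (\<lambda>a. app z (y a) \<circ> \<pi>)"
  have C: "s a \<in> C_inf E" "t a \<in> C_inf E" "\<omega> a \<in> C_inf E" "\<zeta> a \<in> C_inf E" if "a < r" for a
    using that w z by (simp_all add: s_def t_def \<omega>_def \<zeta>_def sg_C)
  have Y0: "app Y (\<omega> a) = 0" "app Y (\<zeta> a) = 0" if "a < r" for a
    using that w z by (simp_all add: \<omega>_def \<zeta>_def vert_pullback[OF Y])
  have tm: "(\<Sum>c<r. t c * m a c) = \<zeta> a" and sm: "(\<Sum>c<r. s c * m a c) = \<omega> a" "(\<Sum>c<r. s c * m c a) = - \<omega> a" if "a < r" for a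
    unfolding s_def t_def \<omega>_def \<zeta>_def using sg_m[OF w that] sg_m[OF z that] by simp_all
  have key: "app Y (sg v v') = - (\<Sum>c<r. app Y (sg v' (u c)) * (app v (y c) \<circ> \<pi>))"
    if v: "v \<in> vector_fields B" "v' \<in> vector_fields B" for v v'
  proof -
    have "sg v v' = (\<Sum>c<r. (app v (y c) \<circ> \<pi>) * sg (u c) v')" by (rule sg_expand[OF v])
    also have "\<dots> = (\<Sum>c<r. (- sg v' (u c)) * (app v (y c) \<circ> \<pi>))"
      by (rule sum.cong[OF refl]) (simp add: sg_skew[OF B.frame_vf v(2)])
    finally have "app Y (sg v v') = app Y (\<Sum>c<r. (- sg v' (u c)) * (app v (y c) \<circ> \<pi>))" by (simp only:)
    also have "\<dots> = (\<Sum>c<r. app Y (- sg v' (u c)) * (app v (y c) \<circ> \<pi>) + (- sg v' (u c)) * app Y (app v (y c) \<circ> \<pi>))"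
      by (rule E.app_sum_mult[OF YV]) (simp_all add: E.C_inf_uminus sg_C v)
    also have "\<dots> = - (\<Sum>c<r. app Y (sg v' (u c)) * (app v (y c) \<circ> \<pi>))"
      unfolding sum_negf[symmetric]
      by (rule sum.cong[OF refl]) (simp add: vert_pullback[OF Y] v E.app_uminus[OF YV] sg_C)
    finally show ?thesis .
  qed
  \<comment> \<open>Differentiating \<open>\<Sum>c. t c * m a c = \<zeta> a\<close> along \<open>Y\<close> moves the derivative from \<open>m\<close> to \<open>t\<close>.\<close>
  have first: "(\<Sum>a<r. \<Sum>c<r. s a * t c * app Y (m a c)) = - app Y (sg w z)"
  proof -
    have row: "(\<Sum>c<r. t c * app Y (m a c)) = - (\<Sum>c<r. app Y (t c) * m a c)" if a: "a < r" for a
    proof -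
      have "app Y (\<Sum>c<r. t c * m a c) = (\<Sum>c<r. app Y (t c) * m a c + t c * app Y (m a c))"
        by (rule E.app_sum_mult[OF YV]) (simp_all add: C mC a)
      then have "(\<Sum>c<r. app Y (t c) * m a c) + (\<Sum>c<r. t c * app Y (m a c)) = 0"
        unfolding tm[OF a] Y0(2)[OF a] sum.distrib by (rule sym)
      then show ?thesis by (simp add: eq_neg_iff_add_eq_0 add.commute)
    qed
    have "(\<Sum>a<r. \<Sum>c<r. s a * t c * app Y (m a c)) = (\<Sum>a<r. s a * (\<Sum>c<r. t c * app Y (m a c)))"
      by (simp only: sum_distrib_left mult.assoc)
    also have "\<dots> = (\<Sum>a<r. s a * - (\<Sum>c<r. app Y (t c) * m a c))"
      by (rule sum.cong[OF refl]) (simp only: row lessThan_iff)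
    also have "\<dots> = - (\<Sum>a<r. \<Sum>c<r. app Y (t c) * (s a * m a c))"
      by (simp only: mult_minus_right sum_negf sum_distrib_left mult.left_commute)
    also have "(\<Sum>a<r. \<Sum>c<r. app Y (t c) * (s a * m a c)) = (\<Sum>c<r. \<Sum>a<r. app Y (t c) * (s a * m a c))" by (rule sum.swap)
    also have "\<dots> = (\<Sum>c<r. app Y (t c) * - \<omega> c)"
      unfolding sum_distrib_left[symmetric] by (rule sum.cong[OF refl]) (simp only: sm(2) lessThan_iff)
    also have "- (\<Sum>c<r. app Y (t c) * - \<omega> c) = (\<Sum>c<r. app Y (t c) * \<omega> c)" by (simp only: mult_minus_right sum_negf minus_minus)
    also have "\<dots> = - app Y (sg w z)" unfolding key[OF w z] t_def \<omega>_def by (simp only: minus_minus)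
    finally show ?thesis .
  qed
  \<comment> \<open>Contraction with \<open>\<sigma>\<close> turns Hamiltonian fields of base functions into horizontal lifts.\<close>
  have K: "(\<Sum>a<r. sg v (u a) * app (T.ham (q d)) (ba a)) = app (Hor v) (q d)" if "v \<in> vector_fields B" for v d
  proof -
    have "(\<Sum>a<r. sg v (u a) * app (T.ham (q d)) (ba a)) = - (\<Sum>a<r. sg v (u a) * app (T.ham (ba a)) (q d))"
      unfolding sum_negf[symmetric] by (rule sum.cong[OF refl]) (simp only: T.ham_skew[of "q d"] mult_minus_right)
    then show ?thesis unfolding Hor_by_ham[OF that] .
  qed
  have second: "(\<Sum>a<r. \<Sum>c<r. s a * t c * (\<Sum>d<r. m d c * app (T.ham (q d)) (ba a) - m d a * app (T.ham (q d)) (ba c))) = - cov_diff Q w z"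
  proof -
    define k where "k = (\<lambda>d a. app (T.ham (q d)) (ba a))"
    have "(\<Sum>a<r. \<Sum>c<r. s a * t c * (\<Sum>d<r. m d c * k d a - m d a * k d c)) =
        (\<Sum>a<r. \<Sum>c<r. \<Sum>d<r. (t c * m d c) * (s a * k d a) - (s a * m d a) * (t c * k d c))"
      unfolding sum_distrib_left by (intro sum.cong refl) (simp add: algebra_simps)
    also have "\<dots> = (\<Sum>a<r. \<Sum>d<r. \<Sum>c<r. (t c * m d c) * (s a * k d a) - (s a * m d a) * (t c * k d c))"
      by (rule sum.cong[OF refl], rule sum.swap)
    also have "\<dots> = (\<Sum>d<r. \<Sum>a<r. \<Sum>c<r. (t c * m d c) * (s a * k d a) - (s a * m d a) * (t c * k d c))"
      by (rule sum.swap)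
    also have "\<dots> = (\<Sum>d<r. (\<Sum>c<r. t c * m d c) * (\<Sum>a<r. s a * k d a) - (\<Sum>a<r. s a * m d a) * (\<Sum>c<r. t c * k d c))"
    proof (rule sum.cong[OF refl])
      fix d
      have "(\<Sum>a<r. \<Sum>c<r. (t c * m d c) * (s a * k d a) - (s a * m d a) * (t c * k d c)) =
          (\<Sum>a<r. \<Sum>c<r. (s a * k d a) * (t c * m d c)) - (\<Sum>a<r. \<Sum>c<r. (s a * m d a) * (t c * k d c))"
        unfolding sum_subtractf by (simp only: mult.commute)
      also have "\<dots> = (\<Sum>a<r. s a * k d a) * (\<Sum>c<r. t c * m d c) - (\<Sum>a<r. s a * m d a) * (\<Sum>c<r. t c * k d c)"
        by (simp only: sum_product)
      finally show "(\<Sum>a<r. \<Sum>c<r. (t c * m d c) * (s a * k d a) - (s a * m d a) * (t c * k d c)) =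
          (\<Sum>c<r. t c * m d c) * (\<Sum>a<r. s a * k d a) - (\<Sum>a<r. s a * m d a) * (\<Sum>c<r. t c * k d c)"
        by (simp only: mult.commute)
    qed
    also have "\<dots> = (\<Sum>d<r. \<zeta> d * app (Hor w) (q d) - \<omega> d * app (Hor z) (q d))"
    proof (rule sum.cong[OF refl])
      fix d assume "d \<in> {..<r}"
      then have d: "d < r" by simp
      have "(\<Sum>a<r. s a * k d a) = app (Hor w) (q d)" "(\<Sum>c<r. t c * k d c) = app (Hor z) (q d)"
        unfolding s_def t_def k_def by (rule K[OF w], rule K[OF z])
      then show "(\<Sum>c<r. t c * m d c) * (\<Sum>a<r. s a * k d a) - (\<Sum>a<r. s a * m d a) * (\<Sum>c<r. t c * k d c) =
          \<zeta> d * app (Hor w) (q d) - \<omega> d * app (Hor z) (q d)" by (simp only: tm[OF d] sm(1)[OF d])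
    qed
    also have "\<dots> = - cov_diff Q w z"
      unfolding cov_diff_expand[OF Q w z] sum_negf[symmetric]
    proof (rule sum.cong[OF refl])
      fix d assume "d \<in> {..<r}"
      then have d: "ev Q (u d) \<in> C_inf E" using ev_C[OF Q] by simp
      show "\<zeta> d * app (Hor w) (q d) - \<omega> d * app (Hor z) (q d) =
          - (app (Hor w) (ev Q (u d)) * (app z (y d) \<circ> \<pi>) - (app w (y d) \<circ> \<pi>) * app (Hor z) (ev Q (u d)))"
        unfolding q_def E.app_uminus[OF Hor_vf[OF w] d] E.app_uminus[OF Hor_vf[OF z] d] \<zeta>_def \<omega>_def by (simp add: algebra_simps)
    qed
    finally show ?thesis unfolding k_def .
  qed
  have "(\<Sum>a<r. \<Sum>c<r. s a * t c * D (ba a) (ba c)) = (\<Sum>a<r. \<Sum>c<r. s a * t c * app Y (m a c)) +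
      (\<Sum>a<r. \<Sum>c<r. s a * t c * (\<Sum>d<r. m d c * app (T.ham (q d)) (ba a) - m d a * app (T.ham (q d)) (ba c)))"
    unfolding sum.distrib[symmetric] by (intro sum.cong refl) (simp only: D_base lessThan_iff distrib_left)
  then have "(\<Sum>a<r. \<Sum>c<r. s a * t c * D (ba a) (ba c)) = - app Y (sg w z) + - cov_diff Q w z"
    unfolding first second .
  then show ?thesis unfolding s_def t_def by simp
qed

lemma D_vector_field:
  assumes f: "f \<in> C_inf E"
  obtains W where "W \<in> vector_fields E" "\<And>g. D f g = app W g"
proof (rule that[of "lie_bracket (hor_field Q + Y) (T.ham f) - T.ham (app (hor_field Q + Y) f)"])
  have Z: "hor_field Q + Y \<in> vector_fields E" by (rule E.vector_field_add[OF hor_field_vf[OF Q] YV])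
  show "lie_bracket (hor_field Q + Y) (T.ham f) - T.ham (app (hor_field Q + Y) f) \<in> vector_fields E"
    by (intro E.vector_field_diff E.vector_field_bracket Z T.ham_vector_field E.app_C f)
  show "D f g = app (lie_bracket (hor_field Q + Y) (T.ham f) - T.ham (app (hor_field Q + Y) f)) g" for g
    unfolding D_def T.defect_def app_minus app_bracket by simp
qed

lemma D_skew: "f \<in> C_inf E \<Longrightarrow> g \<in> C_inf E \<Longrightarrow> D f g = - D g f"
  unfolding D_def by (rule T.defect_skew[OF E.vector_field_add[OF hor_field_vf[OF Q] YV]])

lemma D_base_expand:
  assumes f: "f \<in> C_inf E" and j: "j < r"
  shows "D f (ba j) = (\<Sum>c<r. D f (ba c) * (app (u c) (y j) \<circ> \<pi>))"
proof -
  obtain W where W: "W \<in> vector_fields E" "\<And>g. D f g = app W g" by (rule D_vector_field[OF f]) (rule that)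
  show ?thesis unfolding W(2) ba_def[of j] by (rule app_pullback_expand[OF W(1)]) (simp add: j)
qed

text \<open>The contraction with \<open>\<sigma>\<close> is undone by contracting with \<open>m\<close> in each argument. As the frame is not a basis, this
  gives back only the projections of the arguments, but \<open>D\<close> is invariant under these (\<open>D_base_expand\<close>).\<close>

lemma D_base_from_contraction:
  assumes hyp: "\<And>w z. w \<in> vector_fields B \<Longrightarrow> z \<in> vector_fields B \<Longrightarrow> cov_diff Q w z + app Y (sg w z) = 0"
    and i: "i < r" and j: "j < r"
  shows "D (ba i) (ba j) = 0"
proof -
  have ms: "(\<Sum>x<r. m i x * sg (u x) (u a)) = - (app (u a) (y i) \<circ> \<pi>)" if "a < r" "i < r" for a i
    unfolding m_def ba_def[of i] by (rule ham_sigma) (use that in simp_all)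
  have zero: "(\<Sum>a<r. \<Sum>c<r. sg (u x) (u a) * sg (u x') (u c) * D (ba a) (ba c)) = 0" if "x < r" "x' < r" for x x'
    using D_contract[OF B.frame_vf[OF that(1)] B.frame_vf[OF that(2)]] hyp[OF B.frame_vf[OF that(1)] B.frame_vf[OF that(2)]] by simp
  have step1: "(\<Sum>a<r. (app (u a) (y i) \<circ> \<pi>) * (\<Sum>c<r. sg (u x') (u c) * D (ba a) (ba c))) = 0" if x': "x' < r" for x'
  proof -
    have "(\<Sum>x<r. m i x * (\<Sum>a<r. \<Sum>c<r. sg (u x) (u a) * sg (u x') (u c) * D (ba a) (ba c))) = 0"
      by (rule sum.neutral) (simp add: zero x')
    moreover have "(\<Sum>x<r. m i x * (\<Sum>a<r. \<Sum>c<r. sg (u x) (u a) * sg (u x') (u c) * D (ba a) (ba c))) =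
        (\<Sum>x<r. \<Sum>a<r. (m i x * sg (u x) (u a)) * (\<Sum>c<r. sg (u x') (u c) * D (ba a) (ba c)))"
      by (simp only: sum_distrib_left mult.assoc)
    moreover have "\<dots> = (\<Sum>a<r. \<Sum>x<r. (m i x * sg (u x) (u a)) * (\<Sum>c<r. sg (u x') (u c) * D (ba a) (ba c)))"
      by (rule sum.swap)
    moreover have "\<dots> = (\<Sum>a<r. - (app (u a) (y i) \<circ> \<pi>) * (\<Sum>c<r. sg (u x') (u c) * D (ba a) (ba c)))"
      unfolding sum_distrib_right[symmetric] by (rule sum.cong[OF refl]) (simp only: ms[OF _ i] lessThan_iff)
    ultimately show ?thesis by (simp add: sum_negf)
  qed
  have Dexp: "(\<Sum>a<r. (app (u a) (y i) \<circ> \<pi>) * D (ba a) (ba c)) = D (ba i) (ba c)" if c: "c < r" for c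
  proof -
    have "D (ba i) (ba c) = - D (ba c) (ba i)" by (rule D_skew) (simp_all add: i c)
    also have "\<dots> = - (\<Sum>a<r. D (ba c) (ba a) * (app (u a) (y i) \<circ> \<pi>))"
      unfolding D_base_expand[OF ba_C[OF c] i, symmetric] ..
    also have "\<dots> = (\<Sum>a<r. (app (u a) (y i) \<circ> \<pi>) * D (ba a) (ba c))"
      unfolding sum_negf[symmetric]
    proof (rule sum.cong[OF refl])
      fix a assume "a \<in> {..<r}"
      then have "D (ba c) (ba a) = - D (ba a) (ba c)" by (intro D_skew) (simp_all add: c)
      then show "- (D (ba c) (ba a) * (app (u a) (y i) \<circ> \<pi>)) = (app (u a) (y i) \<circ> \<pi>) * D (ba a) (ba c)"
        by (simp add: mult.commute)
    qed
    finally show ?thesis by (rule sym)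
  qed
  have step2: "(\<Sum>c<r. sg (u x') (u c) * D (ba i) (ba c)) = 0" if x': "x' < r" for x'
  proof -
    have "(\<Sum>c<r. sg (u x') (u c) * D (ba i) (ba c)) = (\<Sum>c<r. \<Sum>a<r. sg (u x') (u c) * ((app (u a) (y i) \<circ> \<pi>) * D (ba a) (ba c)))"
      unfolding sum_distrib_left[symmetric] by (rule sum.cong[OF refl]) (simp only: Dexp lessThan_iff)
    also have "\<dots> = (\<Sum>a<r. \<Sum>c<r. sg (u x') (u c) * ((app (u a) (y i) \<circ> \<pi>) * D (ba a) (ba c)))" by (rule sum.swap)
    also have "\<dots> = (\<Sum>a<r. (app (u a) (y i) \<circ> \<pi>) * (\<Sum>c<r. sg (u x') (u c) * D (ba a) (ba c)))"
      by (simp only: sum_distrib_left mult.left_commute)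
    finally show ?thesis unfolding step1[OF x'] .
  qed
  have "0 = (\<Sum>x<r. m j x * (\<Sum>c<r. sg (u x) (u c) * D (ba i) (ba c)))"
    by (rule sym, rule sum.neutral) (simp add: step2)
  also have "\<dots> = (\<Sum>x<r. \<Sum>c<r. (m j x * sg (u x) (u c)) * D (ba i) (ba c))"
    by (simp only: sum_distrib_left mult.assoc)
  also have "\<dots> = (\<Sum>c<r. \<Sum>x<r. (m j x * sg (u x) (u c)) * D (ba i) (ba c))" by (rule sum.swap)
  also have "\<dots> = (\<Sum>c<r. - (app (u c) (y j) \<circ> \<pi>) * D (ba i) (ba c))"
    unfolding sum_distrib_right[symmetric] by (rule sum.cong[OF refl]) (simp only: ms[OF _ j] lessThan_iff)
  also have "\<dots> = - (\<Sum>c<r. D (ba i) (ba c) * (app (u c) (y j) \<circ> \<pi>))"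
    by (simp only: mult_minus_left sum_negf mult.commute)
  also have "\<dots> = - D (ba i) (ba j)" unfolding D_base_expand[OF ba_C[OF i] j, symmetric] ..
  finally show ?thesis by simp
qed

text \<open>The components of \<open>L\<^sub>Z \<Theta>\<close> with respect to the splitting into horizontal and vertical vectors are read off
  from \<open>D_second_argument\<close>, \<open>Er_sum\<close> and \<open>D_contract\<close>; a bivector vanishes if and only if all three do.\<close>

theorem Poiss_components:
  "hor_field Q + Y \<in> Poiss E \<Theta> \<longleftrightarrow> Y \<in> Poiss E P \<and>
    (\<forall>w\<in>vector_fields B. \<forall>g\<in>C_inf E. app (lie_bracket (Hor w) Y) g = - app (V.ham (ev Q w)) g) \<and>
    (\<forall>w\<in>vector_fields B. \<forall>z\<in>vector_fields B. cov_diff Q w z + app Y (sg w z) = 0)"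
  (is "_ \<longleftrightarrow> ?p \<and> ?mixed \<and> ?base")
proof
  assume "hor_field Q + Y \<in> Poiss E \<Theta>"
  then have D0: "D f g = 0" if "f \<in> C_inf E" "g \<in> C_inf E" for f g
    using that unfolding T.Poiss_iff D_def by blast
  have V0: "V.defect Y (ba c) g = 0" if c: "c < r" and g: "g \<in> C_inf E" for c g
  proof -
    have p: "app (V.ham (ba c)) h = 0" for h unfolding ba_def by (rule ham_P_pullback_left) (simp add: c)
    show ?thesis unfolding V.defect_def Yba[OF c] p using V.ham_const[OF g, of 0] E.app_0[OF YV] by (simp add: zero_fun_def[symmetric])
  qed
  have mE: "(\<Sum>a<r. m a c * Er a g) = 0" if c: "c < r" and g: "g \<in> C_inf E" for c g
  proof -
    have "(\<Sum>x<r. D (ba c) (ba x) * app (Ha x) g) = 0" by (rule sum.neutral) (simp add: D0 c)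
    then show ?thesis
      using D_second_argument[OF ba_C[OF c] g] unfolding D0[OF ba_C[OF c] g] V0[OF c g] m_def by simp
  qed
  have sumE: "(\<Sum>a<r. (app w (y a) \<circ> \<pi>) * Er a g) = 0" if w: "w \<in> vector_fields B" and g: "g \<in> C_inf E" for w g
  proof -
    have "(\<Sum>a<r. (app w (y a) \<circ> \<pi>) * Er a g) = (\<Sum>a<r. (\<Sum>c<r. sg w (u c) * m a c) * Er a g)"
      by (rule sum.cong[OF refl]) (simp only: sg_m(2)[OF w] lessThan_iff)
    also have "\<dots> = (\<Sum>a<r. \<Sum>c<r. sg w (u c) * (m a c * Er a g))" by (simp only: sum_distrib_right mult.assoc)
    also have "\<dots> = (\<Sum>c<r. \<Sum>a<r. sg w (u c) * (m a c * Er a g))" by (rule sum.swap)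
    also have "\<dots> = (\<Sum>c<r. sg w (u c) * 0)"
      unfolding sum_distrib_left[symmetric] by (rule sum.cong[OF refl]) (simp only: mE[OF _ g] lessThan_iff)
    finally show ?thesis by simp
  qed
  have mixed: "app (lie_bracket (Hor w) Y) g = - app (V.ham (ev Q w)) g" if "w \<in> vector_fields B" "g \<in> C_inf E" for w g
    using Er_sum[OF that] sumE[OF that] by (simp add: algebra_simps)
  have E0: "Er a g = 0" if a: "a < r" and g: "g \<in> C_inf E" for a g
    unfolding Er_def q_def Ha_def V.ham_uminus[OF ev_C[OF Q B.frame_vf[OF a]] g] mixed[OF B.frame_vf[OF a] g] by simp
  have "V.defect Y f g = 0" if f: "f \<in> C_inf E" and g: "g \<in> C_inf E" for f g
  proof -
    have "(\<Sum>c<r. D f (ba c) * app (Ha c) g) = 0" "(\<Sum>a<r. app (T.ham (ba a)) f * Er a g) = 0"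
      by (rule sum.neutral, simp add: D0 f E0 g)+
    then show ?thesis using D_second_argument[OF f g] D0[OF f g] by simp
  qed
  then have ?p using YV by (simp add: V.Poiss_iff)
  moreover have "cov_diff Q w z + app Y (sg w z) = 0" if w: "w \<in> vector_fields B" "z \<in> vector_fields B" for w z
  proof -
    have "(\<Sum>a<r. \<Sum>c<r. sg w (u a) * sg z (u c) * D (ba a) (ba c)) = 0"
      by (intro sum.neutral ballI) (simp add: D0)
    then have "- (cov_diff Q w z + app Y (sg w z)) = 0" unfolding D_contract[OF w] .
    then show ?thesis by (simp only: neg_equal_0_iff_equal)
  qed
  ultimately show "?p \<and> ?mixed \<and> ?base" using mixed by blast
next
  assume h: "?p \<and> ?mixed \<and> ?base"
  have E0: "Er a g = 0" if a: "a < r" and g: "g \<in> C_inf E" for a g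
  proof -
    have "app (lie_bracket (Hor (u a)) Y) g = - app (V.ham (ev Q (u a))) g"
      using h B.frame_vf[OF a] g by blast
    then show ?thesis
      unfolding Er_def q_def Ha_def V.ham_uminus[OF ev_C[OF Q B.frame_vf[OF a]] g] by simp
  qed
  have Db: "D (ba i) (ba j) = 0" if "i < r" "j < r" for i j
    by (rule D_base_from_contraction[OF _ that]) (use h in blast)
  have Vd: "V.defect Y f g = 0" if "f \<in> C_inf E" "g \<in> C_inf E" for f g
    using conjunct1[OF h] that unfolding V.Poiss_iff by blast
  have red: "D f g = (\<Sum>c<r. D f (ba c) * app (Ha c) g)" if f: "f \<in> C_inf E" and g: "g \<in> C_inf E" for f g
  proof -
    have "(\<Sum>a<r. app (T.ham (ba a)) f * Er a g) = 0" by (rule sum.neutral) (simp add: E0 g)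
    then show ?thesis using D_second_argument[OF f g] Vd[OF f g] by simp
  qed
  have Dbg: "D (ba c) g = 0" if c: "c < r" and g: "g \<in> C_inf E" for c g
    unfolding red[OF ba_C[OF c] g] by (rule sum.neutral) (simp add: Db c)
  have "D f g = 0" if f: "f \<in> C_inf E" and g: "g \<in> C_inf E" for f g
    unfolding red[OF f g]
  proof (rule sum.neutral, intro ballI)
    fix c assume "c \<in> {..<r}"
    then have c: "c < r" by simp
    have "D f (ba c) = 0" using D_skew[OF f ba_C[OF c]] Dbg[OF c f] by simp
    then show "D f (ba c) * app (Ha c) g = 0" by simp
  qed
  then show "hor_field Q + Y \<in> Poiss E \<Theta>"
    unfolding T.Poiss_iff D_def using E.vector_field_add[OF hor_field_vf[OF Q] YV] by blast
qed

end

end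

section \<open>Splitting of short exact sequences of quotients\<close>

definition scl :: "real \<Rightarrow> ('x \<Rightarrow> 'y \<Rightarrow> real) \<Rightarrow> 'x \<Rightarrow> 'y \<Rightarrow> real" where
  "scl c f = (\<lambda>x y. c * f x y)"

interpretation fs: vector_space scl
  by unfold_locales (auto simp: scl_def fun_eq_iff algebra_simps)

interpretation fsp: vector_space_pair scl scl ..

definition linear_on :: "('x \<Rightarrow> 'y \<Rightarrow> real) set \<Rightarrow> (('x \<Rightarrow> 'y \<Rightarrow> real) \<Rightarrow> ('u \<Rightarrow> 'v \<Rightarrow> real)) \<Rightarrow> bool" where
  "linear_on S f \<longleftrightarrow> (\<forall>x\<in>S. \<forall>y\<in>S. f (x + y) = f x + f y) \<and> (\<forall>c. \<forall>x\<in>S. f (scl c x) = scl c (f x))"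

lemma linear_on_add: "linear_on S f \<Longrightarrow> x \<in> S \<Longrightarrow> y \<in> S \<Longrightarrow> f (x + y) = f x + f y"
  and linear_on_scl: "linear_on S f \<Longrightarrow> x \<in> S \<Longrightarrow> f (scl c x) = scl c (f x)"
  by (simp_all add: linear_on_def)

lemma linear_on_0: "linear_on S f \<Longrightarrow> fs.subspace S \<Longrightarrow> f 0 = 0"
  using linear_on_scl[of S f 0 0] fs.subspace_0[of S] by simp

lemma linear_on_diff: "linear_on S f \<Longrightarrow> fs.subspace S \<Longrightarrow> x \<in> S \<Longrightarrow> y \<in> S \<Longrightarrow> f (x - y) = f x - f y"
  using linear_on_add[of S f "x - y" y] fs.subspace_diff[of S x y] by (simp add: algebra_simps)

lemma linear_on_subset: "linear_on S f \<Longrightarrow> T \<subseteq> S \<Longrightarrow> linear_on T f"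
  unfolding linear_on_def by blast

lemma linear_on_image:
  assumes "linear_on S f" "fs.subspace S"
  shows "fs.subspace (f ` S)"
proof (rule fs.subspaceI)
  show "0 \<in> f ` S" using linear_on_0[OF assms] fs.subspace_0[OF assms(2)] by (metis imageI)
  show "x + y \<in> f ` S" if "x \<in> f ` S" "y \<in> f ` S" for x y
    using that fs.subspace_add[OF assms(2)] by (auto simp: linear_on_add[OF assms(1), symmetric])
  show "scl c x \<in> f ` S" if "x \<in> f ` S" for c x
    using that fs.subspace_scale[OF assms(2)] by (auto simp: linear_on_scl[OF assms(1), symmetric])
qed

definition coset :: "('x \<Rightarrow> 'y \<Rightarrow> real) set \<Rightarrow> ('x \<Rightarrow> 'y \<Rightarrow> real) \<Rightarrow> ('x \<Rightarrow> 'y \<Rightarrow> real) set" where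
  "coset N z = (\<lambda>n. n + z) ` N"

lemma a_r_coset_function_space: "a_r_coset (function_space S) N z = coset N z"
  by (auto simp: a_r_coset_def' coset_def function_space_def)

lemma coset_iff: "w \<in> coset N z \<longleftrightarrow> w - z \<in> N"
  unfolding coset_def image_iff by (metis diff_add_cancel add_diff_cancel_right')

lemma coset_eq_iff:
  assumes N: "fs.subspace N"
  shows "coset N z = coset N w \<longleftrightarrow> z - w \<in> N"
proof
  assume "coset N z = coset N w"
  moreover have "z \<in> coset N z" using fs.subspace_0[OF N] by (simp add: coset_iff)
  ultimately show "z - w \<in> N" by (simp add: coset_iff)
next
  assume zw: "z - w \<in> N"
  have "v - z \<in> N \<longleftrightarrow> v - w \<in> N" for v
    using fs.subspace_add[OF N _ zw, of "v - z"] fs.subspace_diff[OF N _ zw, of "v - w"] by auto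
  then show "coset N z = coset N w" by (auto simp: coset_iff)
qed

lemma quotient_carrier: "carrier (quotient_space (function_space S) N) = coset N ` S"
  by (auto simp: quotient_space_def A_RCOSETS_def' a_r_coset_function_space) (auto simp: function_space_def)

lemma quotient_add:
  assumes N: "fs.subspace N"
  shows "coset N z \<oplus>\<^bsub>quotient_space (function_space S) N\<^esub> coset N w = coset N (z + w)"
proof -
  have "coset N z \<oplus>\<^bsub>quotient_space (function_space S) N\<^esub> coset N w = (\<Union>x\<in>coset N z. \<Union>y\<in>coset N w. {x + y})"
    by (simp add: quotient_space_def set_add_def') (simp add: function_space_def)
  also have "\<dots> = coset N (z + w)"
  proof (rule Set.set_eqI)
    fix v
    show "v \<in> (\<Union>x\<in>coset N z. \<Union>y\<in>coset N w. {x + y}) \<longleftrightarrow> v \<in> coset N (z + w)"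
    proof
      assume "v \<in> (\<Union>x\<in>coset N z. \<Union>y\<in>coset N w. {x + y})"
      then obtain x y where "x - z \<in> N" "y - w \<in> N" "v = x + y" by (auto simp: coset_iff)
      then show "v \<in> coset N (z + w)" using fs.subspace_add[OF N, of "x - z" "y - w"] by (simp add: coset_iff algebra_simps)
    next
      assume "v \<in> coset N (z + w)"
      then have "v - w \<in> coset N z" by (simp add: coset_iff algebra_simps)
      moreover have "w \<in> coset N w" using fs.subspace_0[OF N] by (simp add: coset_iff)
      ultimately have "(v - w) + w \<in> (\<Union>x\<in>coset N z. \<Union>y\<in>coset N w. {x + y})" by blast
      then show "v \<in> (\<Union>x\<in>coset N z. \<Union>y\<in>coset N w. {x + y})" by simp
    qed
  qed
  finally show ?thesis .
qed

lemma quotient_smult: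
  assumes N: "fs.subspace N"
  shows "c \<odot>\<^bsub>quotient_space (function_space S) N\<^esub> coset N z = coset N (scl c z)"
proof -
  have "c \<odot>\<^bsub>quotient_space (function_space S) N\<^esub> coset N z = (\<Union>k\<in>coset N z. coset N (scl c k))"
    by (simp add: quotient_space_def a_r_coset_function_space) (simp add: function_space_def scl_def)
  also have "\<dots> = (\<Union>k\<in>coset N z. coset N (scl c z))"
  proof (intro SUP_cong refl)
    fix k assume "k \<in> coset N z"
    then have "scl c (k - z) \<in> N" using fs.subspace_scale[OF N] by (simp add: coset_iff)
    then show "coset N (scl c k) = coset N (scl c z)" by (simp add: coset_eq_iff[OF N] fs.scale_right_diff_distrib)
  qed
  also have "\<dots> = coset N (scl c z)" using fs.subspace_0[OF N] by (auto simp: coset_def)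
  finally show ?thesis .
qed

text \<open>A surjection of vector spaces has a linear section; adapting the basis to a subspace makes
  the section compatible with given subspaces that correspond to each other.\<close>

lemma linear_section:
  fixes p :: "('x \<Rightarrow> 'y \<Rightarrow> real) \<Rightarrow> ('u \<Rightarrow> 'v \<Rightarrow> real)"
  assumes S: "fs.subspace S" and N: "fs.subspace N" "N \<subseteq> S" and p: "linear_on S p"
    and NK: "fs.subspace (p ` N)"
  obtains g where "linear_on (p ` S) g" "\<And>k. k \<in> p ` S \<Longrightarrow> g k \<in> S \<and> p (g k) = k" "\<And>k. k \<in> p ` N \<Longrightarrow> g k \<in> N"
proof -
  obtain B0 where B0: "B0 \<subseteq> p ` N" "fs.independent B0" "p ` N \<subseteq> fs.span B0"
    using fs.maximal_independent_subset[of "p ` N"] by blast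
  have "B0 \<subseteq> p ` S" using B0(1) N(2) by blast
  then obtain B1 where B1: "B0 \<subseteq> B1" "B1 \<subseteq> p ` S" "fs.independent B1" "p ` S \<subseteq> fs.span B1"
    using fs.maximal_independent_subset_extend[OF _ B0(2), of "p ` S"] by blast
  have "\<forall>b\<in>B1. \<exists>z. z \<in> S \<and> p z = b \<and> (b \<in> B0 \<longrightarrow> z \<in> N)"
  proof
    fix b assume b: "b \<in> B1"
    show "\<exists>z. z \<in> S \<and> p z = b \<and> (b \<in> B0 \<longrightarrow> z \<in> N)"
    proof (cases "b \<in> B0")
      case True
      then obtain z where "z \<in> N" "b = p z" using B0(1) by blast
      then show ?thesis using N(2) by blast
    next
      case False
      then show ?thesis using b B1(2) by blast
    qed
  qed
  from bchoice[OF this] obtain h where h: "\<forall>b\<in>B1. h b \<in> S \<and> p (h b) = b \<and> (b \<in> B0 \<longrightarrow> h b \<in> N)" ..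
  obtain g where g: "Vector_Spaces.linear scl scl g" "\<And>x. x \<in> B1 \<Longrightarrow> g x = h x"
    using fsp.linear_independent_extend[OF B1(3), of h] by blast
  have ga: "g (x + y) = g x + g y" and gs: "g (scl c x) = scl c (g x)" for x y c
    by (rule fsp.linear_add[OF g(1)], rule fsp.linear_scale[OF g(1)])
  have g0: "g 0 = 0" using gs[of 0 0] by simp
  have "fs.subspace {k. g k \<in> S \<and> p (g k) = k}"
    by (rule fs.subspaceI)
      (simp_all add: g0 ga gs fs.subspace_0[OF S] fs.subspace_add[OF S] fs.subspace_scale[OF S] linear_on_0[OF p S] linear_on_add[OF p] linear_on_scl[OF p])
  moreover have "B1 \<subseteq> {k. g k \<in> S \<and> p (g k) = k}"
  proof
    fix b assume "b \<in> B1"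
    then show "b \<in> {k. g k \<in> S \<and> p (g k) = k}" using g(2)[of b] h by simp
  qed
  ultimately have K: "fs.span B1 \<subseteq> {k. g k \<in> S \<and> p (g k) = k}" by (simp add: fs.span_minimal)
  have "fs.subspace {k. g k \<in> N}"
    by (rule fs.subspaceI) (simp_all add: g0 ga gs fs.subspace_0[OF N(1)] fs.subspace_add[OF N(1)] fs.subspace_scale[OF N(1)])
  moreover have "B0 \<subseteq> {k. g k \<in> N}"
  proof
    fix b assume "b \<in> B0"
    then show "b \<in> {k. g k \<in> N}" using B1(1) g(2)[of b] h by auto
  qed
  ultimately have KN: "fs.span B0 \<subseteq> {k. g k \<in> N}" by (simp add: fs.span_minimal)
  show ?thesis
  proof (rule that[of g])
    show "linear_on (p ` S) g" by (simp add: linear_on_def ga gs)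
    show "g k \<in> S \<and> p (g k) = k" if "k \<in> p ` S" for k using K B1(4) that by blast
    show "g k \<in> N" if "k \<in> p ` N" for k using KN B0(3) that by blast
  qed
qed

text \<open>The sequence \<open>0 \<rightarrow> A \<rightarrow> S \<rightarrow> p S \<rightarrow> 0\<close> and its restriction \<open>0 \<rightarrow> NA \<rightarrow> N \<rightarrow> p N \<rightarrow> 0\<close> are exact.
  They split simultaneously, so the quotients form a split exact sequence too.\<close>

theorem quotient_splits:
  fixes p :: "('x \<Rightarrow> 'y \<Rightarrow> real) \<Rightarrow> ('x \<Rightarrow> 'y \<Rightarrow> real)" and \<iota> :: "('u \<Rightarrow> 'v \<Rightarrow> real) \<Rightarrow> ('x \<Rightarrow> 'y \<Rightarrow> real)"
  assumes S: "fs.subspace S" and N: "fs.subspace N" "N \<subseteq> S" and A: "fs.subspace A" and NA: "fs.subspace NA" "NA \<subseteq> A"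
    and p: "linear_on S p" and \<iota>: "linear_on A \<iota>" "inj_on \<iota> A"
    and kerS: "{z \<in> S. p z = 0} = \<iota> ` A" and kerN: "{z \<in> N. p z = 0} = \<iota> ` NA"
    and NK: "fs.subspace (p ` N)"
  shows "\<exists>\<Phi>. \<Phi> \<in> linear_isos (quotient_space (function_space S) N)
    (direct_sum (quotient_space (function_space A) NA) (quotient_space (function_space (p ` S)) (p ` N)))"
proof -
  obtain g where g: "linear_on (p ` S) g" "\<And>k. k \<in> p ` S \<Longrightarrow> g k \<in> S \<and> p (g k) = k" "\<And>k. k \<in> p ` N \<Longrightarrow> g k \<in> N"
    by (rule linear_section[OF S N p NK]) (rule that)
  \<comment> \<open>The retraction of \<open>\<iota>\<close> that belongs to the section \<open>g\<close>; it maps \<open>N\<close> to \<open>NA\<close> because \<open>g\<close> is compatible with \<open>N\<close>.\<close>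
  define j where "j z = the_inv_into A \<iota> (z - g (p z))" for z
  have gp: "g (p z) \<in> S" "p (g (p z)) = p z" if "z \<in> S" for z using g(2) that by blast+
  have rem: "z - g (p z) \<in> \<iota> ` A" if z: "z \<in> S" for z
  proof -
    have "z - g (p z) \<in> {z \<in> S. p z = 0}"
      using fs.subspace_diff[OF S z gp(1)[OF z]] linear_on_diff[OF p S z gp(1)[OF z]] gp(2)[OF z] by simp
    then show ?thesis unfolding kerS .
  qed
  have jA: "j z \<in> A" if "z \<in> S" for z unfolding j_def using the_inv_into_into[OF \<iota>(2) rem[OF that]] by blast
  have ij: "\<iota> (j z) = z - g (p z)" if "z \<in> S" for z unfolding j_def by (rule f_the_inv_into_f[OF \<iota>(2) rem[OF that]])
  have j_lin: "linear_on S j"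
    unfolding linear_on_def
  proof (intro conjI ballI allI)
    fix x y assume x: "x \<in> S" and y: "y \<in> S"
    have xy: "x + y \<in> S" by (rule fs.subspace_add[OF S x y])
    have "\<iota> (j (x + y)) = \<iota> (j x + j y)"
      unfolding linear_on_add[OF \<iota>(1) jA[OF x] jA[OF y]] ij[OF x] ij[OF y] ij[OF xy] linear_on_add[OF p x y]
        linear_on_add[OF g(1) imageI[OF x] imageI[OF y]] by (simp add: algebra_simps)
    then show "j (x + y) = j x + j y" by (rule inj_onD[OF \<iota>(2) _ jA[OF xy] fs.subspace_add[OF A jA[OF x] jA[OF y]]])
  next
    fix c x assume x: "x \<in> S"
    have cx: "scl c x \<in> S" by (rule fs.subspace_scale[OF S x])
    have "\<iota> (j (scl c x)) = \<iota> (scl c (j x))"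
      unfolding linear_on_scl[OF \<iota>(1) jA[OF x]] ij[OF x] ij[OF cx] linear_on_scl[OF p x] linear_on_scl[OF g(1) imageI[OF x]]
      by (simp add: fs.scale_right_diff_distrib)
    then show "j (scl c x) = scl c (j x)" by (rule inj_onD[OF \<iota>(2) _ jA[OF cx] fs.subspace_scale[OF A jA[OF x]]])
  qed
  have N_iff: "z \<in> N \<longleftrightarrow> j z \<in> NA \<and> p z \<in> p ` N" if z: "z \<in> S" for z
  proof
    assume zN: "z \<in> N"
    then have "g (p z) \<in> N" using g(3) by blast
    then have "z - g (p z) \<in> {z \<in> N. p z = 0}"
      using fs.subspace_diff[OF N(1) zN] linear_on_diff[OF p S z gp(1)[OF z]] gp(2)[OF z] by simp
    then obtain a where a: "a \<in> NA" "\<iota> (j z) = \<iota> a" unfolding kerN ij[OF z] by blast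
    then have "j z = a" using inj_onD[OF \<iota>(2) a(2) jA[OF z]] NA(2) by blast
    then show "j z \<in> NA \<and> p z \<in> p ` N" using a(1) zN by blast
  next
    assume h: "j z \<in> NA \<and> p z \<in> p ` N"
    then have "\<iota> (j z) \<in> \<iota> ` NA" by blast
    then have "z - g (p z) \<in> N" unfolding ij[OF z] kerN[symmetric] by simp
    moreover have "g (p z) \<in> N" using h g(3) by blast
    ultimately show "z \<in> N" using fs.subspace_add[OF N(1), of "z - g (p z)" "g (p z)"] by simp
  qed
  have onto: "\<exists>z\<in>S. j z = a \<and> p z = k" if a: "a \<in> A" and k: "k \<in> p ` S" for a k
  proof -
    have ia: "\<iota> a \<in> S" "p (\<iota> a) = 0" using a kerS by blast+
    have gk: "g k \<in> S" "p (g k) = k" using g(2)[OF k] by simp_all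
    define z where "z = \<iota> a + g k"
    have zS: "z \<in> S" unfolding z_def by (rule fs.subspace_add[OF S ia(1) gk(1)])
    have pz: "p z = k" unfolding z_def linear_on_add[OF p ia(1) gk(1)] using ia gk by simp
    have "\<iota> (j z) = \<iota> a" unfolding ij[OF zS] pz by (simp add: z_def)
    then have "j z = a" by (rule inj_onD[OF \<iota>(2) _ jA[OF zS] a])
    then show ?thesis using zS pz by blast
  qed
  define \<Phi> where "\<Phi> K = (let z = SOME z. z \<in> S \<and> coset N z = K in (coset NA (j z), coset (p ` N) (p z)))" for K
  have eq_iff: "coset N z = coset N w \<longleftrightarrow> coset NA (j z) = coset NA (j w) \<and> coset (p ` N) (p z) = coset (p ` N) (p w)"
    if z: "z \<in> S" and w: "w \<in> S" for z w
    unfolding coset_eq_iff[OF N(1)] coset_eq_iff[OF NA(1)] coset_eq_iff[OF NK] N_iff[OF fs.subspace_diff[OF S z w]]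
      linear_on_diff[OF j_lin S z w] linear_on_diff[OF p S z w] ..
  have \<Phi>: "\<Phi> (coset N z) = (coset NA (j z), coset (p ` N) (p z))" if z: "z \<in> S" for z
  proof -
    define w where "w = (SOME w. w \<in> S \<and> coset N w = coset N z)"
    have w: "w \<in> S \<and> coset N w = coset N z" unfolding w_def by (rule someI[of _ z]) (simp add: z)
    have "coset NA (j w) = coset NA (j z)" "coset (p ` N) (p w) = coset (p ` N) (p z)"
      using w eq_iff[OF conjunct1[OF w] z] by simp_all
    then show ?thesis unfolding \<Phi>_def Let_def w_def[symmetric] by simp
  qed
  let ?Q = "quotient_space (function_space S) N"
  let ?D = "direct_sum (quotient_space (function_space A) NA) (quotient_space (function_space (p ` S)) (p ` N))"
  have cQ: "carrier ?Q = coset N ` S" by (rule quotient_carrier)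
  have cD: "carrier ?D = (coset NA ` A) \<times> (coset (p ` N) ` p ` S)" by (simp add: direct_sum_def quotient_carrier)
  have "bij_betw \<Phi> (carrier ?Q) (carrier ?D)"
    unfolding bij_betw_def cQ cD
  proof
    show "inj_on \<Phi> (coset N ` S)"
    proof (rule inj_onI)
      fix x y assume "x \<in> coset N ` S" "y \<in> coset N ` S" and e: "\<Phi> x = \<Phi> y"
      then obtain z w where zw: "z \<in> S" "w \<in> S" "x = coset N z" "y = coset N w" by blast
      then show "x = y" using e by (simp add: \<Phi> eq_iff)
    qed
    show "\<Phi> ` coset N ` S = (coset NA ` A) \<times> (coset (p ` N) ` p ` S)"
    proof
      show "\<Phi> ` coset N ` S \<subseteq> (coset NA ` A) \<times> (coset (p ` N) ` p ` S)"
      proof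
        fix x assume "x \<in> \<Phi> ` coset N ` S"
        then obtain z where z: "z \<in> S" "x = (coset NA (j z), coset (p ` N) (p z))" using \<Phi> by auto
        then show "x \<in> (coset NA ` A) \<times> (coset (p ` N) ` p ` S)" using jA by blast
      qed
      show "(coset NA ` A) \<times> (coset (p ` N) ` p ` S) \<subseteq> \<Phi> ` coset N ` S"
      proof
        fix x assume "x \<in> (coset NA ` A) \<times> (coset (p ` N) ` p ` S)"
        then obtain a k where ak: "a \<in> A" "k \<in> p ` S" "x = (coset NA a, coset (p ` N) k)" by blast
        obtain z where z: "z \<in> S" "j z = a" "p z = k" using onto[OF ak(1,2)] by blast
        then have "x = \<Phi> (coset N z)" using \<Phi>[OF z(1)] ak(3) by simp
        then show "x \<in> \<Phi> ` coset N ` S" using z(1) by blast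
      qed
    qed
  qed
  moreover have "\<Phi> (x \<oplus>\<^bsub>?Q\<^esub> y) = \<Phi> x \<oplus>\<^bsub>?D\<^esub> \<Phi> y" if "x \<in> carrier ?Q" "y \<in> carrier ?Q" for x y
  proof -
    obtain z w where zw: "z \<in> S" "w \<in> S" "x = coset N z" "y = coset N w" using \<open>x \<in> carrier ?Q\<close> \<open>y \<in> carrier ?Q\<close> unfolding cQ by blast
    have "\<Phi> (x \<oplus>\<^bsub>?Q\<^esub> y) = (coset NA (j z + j w), coset (p ` N) (p z + p w))"
      unfolding zw(3,4) quotient_add[OF N(1)] \<Phi>[OF fs.subspace_add[OF S zw(1,2)]]
        linear_on_add[OF j_lin zw(1,2)] linear_on_add[OF p zw(1,2)] ..
    also have "\<dots> = \<Phi> x \<oplus>\<^bsub>?D\<^esub> \<Phi> y"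
      unfolding zw(3,4) \<Phi>[OF zw(1)] \<Phi>[OF zw(2)] by (simp add: direct_sum_def quotient_add[OF NA(1)] quotient_add[OF NK])
    finally show ?thesis .
  qed
  moreover have "\<Phi> (c \<odot>\<^bsub>?Q\<^esub> x) = c \<odot>\<^bsub>?D\<^esub> \<Phi> x" if "x \<in> carrier ?Q" for c x
  proof -
    obtain z where z: "z \<in> S" "x = coset N z" using \<open>x \<in> carrier ?Q\<close> unfolding cQ by blast
    have "\<Phi> (c \<odot>\<^bsub>?Q\<^esub> x) = (coset NA (scl c (j z)), coset (p ` N) (scl c (p z)))"
      unfolding z(2) quotient_smult[OF N(1)] \<Phi>[OF fs.subspace_scale[OF S z(1)]]
        linear_on_scl[OF j_lin z(1)] linear_on_scl[OF p z(1)] ..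
    also have "\<dots> = c \<odot>\<^bsub>?D\<^esub> \<Phi> x"
      unfolding z(2) \<Phi>[OF z(1)] by (simp add: direct_sum_def quotient_smult[OF NA(1)] quotient_smult[OF NK])
    finally show ?thesis .
  qed
  ultimately show ?thesis unfolding linear_isos_def by blast
qed

section \<open>The first Poisson cohomology of a coupling tensor\<close>

lemma scl_fscale: "scl c Z = fscale (\<lambda>_. c) Z"
  by (simp add: scl_def fscale_def)

lemma app_scl [simp]: "app (scl c Z) f = (\<lambda>p. c * app Z f p)"
  by (simp add: scl_def app_def)

lemma field_eqI: "(\<And>f. app X f = app Y f) \<Longrightarrow> X = Y"
  unfolding app_def by (intro ext) (metis (no_types))

lemma (in manifold) vector_fields_subspace: "fs.subspace (vector_fields M)"
  by (rule fs.subspaceI) (simp_all add: vector_field_0 vector_field_add scl_fscale vector_field_fscale)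

lemma (in manifold) app_scale_function: "X \<in> vector_fields M \<Longrightarrow> f \<in> C \<Longrightarrow> app X (\<lambda>p. c * f p) = (\<lambda>p. c * app X f p)"
  using tangent_scale[OF vector_field_tangent] by (simp add: app_def)

context framed_bivector begin

lemma ham_scale_function:
  "f \<in> C \<Longrightarrow> h \<in> C \<Longrightarrow> app (ham (\<lambda>p. c * f p)) h = (\<lambda>p. c * app (ham f) h p)"
  unfolding ham_skew[of _ h] by (simp add: app_scale_function fun_eq_iff)

lemma ham_plus: "f \<in> C \<Longrightarrow> g \<in> C \<Longrightarrow> ham (f + g) = ham f + ham g"
  by (rule vector_field_eqI) (simp_all add: C_inf_add vector_field_add ham_add)

lemma ham_neg: "f \<in> C \<Longrightarrow> ham (- f) = - ham f"
  by (rule vector_field_eqI) (simp_all add: C_inf_uminus vector_field_uminus ham_uminus)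

lemma ham_minus: "f \<in> C \<Longrightarrow> g \<in> C \<Longrightarrow> ham (f - g) = ham f - ham g"
  using ham_plus[of f "- g"] ham_neg[of g] by (simp add: C_inf_uminus)

lemma ham_scl: "f \<in> C \<Longrightarrow> ham (\<lambda>p. c * f p) = scl c (ham f)"
  by (rule vector_field_eqI)
    (simp_all add: C_inf_scale ham_scale_function fs.subspace_scale[OF vector_fields_subspace])

lemma Ham_subspace: "fs.subspace (Ham M \<Theta>)"
  unfolding Ham_eq
proof (rule fs.subspaceI)
  have "ham 0 = 0" using ham_scl[of 0 0] by (simp add: zero_fun_def)
  then show "0 \<in> ham ` C" by (metis C_inf_0 imageI)
  show "x + y \<in> ham ` C" if "x \<in> ham ` C" "y \<in> ham ` C" for x y
    using that by (auto simp: ham_plus[symmetric] C_inf_add)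
  show "scl c x \<in> ham ` C" if "x \<in> ham ` C" for c x
    using that by (auto simp: ham_scl[symmetric] C_inf_scale)
qed

lemma defect_scl: "Z \<in> vector_fields M \<Longrightarrow> f \<in> C \<Longrightarrow> g \<in> C \<Longrightarrow> defect (scl c Z) f g = (\<lambda>p. c * defect Z f g p)"
  unfolding defect_def by (simp add: ham_scale_function app_scale_function fun_eq_iff algebra_simps)

lemma Poiss_subspace: "fs.subspace (Poiss M \<Theta>)"
proof (rule fs.subspaceI)
  show scl: "scl c x \<in> Poiss M \<Theta>" if "x \<in> Poiss M \<Theta>" for c x
    using that unfolding Poiss_iff
    by (simp add: defect_scl fs.subspace_scale[OF vector_fields_subspace] zero_fun_def)
  show add: "x + y \<in> Poiss M \<Theta>" if "x \<in> Poiss M \<Theta>" "y \<in> Poiss M \<Theta>" for x y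
    using that unfolding Poiss_iff by (simp add: defect_add vector_field_add)
  have "defect 0 f g = 0" if "f \<in> C" "g \<in> C" for f g
    using defect_scl[OF vector_field_0 that, of 0] by (simp add: zero_fun_def)
  then show "0 \<in> Poiss M \<Theta>" unfolding Poiss_iff by (simp add: vector_field_0)
qed

lemma Ham_Poiss: "poisson_tensor M \<Theta> \<Longrightarrow> Ham M \<Theta> \<subseteq> Poiss M \<Theta>"
  unfolding Ham_eq using Jacobi by (auto simp: Poiss_iff)

end

context coupling_bundle begin

text \<open>The components of a field with respect to \<open>T E = H \<oplus> V\<close>, the horizontal one being encoded as the form
  \<open>\<sigma>(\<pi>\<^sub>* Z, -)\<close> on the base.\<close>

definition vert_part :: "'e vfield \<Rightarrow> 'e vfield" where
  "vert_part Z = Z - (\<Sum>a<r. fscale (app Z (ba a)) (Ha a))"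

definition base_form :: "'e vfield \<Rightarrow> ('e, 'b) bform" where
  "base_form Z = form_of_coeffs (\<lambda>c. \<Sum>a<r. app Z (ba a) * sg (u a) (u c))"

lemma vert_part_vertical: "Z \<in> vector_fields E \<Longrightarrow> vert (vert_part Z)"
proof -
  assume Z: "Z \<in> vector_fields E"
  have "vert_part Z \<in> vector_fields E"
    unfolding vert_part_def by (intro E.vector_field_diff E.vector_field_sum E.vector_field_fscale Z) (simp_all add: Z Ha_vf)
  moreover have "vert_part Z e \<in> Vert e" for e
  proof -
    have "vert_part Z e = Z e - (\<Sum>a<r. (\<lambda>f. Z e (ba a) * Ha a e f))"
      by (simp add: vert_part_def fscale_def app_def sum_fun_apply fun_eq_iff)
    then show ?thesis using vertical_part[OF E.vector_field_tangent[OF Z]] by simp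
  qed
  ultimately show ?thesis by (simp add: vert_def)
qed

lemma vert_part_linear: "linear_on UNIV vert_part"
  unfolding linear_on_def
proof (intro conjI ballI allI)
  show "vert_part (Z + W) = vert_part Z + vert_part W" for Z W
    by (rule field_eqI) (simp add: vert_part_def distrib_right sum.distrib)
  show "vert_part (scl c Z) = scl c (vert_part Z)" for c Z
    by (rule field_eqI) (simp add: vert_part_def fun_eq_iff sum_fun_apply sum_distrib_left algebra_simps)
qed

lemma sg_expand_right:
  assumes "z \<in> vector_fields B" "w \<in> vector_fields B"
  shows "sg z w = (\<Sum>c<r. sg z (u c) * (app w (y c) \<circ> \<pi>))"
proof -
  have "sg z w = - sg w z" by (rule sg_skew[OF assms])
  also have "\<dots> = - (\<Sum>c<r. (app w (y c) \<circ> \<pi>) * sg (u c) z)" by (rule arg_cong[OF sg_expand[OF assms(2,1)]])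
  also have "\<dots> = (\<Sum>c<r. sg z (u c) * (app w (y c) \<circ> \<pi>))"
    unfolding sum_negf[symmetric]
  proof (rule sum.cong[OF refl])
    fix c assume "c \<in> {..<r}"
    then have "u c \<in> vector_fields B" by simp
    from sg_skew[OF assms(1) this] show "- ((app w (y c) \<circ> \<pi>) * sg (u c) z) = sg z (u c) * (app w (y c) \<circ> \<pi>)"
      by (simp add: mult.commute)
  qed
  finally show ?thesis .
qed

lemma ev_base_form:
  assumes w: "w \<in> vector_fields B"
  shows "ev (base_form Z) w = (\<Sum>a<r. app Z (ba a) * sg (u a) w)"
proof -
  have "ev (base_form Z) w = (\<Sum>c<r. \<Sum>a<r. app Z (ba a) * (sg (u a) (u c) * (app w (y c) \<circ> \<pi>)))"
    unfolding base_form_def ev_form_of_coeffs[OF w] by (simp add: sum_distrib_right mult.assoc)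
  also have "\<dots> = (\<Sum>a<r. \<Sum>c<r. app Z (ba a) * (sg (u a) (u c) * (app w (y c) \<circ> \<pi>)))" by (rule sum.swap)
  also have "\<dots> = (\<Sum>a<r. app Z (ba a) * sg (u a) w)"
  proof (rule sum.cong[OF refl])
    fix a assume "a \<in> {..<r}"
    then have "u a \<in> vector_fields B" by simp
    from sg_expand_right[OF this w]
    show "(\<Sum>c<r. app Z (ba a) * (sg (u a) (u c) * (app w (y c) \<circ> \<pi>))) = app Z (ba a) * sg (u a) w"
      by (simp only: sum_distrib_left)
  qed
  finally show ?thesis .
qed

lemma base_form_Omega: "Z \<in> vector_fields E \<Longrightarrow> base_form Z \<in> Omega_B E B \<pi> 1"
  unfolding base_form_def Omega_B_def
  by (rule form_of_coeffs_tensor, rule E.C_inf_sum, rule E.C_inf_mult) (simp_all add: sg_C)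

lemma field_decompose:
  assumes Z: "Z \<in> vector_fields E"
  shows "Z = hor_field (base_form Z) + vert_part Z"
proof (rule field_eqI)
  fix f
  have "app (hor_field (base_form Z)) f = (\<Sum>a<r. \<Sum>c<r. app Z (ba c) * - (sg (u c) (u a) * app (T.ham (ba a)) f))"
    unfolding app_hor_field
    by (rule sum.cong[OF refl]) (simp add: ev_base_form sum_distrib_right sum_negf[symmetric] mult.assoc)
  also have "\<dots> = (\<Sum>c<r. \<Sum>a<r. app Z (ba c) * - (sg (u c) (u a) * app (T.ham (ba a)) f))" by (rule sum.swap)
  also have "\<dots> = (\<Sum>c<r. app Z (ba c) * app (Ha c) f)"
  proof (rule sum.cong[OF refl])
    fix c assume "c \<in> {..<r}"
    then have "u c \<in> vector_fields B" by simp
    from Hor_by_ham[OF this, of f]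
    show "(\<Sum>a<r. app Z (ba c) * - (sg (u c) (u a) * app (T.ham (ba a)) f)) = app Z (ba c) * app (Ha c) f"
      by (simp add: Ha_def sum_distrib_left sum_negf)
  qed
  finally show "app Z f = app (hor_field (base_form Z) + vert_part Z) f" by (simp add: vert_part_def)
qed

lemma app_hor_field_base:
  "app (hor_field Q) f = (\<Sum>c<r. app (hor_field Q) (ba c) * app (Ha c) f)"
proof -
  have "app (hor_field Q) f = (\<Sum>a<r. \<Sum>c<r. - ev Q (u a) * app (T.ham (ba a)) (ba c) * app (Ha c) f)"
    unfolding app_hor_field
  proof (rule sum.cong[OF refl])
    fix a assume "a \<in> {..<r}"
    then have "y a \<in> C_inf B" by simp
    from ham_pullback_frame[OF this, of f]
    show "- ev Q (u a) * app (T.ham (ba a)) f = (\<Sum>c<r. - ev Q (u a) * app (T.ham (ba a)) (ba c) * app (Ha c) f)"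
      unfolding ba_def[of a, symmetric] by (simp only: sum_distrib_left mult.assoc)
  qed
  also have "\<dots> = (\<Sum>c<r. app (hor_field Q) (ba c) * app (Ha c) f)"
    unfolding app_hor_field sum_distrib_right by (rule sum.swap)
  finally show ?thesis .
qed

lemma vert_part_hor_field_plus:
  assumes Y: "vert Y"
  shows "vert_part (hor_field Q + Y) = Y"
proof (rule field_eqI)
  fix f
  have "(\<Sum>a<r. app (hor_field Q + Y) (ba a) * app (Ha a) f) = (\<Sum>a<r. app (hor_field Q) (ba a) * app (Ha a) f)"
  proof (rule sum.cong[OF refl])
    fix a assume "a \<in> {..<r}"
    then have "app Y (ba a) = 0" unfolding ba_def by (intro vert_pullback[OF Y]) simp
    then show "app (hor_field Q + Y) (ba a) * app (Ha a) f = app (hor_field Q) (ba a) * app (Ha a) f" by simp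
  qed
  also have "\<dots> = app (hor_field Q) f" by (rule app_hor_field_base[symmetric])
  finally show "app (vert_part (hor_field Q + Y)) f = app Y f" by (simp add: vert_part_def)
qed

lemma vert_0: "vert 0"
  by (simp add: vert_def E.vector_field_0 vertical_0)

lemma vert_part_hor_field: "vert_part (hor_field Q) = 0"
  using vert_part_hor_field_plus[OF vert_0] by simp

lemma base_form_hor_field:
  assumes Q: "Q \<in> Omega_B E B \<pi> 1"
  shows "base_form (hor_field Q) = Q"
proof (rule form1_eqI[OF Omega_alt1[OF base_form_Omega[OF hor_field_vf[OF Q]]] Omega_alt1[OF Q]])
  fix w assume w: "w \<in> vector_fields B"
  have "ev (base_form (hor_field Q)) w = (\<Sum>c<r. \<Sum>a<r. - ev Q (u a) * (app (T.ham (ba a)) (ba c) * sg (u c) w))"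
    unfolding ev_base_form[OF w] app_hor_field by (simp add: sum_distrib_right mult.assoc)
  also have "\<dots> = (\<Sum>a<r. \<Sum>c<r. - ev Q (u a) * (app (T.ham (ba a)) (ba c) * sg (u c) w))" by (rule sum.swap)
  also have "\<dots> = (\<Sum>a<r. ev Q (u a) * (app w (y a) \<circ> \<pi>))"
  proof (rule sum.cong[OF refl])
    fix a assume "a \<in> {..<r}"
    then have "y a \<in> C_inf B" by simp
    from ham_sigma[OF this w]
    have *: "(\<Sum>c<r. app (T.ham (ba a)) (ba c) * sg (u c) w) = - (app w (y a) \<circ> \<pi>)" by (simp add: ba_def)
    show "(\<Sum>c<r. - ev Q (u a) * (app (T.ham (ba a)) (ba c) * sg (u c) w)) = ev Q (u a) * (app w (y a) \<circ> \<pi>)"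
      unfolding sum_distrib_left[symmetric] * by simp
  qed
  also have "\<dots> = ev Q w" by (rule ev_expand[OF Omega_alt1[OF Q] w, symmetric])
  finally show "ev (base_form (hor_field Q)) w = ev Q w" .
qed

lemma hor_field_inj: "inj_on hor_field (Omega_B E B \<pi> 1)"
  by (rule inj_on_inverseI[of _ base_form]) (rule base_form_hor_field)

lemma ev_plus: "ev (Q + R) w = ev Q w + ev R w"
  and ev_minus: "ev (Q - R) w = ev Q w - ev R w"
  and ev_scl: "ev (scl c Q) w = (\<lambda>e. c * ev Q w e)"
  by (simp_all add: fun_eq_iff ev_apply scl_def)

lemma hor_field_linear: "linear_on UNIV hor_field"
  unfolding linear_on_def
proof (intro conjI ballI allI)
  show "hor_field (Q + R) = hor_field Q + hor_field R" for Q R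
    by (rule field_eqI) (simp add: app_hor_field ev_plus sum.distrib[symmetric] algebra_simps)
  show "hor_field (scl c Q) = scl c (hor_field Q)" for c Q
    by (rule field_eqI) (simp add: app_hor_field ev_scl fun_eq_iff sum_fun_apply sum_distrib_left algebra_simps)
qed

lemma alt_forms_closed:
  "(\<And>e. \<eta> e \<in> alt_forms_at B p (\<pi> e)) \<Longrightarrow> (\<And>e. \<zeta> e \<in> alt_forms_at B p (\<pi> e)) \<Longrightarrow> (\<eta> + \<zeta>) e \<in> alt_forms_at B p (\<pi> e)"
  "(\<And>e. \<eta> e \<in> alt_forms_at B p (\<pi> e)) \<Longrightarrow> scl c \<eta> e \<in> alt_forms_at B p (\<pi> e)"
  using B.alt_forms_add[of "\<eta> e" p "\<pi> e" "\<zeta> e"] B.alt_forms_scale[of "\<eta> e" p "\<pi> e" c]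
  by (simp_all add: scl_def plus_fun_def)

lemma tensor1_subspace:
  assumes A: "submod A" "\<And>c f. f \<in> A \<Longrightarrow> (\<lambda>e. c * f e) \<in> A"
  shows "fs.subspace (tensor_forms B \<pi> 1 A)"
proof (rule fs.subspaceI)
  show "\<eta> + \<zeta> \<in> tensor_forms B \<pi> 1 A" if "\<eta> \<in> tensor_forms B \<pi> 1 A" "\<zeta> \<in> tensor_forms B \<pi> 1 A" for \<eta> \<zeta>
  proof (rule form1I)
    show "(\<eta> + \<zeta>) e \<in> alt_forms_at B 1 (\<pi> e)" for e by (rule alt_forms_closed(1)) (rule tensor_alt1, rule that)+
    show "ev (\<eta> + \<zeta>) w \<in> A" if w: "w \<in> vector_fields B" for w
      using A(1) ev_tensor[OF A(1) \<open>\<eta> \<in> _\<close> w] ev_tensor[OF A(1) \<open>\<zeta> \<in> _\<close> w] unfolding ev_plus submod_def by blast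
  qed
  show s: "scl c \<eta> \<in> tensor_forms B \<pi> 1 A" if "\<eta> \<in> tensor_forms B \<pi> 1 A" for c \<eta>
  proof (rule form1I)
    show "scl c \<eta> e \<in> alt_forms_at B 1 (\<pi> e)" for e by (rule alt_forms_closed(2)) (rule tensor_alt1, rule that)
    show "ev (scl c \<eta>) w \<in> A" if w: "w \<in> vector_fields B" for w
      unfolding ev_scl by (rule A(2)[OF ev_tensor[OF A(1) \<open>\<eta> \<in> _\<close> w]])
  qed
  have "form_of_coeffs (\<lambda>c. 0) \<in> tensor_forms B \<pi> 1 A" using A(1) by (intro form_of_coeffs_tensor) (simp add: submod_def)
  from s[OF this, of 0] show "0 \<in> tensor_forms B \<pi> 1 A" by simp
qed

lemma Omega1_subspace: "fs.subspace (Omega_B E B \<pi> 1)"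
  unfolding Omega_B_def by (rule tensor1_subspace[OF submod_C E.C_inf_scale])

lemma Cas_scale: "F \<in> Casim E P \<Longrightarrow> (\<lambda>e. c * F e) \<in> Casim E P"
  by (simp add: V.Casim_iff E.C_inf_scale V.ham_scl)

lemma Cas1_subspace: "fs.subspace (Cas_forms E B \<pi> P 1)"
  unfolding Cas_forms_def by (rule tensor1_subspace[OF submod_Casim Cas_scale])

lemma cov_diff_linear:
  assumes "Q \<in> Omega_B E B \<pi> 1" "R \<in> Omega_B E B \<pi> 1" "w \<in> vector_fields B" "z \<in> vector_fields B"
  shows "cov_diff (Q + R) w z = cov_diff Q w z + cov_diff R w z" and "cov_diff (Q - R) w z = cov_diff Q w z - cov_diff R w z"
    and "cov_diff (scl c Q) w z = (\<lambda>e. c * cov_diff Q w z e)"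
  using assms unfolding cov_diff_def ev_plus ev_minus ev_scl
  by (simp_all add: E.app_add E.app_diff E.app_scale_function Hor_vf ev_C fun_eq_iff algebra_simps)

lemma ev2_plus: "ev2 (\<eta> + \<zeta>) w z = ev2 \<eta> w z + ev2 \<zeta> w z"
  and ev2_scl: "ev2 (scl c \<eta>) w z = (\<lambda>e. c * ev2 \<eta> w z e)"
  by (simp_all add: ev2_def on_fields_def fun_eq_iff scl_def)

lemma cov1_linear: "linear_on (Omega_B E B \<pi> 1) (cov_deriv E B \<pi> \<gamma> 1)"
  unfolding linear_on_def
proof (intro conjI ballI allI)
  have alt: "\<eta> e \<in> alt_forms_at B 2 (\<pi> e)" if "\<eta> \<in> Omega_B E B \<pi> 2" for \<eta> e
    by (rule B.tensor_form_alt[OF that[unfolded Omega_B_def]])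
  fix Q R assume Q: "Q \<in> Omega_B E B \<pi> 1" and R: "R \<in> Omega_B E B \<pi> 1"
  have QR: "Q + R \<in> Omega_B E B \<pi> 1" by (rule fs.subspace_add[OF Omega1_subspace Q R])
  show "cov_deriv E B \<pi> \<gamma> 1 (Q + R) = cov_deriv E B \<pi> \<gamma> 1 Q + cov_deriv E B \<pi> \<gamma> 1 R"
  proof (rule form2_alt_eqI)
    show "cov_deriv E B \<pi> \<gamma> 1 (Q + R) e \<in> alt_forms_at B 2 (\<pi> e)" for e by (rule alt[OF cov1(1)[OF QR]])
    show "(cov_deriv E B \<pi> \<gamma> 1 Q + cov_deriv E B \<pi> \<gamma> 1 R) e \<in> alt_forms_at B 2 (\<pi> e)" for e
      by (rule alt_forms_closed(1)) (rule alt[OF cov1(1)[OF Q]], rule alt[OF cov1(1)[OF R]])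
    fix w z assume wz: "w \<in> vector_fields B" "z \<in> vector_fields B"
    show "ev2 (cov_deriv E B \<pi> \<gamma> 1 (Q + R)) w z = ev2 (cov_deriv E B \<pi> \<gamma> 1 Q + cov_deriv E B \<pi> \<gamma> 1 R) w z"
      unfolding ev2_plus cov1(2)[OF QR wz] cov1(2)[OF Q wz] cov1(2)[OF R wz] by (rule cov_diff_linear(1)[OF Q R wz])
  qed
next
  have alt: "\<eta> e \<in> alt_forms_at B 2 (\<pi> e)" if "\<eta> \<in> Omega_B E B \<pi> 2" for \<eta> e
    by (rule B.tensor_form_alt[OF that[unfolded Omega_B_def]])
  fix c Q assume Q: "Q \<in> Omega_B E B \<pi> 1"
  have cQ: "scl c Q \<in> Omega_B E B \<pi> 1" by (rule fs.subspace_scale[OF Omega1_subspace Q])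
  show "cov_deriv E B \<pi> \<gamma> 1 (scl c Q) = scl c (cov_deriv E B \<pi> \<gamma> 1 Q)"
  proof (rule form2_alt_eqI)
    show "cov_deriv E B \<pi> \<gamma> 1 (scl c Q) e \<in> alt_forms_at B 2 (\<pi> e)" for e by (rule alt[OF cov1(1)[OF cQ]])
    show "scl c (cov_deriv E B \<pi> \<gamma> 1 Q) e \<in> alt_forms_at B 2 (\<pi> e)" for e
      by (rule alt_forms_closed(2)) (rule alt[OF cov1(1)[OF Q]])
    fix w z assume wz: "w \<in> vector_fields B" "z \<in> vector_fields B"
    show "ev2 (cov_deriv E B \<pi> \<gamma> 1 (scl c Q)) w z = ev2 (scl c (cov_deriv E B \<pi> \<gamma> 1 Q)) w z"
      unfolding ev2_scl cov1(2)[OF cQ wz] cov1(2)[OF Q wz] by (rule cov_diff_linear(3)[OF Q Q wz])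
  qed
qed

subsection \<open>The compatibility conditions\<close>

text \<open>That \<open>Q\<close> may serve as \<open>\<beta>\<^sub>Y\<close>.\<close>

definition compat :: "('e, 'b) bform \<Rightarrow> 'e vfield \<Rightarrow> bool" where
  "compat Q Y \<longleftrightarrow> Q \<in> Omega_B E B \<pi> 1 \<and> (\<forall>w\<in>vector_fields B. lie_bracket (Hor w) Y = - V.ham (ev Q w))"

text \<open>The equation \<open>\<partial>Q + L\<^sub>Y \<sigma> = 0\<close>.\<close>

definition sigma_balanced :: "('e, 'b) bform \<Rightarrow> 'e vfield \<Rightarrow> bool" where
  "sigma_balanced Q Y \<longleftrightarrow> (\<forall>w\<in>vector_fields B. \<forall>z\<in>vector_fields B. cov_diff Q w z + app Y (sg w z) = 0)"

lemma Poiss_hor_field_plus: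
  assumes Q: "Q \<in> Omega_B E B \<pi> 1" and Y: "vert Y"
  shows "hor_field Q + Y \<in> Poiss E \<Theta> \<longleftrightarrow> Y \<in> Poiss E P \<and> compat Q Y \<and> sigma_balanced Q Y"
proof -
  have "lie_bracket (Hor w) Y = - V.ham (ev Q w) \<longleftrightarrow>
      (\<forall>g\<in>C_inf E. app (lie_bracket (Hor w) Y) g = - app (V.ham (ev Q w)) g)" if w: "w \<in> vector_fields B" for w
  proof
    assume "\<forall>g\<in>C_inf E. app (lie_bracket (Hor w) Y) g = - app (V.ham (ev Q w)) g"
    then show "lie_bracket (Hor w) Y = - V.ham (ev Q w)"
      by (intro E.vector_field_eqI E.vector_field_bracket E.vector_field_uminus V.ham_vector_field Hor_vf w vert_vf Y ev_C Q)
        simp_all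
  qed simp
  then have "compat Q Y \<longleftrightarrow>
      (\<forall>w\<in>vector_fields B. \<forall>g\<in>C_inf E. app (lie_bracket (Hor w) Y) g = - app (V.ham (ev Q w)) g)"
    unfolding compat_def using Q by simp
  then show ?thesis unfolding sigma_balanced_def Poiss_components[OF Q Y] by simp
qed

text \<open>Potentials of the brackets with the lifted frame combine to a form \<open>Q\<close>, since both sides of the equation
  for \<open>\<beta>\<^sub>Y\<close> are linear over the functions on the base. So the choice in \<^const>\<open>beta\<close> is never void on
  \<^const>\<open>A_gamma\<close>.\<close>

lemma A_gamma_iff: "Y \<in> A_gamma E B \<pi> \<gamma> P \<longleftrightarrow> Y \<in> Poiss E P \<and> vert Y \<and> (\<exists>Q. compat Q Y)"
proof
  assume Y: "Y \<in> A_gamma E B \<pi> \<gamma> P"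
  then have P: "Y \<in> Poiss E P" and v: "vert Y"
    by (auto simp: A_gamma_def Poiss_V_def vert_def V.Poiss_iff)
  have H: "lie_bracket (Hor w) Y \<in> V.ham ` C_inf E" if "w \<in> vector_fields B" for w
    using Y that unfolding A_gamma_def V.Ham_eq by simp
  have "\<forall>a. \<exists>F. a < r \<longrightarrow> F \<in> C_inf E \<and> lie_bracket (Ha a) Y = V.ham F"
    unfolding Ha_def using H[OF B.frame_vf] by blast
  from choice[OF this] obtain F where F: "\<forall>a. a < r \<longrightarrow> F a \<in> C_inf E \<and> lie_bracket (Ha a) Y = V.ham (F a)" ..
  define Q where "Q = form_of_coeffs (\<lambda>a. - F a)"
  have Q: "Q \<in> Omega_B E B \<pi> 1"
    unfolding Q_def Omega_B_def by (rule form_of_coeffs_tensor, rule E.C_inf_uminus) (simp add: F)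
  have "lie_bracket (Hor w) Y = - V.ham (ev Q w)" if w: "w \<in> vector_fields B" for w
  proof (rule E.vector_field_eqI)
    show "lie_bracket (Hor w) Y \<in> vector_fields E" by (intro E.vector_field_bracket Hor_vf w vert_vf v)
    show "- V.ham (ev Q w) \<in> vector_fields E" by (intro E.vector_field_uminus V.ham_vector_field ev_C Q w)
    fix g assume g: "g \<in> C_inf E"
    have e: "- ev Q w = (\<Sum>a<r. F a * (app w (y a) \<circ> \<pi>))" unfolding Q_def ev_form_of_coeffs[OF w] by (simp add: sum_negf)
    have "app (lie_bracket (Hor w) Y) g = (\<Sum>a<r. (app w (y a) \<circ> \<pi>) * app (V.ham (F a)) g)"
      unfolding bracket_Hor_frame[OF w v g] by (rule sum.cong[OF refl]) (simp add: F)
    also have "\<dots> = app (V.ham (- ev Q w)) g"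
      unfolding e by (rule ham_P_combination[symmetric]) (simp_all add: F w g)
    finally show "app (lie_bracket (Hor w) Y) g = app (- V.ham (ev Q w)) g"
      unfolding V.ham_neg[OF ev_C[OF Q w]] .
  qed
  then show "Y \<in> Poiss E P \<and> vert Y \<and> (\<exists>Q. compat Q Y)" using P v Q unfolding compat_def by blast
next
  assume "Y \<in> Poiss E P \<and> vert Y \<and> (\<exists>Q. compat Q Y)"
  then obtain Q where P: "Y \<in> Poiss E P" and v: "vert Y" and Q: "compat Q Y" by blast
  have "lie_bracket (Hor w) Y \<in> Ham E P" if w: "w \<in> vector_fields B" for w
  proof -
    have C: "ev Q w \<in> C_inf E" using Q ev_C w unfolding compat_def by blast
    have "lie_bracket (Hor w) Y = V.ham (- ev Q w)" unfolding V.ham_neg[OF C] using Q w by (simp add: compat_def)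
    then show ?thesis unfolding V.Ham_eq using E.C_inf_uminus[OF C] by blast
  qed
  then show "Y \<in> A_gamma E B \<pi> \<gamma> P" using P v by (simp add: A_gamma_def Poiss_V_def vert_def)
qed

lemma beta_compat: "compat Q Y \<Longrightarrow> compat (beta E B \<pi> \<gamma> P Y) Y"
proof -
  have "beta E B \<pi> \<gamma> P Y = (SOME Q. compat Q Y)"
    unfolding beta_def compat_def V.ham_def ev_def ..
  then show "compat Q Y \<Longrightarrow> compat (beta E B \<pi> \<gamma> P Y) Y" using someI[of "\<lambda>Q. compat Q Y" Q] by simp
qed

text \<open>The difference of two potentials of the same Hamiltonian field of \<open>P\<close> is a Casimir function.\<close>

lemma compat_diff_Casimir:
  assumes Q: "compat Q Y" and R: "R \<in> Omega_B E B \<pi> 1"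
  shows "compat R Y \<longleftrightarrow> Q - R \<in> Cas_forms E B \<pi> P 1"
proof -
  have Q1: "Q \<in> Omega_B E B \<pi> 1" using Q by (simp add: compat_def)
  have "ev (Q - R) w \<in> Casim E P \<longleftrightarrow> lie_bracket (Hor w) Y = - V.ham (ev R w)" if w: "w \<in> vector_fields B" for w
  proof -
    have e: "ev Q w \<in> C_inf E" "ev R w \<in> C_inf E" using ev_C Q1 R w by blast+
    have "lie_bracket (Hor w) Y = - V.ham (ev Q w)" using Q w by (simp add: compat_def)
    then show ?thesis unfolding ev_minus V.Casim_iff V.ham_minus[OF e] using E.C_inf_diff[OF e] by auto
  qed
  then show ?thesis unfolding compat_def Cas_forms1_iff using R fs.subspace_diff[OF Omega1_subspace Q1 R] by simp
qed

text \<open>That \<open>\<tau>\<^sub>Y = \<partial>\<beta> + L\<^sub>Y \<sigma>\<close> is the coboundary \<open>\<partial>c\<close> of a Casimir-valued form \<open>c\<close> means that \<open>Q = \<beta> - c\<close> is another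
  choice of \<open>\<beta>\<^sub>Y\<close>, for which \<open>\<partial>Q + L\<^sub>Y \<sigma> = 0\<close>.\<close>

lemma ker_rho_iff:
  "Y \<in> ker_rho E B \<pi> \<gamma> \<sigma> P \<longleftrightarrow> Y \<in> Poiss E P \<and> vert Y \<and> (\<exists>Q. compat Q Y \<and> sigma_balanced Q Y)"
proof -
  let ?D = "cov_deriv E B \<pi> \<gamma> 1" and ?\<beta> = "beta E B \<pi> \<gamma> P Y" and ?L = "lie_bform E B \<pi> 2 Y \<sigma>"
  let ?B2 = "coboundaries E B \<pi> \<gamma> P 2"
  have B2: "?B2 = ?D ` Cas_forms E B \<pi> P 1" by (simp add: coboundaries_def numeral_2_eq_2)
  have sub: "fs.subspace ?B2"
    unfolding B2 by (rule linear_on_image[OF linear_on_subset[OF cov1_linear] Cas1_subspace]) (rule subsetI, rule Cas_Omega)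
  have rho: "rho E B \<pi> \<gamma> \<sigma> P Y = \<zero>\<^bsub>cohomology E B \<pi> \<gamma> P 2\<^esub> \<longleftrightarrow> ?D ?\<beta> + ?L \<in> ?B2"
  proof -
    have "\<zero>\<^bsub>cohomology E B \<pi> \<gamma> P 2\<^esub> = coset ?B2 0" by (simp add: cohomology_def quotient_space_def coset_def)
    then show ?thesis unfolding rho_def tau_def a_r_coset_function_space by (simp add: coset_eq_iff[OF sub])
  qed
  have key: "?D ?\<beta> + ?L \<in> ?B2 \<longleftrightarrow> (\<exists>Q. compat Q Y \<and> sigma_balanced Q Y)" if v: "vert Y" and b: "compat ?\<beta> Y"
  proof -
    have b1: "?\<beta> \<in> Omega_B E B \<pi> 1" using b by (simp add: compat_def)
    have eq: "?D ?\<beta> + ?L = ?D c \<longleftrightarrow> sigma_balanced (?\<beta> - c) Y" if c: "c \<in> Omega_B E B \<pi> 1" for c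
    proof -
      have e: "ev2 (?D ?\<beta> + ?L) w z - ev2 (?D c) w z = cov_diff (?\<beta> - c) w z + app Y (sg w z)"
        if wz: "w \<in> vector_fields B" "z \<in> vector_fields B" for w z
        unfolding ev2_plus cov1(2)[OF b1 wz] cov1(2)[OF c wz] lie_bform_sigma(2)[OF v wz] cov_diff_linear(2)[OF b1 c wz] by simp
      have alt: "\<eta> e \<in> alt_forms_at B 2 (\<pi> e)" if "\<eta> \<in> Omega_B E B \<pi> 2" for \<eta> e
        by (rule B.tensor_form_alt[OF that[unfolded Omega_B_def]])
      show ?thesis
      proof
        assume "?D ?\<beta> + ?L = ?D c"
        then show "sigma_balanced (?\<beta> - c) Y" unfolding sigma_balanced_def using e by simp
      next
        assume f: "sigma_balanced (?\<beta> - c) Y"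
        show "?D ?\<beta> + ?L = ?D c"
        proof (rule form2_alt_eqI)
          show "(?D ?\<beta> + ?L) e \<in> alt_forms_at B 2 (\<pi> e)" for e
            by (rule alt_forms_closed(1)) (rule alt[OF cov1(1)[OF b1]], rule alt[OF lie_bform_sigma(1)[OF v]])
          show "?D c e \<in> alt_forms_at B 2 (\<pi> e)" for e by (rule alt[OF cov1(1)[OF c]])
          fix w z assume wz: "w \<in> vector_fields B" "z \<in> vector_fields B"
          then have "cov_diff (?\<beta> - c) w z + app Y (sg w z) = 0" using f unfolding sigma_balanced_def by blast
          then show "ev2 (?D ?\<beta> + ?L) w z = ev2 (?D c) w z" unfolding e[OF wz, symmetric] by simp
        qed
      qed
    qed
    show ?thesis
    proof
      assume "?D ?\<beta> + ?L \<in> ?B2"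
      then obtain c where c: "c \<in> Cas_forms E B \<pi> P 1" "?D ?\<beta> + ?L = ?D c" unfolding B2 by blast
      have c1: "c \<in> Omega_B E B \<pi> 1" by (rule Cas_Omega[OF c(1)])
      have "compat (?\<beta> - c) Y"
        using compat_diff_Casimir[OF b fs.subspace_diff[OF Omega1_subspace b1 c1]] c(1) by simp
      then show "\<exists>Q. compat Q Y \<and> sigma_balanced Q Y" using c(2) unfolding eq[OF c1] by blast
    next
      assume "\<exists>Q. compat Q Y \<and> sigma_balanced Q Y"
      then obtain Q where Q: "compat Q Y" "sigma_balanced Q Y" by blast
      have Q1: "Q \<in> Omega_B E B \<pi> 1" using Q(1) by (simp add: compat_def)
      have c: "?\<beta> - Q \<in> Cas_forms E B \<pi> P 1" using compat_diff_Casimir[OF b Q1] Q(1) by simp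
      have "?D ?\<beta> + ?L = ?D (?\<beta> - Q)" unfolding eq[OF Cas_Omega[OF c]] using Q(2) by simp
      then show "?D ?\<beta> + ?L \<in> ?B2" unfolding B2 using c by blast
    qed
  qed
  show ?thesis
  proof
    assume "Y \<in> ker_rho E B \<pi> \<gamma> \<sigma> P"
    then have Y: "Y \<in> A_gamma E B \<pi> \<gamma> P" and t: "?D ?\<beta> + ?L \<in> ?B2" unfolding ker_rho_def using rho by simp_all
    obtain Q where Q: "Y \<in> Poiss E P" "vert Y" "compat Q Y" using Y unfolding A_gamma_iff by blast
    then show "Y \<in> Poiss E P \<and> vert Y \<and> (\<exists>Q. compat Q Y \<and> sigma_balanced Q Y)"
      using key[OF Q(2) beta_compat[OF Q(3)]] t by blast
  next
    assume h: "Y \<in> Poiss E P \<and> vert Y \<and> (\<exists>Q. compat Q Y \<and> sigma_balanced Q Y)"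
    then obtain Q where Q: "Y \<in> Poiss E P" "vert Y" "compat Q Y" by blast
    then have "Y \<in> A_gamma E B \<pi> \<gamma> P" unfolding A_gamma_iff by blast
    moreover have "?D ?\<beta> + ?L \<in> ?B2" using key[OF Q(2) beta_compat[OF Q(3)]] h by blast
    ultimately show "Y \<in> ker_rho E B \<pi> \<gamma> \<sigma> P" unfolding ker_rho_def using rho by simp
  qed
qed

subsection \<open>The two exact sequences\<close>

lemma vert_part_ham: "vert_part (T.ham F) = V.ham F"
proof (rule field_eqI)
  fix g
  show "app (vert_part (T.ham F)) g = app (V.ham F) g" by (simp add: vert_part_def ham_decompose[of F g])
qed

text \<open>The sign comes from \<open>\<sigma>\<close> being minus the inverse of the horizontal part of \<open>\<Theta>\<close>.\<close>

lemma base_form_ham: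
  assumes F: "F \<in> C_inf E"
  shows "base_form (T.ham F) = cov_deriv E B \<pi> \<gamma> 0 (function_form (- F))"
proof (rule form1_eqI[OF Omega_alt1[OF base_form_Omega[OF T.ham_vector_field[OF F]]] Omega_alt1[OF cov0(1)[OF E.C_inf_uminus[OF F]]]])
  fix w assume w: "w \<in> vector_fields B"
  have "ev (base_form (T.ham F)) w = (\<Sum>a<r. sg w (u a) * app (T.ham (ba a)) F)"
    unfolding ev_base_form[OF w]
  proof (rule sum.cong[OF refl])
    fix a assume "a \<in> {..<r}"
    then have "u a \<in> vector_fields B" by simp
    from sg_skew[OF this w] T.ham_skew[of F "ba a"]
    show "app (T.ham F) (ba a) * sg (u a) w = sg w (u a) * app (T.ham (ba a)) F" by simp
  qed
  also have "\<dots> = - app (Hor w) F" using Hor_by_ham[OF w, of F] by simp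
  also have "\<dots> = ev (cov_deriv E B \<pi> \<gamma> 0 (function_form (- F))) w"
    unfolding cov0(2)[OF E.C_inf_uminus[OF F] w] by (rule E.app_uminus[OF Hor_vf[OF w] F, symmetric])
  finally show "ev (base_form (T.ham F)) w = ev (cov_deriv E B \<pi> \<gamma> 0 (function_form (- F))) w" .
qed

text \<open>For \<open>Y = 0\<close> the mixed condition says that the values of \<open>Q\<close> are Casimir functions, and the horizontal
  one that \<open>\<partial>Q = 0\<close>.\<close>

lemma cocycles_iff: "cocycles E B \<pi> \<gamma> P 1 = {Q \<in> Omega_B E B \<pi> 1. hor_field Q \<in> Poiss E \<Theta>}"
proof -
  have "Q \<in> Cas_forms E B \<pi> P 1 \<and> cov_deriv E B \<pi> \<gamma> 1 Q = 0 \<longleftrightarrow> compat Q 0 \<and> sigma_balanced Q 0"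
    if Q: "Q \<in> Omega_B E B \<pi> 1" for Q
  proof -
    have br: "lie_bracket (Hor w) 0 = 0" if "w \<in> vector_fields B" for w
      by (rule field_eqI) (simp add: app_bracket app_zero E.app_0[OF Hor_vf[OF that]])
    have "lie_bracket (Hor w) 0 = - V.ham (ev Q w) \<longleftrightarrow> ev Q w \<in> Casim E P" if w: "w \<in> vector_fields B" for w
      unfolding br[OF w] V.Casim_iff using ev_C[OF Q w] by (metis neg_equal_0_iff_equal)
    then have "compat Q 0 \<longleftrightarrow> Q \<in> Cas_forms E B \<pi> P 1"
      unfolding compat_def Cas_forms1_iff using Q by simp
    moreover have "cov_deriv E B \<pi> \<gamma> 1 Q = 0 \<longleftrightarrow> sigma_balanced Q 0"
    proof
      assume "cov_deriv E B \<pi> \<gamma> 1 Q = 0"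
      then show "sigma_balanced Q 0" unfolding sigma_balanced_def using cov1(2)[OF Q, symmetric]
        by (simp add: ev2_def on_fields_def app_def zero_fun_def)
    next
      assume f: "sigma_balanced Q 0"
      show "cov_deriv E B \<pi> \<gamma> 1 Q = 0"
      proof (rule form2_alt_eqI)
        show "cov_deriv E B \<pi> \<gamma> 1 Q e \<in> alt_forms_at B 2 (\<pi> e)" for e
          by (rule B.tensor_form_alt[OF cov1(1)[OF Q, unfolded Omega_B_def]])
        show "(0 :: ('e, 'b) bform) e \<in> alt_forms_at B 2 (\<pi> e)" for e
          using B.alt_forms_0 by (simp add: zero_fun_def)
        fix w z assume wz: "w \<in> vector_fields B" "z \<in> vector_fields B"
        then have "cov_diff Q w z + app 0 (sg w z) = 0" using f unfolding sigma_balanced_def by blast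
        then show "ev2 (cov_deriv E B \<pi> \<gamma> 1 Q) w z = ev2 0 w z"
          unfolding cov1(2)[OF Q wz] by (simp add: ev2_def on_fields_def app_def zero_fun_def)
      qed
    qed
    ultimately show ?thesis by simp
  qed
  moreover have "hor_field Q \<in> Poiss E \<Theta> \<longleftrightarrow> compat Q 0 \<and> sigma_balanced Q 0" if "Q \<in> Omega_B E B \<pi> 1" for Q
    using Poiss_hor_field_plus[OF that vert_0] fs.subspace_0[OF V.Poiss_subspace] by simp
  ultimately show ?thesis unfolding cocycles_def using Cas_Omega by blast
qed

text \<open>The Hamiltonian field of \<open>F\<close> is horizontal if and only if \<open>F\<close> is a Casimir function of \<open>P\<close>.\<close>

lemma coboundaries_iff: "coboundaries E B \<pi> \<gamma> P 1 = {Q \<in> Omega_B E B \<pi> 1. hor_field Q \<in> Ham E \<Theta>}"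
proof (intro equalityI subsetI)
  fix Q assume "Q \<in> coboundaries E B \<pi> \<gamma> P 1"
  then obtain F where F: "F \<in> Casim E P" "Q = cov_deriv E B \<pi> \<gamma> 0 (function_form F)"
    by (auto simp: coboundaries_def Cas_forms0)
  have FC: "F \<in> C_inf E" "- F \<in> C_inf E" and ham0: "V.ham F = 0" using F(1) E.C_inf_uminus by (auto simp: V.Casim_iff)
  have "T.ham (- F) = hor_field (base_form (T.ham (- F))) + vert_part (T.ham (- F))"
    by (rule field_decompose) (simp add: FC)
  then have "hor_field Q = T.ham (- F)" unfolding base_form_ham[OF FC(2)] vert_part_ham V.ham_neg[OF FC(1)] ham0 F(2) by simp
  then have "hor_field Q \<in> Ham E \<Theta>" unfolding T.Ham_eq using FC(2) by blast
  then show "Q \<in> {Q \<in> Omega_B E B \<pi> 1. hor_field Q \<in> Ham E \<Theta>}" using cov0(1)[OF FC(1)] F(2) by simp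
next
  fix Q assume "Q \<in> {Q \<in> Omega_B E B \<pi> 1. hor_field Q \<in> Ham E \<Theta>}"
  then obtain F where Q: "Q \<in> Omega_B E B \<pi> 1" and F: "F \<in> C_inf E" "hor_field Q = T.ham F" unfolding T.Ham_eq by blast
  have "V.ham F = 0" using vert_part_ham[of F] vert_part_hor_field[of Q] F(2) by simp
  then have "- F \<in> Casim E P" using F(1) by (simp add: V.Casim_iff V.ham_neg E.C_inf_uminus)
  moreover have "Q = cov_deriv E B \<pi> \<gamma> 0 (function_form (- F))" using base_form_ham[OF F(1)] base_form_hor_field[OF Q] F(2) by simp
  ultimately show "Q \<in> coboundaries E B \<pi> \<gamma> P 1" unfolding coboundaries_def by (auto simp: Cas_forms0)
qed

lemma vert_part_kernel:
  assumes "S \<subseteq> vector_fields E"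
  shows "{Z \<in> S. vert_part Z = 0} = hor_field ` {Q \<in> Omega_B E B \<pi> 1. hor_field Q \<in> S}"
proof (intro equalityI subsetI)
  fix Z assume "Z \<in> {Z \<in> S. vert_part Z = 0}"
  then have Z: "Z \<in> S" "vert_part Z = 0" "Z \<in> vector_fields E" using assms by blast+
  have "Z = hor_field (base_form Z)" using field_decompose[OF Z(3)] Z(2) by simp
  moreover from this have "base_form Z \<in> {Q \<in> Omega_B E B \<pi> 1. hor_field Q \<in> S}" using Z(1) base_form_Omega[OF Z(3)] by simp
  ultimately show "Z \<in> hor_field ` {Q \<in> Omega_B E B \<pi> 1. hor_field Q \<in> S}" by (rule image_eqI)
qed (auto simp: vert_part_hor_field)

lemma vert_part_Poiss: "vert_part ` Poiss E \<Theta> = ker_rho E B \<pi> \<gamma> \<sigma> P"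
proof (intro equalityI subsetI)
  fix Y assume "Y \<in> vert_part ` Poiss E \<Theta>"
  then obtain Z where Z: "Z \<in> Poiss E \<Theta>" "Y = vert_part Z" by blast
  have ZV: "Z \<in> vector_fields E" using Z(1) by (simp add: T.Poiss_iff)
  have "hor_field (base_form Z) + Y \<in> Poiss E \<Theta>" using field_decompose[OF ZV] Z by simp
  then show "Y \<in> ker_rho E B \<pi> \<gamma> \<sigma> P"
    unfolding ker_rho_iff Z(2) Poiss_hor_field_plus[OF base_form_Omega[OF ZV] vert_part_vertical[OF ZV]] using vert_part_vertical[OF ZV] by blast
next
  fix Y assume "Y \<in> ker_rho E B \<pi> \<gamma> \<sigma> P"
  then obtain Q where Y: "Y \<in> Poiss E P" "vert Y" and Q: "compat Q Y" "sigma_balanced Q Y" unfolding ker_rho_iff by blast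
  have "Q \<in> Omega_B E B \<pi> 1" using Q(1) by (simp add: compat_def)
  then have "hor_field Q + Y \<in> Poiss E \<Theta>" using Poiss_hor_field_plus[OF _ Y(2)] Y(1) Q by blast
  then show "Y \<in> vert_part ` Poiss E \<Theta>" using vert_part_hor_field_plus[OF Y(2), of Q] by (metis imageI)
qed

lemma vert_part_Ham: "vert_part ` Ham E \<Theta> = Ham E P"
  unfolding T.Ham_eq V.Ham_eq image_image vert_part_ham ..

theorem H1_Poisson_iso:
  "\<exists>\<Phi>. \<Phi> \<in> linear_isos (H1_Poisson E \<Theta>)
     (direct_sum (cohomology E B \<pi> \<gamma> P 1)
        (quotient_space (function_space (ker_rho E B \<pi> \<gamma> \<sigma> P)) (Ham E P)))"
proof -
  have HP: "Ham E \<Theta> \<subseteq> Poiss E \<Theta>" by (rule T.Ham_Poiss[OF poisson])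
  have PV: "Poiss E \<Theta> \<subseteq> vector_fields E" by (auto simp: T.Poiss_iff)
  have pre: "fs.subspace {Q \<in> Omega_B E B \<pi> 1. hor_field Q \<in> W}" if W: "fs.subspace W" for W
  proof (rule fs.subspaceI)
    have "hor_field 0 = 0" by (rule linear_on_0[OF hor_field_linear fs.subspace_UNIV])
    then show "0 \<in> {Q \<in> Omega_B E B \<pi> 1. hor_field Q \<in> W}"
      using fs.subspace_0[OF W] fs.subspace_0[OF Omega1_subspace] by simp
  qed (simp_all del: One_nat_def add: linear_on_add[OF hor_field_linear] linear_on_scl[OF hor_field_linear] fs.subspace_add[OF W] fs.subspace_scale[OF W]
      fs.subspace_add[OF Omega1_subspace] fs.subspace_scale[OF Omega1_subspace])
  have "\<exists>\<Phi>. \<Phi> \<in> linear_isos (quotient_space (function_space (Poiss E \<Theta>)) (Ham E \<Theta>))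
    (direct_sum (quotient_space (function_space (cocycles E B \<pi> \<gamma> P 1)) (coboundaries E B \<pi> \<gamma> P 1))
      (quotient_space (function_space (vert_part ` Poiss E \<Theta>)) (vert_part ` Ham E \<Theta>)))"
  proof (rule quotient_splits)
    show "fs.subspace (Poiss E \<Theta>)" "fs.subspace (Ham E \<Theta>)" "Ham E \<Theta> \<subseteq> Poiss E \<Theta>"
      by (rule T.Poiss_subspace, rule T.Ham_subspace, rule HP)
    show "fs.subspace (cocycles E B \<pi> \<gamma> P 1)" unfolding cocycles_iff by (rule pre[OF T.Poiss_subspace])
    show "fs.subspace (coboundaries E B \<pi> \<gamma> P 1)" unfolding coboundaries_iff by (rule pre[OF T.Ham_subspace])
    show "coboundaries E B \<pi> \<gamma> P 1 \<subseteq> cocycles E B \<pi> \<gamma> P 1" unfolding cocycles_iff coboundaries_iff using HP by blast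
    show "linear_on (Poiss E \<Theta>) vert_part" by (rule linear_on_subset[OF vert_part_linear]) simp
    show "linear_on (cocycles E B \<pi> \<gamma> P 1) hor_field" by (rule linear_on_subset[OF hor_field_linear]) simp
    show "inj_on hor_field (cocycles E B \<pi> \<gamma> P 1)" unfolding cocycles_iff by (rule inj_on_subset[OF hor_field_inj]) blast
    show "{Z \<in> Poiss E \<Theta>. vert_part Z = 0} = hor_field ` cocycles E B \<pi> \<gamma> P 1" unfolding cocycles_iff by (rule vert_part_kernel[OF PV])
    show "{Z \<in> Ham E \<Theta>. vert_part Z = 0} = hor_field ` coboundaries E B \<pi> \<gamma> P 1"
      unfolding coboundaries_iff by (rule vert_part_kernel[OF order_trans[OF HP PV]])
    show "fs.subspace (vert_part ` Ham E \<Theta>)" unfolding vert_part_Ham by (rule V.Ham_subspace)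
  qed
  then show ?thesis unfolding H1_Poisson_def cohomology_def vert_part_Poiss vert_part_Ham .
qed

end

theorem theorem2:
  fixes E :: "'e::{second_countable_topology, t2_space} smooth_structure"
    and B :: "'b::{second_countable_topology, t2_space} smooth_structure"
    and \<pi> :: "'e \<Rightarrow> 'b"
    and \<Theta> P :: "'e bifield"
    and \<gamma> :: "'e \<Rightarrow> 'e tvec \<Rightarrow> 'e tvec"
    and \<sigma> :: "('e, 'b) bform"
  assumes "fiber_bundle E B \<pi>"
    and "poisson_tensor E \<Theta>"
    and "coupling E B \<pi> \<Theta>"
    and "geometric_data E B \<pi> \<Theta> \<gamma> \<sigma> P"
  shows "\<exists>\<Phi>. \<Phi> \<in> linear_isos (H1_Poisson E \<Theta>)
           (direct_sum (cohomology E B \<pi> \<gamma> P 1)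
              (quotient_space (function_space (ker_rho E B \<pi> \<gamma> \<sigma> P)) (Ham E P)))"
proof -
  have "smooth_manifold E" "smooth_manifold B" using assms(1) by (simp_all add: fiber_bundle_def)
  then interpret E: manifold E + B: manifold B by unfold_locales
  show ?thesis
  proof (rule E.global_frame)
    fix rE :: nat and yE uE
    assume E: "\<And>a. a < rE \<Longrightarrow> yE a \<in> C_inf E" "\<And>a. a < rE \<Longrightarrow> uE a \<in> vector_fields E"
      "\<And>p v. v \<in> tangent E p \<Longrightarrow> v = (\<lambda>f. \<Sum>a<rE. v (yE a) * uE a p f)"
    show ?thesis
    proof (rule B.global_frame)
      fix r :: nat and y u
      assume B: "\<And>a. a < r \<Longrightarrow> y a \<in> C_inf B" "\<And>a. a < r \<Longrightarrow> u a \<in> vector_fields B"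
        "\<And>p v. v \<in> tangent B p \<Longrightarrow> v = (\<lambda>f. \<Sum>a<r. v (y a) * u a p f)"
      interpret coupling_bundle E rE yE uE B r y u \<pi> \<Theta> \<gamma> \<sigma> P
        by unfold_locales (rule E(1) E(2) E(3) B(1) B(2) B(3) assms, assumption?)+
      show ?thesis by (rule H1_Poisson_iso)
    qed
  qed
qed

end
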